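(* Let $K$ be a field, let $a\ge1$, $n\ge1$, $b\ge 3$ be integers, and let $G_{a,b,n}=\overline{K}_a\nabla(nB_b)$. For all integers $i,d\ge 0$, $$\beta_{i,d}(G_{a,b,n})=\sum_{j=0}^{d-2}\binom{a}{j}\beta_{i-j,d-j}(nB_b)+\delta_{d,i+1}\sum_{j=1}^{d-1}\binom{a}{j}\binom{2bn}{d-j},$$ or equivalently, $$\beta_{i,d}(G_{a,b,n})=\sum_{j=0}^{d-2}\binom{a}{j}[u^{i-j}v^{d-j}]P_b(u,v)^n+\delta_{d,i+1}\sum_{j=1}^{d-1}\binom{a}{j}\binom{2bn}{d-j},$$ where $[u^pv^q]$ denotes extraction of the coefficient of $u^pv^q$ and $$P_b(u,v)=1+\sum_{r=1}^{2b-2}\lambda_r u^rv^{r+1}+\sum_{r=1}^{2b-2}\mu_r u^rv^{r+2}.$$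
   Context: All graphs are finite, simple and undirected. For $b\ge 2$, $B_b$ is the graph with vertices $x_1,\dots,x_b,y_1,\dots,y_b$ and edges $\{x_i,x_j\}$ and $\{y_i,y_j\}$ for $1\le i<j\le b$, and $\{x_i,y_i\}$ for $1\le i\le b$. $nB_b$ is the disjoint union of $n$ copies of $B_b$. The join $G\nabla H$ of graphs on disjoint vertex sets is obtained from the disjoint union by adding every edge between $V(G)$ and $V(H)$. $\overline{K}_a$ is the edgeless graph on $a$ vertices. For a graph $G$, $R_G$ is the standard graded polynomial ring over $K$ whose variables are the vertices of $G$, $I(G)=(xy:\{x,y\}\in E(G))\subseteq R_G$ is the edge ideal, and $\beta_{i,d}(G)$ denotes the graded Betti number of $R_G/I(G)$ over $R_G$ in homological degree $i$ and internal degree $d$; out-of-range Betti numbers (and coefficients at negative exponents) are understood to be zero. $\delta_{p,q}$ is the Kronecker delta. For fixed $b\ge3$ the integers $\lambda_i,\mu_i$ are defined as follows, with the convention $\binom{u}{v}=0$ if $v<0$ or $v>u$. For $1\le i\le 2b-2$: $\lambda_1=2\binom{b}{2}+b$; $\lambda_3=6\binom{b}{4}+2b\binom{b-1}{2}+\binom{b}{2}$; and $\lambda_i=2i\binom{b}{i+1}+2b\binom{b-1}{i-1}$ for $i\ne1,3$. Also $\lambda_i=0$ outside $1\le i\le 2b-2$. For $1\le i\le 2b-2$, $$\mu_i=\lambda_{i+1}+\binom{2b-2}{i+2}-(2b-2)\binom{2b-2}{i+1}+(b^2-3b+1)\binom{2b-2}{i}.$$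
   Formalization: The pair (i,d)=(0,0) is excluded: there the Betti number of R_G/I(G) is 1, while the right-hand sides are 0 (empty first sum and Kronecker delta zero); every other pair i,d≥0 is covered. *)

theory Defs
  imports "HOL-Library.Poly_Mapping" "HOL-Computational_Algebra.Polynomial"
    "Jordan_Normal_Form.Matrix"
begin

section \<open>Graphs\<close>

record 'v ugraph =
  verts :: "'v set"
  edges :: "'v set set"

definition simple_graph :: "'v ugraph \<Rightarrow> bool" where
  "simple_graph G \<longleftrightarrow> finite (verts G) \<and> (\<forall>e\<in>edges G. e \<subseteq> verts G \<and> card e = 2)"

definition edgeless_graph :: "nat \<Rightarrow> nat ugraph" where
  "edgeless_graph a = \<lparr>verts = {1..a}, edges = {}\<rparr>"

text \<open>The vertex \<open>x\<^sub>i\<close> is \<open>Inl i\<close> and \<open>y\<^sub>i\<close> is \<open>Inr i\<close>.\<close>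

definition B_graph :: "nat \<Rightarrow> (nat + nat) ugraph" where
  "B_graph b =
    \<lparr>verts = {1..b} <+> {1..b},
     edges = {{Inl i, Inl j} | i j. 1 \<le> i \<and> i < j \<and> j \<le> b}
           \<union> {{Inr i, Inr j} | i j. 1 \<le> i \<and> i < j \<and> j \<le> b}
           \<union> {{Inl i, Inr i} | i. 1 \<le> i \<and> i \<le> b}\<rparr>"

definition disjoint_copies :: "nat \<Rightarrow> 'v ugraph \<Rightarrow> (nat \<times> 'v) ugraph" where
  "disjoint_copies n G =
    \<lparr>verts = {1..n} \<times> verts G,
     edges = {Pair k ` e | k e. k \<in> {1..n} \<and> e \<in> edges G}\<rparr>"

text \<open>The sum type makes the two vertex sets disjoint.\<close>

definition graph_join :: "'v ugraph \<Rightarrow> 'w ugraph \<Rightarrow> ('v + 'w) ugraph" where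
  "graph_join G H =
    \<lparr>verts = verts G <+> verts H,
     edges = (image Inl) ` edges G \<union> (image Inr) ` edges H
           \<union> {{Inl x, Inr y} | x y. x \<in> verts G \<and> y \<in> verts H}\<rparr>"

definition G_graph :: "nat \<Rightarrow> nat \<Rightarrow> nat \<Rightarrow> (nat + nat \<times> (nat + nat)) ugraph" where
  "G_graph a b n = graph_join (edgeless_graph a) (disjoint_copies n (B_graph b))"

lemma simple_graph_edgeless_graph: "simple_graph (edgeless_graph a)"
  by (simp add: simple_graph_def edgeless_graph_def)

lemma simple_graph_B_graph: "simple_graph (B_graph b)"
  by (auto simp: simple_graph_def B_graph_def card_insert_if)

lemma simple_graph_disjoint_copies:
  "simple_graph G \<Longrightarrow> simple_graph (disjoint_copies n G)"
  by (auto simp: simple_graph_def disjoint_copies_def card_image inj_on_def)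

lemma simple_graph_graph_join:
  "simple_graph G \<Longrightarrow> simple_graph H \<Longrightarrow> simple_graph (graph_join G H)"
  by (auto simp: simple_graph_def graph_join_def card_image inj_on_def card_insert_if)

lemma simple_graph_G_graph: "simple_graph (G_graph a b n)"
  unfolding G_graph_def
  by (intro simple_graph_graph_join simple_graph_edgeless_graph
      simple_graph_disjoint_copies simple_graph_B_graph)


section \<open>Graded Betti numbers\<close>

type_synonym ('v, 'k) mpoly = "('v \<Rightarrow>\<^sub>0 nat) \<Rightarrow>\<^sub>0 'k"

definition mon_deg :: "('v \<Rightarrow>\<^sub>0 nat) \<Rightarrow> nat" where
  "mon_deg m = (\<Sum>v\<in>Poly_Mapping.keys m. Poly_Mapping.lookup m v)"

definition var :: "'v \<Rightarrow> ('v, 'k::field) mpoly" where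
  "var v = Poly_Mapping.single (Poly_Mapping.single v 1) 1"

definition poly_ring :: "'v set \<Rightarrow> ('v, 'k::field) mpoly set" where
  "poly_ring V = {p. \<forall>m\<in>Poly_Mapping.keys p. Poly_Mapping.keys m \<subseteq> V}"

text \<open>The edge set is finite, so the ideal generated by the monomials \<open>x y\<close> is the set of
  all combinations of these monomials with coefficients in the polynomial ring.\<close>

definition edge_ideal :: "'v ugraph \<Rightarrow> ('v, 'k::field) mpoly set" where
  "edge_ideal G =
    {\<Sum>e\<in>edges G. q e * (\<Prod>v\<in>e. var v) | q. \<forall>e\<in>edges G. q e \<in> poly_ring (verts G)}"

text \<open>A list \<open>[d\<^sub>1, \<dots>, d\<^sub>r]\<close> stands for the graded free module
  \<open>R(-d\<^sub>1) \<oplus> \<dots> \<oplus> R(-d\<^sub>r)\<close> over \<open>R = poly_ring V\<close>.\<close>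

definition free_module :: "'v set \<Rightarrow> nat list \<Rightarrow> ('v, 'k::field) mpoly vec set" where
  "free_module V ds =
    {f \<in> carrier_vec (length ds). \<forall>k<length ds. f $ k \<in> poly_ring V}"

text \<open>Degree-preserving homomorphisms from the free module of \<open>cs\<close> to that of \<open>rs\<close>: the
  \<open>(k, l)\<close> entry is homogeneous of degree \<open>cs ! l - rs ! k\<close>, and is zero if that is negative.\<close>

definition graded_hom ::
  "'v set \<Rightarrow> nat list \<Rightarrow> nat list \<Rightarrow> ('v, 'k::field) mpoly mat \<Rightarrow> bool" where
  "graded_hom V cs rs A \<longleftrightarrow>
     A \<in> carrier_mat (length rs) (length cs) \<and>
     (\<forall>k<length rs. \<forall>l<length cs. A $$ (k, l) \<in> poly_ring V \<and>
        (\<forall>m\<in>Poly_Mapping.keys (A $$ (k, l)). mon_deg m + rs ! k = cs ! l))"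

text \<open>Minimal graded free resolutions
  \<open>\<dots> \<rightarrow> F\<^sub>2 \<rightarrow> F\<^sub>1 \<rightarrow> F\<^sub>0 \<rightarrow> R/I \<rightarrow> 0\<close>, with \<open>F\<^sub>i\<close> given by \<open>F i\<close>. The augmentation
  \<open>F\<^sub>0 \<rightarrow> R/I\<close> is given by a lift \<open>\<epsilon>\<close> to \<open>R\<close>, and \<open>D i\<close> is the differential
  \<open>F\<^sub>i\<^sub>+\<^sub>1 \<rightarrow> F\<^sub>i\<close>. Minimality says that the image of \<open>D i\<close> lies in \<open>\<mm> F\<^sub>i\<close>, where \<open>\<mm>\<close>
  is the ideal generated by the variables. Shifts are natural numbers because \<open>R/I\<close> is
  generated in nonnegative degrees.\<close>

definition minimal_graded_free_resolution ::
  "'v set \<Rightarrow> ('v, 'k::field) mpoly set \<Rightarrow> (nat \<Rightarrow> nat list) \<Rightarrow>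
   ('v, 'k) mpoly mat \<Rightarrow> (nat \<Rightarrow> ('v, 'k) mpoly mat) \<Rightarrow> bool" where
  "minimal_graded_free_resolution V I F \<epsilon> D \<longleftrightarrow>
     graded_hom V (F 0) [0] \<epsilon> \<and>
     (\<forall>i. graded_hom V (F (Suc i)) (F i) (D i)) \<and>
     (\<forall>p\<in>poly_ring V. \<exists>f\<in>free_module V (F 0). p - (\<epsilon> *\<^sub>v f) $ 0 \<in> I) \<and>
     (\<forall>f\<in>free_module V (F 0).
        (\<epsilon> *\<^sub>v f) $ 0 \<in> I \<longleftrightarrow> f \<in> (*\<^sub>v) (D 0) ` free_module V (F 1)) \<and>
     (\<forall>i. \<forall>f\<in>free_module V (F (Suc i)).
        D i *\<^sub>v f = 0\<^sub>v (length (F i)) \<longleftrightarrow>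
        f \<in> (*\<^sub>v) (D (Suc i)) ` free_module V (F (Suc (Suc i)))) \<and>
     (\<forall>i. \<forall>k<length (F i). \<forall>l<length (F (Suc i)).
        Poly_Mapping.lookup (D i $$ (k, l)) 0 = 0)"

definition graded_betti ::
  "'v set \<Rightarrow> ('v, 'k::field) mpoly set \<Rightarrow> nat \<Rightarrow> nat \<Rightarrow> nat" where
  "graded_betti V I i d =
     (THE m. \<exists>F \<epsilon> D. minimal_graded_free_resolution V I F \<epsilon> D \<and> m = count_list (F i) d)"

definition graph_betti :: "'k::field itself \<Rightarrow> 'v ugraph \<Rightarrow> int \<Rightarrow> int \<Rightarrow> nat" where
  "graph_betti K G i d =
     (if i < 0 \<or> d < 0 then 0
      else graded_betti (verts G) (edge_ideal G :: ('v, 'k) mpoly set) (nat i) (nat d))"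


section \<open>The polynomial of the graph B\<close>

definition lam :: "nat \<Rightarrow> nat \<Rightarrow> nat" where
  "lam b i =
     (if i < 1 \<or> i > 2 * b - 2 then 0
      else if i = 1 then 2 * (b choose 2) + b
      else if i = 3 then 6 * (b choose 4) + 2 * b * ((b - 1) choose 2) + (b choose 2)
      else 2 * i * (b choose (i + 1)) + 2 * b * ((b - 1) choose (i - 1)))"

definition mu :: "nat \<Rightarrow> nat \<Rightarrow> int" where
  "mu b i =
     int (lam b (i + 1)) + int ((2 * b - 2) choose (i + 2))
     - (2 * int b - 2) * int ((2 * b - 2) choose (i + 1))
     + ((int b)\<^sup>2 - 3 * int b + 1) * int ((2 * b - 2) choose i)"

text \<open>Polynomials in \<open>u\<close> and \<open>v\<close> are polynomials in \<open>u\<close> whose coefficients are polynomials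
  in \<open>v\<close>, so \<open>monom (monom c q) p\<close> is \<open>c u\<^sup>p v\<^sup>q\<close>.\<close>

definition P_poly :: "nat \<Rightarrow> int poly poly" where
  "P_poly b =
     1 + (\<Sum>r = 1..2 * b - 2. monom (monom (int (lam b r)) (r + 1)) r)
       + (\<Sum>r = 1..2 * b - 2. monom (monom (mu b r) (r + 2)) r)"

definition coeff_uv :: "int poly poly \<Rightarrow> int \<Rightarrow> int \<Rightarrow> int" where
  "coeff_uv P p q =
     (if p < 0 \<or> q < 0 then 0 else poly.coeff (poly.coeff P (nat p)) (nat q))"

end

(*
By Hochster's formula, the Betti number in degrees (i, d) is the sum over the vertex sets W of size d of
the dimension of the reduced cohomology in degree d - i - 1 of the independence complex of the induced
graph on W.  The formula itself is obtained by computing Tor with the Koszul resolution, multidegree by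
multidegree.  The independence complex of a disjoint union is a join, so the Kuenneth formula multiplies
the generating polynomials.  The independence complex of a join is a disjoint union, which only adds one
class in degree 0 when W meets both parts.  For B the complex is the bipartite graph obtained from
K_{b,b} by deleting a perfect matching: its components give the numbers lambda, and its Euler
characteristic gives the numbers mu.
*)
theory Submission
  imports Defs "HOL-Library.Function_Algebras"
begin

section \<open>Dimensions of finite-dimensional subspaces\<close>

text \<open>\<open>graded_betti\<close> is a definite description over minimal resolutions, so
  uniqueness of the counts and existence of a resolution both have to be shown. No derived functor
  is formed: homology enters only as an integer, cycles minus boundaries. If M' is the kernel of a
  minimal free cover of M, Koszul homology of M in degree j + 1 has the same dimension as that of M'
  in degree j; repeating this along the syzygies ends in degree 0, which counts generators.
  Existence needs finitely generated syzygies. This does not come from the Hilbert basis theorem but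
  from the same numbers: Hochster's sum is empty once d exceeds the number of vertices, and the
  vanishing is inherited by every syzygy module. Faces are encoded by their complements S in W,
  which turns the Koszul differential into a coboundary. A numbering \<iota> of the vertices
  supplies the signs, and the Kuenneth argument needs the first factor to precede the second. The
  field does not matter in the end because components and Euler characteristic of a graph do not
  depend on it.\<close>

context vector_space
begin

text \<open>The ambient spaces are function spaces of infinite dimension, so finiteness is attached
  to subsets; the comparisons of \<open>dim\<close> below rest on it.\<close>

definition findim :: "'b set \<Rightarrow> bool" where
  "findim S \<longleftrightarrow> (\<exists>B. finite B \<and> S \<subseteq> span B)"

lemma findim_subset: "local.findim T \<Longrightarrow> S \<subseteq> T \<Longrightarrow> local.findim S"
  unfolding findim_def by blast

lemma findim_basis:
  assumes "local.findim S"
  obtains B where "B \<subseteq> S" "finite B" "local.independent B" "S \<subseteq> span B" "card B = dim S"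
proof -
  obtain C where C: "finite C" "S \<subseteq> span C"
    using assms unfolding findim_def by blast
  obtain B where B: "B \<subseteq> S" "local.independent B" "S \<subseteq> span B" "card B = dim S"
    using basis_exists by blast
  have "B \<subseteq> span C" using B(1) C(2) by blast
  then have "finite B"
    using independent_span_bound[OF C(1) B(2)] by blast
  with B show thesis using that by blast
qed

lemma findim_subspace_eqI:
  assumes "local.findim T" "S \<subseteq> T" "subspace S" "dim T \<le> dim S"
  shows "S = T"
proof (rule ccontr)
  assume "S \<noteq> T"
  then obtain x where x: "x \<in> T" "x \<notin> S" using assms(2) by blast
  obtain B where B: "B \<subseteq> S" "finite B" "local.independent B" "S \<subseteq> span B" "card B = dim S"
    using findim_basis[OF findim_subset[OF assms(1,2)]] .
  have sp: "span B = S" using B assms(3) span_minimal by blast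
  then have "local.independent (insert x B)" using x B independent_insertI by blast
  moreover obtain C where C: "finite C" "T \<subseteq> span C" "card C = dim T"
    using findim_basis[OF assms(1)] by metis
  moreover have "insert x B \<subseteq> span C" using B x C assms(2) by blast
  ultimately have "card (insert x B) \<le> card C"
    using independent_span_bound by blast
  moreover have "card (insert x B) = Suc (card B)"
    using x B sp span_superset by (subst card_insert_disjoint) auto
  ultimately show False using B C assms(4) by simp
qed

lemma dim_zero_space [simp]: "dim {0} = 0"
  using dim_le_card[of "{0}" "{}"] by simp

lemma findim_sum_Collect:
  assumes "local.findim S" "local.findim T"
  shows "local.findim {x + y |x y. x \<in> S \<and> y \<in> T}"
proof -
  obtain B C where BC: "finite B" "S \<subseteq> span B" "finite C" "T \<subseteq> span C"
    using assms unfolding findim_def by blast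
  have "{x + y |x y. x \<in> S \<and> y \<in> T} \<subseteq> span (B \<union> C)"
    using BC(2,4) span_mono[of B "B \<union> C"] span_mono[of C "B \<union> C"] by (auto intro!: span_add)
  with BC show ?thesis unfolding findim_def by (meson finite_UnI)
qed

end

context vector_space_pair
begin

lemma findim_image:
  assumes "Vector_Spaces.linear s1 s2 f" "vs1.findim S"
  shows "vs2.findim (f ` S)"
  using assms linear_spans_image unfolding vs1.findim_def vs2.findim_def
  by (metis finite_imageI)

lemma dim_image_inj:
  assumes f: "Vector_Spaces.linear s1 s2 f" and S: "vs1.subspace S" "vs1.findim S" and inj: "\<And>x. x \<in> S \<Longrightarrow> f x = 0 \<Longrightarrow> x = 0"
  shows "vs2.dim (f ` S) = vs1.dim S"
proof -
  obtain B where B: "B \<subseteq> S" "finite B" "vs1.independent B" "S \<subseteq> vs1.span B" "card B = vs1.dim S"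
    using vs1.findim_basis[OF S(2)] .
  have sp: "vs1.span B = S" using B S vs1.span_minimal by blast
  have injS: "inj_on f S"
    using inj linear_inj_on_iff_eq_0[OF f S(1)] by blast
  have "vs2.independent (f ` B)"
    using linear_independent_injective_image[OF f B(3)] injS sp by simp
  moreover have "f ` S = vs2.span (f ` B)"
    using linear_span_image[OF f] sp by metis
  moreover have "card (f ` B) = card B"
    using card_image inj_on_subset[OF injS B(1)] by blast
  ultimately show ?thesis using B(5) vs2.dim_span_eq_card_independent by metis
qed

text \<open>A basis \<open>B\<close> of the kernel is extended to a basis \<open>C\<close> of
  \<open>S\<close>; the added vectors span a complement that \<open>f\<close> maps injectively onto
  the image.\<close>

lemma rank_nullity:
  assumes f: "Vector_Spaces.linear s1 s2 f" and S: "vs1.subspace S" "vs1.findim S"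
  shows "vs1.dim S = vs1.dim {x \<in> S. f x = 0} + vs2.dim (f ` S)"
proof -
  let ?N = "{x \<in> S. f x = 0}"
  have N: "vs1.subspace ?N"
    using S(1) linear_0[OF f] linear_add[OF f] linear_scale[OF f] unfolding vs1.subspace_def by auto
  obtain B where B: "B \<subseteq> ?N" "finite B" "vs1.independent B" "?N \<subseteq> vs1.span B" "card B = vs1.dim ?N"
    using vs1.findim_basis[OF vs1.findim_subset[OF S(2)], of ?N] by blast
  have BS: "B \<subseteq> S" using B(1) by blast
  obtain C where C: "B \<subseteq> C" "C \<subseteq> S" "vs1.independent C" "S \<subseteq> vs1.span C"
    using vs1.maximal_independent_subset_extend[OF BS B(3)] by blast
  obtain D where D: "finite D" "S \<subseteq> vs1.span D" using S(2) unfolding vs1.findim_def by blast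
  have finC: "finite C" using vs1.independent_span_bound[OF D(1) C(3)] C(2) D(2) by blast
  have spC: "vs1.span C = S" using C S vs1.span_minimal by blast
  have cardC: "card C = vs1.dim S" using vs1.basis_card_eq_dim C by blast
  let ?E = "C - B"
  have spE: "vs1.span ?E \<subseteq> S" using spC vs1.span_mono by blast
  \<comment> \<open>Such an \<open>x\<close> lies in the spans of both \<open>B\<close> and
    \<open>C - B\<close>, so each of its coordinates with respect to \<open>C\<close>
    vanishes.\<close>
  have inter: "x = 0" if x: "x \<in> vs1.span ?E" "f x = 0" for x
  proof -
    have "x \<in> vs1.span B" using x spE B(4) by blast
    then have x1: "vs1.representation B x = vs1.representation C x"
      using vs1.representation_extend[OF C(3) _ C(1)] by metis
    have x2: "vs1.representation ?E x = vs1.representation C x"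
      using vs1.representation_extend[OF C(3) x(1)] by auto
    have "vs1.representation C x b = 0" for b
    proof (cases "b \<in> B")
      case True
      then have "vs1.representation ?E x b = 0"
        using vs1.representation_ne_zero[of ?E x b] by blast
      then show ?thesis using x2 by simp
    next
      case False
      then have "vs1.representation B x b = 0"
        using vs1.representation_ne_zero[of B x b] by blast
      then show ?thesis using x1 by simp
    qed
    moreover have "x = (\<Sum>b\<in>C. s1 (vs1.representation C x b) b)"
      using vs1.sum_representation_eq[OF C(3) _ finC] x(1) spE spC by auto
    ultimately show ?thesis by simp
  qed
  have "f ` S = f ` vs1.span ?E"
  proof
    show "f ` S \<subseteq> f ` vs1.span ?E"
    proof
      fix y assume "y \<in> f ` S"
      then have "y \<in> vs2.span (f ` C)" using spC linear_span_image[OF f] by auto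
      moreover have "f ` C \<subseteq> vs2.span (f ` ?E)"
      proof
        fix z assume "z \<in> f ` C"
        then obtain c where c: "c \<in> C" "z = f c" by blast
        show "z \<in> vs2.span (f ` ?E)"
        proof (cases "c \<in> B")
          case True
          then have "f c = 0" using B(1) by blast
          then show ?thesis using c vs2.span_zero by simp
        next
          case False
          then have "f c \<in> f ` ?E" using c by blast
          then show ?thesis using c vs2.span_base by simp
        qed
      qed
      ultimately have "y \<in> vs2.span (f ` ?E)"
        using vs2.span_minimal[OF _ vs2.subspace_span] by blast
      then show "y \<in> f ` vs1.span ?E" using linear_span_image[OF f] by simp
    qed
  qed (use spE in blast)
  moreover have "vs2.dim (f ` vs1.span ?E) = vs1.dim (vs1.span ?E)"
    using inter finC by (intro dim_image_inj[OF f]) (auto simp: vs1.findim_def)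
  moreover have "vs1.dim (vs1.span ?E) = card ?E"
    using vs1.independent_mono[OF C(3)] by (intro vs1.dim_span_eq_card_independent) blast
  moreover have "card C = card B + card ?E"
    using C(1) finC by (metis card_Diff_subset card_mono finite_subset le_add_diff_inverse)
  ultimately show ?thesis using cardC B(5) by simp
qed

lemma subspace_kernel_on:
  assumes f: "Vector_Spaces.linear s1 s2 f" and S: "vs1.subspace S" and T: "vs2.subspace T"
  shows "vs1.subspace {x \<in> S. f x \<in> T}"
  using assms linear_0[OF f] linear_add[OF f] linear_scale[OF f]
  unfolding vs1.subspace_def vs2.subspace_def by auto

text \<open>Since \<open>N\<close> is the preimage of \<open>T'\<close>, \<open>f\<close> induces an
  isomorphism from S / N to T / T'. Two uses of rank-nullity with the same kernel give this as an
  identity of sums, with neither quotient spaces nor subtraction in \<open>nat\<close>.\<close>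

lemma dim_quotient_eq:
  assumes f: "Vector_Spaces.linear s1 s2 f" and S: "vs1.subspace S" "vs1.findim S"
    and T: "f ` S = T" and T': "vs2.subspace T'" "T' \<subseteq> T"
    and N: "\<And>x. x \<in> N \<longleftrightarrow> x \<in> S \<and> f x \<in> T'"
  shows "vs1.dim S + vs2.dim T' = vs1.dim N + vs2.dim T"
proof -
  have N_eq: "N = {x \<in> S. f x \<in> T'}" using N by blast
  have "vs1.subspace N" unfolding N_eq by (rule subspace_kernel_on[OF f S(1) T'(1)])
  moreover have "vs1.findim N" by (rule vs1.findim_subset[OF S(2)]) (auto simp: N_eq)
  moreover have "f ` N = T'" using T' T N_eq by auto
  moreover have "{x \<in> N. f x = 0} = {x \<in> S. f x = 0}"
    using N_eq vs2.subspace_0[OF T'(1)] by auto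
  ultimately show ?thesis
    using rank_nullity[OF f, of N] rank_nullity[OF f S] T by simp
qed

text \<open>The short exact sequence \<open>0 \<rightarrow> L \<rightarrow> P \<rightarrow> Q \<rightarrow> 0\<close> of complexes, with \<open>P\<close> exact at the
  places in question: the connecting homomorphism is an isomorphism. Both homologies are the
  quotient of \<open>{x \<in> P1. p (dP x) = 0}\<close> by \<open>L1 + dP ` P2\<close>.\<close>

lemma homology_dim_shift:
  assumes dP: "Vector_Spaces.linear s1 s1 dP" and dQ: "Vector_Spaces.linear s2 s2 dQ" and p: "Vector_Spaces.linear s1 s2 p"
    and P2: "vs1.subspace P2" and P1: "vs1.subspace P1" "vs1.findim P1"
    and PQ2: "p ` P2 = Q2" and PQ1: "p ` P1 = Q1"
    and comm: "\<And>x. x \<in> P1 \<union> P2 \<Longrightarrow> p (dP x) = dQ (p x)"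
    and dP1: "\<And>x. x \<in> P1 \<Longrightarrow> dP x \<in> P0" and dP2: "\<And>x. x \<in> P2 \<Longrightarrow> dP x \<in> P1"
    and dPdP: "\<And>x. x \<in> P1 \<union> P2 \<Longrightarrow> dP (dP x) = 0"
    and L1: "\<And>x. x \<in> L1 \<longleftrightarrow> x \<in> P1 \<and> p x = 0" and L0: "\<And>x. x \<in> L0 \<longleftrightarrow> x \<in> P0 \<and> p x = 0"
    and ex1: "\<And>x. x \<in> P1 \<Longrightarrow> dP x = 0 \<Longrightarrow> x \<in> dP ` P2"
    and ex0: "\<And>x. x \<in> L0 \<Longrightarrow> dP x = 0 \<Longrightarrow> x \<in> dP ` P1"
  shows "vs2.dim {x \<in> Q1. dQ x = 0} + vs1.dim (dP ` L1) = vs1.dim {x \<in> L0. dP x = 0} + vs2.dim (dQ ` Q2)"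
proof -
  interpret p11: vector_space_pair s1 s1 ..
  interpret p22: vector_space_pair s2 s2 ..
  let ?X = "{x \<in> P1. p (dP x) = 0}" and ?ZQ = "{x \<in> Q1. dQ x = 0}" and ?ZL = "{x \<in> L0. dP x = 0}"
  let ?N = "{x + y |x y. x \<in> L1 \<and> y \<in> dP ` P2}"
  have p_dP: "Vector_Spaces.linear s1 s2 (\<lambda>x. p (dP x))"
    using Vector_Spaces.linear_compose[OF dP p] by (simp add: comp_def)
  have X: "vs1.subspace ?X" using subspace_kernel_on[OF p_dP P1(1) vs2.subspace_single_0] by simp
  have fX: "vs1.findim ?X" by (rule vs1.findim_subset[OF P1(2)]) auto
  have L1_sub: "vs1.subspace L1"
  proof -
    have "L1 = {x \<in> P1. p x \<in> {0}}" using L1 by blast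
    then show ?thesis using subspace_kernel_on[OF p P1(1) vs2.subspace_single_0] by metis
  qed
  have Q2: "vs2.subspace Q2" using linear_subspace_image[OF p P2] PQ2 by simp
  have subX: "?N \<subseteq> ?X"
  proof clarify
    fix x y assume "x \<in> L1" "y \<in> P2"
    moreover from this have "p (dP x) = 0" using comm L1 p22.linear_0[OF dQ] by auto
    ultimately show "x + dP y \<in> P1 \<and> p (dP (x + dP y)) = 0"
      using L1 dP2 vs1.subspace_add[OF P1(1)] p11.linear_add[OF dP] dPdP linear_0[OF p] by simp
  qed
  \<comment> \<open>\<open>p\<close> maps \<open>?X\<close> onto the cycles of \<open>Q1\<close>,
    and exactly the elements of \<open>?N\<close> go to boundaries.\<close>
  have A: "vs1.dim ?X + vs2.dim (dQ ` Q2) = vs1.dim ?N + vs2.dim ?ZQ"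
  proof (rule dim_quotient_eq[OF p X fX])
    show "p ` ?X = ?ZQ" using PQ1 comm by auto
    show "vs2.subspace (dQ ` Q2)" using p22.linear_subspace_image[OF dQ Q2] .
    show "dQ ` Q2 \<subseteq> ?ZQ"
    proof clarify
      fix q assume "q \<in> Q2"
      then obtain x where x: "x \<in> P2" "q = p x" using PQ2 by blast
      then have "dQ q = p (dP x)" using comm by simp
      moreover have "dQ (p (dP x)) = p (dP (dP x))" using comm dP2 x by simp
      ultimately show "dQ q \<in> Q1 \<and> dQ (dQ q) = 0"
        using x dP2 PQ1 dPdP linear_0[OF p] by auto
    qed
    fix x
    show "x \<in> ?N \<longleftrightarrow> x \<in> ?X \<and> p x \<in> dQ ` Q2"
    proof
      assume x: "x \<in> ?N"
      then obtain u y where "x = u + dP y" "u \<in> L1" "y \<in> P2" by blast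
      then have "p x = dQ (p y)" using linear_add[OF p] L1 comm by simp
      then show "x \<in> ?X \<and> p x \<in> dQ ` Q2" using x subX PQ2 \<open>y \<in> P2\<close> by blast
    next
      assume x: "x \<in> ?X \<and> p x \<in> dQ ` Q2"
      then obtain y where y: "y \<in> P2" "p x = p (dP y)" using PQ2 comm by auto
      have "x - dP y \<in> L1"
        using x y L1 dP2 vs1.subspace_diff[OF P1(1)] linear_diff[OF p] by simp
      moreover have "x = (x - dP y) + dP y" by simp
      ultimately show "x \<in> ?N" using y(1) by blast
    qed
  qed
  \<comment> \<open>\<open>dP\<close> maps the same \<open>?X\<close> onto the cycles of
    \<open>L0\<close>, by \<open>ex0\<close>; by \<open>ex1\<close> the preimage of the boundaries
    coming from \<open>L1\<close> is again \<open>?N\<close>.\<close>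
  have B: "vs1.dim ?X + vs1.dim (dP ` L1) = vs1.dim ?N + vs1.dim ?ZL"
  proof (rule p11.dim_quotient_eq[OF dP X fX])
    show "dP ` ?X = ?ZL"
    proof
      show "dP ` ?X \<subseteq> ?ZL" using dP1 L0 dPdP by auto
      show "?ZL \<subseteq> dP ` ?X" using ex0 L0 by (fastforce simp: image_iff)
    qed
    show "vs1.subspace (dP ` L1)" using p11.linear_subspace_image[OF dP L1_sub] .
    show "dP ` L1 \<subseteq> ?ZL" using L1 L0 dP1 dPdP comm p22.linear_0[OF dQ] by auto
    fix x
    show "x \<in> ?N \<longleftrightarrow> x \<in> ?X \<and> dP x \<in> dP ` L1"
    proof
      assume x: "x \<in> ?N"
      then obtain u y where "x = u + dP y" "u \<in> L1" "y \<in> P2" by blast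
      then have "dP x = dP u" using p11.linear_add[OF dP] dPdP by simp
      then show "x \<in> ?X \<and> dP x \<in> dP ` L1" using x subX \<open>u \<in> L1\<close> by blast
    next
      assume x: "x \<in> ?X \<and> dP x \<in> dP ` L1"
      then obtain u where u: "u \<in> L1" "dP x = dP u" by blast
      then have "dP (x - u) = 0" using p11.linear_diff[OF dP] by simp
      moreover have "x - u \<in> P1" using x u L1 vs1.subspace_diff[OF P1(1)] by blast
      ultimately obtain y where "x - u = dP y" "y \<in> P2" using ex1 by blast
      then have "x = u + dP y" by (metis add.commute diff_add_cancel)
      then show "x \<in> ?N" using u(1) \<open>y \<in> P2\<close> by blast
    qed
  qed
  show ?thesis using A B by simp
qed

end

section \<open>Function spaces and finite products of subspaces\<close>

definition fscale :: "('k \<Rightarrow> 'm \<Rightarrow> 'm) \<Rightarrow> 'k \<Rightarrow> ('a \<Rightarrow> 'm) \<Rightarrow> 'a \<Rightarrow> 'm" where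
  "fscale s c f = (\<lambda>a. s c (f a))"

lemma fscale_apply: "fscale s c f a = s c (f a)"
  by (simp add: fscale_def)

lemma vector_space_fscale: "vector_space s \<Longrightarrow> vector_space (fscale s)"
  unfolding vector_space_def by (auto simp: fun_eq_iff fscale_apply)

lemma vector_space_times: "vector_space ((*) :: 'k::field \<Rightarrow> 'k \<Rightarrow> 'k)"
  by unfold_locales (auto simp: algebra_simps)

lemma sum_fun_apply: "(\<Sum>x\<in>A. f x) y = (\<Sum>x\<in>A. f x y)"
  by (induction A rule: infinite_finite_induct) auto

text \<open>A finite direct sum inside a function type. The value 0 outside \<open>I\<close> makes a
  family the same thing as a function, so Koszul chains and multigraded pieces can be plain
  functions.\<close>

definition fun_prod :: "'a set \<Rightarrow> ('a \<Rightarrow> 'm::zero set) \<Rightarrow> ('a \<Rightarrow> 'm) set" where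
  "fun_prod I U = {f. \<forall>a. if a \<in> I then f a \<in> U a else f a = 0}"

lemma subspace_fun_prod:
  assumes "vector_space s" "\<And>a. a \<in> I \<Longrightarrow> module.subspace s (U a)"
  shows "module.subspace (fscale s) (fun_prod I U)"
proof -
  interpret vector_space s by fact
  interpret f: vector_space "fscale s :: _ \<Rightarrow> ('c \<Rightarrow> _) \<Rightarrow> _" by (rule vector_space_fscale) fact
  show ?thesis using assms(2) unfolding fun_prod_def f.subspace_def
    by (auto simp: subspace_def fscale_apply)
qed

text \<open>Evaluation at a new index maps onto \<open>U a\<close> with the smaller product as
  kernel, so rank-nullity adds one summand at a time.\<close>

lemma findim_dim_fun_prod:
  fixes s :: "'k::field \<Rightarrow> 'm::ab_group_add \<Rightarrow> 'm" and U :: "'a \<Rightarrow> 'm set"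
  assumes "vector_space s" "finite I"
    and "\<And>a. a \<in> I \<Longrightarrow> module.subspace s (U a)" "\<And>a. a \<in> I \<Longrightarrow> vector_space.findim s (U a)"
  shows "vector_space.findim (fscale s) (fun_prod I U) \<and>
    vector_space.dim (fscale s) (fun_prod I U) = (\<Sum>a\<in>I. vector_space.dim s (U a))"
  using assms(2-4)
proof (induction I rule: finite_induct)
  interpret s: vector_space s by fact
  interpret f: vector_space "fscale s :: _ \<Rightarrow> ('a \<Rightarrow> _) \<Rightarrow> _" by (rule vector_space_fscale) fact
  case empty
  have *: "fun_prod {} U = {0}" by (auto simp: fun_prod_def)
  have "f.findim {0}" unfolding f.findim_def by (intro exI[of _ "{}"]) simp
  moreover have "f.dim {0} = 0" by (rule f.dim_zero_space)
  ultimately show ?case unfolding * by (simp only: sum.empty)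
next
  interpret s: vector_space s by fact
  interpret f: vector_space "fscale s :: _ \<Rightarrow> ('a \<Rightarrow> _) \<Rightarrow> _" by (rule vector_space_fscale) fact
  interpret p: vector_space_pair "fscale s :: _ \<Rightarrow> ('a \<Rightarrow> _) \<Rightarrow> _" s ..
  interpret q: vector_space_pair s "fscale s :: _ \<Rightarrow> ('a \<Rightarrow> _) \<Rightarrow> _" ..
  case (insert a I)
  let ?P = "fun_prod (insert a I) U" and ?Q = "fun_prod I U"
  let ?ev = "\<lambda>f::'a \<Rightarrow> 'm. f a" and ?em = "\<lambda>x b. if b = a then x else (0::'m)"
  have lin: "Vector_Spaces.linear (fscale s) s ?ev"
    unfolding Vector_Spaces.linear_iff using s.vector_space_axioms f.vector_space_axioms by (simp add: fscale_apply)
  have lin2: "Vector_Spaces.linear s (fscale s) ?em"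
    unfolding Vector_Spaces.linear_iff using s.vector_space_axioms f.vector_space_axioms by (simp add: fun_eq_iff fscale_apply)
  have subP: "f.subspace ?P" using subspace_fun_prod[OF assms(1)] insert.prems by blast
  have "?P \<subseteq> {x + y |x y. x \<in> ?em ` U a \<and> y \<in> ?Q}"
  proof
    fix f assume f: "f \<in> ?P"
    have "f = ?em (f a) + f(a := 0)" by (auto simp: fun_eq_iff)
    moreover have "f a \<in> U a" "f(a := 0) \<in> ?Q" using f insert.hyps by (auto simp: fun_prod_def)
    ultimately show "f \<in> {x + y |x y. x \<in> ?em ` U a \<and> y \<in> ?Q}" by blast
  qed
  moreover have "f.findim {x + y |x y. x \<in> ?em ` U a \<and> y \<in> ?Q}"
    using insert by (intro f.findim_sum_Collect q.findim_image[OF lin2]) auto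
  ultimately have fin: "f.findim ?P" using f.findim_subset by blast
  have img: "?ev ` ?P = U a"
  proof
    show "?ev ` ?P \<subseteq> U a" by (auto simp: fun_prod_def split: if_splits)
    show "U a \<subseteq> ?ev ` ?P"
    proof
      fix x assume "x \<in> U a"
      then have "?em x \<in> ?P" using insert.prems s.subspace_0 by (auto simp: fun_prod_def)
      then show "x \<in> ?ev ` ?P" by (rule rev_image_eqI) simp
    qed
  qed
  have ker: "{f \<in> ?P. f a = 0} = ?Q"
  proof
    show "{f \<in> ?P. f a = 0} \<subseteq> ?Q" unfolding fun_prod_def by auto
    show "?Q \<subseteq> {f \<in> ?P. f a = 0}"
    proof
      fix f assume f: "f \<in> ?Q"
      then have "f a = 0" using insert.hyps by (simp add: fun_prod_def)
      moreover have "0 \<in> U a" using insert.prems(1) s.subspace_0 by blast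
      ultimately show "f \<in> {f \<in> ?P. f a = 0}" using f by (auto simp: fun_prod_def)
    qed
  qed
  have "f.dim ?P = f.dim ?Q + s.dim (U a)"
    using p.rank_nullity[OF lin subP fin] img ker by simp
  then show ?case using insert fin by simp
qed

section \<open>Signs and the simplex\<close>

text \<open>The usual Koszul sign. Vertex types carry no order, so an injective numbering \<iota>
  takes its place.\<close>

definition ksgn :: "('v \<Rightarrow> nat) \<Rightarrow> 'v \<Rightarrow> 'v set \<Rightarrow> 'k::field" where
  "ksgn \<iota> v S = (-1) ^ card {u \<in> S. \<iota> u < \<iota> v}"

lemma ksgn_mult_self [simp]: "ksgn \<iota> v S * ksgn \<iota> v S = 1"
  by (simp add: ksgn_def power_mult_distrib[symmetric])

lemma ksgn_mult_self_left [simp]: "ksgn \<iota> v S * (ksgn \<iota> v S * x) = x"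
  by (simp add: mult.assoc[symmetric])

lemma ksgn_nonzero [simp]: "ksgn \<iota> v S \<noteq> 0"
  by (simp add: ksgn_def)

lemma ksgn_insert:
  assumes "finite S" "u \<notin> S"
  shows "ksgn \<iota> v (insert u S) = (if \<iota> u < \<iota> v then - ksgn \<iota> v S else ksgn \<iota> v S)"
proof -
  have "{x \<in> insert u S. \<iota> x < \<iota> v} =
      (if \<iota> u < \<iota> v then insert u {x \<in> S. \<iota> x < \<iota> v} else {x \<in> S. \<iota> x < \<iota> v})"
    by auto
  then show ?thesis using assms by (simp add: ksgn_def)
qed

text \<open>The two orders of adding \<open>u\<close> and \<open>v\<close> to \<open>S\<close>
  cancel; this is why the differentials square to zero.\<close>

lemma ksgn_antisym:
  assumes "finite S" "u \<notin> S" "v \<notin> S" "\<iota> u \<noteq> \<iota> v"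
  shows "ksgn \<iota> v S * ksgn \<iota> u (insert v S) = - (ksgn \<iota> u S * ksgn \<iota> v (insert u S))"
  using assms by (simp add: ksgn_insert)

text \<open>The variant that makes the cone operator in \<open>fdiff_exact\<close> a contracting
  homotopy.\<close>

lemma ksgn_antisym':
  assumes "finite S" "u \<notin> S" "v \<notin> S" "\<iota> u \<noteq> \<iota> v"
  shows "ksgn \<iota> v (insert u S) * ksgn \<iota> u (insert v S) = - (ksgn \<iota> u S * ksgn \<iota> v S)"
  using assms by (auto simp add: ksgn_insert)

text \<open>The terms (u, v) and (v, u) are cancelled in pairs, by induction on \<open>A\<close>.
  Showing that the sum equals its own negative would not be enough in characteristic 2.\<close>

lemma sum_antisym:
  fixes t :: "'a \<Rightarrow> 'a \<Rightarrow> 'b::ab_group_add"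
  assumes "finite A" "\<And>u v. u \<in> A \<Longrightarrow> v \<in> A \<Longrightarrow> u \<noteq> v \<Longrightarrow> t u v = - t v u"
  shows "(\<Sum>u\<in>A. \<Sum>v\<in>A - {u}. t u v) = 0"
  using assms
proof (induction A rule: finite_induct)
  case (insert a A)
  have "(\<Sum>v\<in>insert a A - {u}. t u v) = t u a + (\<Sum>v\<in>A - {u}. t u v)" if "u \<in> A" for u
  proof -
    have "insert a A - {u} = insert a (A - {u})" using that insert.hyps by blast
    then show ?thesis using insert.hyps by simp
  qed
  then have "(\<Sum>u\<in>A. \<Sum>v\<in>insert a A - {u}. t u v) =
      (\<Sum>u\<in>A. t u a) + (\<Sum>u\<in>A. \<Sum>v\<in>A - {u}. t u v)"
    by (simp add: sum.distrib)
  moreover have "(\<Sum>u\<in>A. \<Sum>v\<in>A - {u}. t u v) = 0"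
    by (rule insert.IH) (rule insert.prems, auto)
  moreover have "(\<Sum>u\<in>A. t u a) = (\<Sum>u\<in>A. - t a u)"
  proof (rule sum.cong[OF refl])
    fix u assume "u \<in> A"
    then show "t u a = - t a u" using insert.hyps by (intro insert.prems) auto
  qed
  moreover have "insert a A - {a} = A" using insert.hyps by blast
  ultimately show ?case
    by (simp only: sum.insert[OF insert.hyps] sum_negf) simp
qed simp

text \<open>The chains are functions on those subsets \<open>S\<close> of \<open>W\<close> that satisfy \<open>P\<close>. For
  \<open>P S = (W - S independent)\<close> this is, up to the complement \<open>S \<mapsto> W - S\<close>, the cochain
  complex of the independence complex.\<close>

definition fchain :: "'v set \<Rightarrow> ('v set \<Rightarrow> bool) \<Rightarrow> nat \<Rightarrow> ('v set \<Rightarrow> 'k::field) set" where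
  "fchain W P j = {f. \<forall>S. f S \<noteq> 0 \<longrightarrow> S \<subseteq> W \<and> P S \<and> card S = j}"

definition fdiff ::
  "('v \<Rightarrow> nat) \<Rightarrow> 'v set \<Rightarrow> ('v set \<Rightarrow> bool) \<Rightarrow> ('v set \<Rightarrow> 'k::field) \<Rightarrow> 'v set \<Rightarrow> 'k" where
  "fdiff \<iota> W P f = (\<lambda>S. if S \<subseteq> W \<and> P S then \<Sum>v\<in>W - S. ksgn \<iota> v S * f (insert v S) else 0)"

abbreviation fsc :: "'k::field \<Rightarrow> ('a \<Rightarrow> 'k) \<Rightarrow> 'a \<Rightarrow> 'k" where
  "fsc \<equiv> fscale (*)"

lemma vector_space_fsc: "vector_space fsc"
  by (intro vector_space_fscale vector_space_times)

lemma fdiff_linear: "Vector_Spaces.linear fsc fsc (fdiff \<iota> W P)"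
  unfolding Vector_Spaces.linear_iff
  by (auto simp: vector_space_fsc fdiff_def fscale_apply fun_eq_iff sum.distrib sum_distrib_left algebra_simps)

lemma fchain_subspace: "module.subspace fsc (fchain W P j)"
proof -
  interpret vector_space fsc by (rule vector_space_fsc)
  have *: "fchain W P j = {f. \<forall>S. \<not> (S \<subseteq> W \<and> P S \<and> card S = j) \<longrightarrow> f S = 0}"
    by (auto simp: fchain_def)
  show ?thesis unfolding * subspace_def by (auto simp: fscale_apply)
qed

lemma fchain_findim:
  assumes "finite W" shows "vector_space.findim fsc (fchain W P j :: ('v set \<Rightarrow> 'k::field) set)"
proof -
  interpret k: vector_space "(*) :: 'k \<Rightarrow> 'k \<Rightarrow> 'k" by (rule vector_space_times)
  interpret vector_space "fsc :: 'k \<Rightarrow> ('v set \<Rightarrow> 'k) \<Rightarrow> _" by (rule vector_space_fsc)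
  have "x \<in> k.span {1}" for x :: 'k
    using k.span_scale[OF k.span_base, of 1 "{1}" x] by simp
  then have "k.findim UNIV" unfolding k.findim_def by (intro exI[of _ "{1}"]) auto
  then have "local.findim (fun_prod (Pow W) (\<lambda>_. UNIV :: 'k set))"
    using findim_dim_fun_prod[OF vector_space_times, of "Pow W" "\<lambda>_. UNIV :: 'k set"] assms
    by auto
  moreover have "fchain W P j \<subseteq> fun_prod (Pow W) (\<lambda>_. UNIV :: 'k set)"
    by (auto simp: fchain_def fun_prod_def)
  ultimately show ?thesis by (rule findim_subset)
qed

lemma fdiff_fchain: 
  assumes "finite W" "f \<in> fchain W P (Suc j)"
  shows "fdiff \<iota> W P f \<in> fchain W P j"
  unfolding fchain_def
proof (intro CollectI allI impI)
  fix S assume S: "fdiff \<iota> W P f S \<noteq> 0"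
  then have SW: "S \<subseteq> W" "P S" by (auto simp: fdiff_def split: if_splits)
  have "(\<Sum>v\<in>W - S. ksgn \<iota> v S * f (insert v S)) \<noteq> 0"
    using S SW by (simp add: fdiff_def)
  then obtain v where "v \<in> W - S" "ksgn \<iota> v S * f (insert v S) \<noteq> 0"
    by (meson sum.not_neutral_contains_not_neutral)
  then have "card (insert v S) = Suc j" "v \<notin> S"
    using assms(2) by (auto simp: fchain_def)
  then have "card S = j" using SW finite_subset[OF _ assms(1)] by (auto simp: card_insert_if)
  then show "S \<subseteq> W \<and> P S \<and> card S = j" using SW by blast
qed

text \<open>As \<open>P\<close> is closed upwards, the condition inside the inner differential holds
  whenever the outer one does; the double sum is then antisymmetric.\<close>

lemma fdiff_fdiff:
  assumes W: "finite W" "inj_on \<iota> W" and f: "f \<in> fchain W P j"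
    and P: "\<And>S v. P S \<Longrightarrow> v \<in> W \<Longrightarrow> S \<subseteq> W \<Longrightarrow> P (insert v S)"
  shows "fdiff \<iota> W P (fdiff \<iota> W P f) = 0"
proof
  fix S
  show "fdiff \<iota> W P (fdiff \<iota> W P f) S = (0 :: _ \<Rightarrow> _) S"
  proof (cases "S \<subseteq> W \<and> P S")
    case True
    have *: "ksgn \<iota> v S * fdiff \<iota> W P f (insert v S) =
        (\<Sum>u\<in>(W - S) - {v}. ksgn \<iota> v S * (ksgn \<iota> u (insert v S) * f (insert u (insert v S))))"
      if "v \<in> W - S" for v
    proof -
      have "W - insert v S = (W - S) - {v}" by blast
      then show ?thesis using that True P[of S v] by (simp add: fdiff_def sum_distrib_left)
    qed
    have "fdiff \<iota> W P (fdiff \<iota> W P f) S = (\<Sum>v\<in>W - S. \<Sum>u\<in>(W - S) - {v}.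
        ksgn \<iota> v S * (ksgn \<iota> u (insert v S) * f (insert u (insert v S))))"
      using True by (subst fdiff_def) (simp only: if_True simp_thms, rule sum.cong[OF refl *])
    also have "\<dots> = 0"
    proof (rule sum_antisym)
      fix u v assume uv: "u \<in> W - S" "v \<in> W - S" "u \<noteq> v"
      then have "\<iota> u \<noteq> \<iota> v" using W(2) by (auto simp: inj_on_def)
      moreover have "finite S" using True W(1) finite_subset by blast
      ultimately have "ksgn \<iota> u S * ksgn \<iota> v (insert u S) =
          - (ksgn \<iota> v S * ksgn \<iota> u (insert v S) :: 'b)"
        using uv by (intro ksgn_antisym) auto
      then show "ksgn \<iota> u S * (ksgn \<iota> v (insert u S) * f (insert v (insert u S))) =
          - (ksgn \<iota> v S * (ksgn \<iota> u (insert v S) * f (insert u (insert v S))))"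
        by (simp add: mult.assoc[symmetric] insert_commute)
    qed (use W in auto)
    finally show ?thesis by simp
  qed (auto simp: fdiff_def)
qed

text \<open>If adding or removing \<open>w\<close> does not affect \<open>P\<close>, then the complex is a cone with apex \<open>w\<close>.\<close>

lemma fdiff_exact:
  fixes f :: "'v set \<Rightarrow> 'k::field"
  assumes W: "finite W" "inj_on \<iota> W" "w \<in> W"
    and P: "\<And>S. S \<subseteq> W \<Longrightarrow> w \<in> S \<Longrightarrow> P S \<longleftrightarrow> P (S - {w})"
    and f: "f \<in> fchain W P j" "fdiff \<iota> W P f = 0"
  shows "f \<in> fdiff \<iota> W P ` fchain W P (Suc j)"
proof -
  \<comment> \<open>The cone operator: a set containing \<open>w\<close> receives, with a sign, the
    value of \<open>f\<close> on the set without \<open>w\<close>.\<close>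
  define h where "h S = (if w \<in> S then ksgn \<iota> w (S - {w}) * f (S - {w}) else 0)" for S
  have "h \<in> fchain W P (Suc j)"
    unfolding fchain_def
  proof (intro CollectI allI impI)
    fix S assume "h S \<noteq> 0"
    then have "w \<in> S" "f (S - {w}) \<noteq> 0" by (auto simp: h_def split: if_splits)
    moreover from this have "S - {w} \<subseteq> W" "P (S - {w})" "card (S - {w}) = j"
      using f(1) unfolding fchain_def by auto
    moreover from this have "finite S" using W(1) by (metis finite_Diff2 finite_subset finite.emptyI finite_insert)
    ultimately show "S \<subseteq> W \<and> P S \<and> card S = Suc j"
      using W(3) P[of S] card_Suc_Diff1[of S w] by auto
  qed
  moreover have "fdiff \<iota> W P h S = f S" for S
  proof (cases "S \<subseteq> W \<and> P S")
    case False
    then show ?thesis using f(1) by (auto simp: fdiff_def fchain_def)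
  next
    case True
    then have finS: "finite S" using W(1) finite_subset by blast
    show ?thesis
    proof (cases "w \<in> S")
      \<comment> \<open>Here \<open>f S\<close> comes from the cycle condition at
        \<open>S - {w}\<close>, of which it is the term for \<open>w\<close>.\<close>
      case wS: True
      define T where "T = S - {w}"
      have T: "S = insert w T" "w \<notin> T" "finite T" "T \<subseteq> W" "P T"
        using wS True finS P[of S] by (auto simp: T_def)
      have WT: "W - T = insert w (W - S)" using T W(3) by auto
      have "0 = fdiff \<iota> W P f T" using f(2) by simp
      also have "\<dots> = ksgn \<iota> w T * f S + (\<Sum>v\<in>W - S. ksgn \<iota> v T * f (insert v T))"
        using T(4,5) W(1) unfolding fdiff_def WT using wS by (simp add: T(1)[symmetric])
      finally have eq: "(\<Sum>v\<in>W - S. ksgn \<iota> v T * f (insert v T)) = - (ksgn \<iota> w T * f S)"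
        by (simp add: eq_neg_iff_add_eq_0 add.commute)
      have "fdiff \<iota> W P h S = (\<Sum>v\<in>W - S. ksgn \<iota> v S * (ksgn \<iota> w (insert v T) * f (insert v T)))"
      proof -
        have "h (insert v S) = ksgn \<iota> w (insert v T) * f (insert v T)" if "v \<in> W - S" for v
        proof -
          have "insert v S - {w} = insert v T" using T wS that by blast
          then show ?thesis using wS by (simp add: h_def)
        qed
        then show ?thesis using True by (simp add: fdiff_def)
      qed
      also have "\<dots> = (\<Sum>v\<in>W - S. - (ksgn \<iota> w T * (ksgn \<iota> v T * f (insert v T))))"
      proof (rule sum.cong[OF refl])
        fix v assume v: "v \<in> W - S"
        then have "\<iota> w \<noteq> \<iota> v" using W wS by (auto simp: inj_on_def)
        then have "ksgn \<iota> v S * ksgn \<iota> w (insert v T) = - (ksgn \<iota> w T * ksgn \<iota> v T :: 'k)"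
          unfolding T(1) using T v by (intro ksgn_antisym') auto
        then show "ksgn \<iota> v S * (ksgn \<iota> w (insert v T) * f (insert v T)) =
            - (ksgn \<iota> w T * (ksgn \<iota> v T * f (insert v T)))"
          by (simp add: mult.assoc[symmetric])
      qed
      also have "\<dots> = f S" using eq by (simp add: sum_negf sum_distrib_left[symmetric])
      finally show ?thesis .
    next
      case wS: False
      have "fdiff \<iota> W P h S = (\<Sum>v\<in>W - S. if v = w then ksgn \<iota> w S * h (insert w S) else 0)"
        using True wS by (auto simp: fdiff_def h_def intro!: sum.cong)
      also have "\<dots> = ksgn \<iota> w S * h (insert w S)" using W wS by simp
      also have "\<dots> = f S" using wS by (simp add: h_def)
      finally show ?thesis .
    qed
  qed
  ultimately show ?thesis by (metis ext image_eqI)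
qed

section \<open>Monomials and homogeneous polynomials\<close>

lemma poly_mapping_sum_single: "(\<Sum>m\<in>Poly_Mapping.keys p. Poly_Mapping.single m (Poly_Mapping.lookup p m)) = p"
  by (rule poly_mapping_eqI) (simp add: lookup_sum lookup_single when_def in_keys_iff)

lemma lookup_sum_single:
  assumes "finite D"
  shows "Poly_Mapping.lookup (\<Sum>m\<in>D. Poly_Mapping.single m (c m)) x = (if x \<in> D then c x else 0)"
  using assms by (simp add: lookup_sum lookup_single when_def)

lemma lookup_single_mult:
  fixes p :: "('v, 'k::field) mpoly"
  shows "Poly_Mapping.lookup (Poly_Mapping.single t c * p) x =
    (\<Sum>m\<in>Poly_Mapping.keys p. if t + m = x then c * Poly_Mapping.lookup p m else 0)"
proof -
  have "Poly_Mapping.single t c * p =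
      (\<Sum>m\<in>Poly_Mapping.keys p. Poly_Mapping.single (t + m) (c * Poly_Mapping.lookup p m))"
    by (subst (1) poly_mapping_sum_single[of p, symmetric]) (simp add: sum_distrib_left mult_single)
  then show ?thesis by (simp add: lookup_sum lookup_single when_def cong: if_cong)
qed

lemma lookup_single_mult_add [simp]:
  fixes p :: "('v, 'k::field) mpoly"
  shows "Poly_Mapping.lookup (Poly_Mapping.single t c * p) (t + m) = c * Poly_Mapping.lookup p m"
  unfolding lookup_single_mult by (simp add: in_keys_iff)

lemma lookup_single_zero_mult [simp]:
  fixes p :: "('v, 'k::field) mpoly"
  shows "Poly_Mapping.lookup (Poly_Mapping.single 0 c * p) m = c * Poly_Mapping.lookup p m"
  using lookup_single_mult_add[of 0 c p m] by simp

lemma single_add_diff: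
  fixes m :: "'v \<Rightarrow>\<^sub>0 nat"
  assumes "v \<in> Poly_Mapping.keys m"
  shows "Poly_Mapping.single v 1 + (m - Poly_Mapping.single v 1) = m"
  using assms by (intro poly_mapping_eqI) (auto simp: lookup_add lookup_minus lookup_single when_def in_keys_iff)

lemma lookup_single_var_mult:
  fixes p :: "('v, 'k::field) mpoly"
  shows "Poly_Mapping.lookup (Poly_Mapping.single (Poly_Mapping.single v 1) c * p) m =
    (if v \<in> Poly_Mapping.keys m then c * Poly_Mapping.lookup p (m - Poly_Mapping.single v 1) else 0)"
proof (cases "v \<in> Poly_Mapping.keys m")
  case True
  then show ?thesis
    using lookup_single_mult_add[of "Poly_Mapping.single v 1" c p "m - Poly_Mapping.single v 1"]
    by (simp only: single_add_diff if_True)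
next
  case False
  then have "Poly_Mapping.single v 1 + x \<noteq> m" for x
    by (auto simp: in_keys_iff lookup_add)
  then show ?thesis using False by (simp add: lookup_single_mult)
qed

lemma mon_deg_add: "mon_deg (m + m') = mon_deg m + mon_deg m'"
  unfolding mon_deg_def by (rule setsum_keys_plus_distrib) auto

lemma mon_deg_superset:
  assumes "finite A" "Poly_Mapping.keys m \<subseteq> A"
  shows "mon_deg m = (\<Sum>v\<in>A. Poly_Mapping.lookup m v)"
  unfolding mon_deg_def using assms by (intro sum.mono_neutral_left) (auto simp: in_keys_iff)

lemma mon_deg_single [simp]: "mon_deg (Poly_Mapping.single v n) = n"
  by (simp add: mon_deg_def)

lemma mon_deg_eq_0_iff [simp]: "mon_deg m = 0 \<longleftrightarrow> m = 0"
proof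
  assume "mon_deg m = 0"
  then have "Poly_Mapping.lookup m v = 0" for v
    by (cases "v \<in> Poly_Mapping.keys m") (auto simp: mon_deg_def in_keys_iff)
  then show "m = 0" by (metis poly_mapping_eqI lookup_zero)
qed (simp add: mon_deg_def)

definition ind_mon :: "'v set \<Rightarrow> ('v \<Rightarrow>\<^sub>0 nat)" where
  "ind_mon S = (\<Sum>v\<in>S. Poly_Mapping.single v 1)"

lemma lookup_ind_mon: "finite S \<Longrightarrow> Poly_Mapping.lookup (ind_mon S) v = of_bool (v \<in> S)"
  unfolding ind_mon_def by (subst lookup_sum_single) auto

lemma keys_ind_mon [simp]: "finite S \<Longrightarrow> Poly_Mapping.keys (ind_mon S) = S"
  by (auto simp: in_keys_iff lookup_ind_mon)

lemma mon_deg_ind_mon [simp]: "finite S \<Longrightarrow> mon_deg (ind_mon S) = card S"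
  by (simp add: mon_deg_def lookup_ind_mon)

lemma ind_mon_insert: "finite S \<Longrightarrow> v \<notin> S \<Longrightarrow> ind_mon (insert v S) = Poly_Mapping.single v 1 + ind_mon S"
  by (simp add: ind_mon_def)

lemma ind_mon_empty [simp]: "ind_mon {} = 0"
  by (simp add: ind_mon_def)

lemma minus_add_ind_mon:
  assumes "S \<subseteq> Poly_Mapping.keys \<alpha>"
  shows "\<alpha> - ind_mon S + ind_mon S = \<alpha>"
proof (rule poly_mapping_eqI)
  fix v
  have "finite S" by (rule finite_subset[OF assms finite_keys])
  moreover have "v \<in> S \<Longrightarrow> Poly_Mapping.lookup \<alpha> v \<noteq> 0" using assms by (auto simp: in_keys_iff)
  ultimately show "Poly_Mapping.lookup (\<alpha> - ind_mon S + ind_mon S) v = Poly_Mapping.lookup \<alpha> v"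
    by (auto simp: lookup_add lookup_minus lookup_ind_mon)
qed

lemma finite_monomials:
  assumes "finite V"
  shows "finite {m :: 'v \<Rightarrow>\<^sub>0 nat. Poly_Mapping.keys m \<subseteq> V \<and> mon_deg m + c = e}"
proof -
  let ?A = "{m :: 'v \<Rightarrow>\<^sub>0 nat. Poly_Mapping.keys m \<subseteq> V \<and> mon_deg m + c = e}"
  have "Poly_Mapping.lookup ` ?A \<subseteq> {f. \<forall>x. (x \<in> V \<longrightarrow> f x \<in> {..e}) \<and> (x \<notin> V \<longrightarrow> f x = 0)}"
  proof (clarsimp, intro conjI impI)
    fix m :: "'v \<Rightarrow>\<^sub>0 nat" and x
    assume m: "Poly_Mapping.keys m \<subseteq> V" "e = mon_deg m + c"
    have "Poly_Mapping.lookup m x \<le> mon_deg m" if "x \<in> V"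
      using mon_deg_superset[OF assms m(1)] member_le_sum[of x V "Poly_Mapping.lookup m"] that assms by simp
    then show "x \<in> V \<Longrightarrow> Poly_Mapping.lookup m x \<le> mon_deg m + c" by simp
    show "x \<notin> V \<Longrightarrow> Poly_Mapping.lookup m x = 0" using m(1) by (auto simp: in_keys_iff)
  qed
  then have "finite (Poly_Mapping.lookup ` ?A)"
    using finite_set_of_finite_funs[OF assms, of "{..e}" 0] finite_subset by blast
  moreover have "inj_on Poly_Mapping.lookup ?A"
    by (intro inj_onI poly_mapping_eqI) simp
  ultimately show ?thesis by (rule finite_imageD)
qed

definition psc :: "'k::field \<Rightarrow> ('v, 'k) mpoly \<Rightarrow> ('v, 'k) mpoly" where
  "psc c p = Poly_Mapping.single 0 c * p"

lemma vector_space_psc: "vector_space psc"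
  by unfold_locales (auto simp: psc_def algebra_simps single_add mult_single mult.assoc[symmetric])

text \<open>The part of degree \<open>e\<close> of the shifted ring R(-c). The condition is additive
  so that only 0 remains when e < c.\<close>

definition hpoly :: "'v set \<Rightarrow> nat \<Rightarrow> nat \<Rightarrow> ('v, 'k::field) mpoly set" where
  "hpoly V c e = {p. \<forall>m\<in>Poly_Mapping.keys p. Poly_Mapping.keys m \<subseteq> V \<and> mon_deg m + c = e}"

lemma hpoly_lookup: "p \<in> hpoly V c e \<longleftrightarrow>
    (\<forall>m. \<not> (Poly_Mapping.keys m \<subseteq> V \<and> mon_deg m + c = e) \<longrightarrow> Poly_Mapping.lookup p m = 0)"
  unfolding hpoly_def by (auto simp: in_keys_iff)

lemma hpoly_subspace: "module.subspace psc (hpoly V c e)"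
proof -
  interpret vector_space psc by (rule vector_space_psc)
  show ?thesis unfolding subspace_def by (auto simp: hpoly_lookup lookup_add psc_def)
qed

lemma hpoly_findim:
  assumes "finite V" shows "vector_space.findim psc (hpoly V c e :: ('v, 'k::field) mpoly set)"
proof -
  interpret vector_space "psc :: 'k \<Rightarrow> ('v, 'k) mpoly \<Rightarrow> _" by (rule vector_space_psc)
  let ?B = "(\<lambda>m. Poly_Mapping.single m 1) ` {m. Poly_Mapping.keys m \<subseteq> V \<and> mon_deg m + c = e}"
  have "hpoly V c e \<subseteq> span ?B"
  proof
    fix p :: "('v, 'k) mpoly" assume p: "p \<in> hpoly V c e"
    have "(\<Sum>m\<in>Poly_Mapping.keys p. psc (Poly_Mapping.lookup p m) (Poly_Mapping.single m 1)) \<in> span ?B"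
      using p by (intro span_sum span_scale span_base) (auto simp: hpoly_def)
    then show "p \<in> span ?B" by (simp add: psc_def mult_single poly_mapping_sum_single)
  qed
  then show ?thesis unfolding findim_def using finite_monomials[OF assms] by blast
qed

lemma hpoly_var_mult:
  assumes "p \<in> hpoly V c e" "v \<in> V"
  shows "Poly_Mapping.single (Poly_Mapping.single v 1) a * p \<in> hpoly V c (Suc e)"
  unfolding hpoly_lookup
proof (intro allI impI)
  fix m assume m: "\<not> (Poly_Mapping.keys m \<subseteq> V \<and> mon_deg m + c = Suc e)"
  let ?n = "m - Poly_Mapping.single v 1"
  have "Poly_Mapping.lookup p ?n = 0" if v: "v \<in> Poly_Mapping.keys m"
  proof -
    have "mon_deg m = Suc (mon_deg ?n)"
      using mon_deg_add[of "Poly_Mapping.single v 1" ?n] single_add_diff[OF v] by simp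
    moreover have "Poly_Mapping.keys m \<subseteq> insert v (Poly_Mapping.keys ?n)"
      by (auto simp: in_keys_iff lookup_minus lookup_single when_def split: if_splits)
    ultimately have "\<not> (Poly_Mapping.keys ?n \<subseteq> V \<and> mon_deg ?n + c = e)"
      using m assms(2) by auto
    then show ?thesis using assms(1) by (simp add: hpoly_lookup)
  qed
  then show "Poly_Mapping.lookup (Poly_Mapping.single (Poly_Mapping.single v 1) a * p) m = 0"
    unfolding lookup_single_var_mult by simp
qed

section \<open>The Koszul complex\<close>

abbreviation vsc :: "'k::field \<Rightarrow> ('a \<Rightarrow> ('v, 'k) mpoly) \<Rightarrow> 'a \<Rightarrow> ('v, 'k) mpoly" where
  "vsc \<equiv> fscale psc"

abbreviation csc :: "'k::field \<Rightarrow> ('b \<Rightarrow> 'a \<Rightarrow> ('v, 'k) mpoly) \<Rightarrow> 'b \<Rightarrow> 'a \<Rightarrow> ('v, 'k) mpoly" where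
  "csc \<equiv> fscale vsc"

lemma vector_space_vsc: "vector_space vsc"
  by (intro vector_space_fscale vector_space_psc)

lemma vector_space_csc: "vector_space csc"
  by (intro vector_space_fscale vector_space_psc)

text \<open>The degree \<open>e\<close> part of the graded free module given by \<open>ds\<close>.\<close>

definition free_part :: "'v set \<Rightarrow> nat list \<Rightarrow> nat \<Rightarrow> (nat \<Rightarrow> ('v, 'k::field) mpoly) set" where
  "free_part V ds e = fun_prod {..<length ds} (\<lambda>k. hpoly V (ds ! k) e)"

text \<open>A graded module \<open>M\<close> is given by its homogeneous parts.\<close>

definition kchain ::
  "'v set \<Rightarrow> (nat \<Rightarrow> (nat \<Rightarrow> ('v, 'k::field) mpoly) set) \<Rightarrow> nat \<Rightarrow> nat \<Rightarrow>
    ('v set \<Rightarrow> nat \<Rightarrow> ('v, 'k) mpoly) set" where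
  "kchain V M j d = fun_prod {S. S \<subseteq> V \<and> card S = j \<and> j \<le> d} (\<lambda>_. M (d - j))"

text \<open>The exterior degree drops by one while the factor x_v raises the module degree by one,
  so the total degree \<open>d\<close> of \<open>kchain\<close> is preserved.\<close>

definition kdiff ::
  "('v \<Rightarrow> nat) \<Rightarrow> 'v set \<Rightarrow> ('v set \<Rightarrow> nat \<Rightarrow> ('v, 'k::field) mpoly) \<Rightarrow> 'v set \<Rightarrow> nat \<Rightarrow> ('v, 'k) mpoly" where
  "kdiff \<iota> V g = (\<lambda>S k. \<Sum>v\<in>V - S.
     Poly_Mapping.single (Poly_Mapping.single v 1) (ksgn \<iota> v S) * g (insert v S) k)"

text \<open>Closure under scaled variables is enough: monomials and homogeneous polynomials follow
  in \<open>graded_submodule_mult_single\<close> and \<open>graded_submodule_mult\<close>.\<close>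

definition graded_submodule ::
  "'v set \<Rightarrow> (nat \<Rightarrow> (nat \<Rightarrow> ('v, 'k::field) mpoly) set) \<Rightarrow> bool" where
  "graded_submodule V M \<longleftrightarrow> (\<forall>e. module.subspace vsc (M e)) \<and>
     (\<forall>e v a f. v \<in> V \<longrightarrow> f \<in> M e \<longrightarrow>
       (\<lambda>k. Poly_Mapping.single (Poly_Mapping.single v 1) a * f k) \<in> M (Suc e))"

lemma kdiff_linear: "Vector_Spaces.linear csc csc (kdiff \<iota> V)"
  unfolding Vector_Spaces.linear_iff
  by (auto simp: vector_space_csc kdiff_def fscale_apply psc_def fun_eq_iff sum.distrib
      sum_distrib_left distrib_left mult.left_commute)

lemma free_part_submodule: "graded_submodule V (free_part V ds)"
  unfolding graded_submodule_def free_part_def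
proof (intro conjI allI impI)
  fix e
  show "module.subspace vsc (fun_prod {..<length ds} (\<lambda>k. hpoly V (ds ! k) e))"
    by (intro subspace_fun_prod vector_space_psc hpoly_subspace)
next
  fix e v a and f :: "nat \<Rightarrow> ('a, 'b) mpoly"
  assume "v \<in> V" "f \<in> fun_prod {..<length ds} (\<lambda>k. hpoly V (ds ! k) e)"
  then show "(\<lambda>k. Poly_Mapping.single (Poly_Mapping.single v 1) a * f k)
      \<in> fun_prod {..<length ds} (\<lambda>k. hpoly V (ds ! k) (Suc e))"
    using hpoly_var_mult[of _ V _ e v a] by (auto simp: fun_prod_def split: if_splits)
qed

lemma free_part_findim:
  "finite V \<Longrightarrow> vector_space.findim vsc (free_part V ds e :: (nat \<Rightarrow> ('v, 'k::field) mpoly) set)"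
  unfolding free_part_def
  using findim_dim_fun_prod[OF vector_space_psc, of "{..<length ds}" "\<lambda>k. hpoly V (ds ! k) e"]
    hpoly_subspace hpoly_findim by blast

lemma kchain_subspace: "graded_submodule V M \<Longrightarrow> module.subspace csc (kchain V M j d)"
  unfolding kchain_def graded_submodule_def by (intro subspace_fun_prod vector_space_vsc) auto

lemma kchain_findim:
  assumes "finite V" "graded_submodule V M" "\<And>e. vector_space.findim vsc (M e)"
  shows "vector_space.findim csc (kchain V M j d)"
proof -
  have "finite {S. S \<subseteq> V \<and> card S = j \<and> j \<le> d}"
    by (rule finite_subset[of _ "Pow V"]) (use assms(1) in auto)
  then show ?thesis unfolding kchain_def
    using findim_dim_fun_prod[OF vector_space_vsc, of "{S. S \<subseteq> V \<and> card S = j \<and> j \<le> d}" "\<lambda>_. M (d - j)"]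
      assms by (auto simp: graded_submodule_def)
qed

lemma kchain_mono: "(\<And>e. M e \<subseteq> N e) \<Longrightarrow> kchain V M j d \<subseteq> kchain V N j d"
  unfolding kchain_def fun_prod_def by (auto split: if_splits)

lemma kdiff_kchain:
  fixes M :: "nat \<Rightarrow> (nat \<Rightarrow> ('v, 'k::field) mpoly) set"
  assumes V: "finite V" and M: "graded_submodule V M" and g: "g \<in> kchain V M (Suc j) d"
  shows "kdiff \<iota> V g \<in> kchain V M j d"
  unfolding kchain_def fun_prod_def
proof (intro CollectI allI)
  fix S
  interpret vector_space "vsc :: 'k \<Rightarrow> (nat \<Rightarrow> ('v, 'k) mpoly) \<Rightarrow> _" by (rule vector_space_vsc)
  have sub: "subspace (M e)" for e using M by (simp add: graded_submodule_def)
  have kd: "kdiff \<iota> V g S = (\<Sum>v\<in>V - S. (\<lambda>k.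
      Poly_Mapping.single (Poly_Mapping.single v 1) (ksgn \<iota> v S) * g (insert v S) k))"
    by (simp add: kdiff_def fun_eq_iff sum_fun_apply)
  have g0: "g T = 0" if "\<not> (T \<subseteq> V \<and> card T = Suc j \<and> Suc j \<le> d)" for T
    using g that unfolding kchain_def fun_prod_def by auto
  have g1: "g T \<in> M (d - Suc j)" if "T \<subseteq> V \<and> card T = Suc j \<and> Suc j \<le> d" for T
    using g that unfolding kchain_def fun_prod_def by auto
  show "if S \<in> {S. S \<subseteq> V \<and> card S = j \<and> j \<le> d} then kdiff \<iota> V g S \<in> M (d - j) else kdiff \<iota> V g S = 0"
  proof (cases "S \<subseteq> V \<and> card S = j \<and> j \<le> d")
    case True
    have "(\<lambda>k. Poly_Mapping.single (Poly_Mapping.single v 1) (ksgn \<iota> v S) * g (insert v S) k) \<in> M (d - j)"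
      if "v \<in> V" for v
    proof (cases "insert v S \<subseteq> V \<and> card (insert v S) = Suc j \<and> Suc j \<le> d")
      case True
      then have "Suc (d - Suc j) = d - j" by (simp add: Suc_diff_Suc)
      then show ?thesis using g1[OF True] M that unfolding graded_submodule_def by metis
    next
      case False
      then have "g (insert v S) = 0" by (rule g0)
      then have "(\<lambda>k. Poly_Mapping.single (Poly_Mapping.single v 1) (ksgn \<iota> v S) * g (insert v S) k) = 0"
        by (simp add: fun_eq_iff)
      then show ?thesis using subspace_0[OF sub] by simp
    qed
    then have "kdiff \<iota> V g S \<in> M (d - j)"
      unfolding kd by (intro subspace_sum[OF sub]) auto
    then show ?thesis using True by simp
  next
    case False
    have "g (insert v S) = 0" if "v \<in> V - S" for v
    proof (rule g0, rule notI)
      assume *: "insert v S \<subseteq> V \<and> card (insert v S) = Suc j \<and> Suc j \<le> d"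
      then have "finite S" using V finite_subset[of "insert v S" V] by simp
      then have "card S = j" using * that by simp
      then show False using * False by simp
    qed
    then have "kdiff \<iota> V g S = 0" by (simp add: kdiff_def fun_eq_iff)
    then show ?thesis by (simp only: mem_Collect_eq False if_False)
  qed
qed

lemma kdiff_kdiff:
  fixes M :: "nat \<Rightarrow> (nat \<Rightarrow> ('v, 'k::field) mpoly) set"
  assumes V: "finite V" "inj_on \<iota> V" and g: "g \<in> kchain V M j d"
  shows "kdiff \<iota> V (kdiff \<iota> V g) = 0"
proof (intro ext)
  fix S k
  let ?c = "\<lambda>v S. Poly_Mapping.single (Poly_Mapping.single v 1) (ksgn \<iota> v S) :: ('v, 'k) mpoly"
  have eq: "kdiff \<iota> V (kdiff \<iota> V g) S k =
      (\<Sum>v\<in>V - S. \<Sum>u\<in>(V - S) - {v}. ?c v S * (?c u (insert v S) * g (insert u (insert v S)) k))"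
  proof -
    have "V - insert v S = (V - S) - {v}" for v by blast
    then show ?thesis by (simp add: kdiff_def sum_distrib_left)
  qed
  show "kdiff \<iota> V (kdiff \<iota> V g) S k = 0 S k"
  proof (cases "S \<subseteq> V")
    case True
    then have finS: "finite S" using V finite_subset by blast
    have "(\<Sum>v\<in>V - S. \<Sum>u\<in>(V - S) - {v}. ?c v S * (?c u (insert v S) * g (insert u (insert v S)) k)) = 0"
    proof (rule sum_antisym)
      fix u v assume uv: "u \<in> V - S" "v \<in> V - S" "u \<noteq> v"
      then have "\<iota> u \<noteq> \<iota> v" using V(2) by (auto simp: inj_on_def)
      then have "ksgn \<iota> u S * ksgn \<iota> v (insert u S) = - (ksgn \<iota> v S * ksgn \<iota> u (insert v S) :: 'k)"
        using uv finS by (intro ksgn_antisym) auto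
      then have "?c u S * ?c v (insert u S) = - (?c v S * ?c u (insert v S))"
        by (simp add: mult_single add.commute single_uminus)
      then show "?c u S * (?c v (insert u S) * g (insert v (insert u S)) k) =
          - (?c v S * (?c u (insert v S) * g (insert u (insert v S)) k))"
        by (simp add: mult.assoc[symmetric] insert_commute)
    qed (use V in auto)
    then show ?thesis using eq by simp
  next
    case False
    then have "g (insert u (insert v S)) = 0" for u v
      using g unfolding kchain_def fun_prod_def by auto
    then show ?thesis using eq by simp
  qed
qed

text \<open>In multidegree \<open>\<alpha>\<close>, the Koszul complex of the polynomial ring is the complex of the
  full simplex on the support of \<open>\<alpha>\<close>: the coefficient of \<open>x\<^sup>m e\<^sub>S\<close> is placed at \<open>S\<close>
  in multidegree \<open>\<alpha> = m + ind_mon S\<close>.\<close>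

definition fib :: "('v set \<Rightarrow> nat \<Rightarrow> ('v, 'k::field) mpoly) \<Rightarrow> nat \<Rightarrow> ('v \<Rightarrow>\<^sub>0 nat) \<Rightarrow> 'v set \<Rightarrow> 'k" where
  "fib g k \<alpha> S = (if S \<subseteq> Poly_Mapping.keys \<alpha> then Poly_Mapping.lookup (g S k) (\<alpha> - ind_mon S) else 0)"

lemma keys_minus_ind_mon:
  assumes "S \<subseteq> Poly_Mapping.keys \<alpha>" "v \<notin> S"
  shows "v \<in> Poly_Mapping.keys (\<alpha> - ind_mon S) \<longleftrightarrow> v \<in> Poly_Mapping.keys \<alpha>"
proof -
  have "finite S" by (rule finite_subset[OF assms(1) finite_keys])
  then show ?thesis using assms by (simp add: in_keys_iff lookup_minus lookup_ind_mon)
qed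

lemma minus_ind_mon_insert:
  assumes "insert v S \<subseteq> Poly_Mapping.keys \<alpha>" "v \<notin> S"
  shows "\<alpha> - ind_mon S - Poly_Mapping.single v 1 = \<alpha> - ind_mon (insert v S)"
proof -
  have "finite S" using finite_subset[OF assms(1) finite_keys] by simp
  then have "ind_mon (insert v S) = ind_mon S + Poly_Mapping.single v 1"
    by (subst ind_mon_insert) (auto simp: assms(2) add.commute)
  then show ?thesis by (metis diff_diff_add)
qed

text \<open>Passing from \<open>insert v S\<close> to \<open>S\<close> gains the factor x_v, so the
  multidegree \<alpha> is kept; a vertex outside the support of \<alpha> contributes
  nothing.\<close>

lemma fib_kdiff:
  fixes g :: "'v set \<Rightarrow> nat \<Rightarrow> ('v, 'k::field) mpoly"
  assumes V: "finite V" and \<alpha>: "Poly_Mapping.keys \<alpha> \<subseteq> V"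
  shows "fib (kdiff \<iota> V g) k \<alpha> = fdiff \<iota> (Poly_Mapping.keys \<alpha>) (\<lambda>_. True) (fib g k \<alpha>)"
proof
  fix S
  show "fib (kdiff \<iota> V g) k \<alpha> S = fdiff \<iota> (Poly_Mapping.keys \<alpha>) (\<lambda>_. True) (fib g k \<alpha>) S"
  proof (cases "S \<subseteq> Poly_Mapping.keys \<alpha>")
    case True
    have "fib (kdiff \<iota> V g) k \<alpha> S = (\<Sum>v\<in>V - S. Poly_Mapping.lookup
        (Poly_Mapping.single (Poly_Mapping.single v 1) (ksgn \<iota> v S) * g (insert v S) k) (\<alpha> - ind_mon S))"
      using True by (simp add: fib_def kdiff_def lookup_sum)
    also have "\<dots> = (\<Sum>v\<in>V - S. if v \<in> Poly_Mapping.keys \<alpha> - S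
        then ksgn \<iota> v S * fib g k \<alpha> (insert v S) else 0)"
    proof (rule sum.cong[OF refl])
      fix v assume "v \<in> V - S"
      then show "Poly_Mapping.lookup (Poly_Mapping.single (Poly_Mapping.single v 1) (ksgn \<iota> v S) * g (insert v S) k)
            (\<alpha> - ind_mon S) = (if v \<in> Poly_Mapping.keys \<alpha> - S then ksgn \<iota> v S * fib g k \<alpha> (insert v S) else 0)"
        using True keys_minus_ind_mon[OF True, of v] minus_ind_mon_insert[of v S \<alpha>]
        unfolding lookup_single_var_mult fib_def by auto
    qed
    also have "\<dots> = (\<Sum>v\<in>Poly_Mapping.keys \<alpha> - S. ksgn \<iota> v S * fib g k \<alpha> (insert v S))"
    proof -
      have "(V - S) \<inter> (Poly_Mapping.keys \<alpha> - S) = Poly_Mapping.keys \<alpha> - S" using \<alpha> by blast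
      then show ?thesis by (simp only: sum.inter_restrict[OF finite_Diff[OF V], symmetric])
    qed
    finally show ?thesis using True by (simp add: fdiff_def)
  qed (simp add: fib_def fdiff_def)
qed

lemma fib_fchain:
  assumes "g \<in> kchain V M j d"
  shows "fib g k \<alpha> \<in> fchain (Poly_Mapping.keys \<alpha>) (\<lambda>_. True) j"
  using assms unfolding fchain_def kchain_def fun_prod_def fib_def
  by (auto split: if_splits)

lemma kchain_free_lookup:
  assumes V: "finite V" and g: "g \<in> kchain V (free_part V ds) j d"
    and nz: "Poly_Mapping.lookup (g S k) m \<noteq> 0"
  shows "S \<subseteq> V" "card S = j" "k < length ds" "Poly_Mapping.keys m \<subseteq> V" "mon_deg m + j + ds ! k = d"
proof -
  have gS: "g S \<noteq> 0" using nz by auto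
  then have S: "S \<subseteq> V \<and> card S = j \<and> j \<le> d" "g S \<in> free_part V ds (d - j)"
    using g unfolding kchain_def fun_prod_def by (auto split: if_splits)
  then show "S \<subseteq> V" "card S = j" by auto
  have "g S k \<noteq> 0" using nz by auto
  then have "k < length ds" "g S k \<in> hpoly V (ds ! k) (d - j)"
    using S(2) unfolding free_part_def fun_prod_def by (auto split: if_splits)
  moreover from this(2) have "Poly_Mapping.keys m \<subseteq> V \<and> mon_deg m + ds ! k = d - j"
    using nz unfolding hpoly_lookup by blast
  ultimately show "k < length ds" "Poly_Mapping.keys m \<subseteq> V" "mon_deg m + j + ds ! k = d"
    using S(1) by auto
qed

text \<open>The coefficient of x^m at \<open>S\<close> reappears in the fibre over
  \<open>m + ind_mon S\<close>, so chains may be compared fibrewise.\<close>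

lemma kchain_free_eqI:
  assumes V: "finite V" and g: "g \<in> kchain V (free_part V ds) j d" "g' \<in> kchain V (free_part V ds) j d"
    and eq: "\<And>k \<alpha>. k < length ds \<Longrightarrow> Poly_Mapping.keys \<alpha> \<subseteq> V \<Longrightarrow> mon_deg \<alpha> + ds ! k = d \<Longrightarrow> fib g k \<alpha> = fib g' k \<alpha>"
  shows "g = g'"
proof (intro ext poly_mapping_eqI, rule ccontr)
  fix S k m assume ne: "Poly_Mapping.lookup (g S k) m \<noteq> Poly_Mapping.lookup (g' S k) m"
  then have "S \<subseteq> V \<and> card S = j \<and> k < length ds \<and> Poly_Mapping.keys m \<subseteq> V \<and> mon_deg m + j + ds ! k = d"
    using kchain_free_lookup[OF V g(1), of S k m] kchain_free_lookup[OF V g(2), of S k m] by metis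
  moreover from this have finS: "finite S" using V finite_subset by blast
  ultimately have "fib g k (m + ind_mon S) = fib g' k (m + ind_mon S)"
    using keys_add[of m "ind_mon S"] by (intro eq) (auto simp: mon_deg_add)
  then have "fib g k (m + ind_mon S) S = fib g' k (m + ind_mon S) S" by simp
  moreover have "S \<subseteq> Poly_Mapping.keys (m + ind_mon S)"
    using finS by (auto simp: in_keys_iff lookup_add lookup_ind_mon)
  ultimately show False using ne by (simp add: fib_def)
qed

text \<open>For \<alpha> \<noteq> 0 the fibre is a full simplex, a cone over any vertex of the
  support, hence exact. The fibre over 0 contains only constants at the empty set, and for j = 0
  these are excluded by \<open>const\<close>.\<close>

lemma kdiff_exact:
  fixes g :: "'v set \<Rightarrow> nat \<Rightarrow> ('v, 'k::field) mpoly"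
  assumes V: "finite V" "inj_on \<iota> V" and g: "g \<in> kchain V (free_part V ds) j d"
    and cyc: "kdiff \<iota> V g = 0"
    and const: "j = 0 \<Longrightarrow> (\<And>k. k < length ds \<Longrightarrow> Poly_Mapping.lookup (g {} k) 0 = 0)"
  shows "g \<in> kdiff \<iota> V ` kchain V (free_part V ds) (Suc j) d"
proof -
  let ?M = "\<lambda>k. {\<alpha>. Poly_Mapping.keys \<alpha> \<subseteq> V \<and> mon_deg \<alpha> + ds ! k = d}"
  let ?F = "\<lambda>\<alpha>. fchain (Poly_Mapping.keys \<alpha>) (\<lambda>_. True) (Suc j) :: ('v set \<Rightarrow> 'k) set"
  have ex: "\<exists>h\<in>?F \<alpha>. fdiff \<iota> (Poly_Mapping.keys \<alpha>) (\<lambda>_. True) h = fib g k \<alpha>"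
    if k: "k < length ds" and \<alpha>: "\<alpha> \<in> ?M k" for k \<alpha>
  proof (cases "\<alpha> = 0")
    case True
    have "fib g k \<alpha> S = 0" for S
    proof (rule ccontr)
      assume *: "fib g k \<alpha> S \<noteq> 0"
      then have "S = {}" using True by (auto simp: fib_def split: if_splits)
      then show False using * True k const kchain_free_lookup[OF V(1) g, of S k 0] 
        by (auto simp: fib_def)
    qed
    then have "fdiff \<iota> (Poly_Mapping.keys \<alpha>) (\<lambda>_. True) 0 = fib g k \<alpha>"
      by (simp add: fdiff_def fun_eq_iff)
    moreover have "0 \<in> ?F \<alpha>" by (simp add: fchain_def)
    ultimately show ?thesis by blast
  next
    case False
    then obtain w where w: "w \<in> Poly_Mapping.keys \<alpha>"
      by (metis ex_in_conv mon_deg_def mon_deg_eq_0_iff sum.empty)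
    have kV: "Poly_Mapping.keys \<alpha> \<subseteq> V" using \<alpha> by simp
    have "fdiff \<iota> (Poly_Mapping.keys \<alpha>) (\<lambda>_. True) (fib g k \<alpha>) = fib (kdiff \<iota> V g) k \<alpha>"
      by (rule fib_kdiff[OF V(1) kV, symmetric])
    also have "\<dots> = 0" by (simp add: cyc fib_def fun_eq_iff)
    finally have cyc: "fdiff \<iota> (Poly_Mapping.keys \<alpha>) (\<lambda>_. True) (fib g k \<alpha>) = 0" .
    have "fib g k \<alpha> \<in> fdiff \<iota> (Poly_Mapping.keys \<alpha>) (\<lambda>_. True) ` ?F \<alpha>"
      by (rule fdiff_exact[OF finite_keys inj_on_subset[OF V(2) kV] w _ fib_fchain[OF g] cyc]) simp
    then obtain h where "fib g k \<alpha> = fdiff \<iota> (Poly_Mapping.keys \<alpha>) (\<lambda>_. True) h" "h \<in> ?F \<alpha>"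
      by (rule imageE)
    then show ?thesis by (intro bexI[of _ h]) simp_all
  qed
  \<comment> \<open>A preimage is chosen in every fibre; \<open>g'\<close> then collects the chosen
    values into polynomials, with \<open>D k\<close> the finite set of monomials of the right
    degree.\<close>
  define h where "h k \<alpha> = (SOME h. h \<in> ?F \<alpha> \<and> fdiff \<iota> (Poly_Mapping.keys \<alpha>) (\<lambda>_. True) h = fib g k \<alpha>)" for k \<alpha>
  have h: "h k \<alpha> \<in> ?F \<alpha>" "fdiff \<iota> (Poly_Mapping.keys \<alpha>) (\<lambda>_. True) (h k \<alpha>) = fib g k \<alpha>"
    if "k < length ds" "\<alpha> \<in> ?M k" for k \<alpha>
    using someI_ex[OF ex[OF that, unfolded Bex_def]] unfolding h_def by blast+
  define D where "D k = {m. Poly_Mapping.keys m \<subseteq> V \<and> mon_deg m + (Suc j + ds ! k) = d}" for k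
  have finD: "finite (D k)" for k unfolding D_def by (rule finite_monomials[OF V(1)])
  define g' where "g' S k = (if S \<subseteq> V \<and> card S = Suc j \<and> k < length ds
    then \<Sum>m\<in>D k. Poly_Mapping.single m (h k (m + ind_mon S) S) else 0)" for S k
  have lg': "Poly_Mapping.lookup (g' S k) m =
      (if S \<subseteq> V \<and> card S = Suc j \<and> k < length ds \<and> m \<in> D k then h k (m + ind_mon S) S else 0)" for S k m
    unfolding g'_def by (simp add: lookup_sum_single[OF finD])
  have g': "g' \<in> kchain V (free_part V ds) (Suc j) d"
    unfolding kchain_def fun_prod_def
  proof (intro CollectI allI)
    fix S
    have "g' S = 0" if "\<not> (S \<subseteq> V \<and> card S = Suc j \<and> Suc j \<le> d)"
    proof (intro ext poly_mapping_eqI)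
      fix k m show "Poly_Mapping.lookup (g' S k) m = Poly_Mapping.lookup (0 k) m"
        using that unfolding lg' D_def by auto
    qed
    moreover have "g' S \<in> free_part V ds (d - Suc j)" if "S \<subseteq> V \<and> card S = Suc j \<and> Suc j \<le> d"
      unfolding free_part_def fun_prod_def
    proof (intro CollectI allI)
      fix k
      have "g' S k \<in> hpoly V (ds ! k) (d - Suc j)"
        unfolding hpoly_lookup lg' D_def using that by auto
      then show "if k \<in> {..<length ds} then g' S k \<in> hpoly V (ds ! k) (d - Suc j) else g' S k = 0"
        by (cases "k < length ds") (simp, simp add: g'_def)
    qed
    ultimately show "if S \<in> {S. S \<subseteq> V \<and> card S = Suc j \<and> Suc j \<le> d}
        then g' S \<in> free_part V ds (d - Suc j) else g' S = 0" by auto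
  qed
  have "fib g' k \<alpha> = h k \<alpha>" if k: "k < length ds" and \<alpha>: "\<alpha> \<in> ?M k" for k \<alpha>
  proof
    fix S
    show "fib g' k \<alpha> S = h k \<alpha> S"
    proof (cases "S \<subseteq> Poly_Mapping.keys \<alpha> \<and> card S = Suc j")
      case False
      then have "h k \<alpha> S = 0" using h(1)[OF that] unfolding fchain_def by blast
      moreover have "fib g' k \<alpha> S = 0" using False by (auto simp: fib_def lg')
      ultimately show ?thesis by simp
    next
      case True
      have finS: "finite S" using True finite_subset[OF _ finite_keys] by blast
      have "Poly_Mapping.keys (\<alpha> - ind_mon S) \<subseteq> Poly_Mapping.keys \<alpha>"
        by (auto simp: in_keys_iff lookup_minus)
      moreover have "mon_deg (\<alpha> - ind_mon S) + Suc j = mon_deg \<alpha>"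
        using mon_deg_add[of "\<alpha> - ind_mon S" "ind_mon S"] minus_add_ind_mon[of S \<alpha>] True finS by simp
      ultimately have "\<alpha> - ind_mon S \<in> D k" using \<alpha> by (auto simp: D_def)
      moreover have "S \<subseteq> V" using True \<alpha> by blast
      ultimately show ?thesis using True k minus_add_ind_mon[of S \<alpha>] by (simp add: fib_def lg')
    qed
  qed
  then have "fib (kdiff \<iota> V g') k \<alpha> = fib g k \<alpha>" if "k < length ds" "\<alpha> \<in> ?M k" for k \<alpha>
    using fib_kdiff[OF V(1), of \<alpha> \<iota> g' k] h(2)[OF that] that by auto
  then have "kdiff \<iota> V g' = g"
    by (intro kchain_free_eqI[OF V(1) kdiff_kchain[OF V(1) free_part_submodule g'] g]) auto
  then show ?thesis using g' by blast
qed

section \<open>Graded resolutions and Koszul homology\<close>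

lemma mon_deg_0 [simp]: "mon_deg 0 = 0"
  by simp

lemma kchainI:
  assumes "\<And>S. S \<subseteq> V \<Longrightarrow> card S = j \<Longrightarrow> j \<le> d \<Longrightarrow> g S \<in> M (d - j)"
    and "\<And>S. \<not> (S \<subseteq> V \<and> card S = j \<and> j \<le> d) \<Longrightarrow> g S = 0"
  shows "g \<in> kchain V M j d"
  using assms unfolding kchain_def fun_prod_def by auto

lemma kchain_in: "g \<in> kchain V M j d \<Longrightarrow> S \<subseteq> V \<Longrightarrow> card S = j \<Longrightarrow> j \<le> d \<Longrightarrow> g S \<in> M (d - j)"
  unfolding kchain_def fun_prod_def by auto

lemma kchain_zero: "g \<in> kchain V M j d \<Longrightarrow> \<not> (S \<subseteq> V \<and> card S = j \<and> j \<le> d) \<Longrightarrow> g S = 0"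
  unfolding kchain_def fun_prod_def mem_Collect_eq by (drule spec[of _ S]) (simp only: if_False)

lemma dim_fun_prod_UNIV:
  assumes "finite A"
  shows "vector_space.findim (fsc :: 'k::field \<Rightarrow> ('a \<Rightarrow> 'k) \<Rightarrow> _) (fun_prod A (\<lambda>_. UNIV))"
    and "vector_space.dim (fsc :: 'k \<Rightarrow> ('a \<Rightarrow> 'k) \<Rightarrow> _) (fun_prod A (\<lambda>_. UNIV)) = card A"
proof -
  interpret k: vector_space "(*) :: 'k \<Rightarrow> 'k \<Rightarrow> 'k" by (rule vector_space_times)
  have "x \<in> k.span {1}" for x :: 'k
    using k.span_scale[OF k.span_base, of 1 "{1}" x] by simp
  then have sp: "k.span {1} = UNIV" by blast
  moreover have "k.dim (k.span {1}) = card {1 :: 'k}"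
    by (rule k.dim_span_eq_card_independent) simp
  ultimately have dim: "k.dim UNIV = 1" by simp
  have fd: "k.findim UNIV" unfolding k.findim_def by (intro exI[of _ "{1}"]) (simp add: sp)
  show "vector_space.findim (fsc :: 'k \<Rightarrow> ('a \<Rightarrow> 'k) \<Rightarrow> _) (fun_prod A (\<lambda>_. UNIV))"
    and "vector_space.dim (fsc :: 'k \<Rightarrow> ('a \<Rightarrow> 'k) \<Rightarrow> _) (fun_prod A (\<lambda>_. UNIV)) = card A"
    using findim_dim_fun_prod[OF vector_space_times assms, of "\<lambda>_. UNIV :: 'k set"] fd dim by auto
qed

lemma count_list_card: "count_list xs x = card {k. k < length xs \<and> xs ! k = x}"
  by (simp add: count_list_eq_length_filter length_filter_conv_card eq_commute)

lemma kdiff_degree_0: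
  assumes V: "finite V" and g: "g \<in> kchain V M 0 d"
  shows "kdiff \<iota> V g = 0"
proof (intro ext)
  fix S k
  have "g (insert v S) = 0" if "v \<in> V - S" for v
  proof (rule ccontr)
    assume "g (insert v S) \<noteq> 0"
    then have "insert v S \<subseteq> V \<and> card (insert v S) = 0"
      using g unfolding kchain_def fun_prod_def by (auto split: if_splits)
    then show False using V finite_subset[of "insert v S" V] by auto
  qed
  then show "kdiff \<iota> V g S k = 0 S k" by (simp add: kdiff_def)
qed

lemma const_coeff_kdiff: "Poly_Mapping.lookup (kdiff \<iota> V g S k) 0 = 0"
  unfolding kdiff_def lookup_sum lookup_single_var_mult by simp

text \<open>Degree-0 Koszul homology of a free module F is F / mF. Reading off constant coefficients
  by \<kappa> has the boundaries as kernel, by \<open>kdiff_exact\<close>, and one coordinate for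
  each generator of degree \<open>d\<close> as image.\<close>

lemma dim_kchain_free_0:
  fixes ds :: "nat list"
  assumes V: "finite V" "inj_on \<iota> V"
  shows "vector_space.dim csc (kchain V (free_part V ds) 0 d :: ('v set \<Rightarrow> nat \<Rightarrow> ('v, 'k::field) mpoly) set) =
    vector_space.dim csc (kdiff \<iota> V ` (kchain V (free_part V ds) (Suc 0) d ::
      ('v set \<Rightarrow> nat \<Rightarrow> ('v, 'k::field) mpoly) set)) + count_list ds d"
proof -
  let ?P = "\<lambda>j. kchain V (free_part V ds) j d :: ('v set \<Rightarrow> nat \<Rightarrow> ('v, 'k) mpoly) set"
  interpret c: vector_space "csc :: 'k \<Rightarrow> ('v set \<Rightarrow> nat \<Rightarrow> ('v, 'k) mpoly) \<Rightarrow> _"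
    by (rule vector_space_csc)
  interpret f: vector_space "fsc :: 'k \<Rightarrow> (nat \<Rightarrow> 'k) \<Rightarrow> _" by (rule vector_space_fsc)
  interpret cf: vector_space_pair "csc :: 'k \<Rightarrow> ('v set \<Rightarrow> nat \<Rightarrow> ('v, 'k) mpoly) \<Rightarrow> _"
    "fsc :: 'k \<Rightarrow> (nat \<Rightarrow> 'k) \<Rightarrow> _" ..
  define \<kappa> where "\<kappa> g = (\<lambda>k. Poly_Mapping.lookup (g {} k) 0)" for g :: "'v set \<Rightarrow> nat \<Rightarrow> ('v, 'k) mpoly"
  have lin: "Vector_Spaces.linear csc fsc \<kappa>"
    unfolding Vector_Spaces.linear_iff \<kappa>_def
    using c.vector_space_axioms f.vector_space_axioms
    by (simp add: fun_eq_iff fscale_apply psc_def lookup_add)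
  have rn: "c.dim (?P 0) = c.dim {x \<in> ?P 0. \<kappa> x = 0} + f.dim (\<kappa> ` ?P 0)"
    by (rule cf.rank_nullity[OF lin kchain_subspace[OF free_part_submodule]
          kchain_findim[OF V(1) free_part_submodule free_part_findim[OF V(1)]]])
  have ker: "{x \<in> ?P 0. \<kappa> x = 0} = kdiff \<iota> V ` ?P (Suc 0)"
  proof
    show "{x \<in> ?P 0. \<kappa> x = 0} \<subseteq> kdiff \<iota> V ` ?P (Suc 0)"
    proof clarify
      fix x assume x: "x \<in> ?P 0" "\<kappa> x = 0"
      then have "Poly_Mapping.lookup (x {} k) 0 = 0" for k by (simp add: \<kappa>_def fun_eq_iff)
      then show "x \<in> kdiff \<iota> V ` ?P (Suc 0)"
        using x(1) kdiff_degree_0[OF V(1) x(1)] by (intro kdiff_exact[OF V]) auto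
    qed
    show "kdiff \<iota> V ` ?P (Suc 0) \<subseteq> {x \<in> ?P 0. \<kappa> x = 0}"
      using kdiff_kchain[OF V(1) free_part_submodule] by (auto simp: \<kappa>_def const_coeff_kdiff fun_eq_iff)
  qed
  let ?A = "{k. k < length ds \<and> ds ! k = d}"
  have img: "\<kappa> ` ?P 0 = fun_prod ?A (\<lambda>_. UNIV)"
  proof
    show "\<kappa> ` ?P 0 \<subseteq> fun_prod ?A (\<lambda>_. UNIV)"
    proof
      fix c assume "c \<in> \<kappa> ` ?P 0"
      then obtain x where x: "x \<in> ?P 0" "c = \<kappa> x" by blast
      show "c \<in> fun_prod ?A (\<lambda>_. UNIV)"
        unfolding fun_prod_def x(2) \<kappa>_def using kchain_free_lookup(3,5)[OF V(1) x(1), of "{}" _ 0]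
        by (auto simp: mon_deg_def)
    qed
    show "fun_prod ?A (\<lambda>_. UNIV) \<subseteq> \<kappa> ` ?P 0"
    proof
      fix c :: "nat \<Rightarrow> 'k" assume c: "c \<in> fun_prod ?A (\<lambda>_. UNIV)"
      define x :: "'v set \<Rightarrow> nat \<Rightarrow> ('v, 'k) mpoly" where
        "x = (\<lambda>S k. if S = {} then Poly_Mapping.single 0 (c k) else 0)"
      have "(\<lambda>k. Poly_Mapping.single 0 (c k)) \<in> free_part V ds d"
        using c unfolding free_part_def fun_prod_def by (auto simp: hpoly_def split: if_splits)
      moreover have "S \<subseteq> V \<and> card S = 0 \<longleftrightarrow> S = {}" for S
        using finite_subset[OF _ V(1), of S] by auto
      ultimately have "x \<in> ?P 0" unfolding kchain_def fun_prod_def by (auto simp: x_def fun_eq_iff)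
      moreover have "\<kappa> x = c" by (simp add: \<kappa>_def x_def)
      ultimately show "c \<in> \<kappa> ` ?P 0" by blast
    qed
  qed
  show ?thesis using rn unfolding ker img by (simp add: dim_fun_prod_UNIV count_list_card)
qed

text \<open>The complex \<open>Q\<close> is the Koszul complex of a module covered by the free module of \<open>ds\<close>
  with kernel \<open>M'\<close>.\<close>

lemma resolution_step:
  fixes p :: "('v set \<Rightarrow> nat \<Rightarrow> ('v, 'k::field) mpoly) \<Rightarrow> 'c::ab_group_add"
  assumes V: "finite V" "inj_on \<iota> V"
    and p: "Vector_Spaces.linear csc s p" and dQ: "Vector_Spaces.linear s s dQ"
    and Q: "\<And>j. p ` kchain V (free_part V ds) j d = Q j"
    and comm: "\<And>j x. x \<in> kchain V (free_part V ds) j d \<Longrightarrow> p (kdiff \<iota> V x) = dQ (p x)"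
    and ker: "\<And>j x. x \<in> kchain V M' j d \<longleftrightarrow> x \<in> kchain V (free_part V ds) j d \<and> p x = 0"
    and const: "\<And>x k. x \<in> kchain V M' 0 d \<Longrightarrow> k < length ds \<Longrightarrow> Poly_Mapping.lookup (x {} k) 0 = 0"
  shows "vector_space.dim s {q \<in> Q (Suc j). dQ q = 0} + vector_space.dim csc (kdiff \<iota> V ` kchain V M' (Suc j) d) =
      vector_space.dim csc {x \<in> kchain V M' j d. kdiff \<iota> V x = 0} + vector_space.dim s (dQ ` Q (Suc (Suc j)))"
    and "vector_space.dim s {q \<in> Q 0. dQ q = 0} = count_list ds d + vector_space.dim s (dQ ` Q (Suc 0))"
proof -
  let ?P = "\<lambda>j. kchain V (free_part V ds) j d :: ('v set \<Rightarrow> nat \<Rightarrow> ('v, 'k) mpoly) set"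
  interpret p: Vector_Spaces.linear csc s p by fact
  interpret cs: vector_space_pair csc s
    by (intro vector_space_pair.intro vector_space_csc p.vs2.vector_space_axioms)
  interpret ss: vector_space_pair s s ..
  interpret cc: vector_space_pair "csc :: 'k \<Rightarrow> ('v set \<Rightarrow> nat \<Rightarrow> ('v, 'k) mpoly) \<Rightarrow> _"
    "csc :: 'k \<Rightarrow> ('v set \<Rightarrow> nat \<Rightarrow> ('v, 'k) mpoly) \<Rightarrow> _" ..
  note sub = kchain_subspace[OF free_part_submodule, of V ds _ d]
  note fd = kchain_findim[OF V(1) free_part_submodule free_part_findim[OF V(1)], of ds _ d]
  note kd = kdiff_kchain[OF V(1) free_part_submodule, of _ ds _ d \<iota>]
  \<comment> \<open>For j = 0 this uses \<open>const\<close>, which is minimality: the kernel of the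
    cover lies in mF.\<close>
  have ex: "x \<in> kdiff \<iota> V ` ?P (Suc j)" if "x \<in> kchain V M' j d" "kdiff \<iota> V x = 0" for x j
    using that ker const by (intro kdiff_exact[OF V]) auto
  show "vector_space.dim s {q \<in> Q (Suc j). dQ q = 0} + vector_space.dim csc (kdiff \<iota> V ` kchain V M' (Suc j) d) =
      vector_space.dim csc {x \<in> kchain V M' j d. kdiff \<iota> V x = 0} + vector_space.dim s (dQ ` Q (Suc (Suc j)))"
  proof (rule cs.homology_dim_shift[OF kdiff_linear dQ p sub sub fd Q Q])
    show "x \<in> ?P (Suc j) \<Longrightarrow> kdiff \<iota> V x = 0 \<Longrightarrow> x \<in> kdiff \<iota> V ` ?P (Suc (Suc j))" for x
      by (intro kdiff_exact[OF V]) auto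
    show "kdiff \<iota> V (kdiff \<iota> V x) = 0" if "x \<in> ?P (Suc j) \<union> ?P (Suc (Suc j))" for x
      using that kdiff_kdiff[OF V] by blast
    show "p (kdiff \<iota> V x) = dQ (p x)" if "x \<in> ?P (Suc j) \<union> ?P (Suc (Suc j))" for x
      using that comm by blast
  qed (use kd ker ex in auto)
  have Q0: "{q \<in> Q 0. dQ q = 0} = Q 0"
  proof -
    have "dQ q = 0" if "q \<in> Q 0" for q
    proof -
      obtain x where x: "x \<in> ?P 0" "q = p x" using \<open>q \<in> Q 0\<close> Q by blast
      then have "dQ q = p (kdiff \<iota> V x)" using comm by simp
      then show ?thesis using kdiff_degree_0[OF V(1) x(1)] p.zero by simp
    qed
    then show ?thesis by blast
  qed
  \<comment> \<open>In degree 0 the map \<open>p\<close> is an isomorphism on homology, because the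
    kernel of the cover consists of boundaries of the free complex.\<close>
  have "vector_space.dim csc (?P 0) + vector_space.dim s (dQ ` Q (Suc 0)) =
      vector_space.dim csc (kdiff \<iota> V ` ?P (Suc 0)) + vector_space.dim s (Q 0)"
  proof (rule cs.dim_quotient_eq[OF p sub fd Q])
    show "module.subspace s (dQ ` Q (Suc 0))"
      unfolding Q[symmetric] by (rule ss.linear_subspace_image[OF dQ cs.linear_subspace_image[OF p sub]])
    show "dQ ` Q (Suc 0) \<subseteq> Q 0"
    proof (clarsimp simp: Q[symmetric])
      fix x assume "x \<in> ?P (Suc 0)"
      then have "dQ (p x) = p (kdiff \<iota> V x)" "kdiff \<iota> V x \<in> ?P 0"
        by (rule comm[symmetric]) (rule kd, fact)
      then show "dQ (p x) \<in> p ` ?P 0" by (rule image_eqI)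
    qed
    fix x
    show "x \<in> kdiff \<iota> V ` ?P (Suc 0) \<longleftrightarrow> x \<in> ?P 0 \<and> p x \<in> dQ ` Q (Suc 0)"
    proof
      assume "x \<in> kdiff \<iota> V ` ?P (Suc 0)"
      then obtain y where y: "y \<in> ?P (Suc 0)" "x = kdiff \<iota> V y" by blast
      moreover have "p y \<in> Q (Suc 0)" using Q y(1) by blast
      ultimately show "x \<in> ?P 0 \<and> p x \<in> dQ ` Q (Suc 0)" using comm kd by simp
    next
      assume x: "x \<in> ?P 0 \<and> p x \<in> dQ ` Q (Suc 0)"
      then obtain q where q: "q \<in> Q (Suc 0)" "p x = dQ q" by blast
      then obtain y where y: "y \<in> ?P (Suc 0)" "q = p y" using Q by blast
      have "p (x - kdiff \<iota> V y) = 0" using q y comm p.diff by simp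
      moreover have "x - kdiff \<iota> V y \<in> ?P 0" using x kd[OF y(1)] cs.vs1.subspace_diff[OF sub] by blast
      ultimately have "x - kdiff \<iota> V y \<in> kchain V M' 0 d" using ker by blast
      then have "x - kdiff \<iota> V y \<in> kdiff \<iota> V ` ?P (Suc 0)"
        using ex kdiff_degree_0[OF V(1)] by blast
      then have "x - kdiff \<iota> V y + kdiff \<iota> V y \<in> kdiff \<iota> V ` ?P (Suc 0)"
        using y(1) cs.vs1.subspace_add[OF cc.linear_subspace_image[OF kdiff_linear sub]] by blast
      then show "x \<in> kdiff \<iota> V ` ?P (Suc 0)" by simp
    qed
  qed
  then show "vector_space.dim s {q \<in> Q 0. dQ q = 0} = count_list ds d + vector_space.dim s (dQ ` Q (Suc 0))"
    unfolding Q0 using dim_kchain_free_0[OF V, of ds d, where 'k = 'k] by simp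
qed

definition gens_map :: "nat \<Rightarrow> (nat \<Rightarrow> nat \<Rightarrow> ('v, 'k::field) mpoly) \<Rightarrow> (nat \<Rightarrow> ('v, 'k) mpoly) \<Rightarrow> nat \<Rightarrow> ('v, 'k) mpoly" where
  "gens_map L G f = (\<lambda>k. \<Sum>l<L. f l * G l k)"

text \<open>The dimension of Koszul homology in exterior degree \<open>j\<close> and total degree
  \<open>d\<close>. The difference is taken in \<open>int\<close>, so it can be manipulated before
  the boundaries are known to be cycles.\<close>

definition khdim ::
  "('v \<Rightarrow> nat) \<Rightarrow> 'v set \<Rightarrow> (nat \<Rightarrow> (nat \<Rightarrow> ('v, 'k::field) mpoly) set) \<Rightarrow> nat \<Rightarrow> nat \<Rightarrow> int" where
  "khdim \<iota> V M j d = int (vector_space.dim csc {x \<in> kchain V M j d. kdiff \<iota> V x = 0})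
     - int (vector_space.dim csc (kdiff \<iota> V ` kchain V M (Suc j) d))"

lemma gens_map_scale: "gens_map L G (\<lambda>k. c * f k) = (\<lambda>k. c * gens_map L G f k)"
  by (simp add: gens_map_def sum_distrib_left mult.assoc)

lemma gens_map_add: "gens_map L G (f + g) = gens_map L G f + gens_map L G g"
  by (simp add: gens_map_def fun_eq_iff sum.distrib distrib_right)

lemma gens_map_linear: "Vector_Spaces.linear vsc vsc (gens_map L G)"
  unfolding Vector_Spaces.linear_iff using gens_map_scale[of L G "Poly_Mapping.single 0 _"]
  by (simp add: vector_space_vsc gens_map_add fscale_def psc_def)

lemma gens_map_sum: "gens_map L G (\<lambda>k. \<Sum>v\<in>A. f v k) = (\<lambda>k. \<Sum>v\<in>A. gens_map L G (f v) k)"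
  unfolding gens_map_def sum_distrib_right by (intro ext, rule sum.swap)

lemma lift_linear:
  assumes "Vector_Spaces.linear s t \<phi>"
  shows "Vector_Spaces.linear (fscale s) (fscale t) (\<lambda>g S. \<phi> (g S))"
  using assms unfolding Vector_Spaces.linear_iff
  by (simp add: vector_space_fscale fscale_apply fun_eq_iff)

text \<open>For 0 \<rightarrow> M' \<rightarrow> F \<rightarrow> M \<rightarrow> 0 with M' inside
  mF, Koszul homology of F vanishes in positive degrees. So that of M' is that of M shifted by one,
  and degree 0 of M sees F / mF.\<close>

lemma module_step:
  fixes M M' :: "nat \<Rightarrow> (nat \<Rightarrow> ('v, 'k::field) mpoly) set"
  assumes V: "finite V" "inj_on \<iota> V"
    and surj: "\<And>e. gens_map (length ds) G ` free_part V ds e = M e"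
    and ker: "\<And>e. M' e = {f \<in> free_part V ds e. gens_map (length ds) G f = 0}"
    and const: "\<And>e f k. f \<in> M' e \<Longrightarrow> k < length ds \<Longrightarrow> Poly_Mapping.lookup (f k) 0 = 0"
  shows "khdim \<iota> V M (Suc j) d = khdim \<iota> V M' j d"
    and "khdim \<iota> V M 0 d = int (count_list ds d)"
proof -
  let ?p = "\<lambda>g S. gens_map (length ds) G (g S)"
  let ?P = "\<lambda>j. kchain V (free_part V ds) j d :: ('v set \<Rightarrow> nat \<Rightarrow> ('v, 'k) mpoly) set"
  interpret c: vector_space "csc :: 'k \<Rightarrow> ('v set \<Rightarrow> nat \<Rightarrow> ('v, 'k) mpoly) \<Rightarrow> _"
    by (rule vector_space_csc)
  have g0: "gens_map (length ds) G 0 = 0" by (simp add: gens_map_def fun_eq_iff)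
  have Q: "?p ` ?P j = kchain V M j d" for j
  proof
    show "?p ` ?P j \<subseteq> kchain V M j d"
    proof (rule image_subsetI, rule kchainI)
      fix x S assume x: "x \<in> ?P j"
      show "?p x S \<in> M (d - j)" if "S \<subseteq> V" "card S = j" "j \<le> d"
        using kchain_in[OF x that] surj by blast
      show "?p x S = 0" if "\<not> (S \<subseteq> V \<and> card S = j \<and> j \<le> d)"
        by (simp only: kchain_zero[OF x that] g0)
    qed
    show "kchain V M j d \<subseteq> ?p ` ?P j"
    proof
      fix g assume g: "g \<in> kchain V M j d"
      have "\<exists>y. gens_map (length ds) G y = g S \<and>
          (if S \<subseteq> V \<and> card S = j \<and> j \<le> d then y \<in> free_part V ds (d - j) else y = 0)" for S
      proof (cases "S \<subseteq> V \<and> card S = j \<and> j \<le> d")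
        case True
        then have "g S \<in> gens_map (length ds) G ` free_part V ds (d - j)"
          using kchain_in[OF g] surj by simp
        then obtain y where "g S = gens_map (length ds) G y" "y \<in> free_part V ds (d - j)"
          by (rule imageE)
        then show ?thesis using True by auto
      next
        case False
        then show ?thesis using kchain_zero[OF g False] g0 by auto
      qed
      then obtain x where x: "\<And>S. gens_map (length ds) G (x S) = g S"
        "\<And>S. if S \<subseteq> V \<and> card S = j \<and> j \<le> d then x S \<in> free_part V ds (d - j) else x S = 0" by metis
      have "x \<in> ?P j"
      proof (rule kchainI)
        fix S
        show "x S \<in> free_part V ds (d - j)" if "S \<subseteq> V" "card S = j" "j \<le> d"
          using x(2)[of S] that by simp
        show "x S = 0" if "\<not> (S \<subseteq> V \<and> card S = j \<and> j \<le> d)"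
          using x(2)[of S] by (simp only: that if_False)
      qed
      moreover have "g = ?p x" using x(1) by (simp add: fun_eq_iff)
      ultimately show "g \<in> ?p ` ?P j" by simp
    qed
  qed
  have comm: "?p (kdiff \<iota> V x) = kdiff \<iota> V (?p x)" for x
    unfolding kdiff_def gens_map_sum gens_map_scale ..
  have ker': "x \<in> kchain V M' j d \<longleftrightarrow> x \<in> ?P j \<and> ?p x = 0" for x j
  proof
    assume x: "x \<in> kchain V M' j d"
    have "x S = 0 \<or> x S \<in> M' (d - j)" for S
      using kchain_in[OF x] kchain_zero[OF x] by blast
    then have "gens_map (length ds) G (x S) = 0" for S
      using g0 ker by (metis (mono_tags, lifting) mem_Collect_eq)
    moreover have "x \<in> ?P j" using x kchain_mono[of M' "free_part V ds" V j d] ker by blast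
    ultimately show "x \<in> ?P j \<and> ?p x = 0" by (simp add: fun_eq_iff)
  next
    assume x: "x \<in> ?P j \<and> ?p x = 0"
    then have "gens_map (length ds) G (x S) = 0" for S by (metis zero_fun_apply)
    then show "x \<in> kchain V M' j d"
      using x kchain_in[of x V "free_part V ds" j d] kchain_zero[of x V "free_part V ds" j d]
      by (intro kchainI) (auto simp: ker)
  qed
  have const': "Poly_Mapping.lookup (x {} k) 0 = 0" if "x \<in> kchain V M' 0 d" "k < length ds" for x k
    using kchain_in[OF that(1), of "{}"] const that(2) by simp
  have lin: "Vector_Spaces.linear csc csc (?p :: ('v set \<Rightarrow> nat \<Rightarrow> ('v, 'k) mpoly) \<Rightarrow> _)"
    by (rule lift_linear[OF gens_map_linear])
  note st = resolution_step[where p = ?p and s = csc and dQ = "kdiff \<iota> V" and M' = M' and ds = ds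
      and d = d and Q = "\<lambda>j. kchain V M j d" and V = V and \<iota> = \<iota>, OF V lin kdiff_linear Q]
  have st1: "c.dim {q \<in> kchain V M (Suc j) d. kdiff \<iota> V q = 0} + c.dim (kdiff \<iota> V ` kchain V M' (Suc j) d) =
      c.dim {x \<in> kchain V M' j d. kdiff \<iota> V x = 0} + c.dim (kdiff \<iota> V ` kchain V M (Suc (Suc j)) d)"
    by (rule st(1), rule comm, rule ker', rule const')
  have st2: "c.dim {q \<in> kchain V M 0 d. kdiff \<iota> V q = 0} = count_list ds d + c.dim (kdiff \<iota> V ` kchain V M (Suc 0) d)"
    by (rule st(2), rule comm, rule ker', rule const')
  show "khdim \<iota> V M (Suc j) d = khdim \<iota> V M' j d"
    using st1 unfolding khdim_def by simp
  show "khdim \<iota> V M 0 d = int (count_list ds d)"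
    using st2 unfolding khdim_def by simp
qed

section \<open>Quotients by squarefree monomial ideals\<close>

definition nonface :: "'v set set \<Rightarrow> 'v set \<Rightarrow> bool" where
  "nonface E A \<longleftrightarrow> (\<exists>e\<in>E. e \<subseteq> A)"

lemma nonface_mono: "nonface E A \<Longrightarrow> A \<subseteq> B \<Longrightarrow> nonface E B"
  unfolding nonface_def by blast

definition mono_ideal :: "'v set \<Rightarrow> 'v set set \<Rightarrow> ('v, 'k::field) mpoly set" where
  "mono_ideal V E = {p. \<forall>m\<in>Poly_Mapping.keys p. Poly_Mapping.keys m \<subseteq> V \<and> nonface E (Poly_Mapping.keys m)}"

lemma mono_ideal_lookup: "p \<in> mono_ideal V E \<longleftrightarrow>
    (\<forall>m. \<not> (Poly_Mapping.keys m \<subseteq> V \<and> nonface E (Poly_Mapping.keys m)) \<longrightarrow> Poly_Mapping.lookup p m = 0)"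
  unfolding mono_ideal_def by (auto simp: in_keys_iff)

text \<open>Says that x^(\<alpha> - S) is nonzero in R / I, where \<open>E\<close> gives the
  supports of the squarefree generators of I.\<close>

definition face_at :: "'v set set \<Rightarrow> ('v \<Rightarrow>\<^sub>0 nat) \<Rightarrow> 'v set \<Rightarrow> bool" where
  "face_at E \<alpha> S \<longleftrightarrow> \<not> nonface E (Poly_Mapping.keys (\<alpha> - ind_mon S))"

text \<open>The Koszul complex of R / I, with the monomials outside I as a basis of R / I. The
  coefficient of x^(\<alpha> - S) at the exterior basis element of \<open>S\<close> is stored at
  \<alpha> and \<open>S\<close>, so no quotient module is formed.\<close>

definition qchain ::
  "'v set \<Rightarrow> 'v set set \<Rightarrow> nat \<Rightarrow> nat \<Rightarrow> (('v \<Rightarrow>\<^sub>0 nat) \<Rightarrow> 'v set \<Rightarrow> 'k::field) set" where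
  "qchain V E j d = fun_prod {\<alpha>. Poly_Mapping.keys \<alpha> \<subseteq> V \<and> mon_deg \<alpha> = d}
     (\<lambda>\<alpha>. fchain (Poly_Mapping.keys \<alpha>) (face_at E \<alpha>) j)"

definition qdiff ::
  "('v \<Rightarrow> nat) \<Rightarrow> 'v set set \<Rightarrow> (('v \<Rightarrow>\<^sub>0 nat) \<Rightarrow> 'v set \<Rightarrow> 'k::field) \<Rightarrow> ('v \<Rightarrow>\<^sub>0 nat) \<Rightarrow> 'v set \<Rightarrow> 'k" where
  "qdiff \<iota> E f = (\<lambda>\<alpha>. fdiff \<iota> (Poly_Mapping.keys \<alpha>) (face_at E \<alpha>) (f \<alpha>))"

lemma qchain_zero:
  assumes q: "q \<in> qchain V E j d"
    and "\<not> (\<alpha> \<in> {\<alpha>. Poly_Mapping.keys \<alpha> \<subseteq> V \<and> mon_deg \<alpha> = d} \<and>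
      S \<subseteq> Poly_Mapping.keys \<alpha> \<and> face_at E \<alpha> S \<and> card S = j)"
  shows "q \<alpha> S = 0"
proof (cases "\<alpha> \<in> {\<alpha>. Poly_Mapping.keys \<alpha> \<subseteq> V \<and> mon_deg \<alpha> = d}")
  case True
  then have "q \<alpha> \<in> fchain (Poly_Mapping.keys \<alpha>) (face_at E \<alpha>) j"
    using q by (simp add: qchain_def fun_prod_def)
  then show ?thesis using assms(2) True unfolding fchain_def by blast
next
  case False
  then have "q \<alpha> = 0" using q by (simp add: qchain_def fun_prod_def)
  then show ?thesis by simp
qed

abbreviation qsc :: "'k::field \<Rightarrow> ('a \<Rightarrow> 'b \<Rightarrow> 'k) \<Rightarrow> 'a \<Rightarrow> 'b \<Rightarrow> 'k" where
  "qsc \<equiv> fscale fsc"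

lemma vector_space_qsc: "vector_space qsc"
  by (intro vector_space_fscale vector_space_times)

definition qhdim :: "'k::field itself \<Rightarrow> ('v \<Rightarrow> nat) \<Rightarrow> 'v set \<Rightarrow> 'v set set \<Rightarrow> nat \<Rightarrow> nat \<Rightarrow> int" where
  "qhdim K \<iota> V E j d =
     int (vector_space.dim qsc {q \<in> qchain V E j d :: (('v \<Rightarrow>\<^sub>0 nat) \<Rightarrow> 'v set \<Rightarrow> 'k) set. qdiff \<iota> E q = 0})
     - int (vector_space.dim qsc (qdiff \<iota> E ` (qchain V E (Suc j) d :: (('v \<Rightarrow>\<^sub>0 nat) \<Rightarrow> 'v set \<Rightarrow> 'k) set)))"

lemma qdiff_linear:
  "Vector_Spaces.linear qsc qsc (qdiff \<iota> E :: (('v \<Rightarrow>\<^sub>0 nat) \<Rightarrow> 'v set \<Rightarrow> 'k::field) \<Rightarrow> _)"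
proof -
  have "fdiff \<iota> W P (x + y) = fdiff \<iota> W P x + fdiff \<iota> W P y"
    and "fdiff \<iota> W P (fsc c x) = fsc c (fdiff \<iota> W P x)"
    for W P c and x y :: "'v set \<Rightarrow> 'k"
    using fdiff_linear[of \<iota> W P] unfolding Vector_Spaces.linear_iff by blast+
  then show ?thesis unfolding Vector_Spaces.linear_iff
    by (simp add: vector_space_qsc qdiff_def fun_eq_iff fscale_def[of fsc])
qed

lemma face_at_insert:
  assumes "face_at E \<alpha> S" "insert v S \<subseteq> Poly_Mapping.keys \<alpha>" "v \<notin> S"
  shows "face_at E \<alpha> (insert v S)"
proof -
  have "Poly_Mapping.keys (\<alpha> - ind_mon (insert v S)) \<subseteq> Poly_Mapping.keys (\<alpha> - ind_mon S)"
    unfolding minus_ind_mon_insert[OF assms(2,3), symmetric] by (auto simp: in_keys_iff lookup_minus)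
  then show ?thesis using assms(1) nonface_mono unfolding face_at_def by blast
qed

text \<open>The counterpart of \<open>module_step\<close> for the augmentation onto R / I, the one
  module in the resolution that is not a submodule of a free module.\<close>

lemma quotient_step:
  fixes M' :: "nat \<Rightarrow> (nat \<Rightarrow> ('v, 'k::field) mpoly) set" and e0 :: "nat \<Rightarrow> ('v, 'k) mpoly" and ds :: "nat list"
  defines "\<phi> \<equiv> gens_map (length ds) (\<lambda>l k. e0 l)"
  assumes V: "finite V" "inj_on \<iota> V"
    and hom: "\<And>e f. f \<in> free_part V ds e \<Longrightarrow> \<phi> f 0 \<in> hpoly V 0 e"
    and surj: "\<And>e p. p \<in> hpoly V 0 e \<Longrightarrow> \<exists>f\<in>free_part V ds e. p - \<phi> f 0 \<in> mono_ideal V E"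
    and ker: "\<And>e. M' e = {f \<in> free_part V ds e. \<phi> f 0 \<in> mono_ideal V E}"
    and const: "\<And>e f k. f \<in> M' e \<Longrightarrow> k < length ds \<Longrightarrow> Poly_Mapping.lookup (f k) 0 = 0"
  shows "qhdim TYPE('k) \<iota> V E (Suc j) d = khdim \<iota> V M' j d"
    and "qhdim TYPE('k) \<iota> V E 0 d = int (count_list ds d)"
proof -
  let ?P = "\<lambda>j. kchain V (free_part V ds) j d :: ('v set \<Rightarrow> nat \<Rightarrow> ('v, 'k) mpoly) set"
  let ?A = "{\<alpha>. Poly_Mapping.keys \<alpha> \<subseteq> V \<and> mon_deg \<alpha> = d}"
  \<comment> \<open>Forgetting the coefficients at monomials of the ideal realises the projection to
    R / I.\<close>
  define p :: "('v set \<Rightarrow> nat \<Rightarrow> ('v, 'k) mpoly) \<Rightarrow> ('v \<Rightarrow>\<^sub>0 nat) \<Rightarrow> 'v set \<Rightarrow> 'k" where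
    "p g = (\<lambda>\<alpha> S. if \<alpha> \<in> ?A \<and> face_at E \<alpha> S then fib (\<lambda>S. \<phi> (g S)) 0 \<alpha> S else 0)" for g
  have \<phi>0: "\<phi> 0 = 0" by (simp add: \<phi>_def gens_map_def fun_eq_iff)
  have fib0: "fib g k \<alpha> S = 0" if "g S k = 0" for g :: "'v set \<Rightarrow> nat \<Rightarrow> ('v, 'k) mpoly" and k \<alpha> S
    using that by (simp add: fib_def)
  have p0: "p x \<alpha> S = 0" if "x S = 0" for x \<alpha> S
    using that \<phi>0 by (simp add: p_def fib0)
  have pm: "p x (m + ind_mon S) S = Poly_Mapping.lookup (\<phi> (x S) 0) m"
    if "S \<subseteq> V" "Poly_Mapping.keys m \<subseteq> V" "mon_deg m + card S = d" "\<not> nonface E (Poly_Mapping.keys m)"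
    for x S m
  proof -
    have finS: "finite S" using that(1) V(1) finite_subset by blast
    have "S \<subseteq> Poly_Mapping.keys (m + ind_mon S)"
      using finS by (auto simp: in_keys_iff lookup_add lookup_ind_mon)
    moreover have "m + ind_mon S \<in> ?A"
      using that finS keys_add[of m "ind_mon S"] by (auto simp: mon_deg_add)
    ultimately show ?thesis using that by (simp add: p_def fib_def face_at_def)
  qed
  have lin: "Vector_Spaces.linear csc qsc p"
  proof -
    have "p (x + y) = p x + p y" for x y
      by (simp add: p_def fib_def \<phi>_def gens_map_add fun_eq_iff lookup_add)
    moreover have "p (csc c x) = qsc c (p x)" for c x
      unfolding p_def fib_def \<phi>_def fun_eq_iff fscale_def psc_def gens_map_scale by simp
    ultimately show ?thesis
      unfolding Vector_Spaces.linear_iff using vector_space_csc vector_space_qsc by blast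
  qed
  have pQ: "p x \<in> qchain V E j d" if x: "x \<in> ?P j" for x j
    unfolding qchain_def fun_prod_def
  proof (intro CollectI allI)
    fix \<alpha>
    have "p x \<alpha> \<in> fchain (Poly_Mapping.keys \<alpha>) (face_at E \<alpha>) j"
      unfolding fchain_def
    proof (intro CollectI allI impI)
      fix S assume nz: "p x \<alpha> S \<noteq> 0"
      then have "card S = j" using p0[of x S \<alpha>] kchain_zero[OF x, of S] by blast
      then show "S \<subseteq> Poly_Mapping.keys \<alpha> \<and> face_at E \<alpha> S \<and> card S = j"
        using nz by (auto simp: p_def fib_def split: if_splits)
    qed
    moreover have "p x \<alpha> = 0" if "\<alpha> \<notin> ?A" using that by (simp only: p_def simp_thms if_False zero_fun_def)
    ultimately show "if \<alpha> \<in> ?A then p x \<alpha> \<in> fchain (Poly_Mapping.keys \<alpha>) (face_at E \<alpha>) j else p x \<alpha> = 0"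
      by simp
  qed
  have Q: "p ` ?P j = qchain V E j d" for j
  proof
    show "p ` ?P j \<subseteq> qchain V E j d" using pQ by blast
    show "qchain V E j d \<subseteq> p ` ?P j"
    proof
      fix q :: "('v \<Rightarrow>\<^sub>0 nat) \<Rightarrow> 'v set \<Rightarrow> 'k" assume q: "q \<in> qchain V E j d"
      define D where "D = {m :: 'v \<Rightarrow>\<^sub>0 nat. Poly_Mapping.keys m \<subseteq> V \<and> mon_deg m + j = d}"
      have finD: "finite D" unfolding D_def by (rule finite_monomials[OF V(1)])
      \<comment> \<open>To lift \<open>q\<close>, its values are read as the coefficients of a
        polynomial \<open>r S\<close>, and this is lifted to the cover modulo the ideal.\<close>
      define r where "r S = (\<Sum>m\<in>D. Poly_Mapping.single m (q (m + ind_mon S) S))" for S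
      have lr: "Poly_Mapping.lookup (r S) m = (if m \<in> D then q (m + ind_mon S) S else 0)" for S m
        unfolding r_def by (rule lookup_sum_single[OF finD])
      have r: "r S \<in> hpoly V 0 (d - j)" for S
        unfolding hpoly_lookup lr D_def by auto
      obtain f where f: "\<And>S. f S \<in> free_part V ds (d - j)" "\<And>S. r S - \<phi> (f S) 0 \<in> mono_ideal V E"
        using surj[OF r] by metis
      define x where "x S = (if S \<subseteq> V \<and> card S = j \<and> j \<le> d then f S else 0)" for S
      have x: "x \<in> ?P j" using f(1) by (intro kchainI) (auto simp: x_def)
      have "p x \<alpha> S = q \<alpha> S" for \<alpha> S
      proof (cases "\<alpha> \<in> ?A \<and> S \<subseteq> Poly_Mapping.keys \<alpha> \<and> face_at E \<alpha> S \<and> card S = j")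
        case False
        then have "q \<alpha> S = 0" by (rule qchain_zero[OF q])
        moreover have "p x \<alpha> S = 0" using False by (rule qchain_zero[OF pQ[OF x]])
        ultimately show ?thesis by simp
      next
        case True
        define m where "m = \<alpha> - ind_mon S"
        have \<alpha>: "\<alpha> = m + ind_mon S" using True minus_add_ind_mon[of S \<alpha>] by (simp add: m_def)
        have SV: "S \<subseteq> V" using True by blast
        then have finS: "finite S" using V(1) finite_subset by blast
        have "Poly_Mapping.keys m \<subseteq> Poly_Mapping.keys \<alpha>" by (auto simp: m_def in_keys_iff lookup_minus)
        then have m: "Poly_Mapping.keys m \<subseteq> V" "mon_deg m + card S = d" "\<not> nonface E (Poly_Mapping.keys m)"
          using True finS by (auto simp: \<alpha> mon_deg_add face_at_def)
        have "p x \<alpha> S = Poly_Mapping.lookup (\<phi> (x S) 0) m"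
          unfolding \<alpha> using pm[OF SV m] .
        also have "\<dots> = Poly_Mapping.lookup (r S) m"
          using f(2)[of S] m SV True unfolding mono_ideal_lookup by (auto simp: x_def lookup_minus)
        also have "\<dots> = q \<alpha> S" using m True by (simp add: lr D_def \<alpha>)
        finally show ?thesis .
      qed
      then have "q = p x" by (simp add: fun_eq_iff)
      then show "q \<in> p ` ?P j" using x by blast
    qed
  qed
  have comm: "p (kdiff \<iota> V x) = qdiff \<iota> E (p x)" for x
  proof (intro ext)
    fix \<alpha> S
    have eq: "(\<lambda>S. \<phi> (kdiff \<iota> V x S)) = kdiff \<iota> V (\<lambda>S. \<phi> (x S))"
      unfolding \<phi>_def kdiff_def gens_map_sum gens_map_scale ..
    show "p (kdiff \<iota> V x) \<alpha> S = qdiff \<iota> E (p x) \<alpha> S"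
    proof (cases "\<alpha> \<in> ?A \<and> face_at E \<alpha> S \<and> S \<subseteq> Poly_Mapping.keys \<alpha>")
      case True
      then have "p (kdiff \<iota> V x) \<alpha> S = fib (kdiff \<iota> V (\<lambda>S. \<phi> (x S))) 0 \<alpha> S" by (simp add: p_def eq)
      also have "\<dots> = (\<Sum>v\<in>Poly_Mapping.keys \<alpha> - S. ksgn \<iota> v S * fib (\<lambda>S. \<phi> (x S)) 0 \<alpha> (insert v S))"
        using True by (simp add: fib_kdiff[OF V(1)] fdiff_def)
      also have "\<dots> = (\<Sum>v\<in>Poly_Mapping.keys \<alpha> - S. ksgn \<iota> v S * p x \<alpha> (insert v S))"
        using True face_at_insert[of E \<alpha> S] by (intro sum.cong) (auto simp: p_def)
      finally show ?thesis using True by (simp add: qdiff_def fdiff_def)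
    next
      case False
      have "p (kdiff \<iota> V x) \<alpha> S = 0" using False by (auto simp: p_def fib_def)
      moreover have "qdiff \<iota> E (p x) \<alpha> S = 0"
      proof (cases "\<alpha> \<in> ?A")
        case True
        then show ?thesis using False by (auto simp: qdiff_def fdiff_def)
      next
        case False
        then have "p x \<alpha> T = 0" for T by (simp only: p_def simp_thms if_False)
        then show ?thesis by (simp add: qdiff_def fdiff_def)
      qed
      ultimately show ?thesis by simp
    qed
  qed
  have ker': "x \<in> kchain V M' j d \<longleftrightarrow> x \<in> ?P j \<and> p x = 0" for x j
  proof
    assume x: "x \<in> kchain V M' j d"
    have xP: "x \<in> ?P j" using x kchain_mono[of M' "free_part V ds" V j d] ker by blast
    have xS: "x S = 0 \<or> \<phi> (x S) 0 \<in> mono_ideal V E" for S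
      using kchain_in[OF x, of S] kchain_zero[OF x, of S] ker by blast
    have "p x \<alpha> S = 0" for \<alpha> S
      using xS[of S] p0[of x S \<alpha>] unfolding mono_ideal_lookup p_def fib_def face_at_def by auto
    then show "x \<in> ?P j \<and> p x = 0" using xP by (simp add: fun_eq_iff)
  next
    assume x: "x \<in> ?P j \<and> p x = 0"
    show "x \<in> kchain V M' j d"
    proof (rule kchainI)
      fix S assume S: "S \<subseteq> V" "card S = j" "j \<le> d"
      have xS: "x S \<in> free_part V ds (d - j)" using kchain_in[OF conjunct1[OF x] S] .
      have "\<phi> (x S) 0 \<in> mono_ideal V E"
        unfolding mono_ideal_lookup
      proof (intro allI impI, rule ccontr)
        fix m assume m: "\<not> (Poly_Mapping.keys m \<subseteq> V \<and> nonface E (Poly_Mapping.keys m))"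
          "Poly_Mapping.lookup (\<phi> (x S) 0) m \<noteq> 0"
        then have "Poly_Mapping.keys m \<subseteq> V \<and> mon_deg m + 0 = d - j"
          using hom[OF xS] unfolding hpoly_lookup by blast
        then have "p x (m + ind_mon S) S = Poly_Mapping.lookup (\<phi> (x S) 0) m"
          using m S by (intro pm) auto
        then show False using x m by simp
      qed
      then show "x S \<in> M' (d - j)" using xS ker by blast
    next
      show "x S = 0" if "\<not> (S \<subseteq> V \<and> card S = j \<and> j \<le> d)" for S
        using kchain_zero[OF conjunct1[OF x] that] .
    qed
  qed
  have const': "Poly_Mapping.lookup (x {} k) 0 = 0" if "x \<in> kchain V M' 0 d" "k < length ds" for x k
    using kchain_in[OF that(1), of "{}"] const that(2) by simp
  note st = resolution_step[where p = p and s = qsc and dQ = "qdiff \<iota> E" and M' = M' and ds = ds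
      and d = d and Q = "\<lambda>j. qchain V E j d" and V = V and \<iota> = \<iota>, OF V lin qdiff_linear Q]
  have st1: "vector_space.dim qsc {q \<in> qchain V E (Suc j) d :: (('v \<Rightarrow>\<^sub>0 nat) \<Rightarrow> 'v set \<Rightarrow> 'k) set. qdiff \<iota> E q = 0}
      + vector_space.dim csc (kdiff \<iota> V ` kchain V M' (Suc j) d) =
      vector_space.dim csc {x \<in> kchain V M' j d. kdiff \<iota> V x = 0} +
      vector_space.dim qsc (qdiff \<iota> E ` (qchain V E (Suc (Suc j)) d :: (('v \<Rightarrow>\<^sub>0 nat) \<Rightarrow> 'v set \<Rightarrow> 'k) set))"
    by (rule st(1), rule comm, rule ker', rule const')
  have st2: "vector_space.dim qsc {q \<in> qchain V E 0 d :: (('v \<Rightarrow>\<^sub>0 nat) \<Rightarrow> 'v set \<Rightarrow> 'k) set. qdiff \<iota> E q = 0} =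
      count_list ds d + vector_space.dim qsc (qdiff \<iota> E ` (qchain V E (Suc 0) d :: (('v \<Rightarrow>\<^sub>0 nat) \<Rightarrow> 'v set \<Rightarrow> 'k) set))"
    by (rule st(2), rule comm, rule ker', rule const')
  show "qhdim TYPE('k) \<iota> V E (Suc j) d = khdim \<iota> V M' j d"
    using st1 unfolding qhdim_def khdim_def by simp
  show "qhdim TYPE('k) \<iota> V E 0 d = int (count_list ds d)"
    using st2 unfolding qhdim_def by simp
qed

text \<open>The syzygies of a resolution whose maps are \<open>gens_map\<close> with entries \<open>e0\<close> (augmentation)
  and \<open>G i\<close> (differentials).\<close>

fun syzygies ::
  "'v set \<Rightarrow> 'v set set \<Rightarrow> (nat \<Rightarrow> nat list) \<Rightarrow> (nat \<Rightarrow> ('v, 'k::field) mpoly) \<Rightarrow>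
    (nat \<Rightarrow> nat \<Rightarrow> nat \<Rightarrow> ('v, 'k) mpoly) \<Rightarrow> nat \<Rightarrow> nat \<Rightarrow> (nat \<Rightarrow> ('v, 'k) mpoly) set" where
  "syzygies V E F e0 G 0 e =
     {f \<in> free_part V (F 0) e. gens_map (length (F 0)) (\<lambda>l k. e0 l) f 0 \<in> mono_ideal V E}"
| "syzygies V E F e0 G (Suc i) e =
     {f \<in> free_part V (F (Suc i)) e. gens_map (length (F (Suc i))) (G i) f = 0}"

text \<open>A minimal resolution with functions in place of matrices and with exactness tested in
  each degree separately; \<open>minimal_iff_graded_resolution\<close> is the bridge.\<close>

definition graded_resolution ::
  "'v set \<Rightarrow> 'v set set \<Rightarrow> (nat \<Rightarrow> nat list) \<Rightarrow> (nat \<Rightarrow> ('v, 'k::field) mpoly) \<Rightarrow>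
    (nat \<Rightarrow> nat \<Rightarrow> nat \<Rightarrow> ('v, 'k) mpoly) \<Rightarrow> bool" where
  "graded_resolution V E F e0 G \<longleftrightarrow>
     (\<forall>e. \<forall>f\<in>free_part V (F 0) e. gens_map (length (F 0)) (\<lambda>l k. e0 l) f 0 \<in> hpoly V 0 e) \<and>
     (\<forall>e. \<forall>p\<in>hpoly V 0 e. \<exists>f\<in>free_part V (F 0) e. p - gens_map (length (F 0)) (\<lambda>l k. e0 l) f 0 \<in> mono_ideal V E) \<and>
     (\<forall>i e. gens_map (length (F (Suc i))) (G i) ` free_part V (F (Suc i)) e = syzygies V E F e0 G i e) \<and>
     (\<forall>i. \<forall>l<length (F (Suc i)). \<forall>k<length (F i). Poly_Mapping.lookup (G i l k) 0 = 0)"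

lemma lookup_mult_0:
  fixes p q :: "('v, 'k::field) mpoly"
  shows "Poly_Mapping.lookup (p * q) 0 = Poly_Mapping.lookup p 0 * Poly_Mapping.lookup q 0"
proof -
  have sing: "Poly_Mapping.lookup (Poly_Mapping.single t c * q) 0 =
      (if t = 0 then c * Poly_Mapping.lookup q 0 else 0)" for t :: "'v \<Rightarrow>\<^sub>0 nat" and c :: 'k
  proof (cases "t = 0")
    case False
    have "t + m \<noteq> 0" for m
      using False by (metis add_is_0 mon_deg_add mon_deg_eq_0_iff)
    then show ?thesis using False by (simp add: lookup_single_mult)
  qed simp
  have "p * q = (\<Sum>t\<in>Poly_Mapping.keys p. Poly_Mapping.single t (Poly_Mapping.lookup p t) * q)"
    by (subst (1) poly_mapping_sum_single[of p, symmetric]) (simp add: sum_distrib_right)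
  then show ?thesis by (simp add: lookup_sum sing in_keys_iff)
qed

text \<open>A syzygy is an image under the next map, and the entries of that map have no constant
  term.\<close>

lemma syzygies_const:
  assumes "graded_resolution V E F e0 G" "f \<in> syzygies V E F e0 G i e" "k < length (F i)"
  shows "Poly_Mapping.lookup (f k) 0 = 0"
proof -
  obtain h where "f = gens_map (length (F (Suc i))) (G i) h"
    using assms(1,2) unfolding graded_resolution_def by blast
  moreover have "\<forall>l<length (F (Suc i)). Poly_Mapping.lookup (G i l k) 0 = 0"
    using assms(1,3) unfolding graded_resolution_def by blast
  ultimately show ?thesis by (simp add: gens_map_def lookup_sum lookup_mult_0)
qed

text \<open>Dimension shifting: each passage to the next syzygy module lowers the exterior degree by
  one, until degree 0 counts the generators of \<open>F i\<close>. The right-hand side does not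
  mention the resolution, which gives uniqueness of the counts.\<close>

theorem count_graded_resolution:
  fixes e0 :: "nat \<Rightarrow> ('v, 'k::field) mpoly"
  assumes V: "finite V" "inj_on \<iota> V" and res: "graded_resolution V E F e0 G"
  shows "int (count_list (F i) d) = qhdim TYPE('k) \<iota> V E i d"
proof -
  note res' = res[unfolded graded_resolution_def]
  note const = syzygies_const[OF res]
  let ?S = "syzygies V E F e0 G"
  have q1: "qhdim TYPE('k) \<iota> V E (Suc j) d = khdim \<iota> V (?S 0) j d" for j
    by (rule quotient_step(1)[OF V, where ds = "F 0" and ?e0.0 = e0 and E = E and M' = "?S 0", OF _ _ syzygies.simps(1)])
      (use res' in blast, use res' in blast, rule const)
  have q2: "qhdim TYPE('k) \<iota> V E 0 d = int (count_list (F 0) d)"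
    by (rule quotient_step(2)[OF V, where ds = "F 0" and ?e0.0 = e0 and E = E and M' = "?S 0", OF _ _ syzygies.simps(1)])
      (use res' in blast, use res' in blast, rule const)
  have m1: "khdim \<iota> V (?S i) (Suc j) d = khdim \<iota> V (?S (Suc i)) j d" for i j
    by (rule module_step(1)[OF V, where ds = "F (Suc i)" and G = "G i" and M = "?S i" and M' = "?S (Suc i)",
          OF _ syzygies.simps(2)])
      (use res' in blast, rule const)
  have m2: "khdim \<iota> V (?S i) 0 d = int (count_list (F (Suc i)) d)" for i
    by (rule module_step(2)[OF V, where ds = "F (Suc i)" and G = "G i" and M = "?S i" and M' = "?S (Suc i)",
          OF _ syzygies.simps(2)])
      (use res' in blast, rule const)
  \<comment> \<open>The i-th syzygy module accounts for i + 1 shifts: one for the augmentation and i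
    for the differentials.\<close>
  have syz: "khdim \<iota> V (?S i) j d = qhdim TYPE('k) \<iota> V E (Suc (i + j)) d" for i j
    by (induction i arbitrary: j) (simp_all del: syzygies.simps add: q1 m1[symmetric])
  show ?thesis
    by (cases i) (simp_all del: syzygies.simps add: q2 m2[symmetric] syz)
qed

section \<open>Homogeneous components and matrices\<close>

definition hcomp :: "nat \<Rightarrow> nat \<Rightarrow> ('v, 'k::field) mpoly \<Rightarrow> ('v, 'k) mpoly" where
  "hcomp c e p = (\<Sum>m\<in>{m \<in> Poly_Mapping.keys p. mon_deg m + c = e}. Poly_Mapping.single m (Poly_Mapping.lookup p m))"

lemma lookup_hcomp:
  "Poly_Mapping.lookup (hcomp c e p) m = (if mon_deg m + c = e then Poly_Mapping.lookup p m else 0)"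
  unfolding hcomp_def by (subst lookup_sum_single) (auto simp: in_keys_iff)

lemma hcomp_diff: "hcomp c e (p - q) = hcomp c e p - hcomp c e q"
  by (intro poly_mapping_eqI) (simp add: lookup_hcomp lookup_minus)

lemma hcomp_zero [simp]: "hcomp c e 0 = 0"
  by (intro poly_mapping_eqI) (simp add: lookup_hcomp)

lemma hcomp_sum: "hcomp c e (\<Sum>i\<in>A. f i) = (\<Sum>i\<in>A. hcomp c e (f i))"
  by (intro poly_mapping_eqI) (simp add: lookup_hcomp lookup_sum)

lemma hcomp_single:
  "hcomp c e (Poly_Mapping.single t a) = (if mon_deg t + c = e then Poly_Mapping.single t a else 0)"
  by (intro poly_mapping_eqI) (simp add: lookup_hcomp lookup_single when_def)

text \<open>A homogeneous factor shifts all degrees by the same amount; therefore graded maps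
  commute with taking components, as stated in \<open>gens_map_vcomp\<close>.\<close>

lemma hcomp_mult:
  assumes q: "\<And>m. m \<in> Poly_Mapping.keys q \<Longrightarrow> mon_deg m + r = c"
  shows "hcomp r e (p * q) = hcomp c e p * q"
proof -
  have sing: "hcomp r e (Poly_Mapping.single t a * q) = hcomp c e (Poly_Mapping.single t a) * q" for t a
  proof (rule poly_mapping_eqI)
    fix x
    have "mon_deg x + r = e \<longleftrightarrow> mon_deg t + c = e" if "m \<in> Poly_Mapping.keys q" "t + m = x" for m
      using q[OF that(1)] that(2) mon_deg_add[of t m] by auto
    then show "Poly_Mapping.lookup (hcomp r e (Poly_Mapping.single t a * q)) x =
        Poly_Mapping.lookup (hcomp c e (Poly_Mapping.single t a) * q) x"
      by (auto simp: lookup_hcomp hcomp_single lookup_single_mult intro!: sum.neutral)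
  qed
  have "hcomp r e (p * q) = (\<Sum>t\<in>Poly_Mapping.keys p. hcomp r e (Poly_Mapping.single t (Poly_Mapping.lookup p t) * q))"
    by (subst (1) poly_mapping_sum_single[of p, symmetric]) (simp add: sum_distrib_right hcomp_sum)
  also have "\<dots> = hcomp c e (\<Sum>t\<in>Poly_Mapping.keys p. Poly_Mapping.single t (Poly_Mapping.lookup p t)) * q"
    by (simp add: sing hcomp_sum sum_distrib_right)
  finally show ?thesis by (simp add: poly_mapping_sum_single)
qed

lemma poly_ring_lookup: "p \<in> poly_ring V \<longleftrightarrow>
    (\<forall>m. \<not> Poly_Mapping.keys m \<subseteq> V \<longrightarrow> Poly_Mapping.lookup p m = 0)"
  unfolding poly_ring_def by (auto simp: in_keys_iff)

lemma hcomp_hpoly: "p \<in> poly_ring V \<Longrightarrow> hcomp c e p \<in> hpoly V c e"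
  by (auto simp: hpoly_lookup lookup_hcomp poly_ring_lookup)

lemma hpoly_poly_ring: "hpoly V c e \<subseteq> poly_ring V"
  by (auto simp: hpoly_def poly_ring_def)

lemma hcomp_hpoly_eq: "p \<in> hpoly V c e \<Longrightarrow> hcomp c e p = p"
  by (intro poly_mapping_eqI) (auto simp: lookup_hcomp hpoly_lookup)

lemma mono_ideal_hcomp:
  "p \<in> mono_ideal V E \<longleftrightarrow> (\<forall>e. hcomp c e p \<in> mono_ideal V E)"
  unfolding mono_ideal_lookup lookup_hcomp by auto

lemma poly_ring_sum: "(\<And>i. i \<in> A \<Longrightarrow> f i \<in> poly_ring V) \<Longrightarrow> (\<Sum>i\<in>A. f i) \<in> poly_ring V"
  unfolding poly_ring_lookup by (simp add: lookup_sum)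

lemma poly_ring_mult: "p \<in> poly_ring V \<Longrightarrow> q \<in> poly_ring V \<Longrightarrow> p * q \<in> poly_ring V"
  unfolding poly_ring_def
proof (clarsimp)
  fix m x assume *: "\<forall>m\<in>Poly_Mapping.keys p. Poly_Mapping.keys m \<subseteq> V"
    "\<forall>m\<in>Poly_Mapping.keys q. Poly_Mapping.keys m \<subseteq> V"
    "m \<in> Poly_Mapping.keys (p * q)" "x \<in> Poly_Mapping.keys m"
  then obtain a b where "a \<in> Poly_Mapping.keys p" "b \<in> Poly_Mapping.keys q" "m = a + b"
    using keys_mult[of p q] by auto
  then show "x \<in> V" using * keys_add[of a b] by blast
qed

lemma hpoly_mult:
  assumes "p \<in> hpoly V c e" "q \<in> poly_ring V" "\<And>m. m \<in> Poly_Mapping.keys q \<Longrightarrow> mon_deg m + r = c"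
  shows "p * q \<in> hpoly V r e"
proof -
  have "p * q \<in> poly_ring V" using assms(1,2) hpoly_poly_ring poly_ring_mult by blast
  then have "hcomp r e (p * q) \<in> hpoly V r e" by (rule hcomp_hpoly)
  then show ?thesis by (simp add: hcomp_mult[OF assms(3)] hcomp_hpoly_eq[OF assms(1)])
qed

definition free_fun :: "'v set \<Rightarrow> nat list \<Rightarrow> (nat \<Rightarrow> ('v, 'k::field) mpoly) set" where
  "free_fun V ds = fun_prod {..<length ds} (\<lambda>_. poly_ring V)"

definition vcomp :: "nat list \<Rightarrow> nat \<Rightarrow> (nat \<Rightarrow> ('v, 'k::field) mpoly) \<Rightarrow> nat \<Rightarrow> ('v, 'k) mpoly" where
  "vcomp ds e f k = hcomp (ds ! k) e (f k)"

lemma free_part_iff: "f \<in> free_part V ds e \<longleftrightarrow>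
    (\<forall>k<length ds. f k \<in> hpoly V (ds ! k) e) \<and> (\<forall>k. \<not> k < length ds \<longrightarrow> f k = 0)"
  unfolding free_part_def fun_prod_def by auto

lemma free_fun_iff: "f \<in> free_fun V ds \<longleftrightarrow>
    (\<forall>k<length ds. f k \<in> poly_ring V) \<and> (\<forall>k. \<not> k < length ds \<longrightarrow> f k = 0)"
  unfolding free_fun_def fun_prod_def by auto

lemma free_part_free_fun: "free_part V ds e \<subseteq> free_fun V ds"
  using hpoly_poly_ring by (fastforce simp: free_part_iff free_fun_iff)

lemma vcomp_free_part: "f \<in> free_fun V ds \<Longrightarrow> vcomp ds e f \<in> free_part V ds e"
  unfolding free_part_iff free_fun_iff vcomp_def by (simp add: hcomp_hpoly)

lemma vcomp_free_part_eq: "f \<in> free_part V ds e \<Longrightarrow> vcomp ds e f = f"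
proof
  fix k assume "f \<in> free_part V ds e"
  then show "vcomp ds e f k = f k"
    unfolding free_part_iff vcomp_def by (cases "k < length ds") (auto intro: hcomp_hpoly_eq)
qed

text \<open>Only finitely many monomials occur in the finitely many entries, so all components from
  some \<open>N\<close> on vanish.\<close>

lemma vcomp_sum:
  assumes f: "f \<in> free_fun V ds"
  obtains N where "f = (\<lambda>k. \<Sum>e<N. vcomp ds e f k)"
proof -
  define A where "A = (\<Union>k<length ds. (\<lambda>m. mon_deg m + ds ! k) ` Poly_Mapping.keys (f k))"
  have "finite A" by (simp add: A_def)
  then obtain N where N: "\<And>x. x \<in> A \<Longrightarrow> x < N" using finite_nat_set_iff_bounded by auto
  have "f k = (\<Sum>e<N. vcomp ds e f k)" for k
  proof (rule poly_mapping_eqI)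
    fix m
    have "Poly_Mapping.lookup (\<Sum>e<N. vcomp ds e f k) m =
        (if mon_deg m + ds ! k < N then Poly_Mapping.lookup (f k) m else 0)"
      by (simp add: lookup_sum vcomp_def lookup_hcomp)
    moreover have "Poly_Mapping.lookup (f k) m = 0" if "\<not> mon_deg m + ds ! k < N"
    proof (rule ccontr)
      assume nz: "Poly_Mapping.lookup (f k) m \<noteq> 0"
      then have "k < length ds" using f unfolding free_fun_iff by (metis lookup_zero)
      then have "mon_deg m + ds ! k \<in> A" using nz unfolding A_def in_keys_iff[symmetric] by blast
      then show False using N that by blast
    qed
    ultimately show "Poly_Mapping.lookup (f k) m = Poly_Mapping.lookup (\<Sum>e<N. vcomp ds e f k) m" by auto
  qed
  then show thesis using that by blast
qed

lemma free_fun_eq_0_iff: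
  assumes "f \<in> free_fun V ds"
  shows "f = 0 \<longleftrightarrow> (\<forall>e. vcomp ds e f = 0)"
proof
  show "f = 0 \<Longrightarrow> \<forall>e. vcomp ds e f = 0" by (simp add: vcomp_def fun_eq_iff)
  assume 0: "\<forall>e. vcomp ds e f = 0"
  obtain N where "f = (\<lambda>k. \<Sum>e<N. vcomp ds e f k)" using vcomp_sum[OF assms] .
  then show "f = 0" using 0 by (simp add: fun_eq_iff)
qed

definition homogeneous_gens ::
  "'v set \<Rightarrow> nat list \<Rightarrow> nat list \<Rightarrow> (nat \<Rightarrow> nat \<Rightarrow> ('v, 'k::field) mpoly) \<Rightarrow> bool" where
  "homogeneous_gens V cs rs G \<longleftrightarrow> (\<forall>l<length cs. G l \<in> free_part V rs (cs ! l))"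

lemma homogeneous_gensD:
  assumes "homogeneous_gens V cs rs G" "l < length cs"
  shows "k < length rs \<Longrightarrow> G l k \<in> hpoly V (rs ! k) (cs ! l)" "\<not> k < length rs \<Longrightarrow> G l k = 0"
  using assms unfolding homogeneous_gens_def free_part_def fun_prod_def by auto

lemma homogeneous_gens_keys:
  assumes "homogeneous_gens V cs rs G" "l < length cs" "k < length rs"
  shows "G l k \<in> poly_ring V" "m \<in> Poly_Mapping.keys (G l k) \<Longrightarrow> mon_deg m + rs ! k = cs ! l"
  using homogeneous_gensD(1)[OF assms] hpoly_poly_ring by (blast, simp add: hpoly_def)

lemma gens_map_outside:
  assumes "homogeneous_gens V cs rs G" "\<not> k < length rs"
  shows "gens_map (length cs) G f k = 0"
  unfolding gens_map_def using homogeneous_gensD(2)[OF assms(1) _ assms(2)] by simp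

lemma gens_map_free_part:
  assumes G: "homogeneous_gens V cs rs G" and f: "f \<in> free_part V cs e"
  shows "gens_map (length cs) G f \<in> free_part V rs e"
  unfolding free_part_def fun_prod_def
proof (intro CollectI allI)
  fix k
  interpret vector_space "psc :: 'b \<Rightarrow> ('a, 'b) mpoly \<Rightarrow> _" by (rule vector_space_psc)
  have "gens_map (length cs) G f k \<in> hpoly V (rs ! k) e" if k: "k < length rs"
    unfolding gens_map_def
  proof (rule subspace_sum[OF hpoly_subspace])
    fix l assume "l \<in> {..<length cs}"
    then show "f l * G l k \<in> hpoly V (rs ! k) e"
      using f homogeneous_gens_keys[OF G _ k]
      by (intro hpoly_mult[where c = "cs ! l"]) (auto simp: free_part_def fun_prod_def)
  qed
  then show "if k \<in> {..<length rs} then gens_map (length cs) G f k \<in> hpoly V (rs ! k) e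
      else gens_map (length cs) G f k = 0"
    using gens_map_outside[OF G] by simp
qed

lemma gens_map_free_fun:
  assumes G: "homogeneous_gens V cs rs G" and f: "f \<in> free_fun V cs"
  shows "gens_map (length cs) G f \<in> free_fun V rs"
  unfolding free_fun_def fun_prod_def
proof (intro CollectI allI)
  fix k
  have "gens_map (length cs) G f k \<in> poly_ring V" if k: "k < length rs"
    unfolding gens_map_def
    using f homogeneous_gens_keys(1)[OF G _ k]
    by (intro poly_ring_sum poly_ring_mult) (auto simp: free_fun_def fun_prod_def)
  then show "if k \<in> {..<length rs} then gens_map (length cs) G f k \<in> poly_ring V
      else gens_map (length cs) G f k = 0"
    using gens_map_outside[OF G] by simp
qed

lemma gens_map_vcomp:
  assumes G: "homogeneous_gens V cs rs G"
  shows "gens_map (length cs) G (vcomp cs e f) = vcomp rs e (gens_map (length cs) G f)"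
proof
  fix k
  show "gens_map (length cs) G (vcomp cs e f) k = vcomp rs e (gens_map (length cs) G f) k"
  proof (cases "k < length rs")
    case True
    then show ?thesis
      unfolding gens_map_def vcomp_def hcomp_sum
      by (intro sum.cong[OF refl] hcomp_mult[symmetric] homogeneous_gens_keys(2)[OF G]) auto
  next
    case False
    then show ?thesis by (simp add: gens_map_outside[OF G] vcomp_def)
  qed
qed

lemma free_fun_sum: "(\<And>e. e \<in> A \<Longrightarrow> g e \<in> free_fun V ds) \<Longrightarrow> (\<lambda>k. \<Sum>e\<in>A. g e k) \<in> free_fun V ds"
  unfolding free_fun_def fun_prod_def by (auto intro!: poly_ring_sum sum.neutral)

text \<open>Graded maps respect components, and every element is a finite sum of components. The
  condition \<open>Ker\<close> is abstract because it stands for membership in the ideal at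
  \<open>F 0\<close> and for the kernel of a differential later on.\<close>

lemma exact_iff_exact_parts:
  assumes G: "homogeneous_gens V cs rs G"
    and Ker: "\<And>f. f \<in> free_fun V rs \<Longrightarrow> Ker f \<longleftrightarrow> (\<forall>e. Ker (vcomp rs e f))"
  shows "(\<forall>f\<in>free_fun V rs. Ker f \<longleftrightarrow> f \<in> gens_map (length cs) G ` free_fun V cs) \<longleftrightarrow>
    (\<forall>e. gens_map (length cs) G ` free_part V cs e = {f \<in> free_part V rs e. Ker f})"
    (is "?L \<longleftrightarrow> ?R")
proof
  assume L: ?L
  show ?R
  proof (intro allI equalityI subsetI)
    fix e f assume "f \<in> gens_map (length cs) G ` free_part V cs e"
    then obtain g where g: "g \<in> free_part V cs e" "f = gens_map (length cs) G g" by blast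
    then have "f \<in> free_part V rs e" using gens_map_free_part[OF G] by blast
    moreover have "g \<in> free_fun V cs" using g(1) free_part_free_fun by blast
    ultimately show "f \<in> {f \<in> free_part V rs e. Ker f}"
      using L g(2) free_part_free_fun by blast
  next
    fix e f assume f: "f \<in> {f \<in> free_part V rs e. Ker f}"
    then have "f \<in> free_fun V rs" using free_part_free_fun by blast
    then obtain g where g: "g \<in> free_fun V cs" "f = gens_map (length cs) G g" using L f by blast
    have "vcomp rs e f = f" using f by (intro vcomp_free_part_eq) blast
    then have "f = gens_map (length cs) G (vcomp cs e g)"
      by (simp only: gens_map_vcomp[OF G] g(2))
    then show "f \<in> gens_map (length cs) G ` free_part V cs e"
      using vcomp_free_part[OF g(1)] by blast
  qed
next
  assume R: ?R
  show ?L
  proof (intro ballI iffI)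
    fix f assume f: "f \<in> free_fun V rs" "Ker f"
    then have "vcomp rs e f \<in> gens_map (length cs) G ` free_part V cs e" for e
      using R Ker vcomp_free_part by blast
    then have "\<exists>g. g \<in> free_part V cs e \<and> vcomp rs e f = gens_map (length cs) G g" for e
      by blast
    then obtain g where g: "\<And>e. g e \<in> free_part V cs e" "\<And>e. vcomp rs e f = gens_map (length cs) G (g e)"
      by metis
    obtain N where N: "f = (\<lambda>k. \<Sum>e<N. vcomp rs e f k)" using vcomp_sum[OF f(1)] .
    have "gens_map (length cs) G (\<lambda>k. \<Sum>e<N. g e k) = f"
      unfolding gens_map_sum g(2)[symmetric] N[symmetric] ..
    moreover have "(\<lambda>k. \<Sum>e<N. g e k) \<in> free_fun V cs"
      using g(1) free_part_free_fun by (intro free_fun_sum) blast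
    ultimately show "f \<in> gens_map (length cs) G ` free_fun V cs" by blast
  next
    fix f assume f: "f \<in> free_fun V rs" "f \<in> gens_map (length cs) G ` free_fun V cs"
    then obtain g where g: "g \<in> free_fun V cs" "f = gens_map (length cs) G g" by blast
    have "vcomp rs e f \<in> gens_map (length cs) G ` free_part V cs e" for e
      using vcomp_free_part[OF g(1)] by (simp add: g(2) gens_map_vcomp[OF G, symmetric])
    then have "Ker (vcomp rs e f)" for e using R by blast
    then show "Ker f" using Ker f(1) by blast
  qed
qed

text \<open>Extension by 0 beyond the length puts the elements of all free modules into one type,
  where the vector space results apply.\<close>

definition vec_fun :: "('v, 'k::field) mpoly vec \<Rightarrow> nat \<Rightarrow> ('v, 'k) mpoly" where
  "vec_fun v = (\<lambda>k. if k < dim_vec v then v $ k else 0)"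

lemma vec_fun_free_module:
  "v \<in> free_module V ds \<Longrightarrow> vec_fun v \<in> free_fun V ds"
  unfolding free_module_def free_fun_def fun_prod_def vec_fun_def by auto

lemma vec_free_fun: "f \<in> free_fun V ds \<Longrightarrow> vec (length ds) f \<in> free_module V ds"
  unfolding free_module_def free_fun_def fun_prod_def by auto

lemma vec_fun_vec: "f \<in> free_fun V ds \<Longrightarrow> vec_fun (vec (length ds) f) = f"
  unfolding free_fun_def fun_prod_def vec_fun_def by (auto simp: fun_eq_iff)

lemma vec_vec_fun: "v \<in> carrier_vec n \<Longrightarrow> vec n (vec_fun v) = v"
  unfolding vec_fun_def by auto

lemma ball_free_module:
  fixes P :: "('v, 'k::field) mpoly vec \<Rightarrow> bool"
  shows "(\<forall>v\<in>free_module V ds. P v) \<longleftrightarrow> (\<forall>f\<in>free_fun V ds. P (vec (length ds) f))"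
proof
  assume *: "\<forall>f\<in>free_fun V ds. P (vec (length ds) f)"
  show "\<forall>v\<in>free_module V ds. P v"
  proof
    fix v :: "('v, 'k) mpoly vec" assume v: "v \<in> free_module V ds"
    then have "vec (length ds) (vec_fun v) = v" by (intro vec_vec_fun) (simp add: free_module_def)
    then show "P v" using * vec_fun_free_module[OF v] by metis
  qed
qed (use vec_free_fun in blast)

lemma free_module_eq: "free_module V ds = vec (length ds) ` free_fun V ds"
  using ball_free_module[of V ds "\<lambda>v. v \<in> vec (length ds) ` free_fun V ds"] vec_free_fun by blast

lemma mat_mult_vec_gens:
  assumes G: "homogeneous_gens V cs rs G"
  shows "mat (length rs) (length cs) (\<lambda>(k, l). G l k) *\<^sub>v vec (length cs) f =
    vec (length rs) (gens_map (length cs) G f)"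
  by (auto simp: scalar_prod_def gens_map_def atLeast0LessThan mult.commute intro!: eq_vecI sum.cong)

lemma vec_eq_iff_free_fun:
  "f \<in> free_fun V ds \<Longrightarrow> g \<in> free_fun V ds \<Longrightarrow> vec (length ds) f = vec (length ds) g \<longleftrightarrow> f = g"
  by (metis vec_fun_vec)

lemma mat_image_iff:
  assumes G: "homogeneous_gens V cs rs G" and f: "f \<in> free_fun V rs"
  shows "vec (length rs) f \<in> (*\<^sub>v) (mat (length rs) (length cs) (\<lambda>(k, l). G l k)) ` free_module V cs \<longleftrightarrow>
    f \<in> gens_map (length cs) G ` free_fun V cs"
  unfolding free_module_eq image_image mat_mult_vec_gens[OF G]
  using vec_eq_iff_free_fun[OF f gens_map_free_fun[OF G]] by (auto simp: image_iff)

lemma graded_hom_gens: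
  assumes "homogeneous_gens V cs rs G"
  shows "graded_hom V cs rs (mat (length rs) (length cs) (\<lambda>(k, l). G l k))"
  unfolding graded_hom_def using homogeneous_gens_keys[OF assms] by auto

text \<open>The defining conditions are translated one at a time: surjectivity (\<open>A\<close>),
  exactness at \<open>F 0\<close> (\<open>B\<close>), exactness further on (\<open>C\<close>) and
  minimality (\<open>D\<close>). Matrix columns become the functions \<open>G i l\<close>, hence the
  swapped indices.\<close>

theorem minimal_iff_graded_resolution:
  fixes e0 :: "nat \<Rightarrow> ('v, 'k::field) mpoly"
  assumes e0: "homogeneous_gens V (F 0) [0] (\<lambda>l k. if k = 0 then e0 l else 0)"
    and G: "\<And>i. homogeneous_gens V (F (Suc i)) (F i) (G i)"
  shows "minimal_graded_free_resolution V (mono_ideal V E) F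
      (mat (length [0::nat]) (length (F 0)) (\<lambda>(k, l). if k = 0 then e0 l else 0))
      (\<lambda>i. mat (length (F i)) (length (F (Suc i))) (\<lambda>(k, l). G i l k))
    \<longleftrightarrow> graded_resolution V E F e0 G"
proof -
  let ?e = "mat (length [0::nat]) (length (F 0)) (\<lambda>(k, l). if k = 0 then e0 l else 0)"
  let ?D = "\<lambda>i. mat (length (F i)) (length (F (Suc i))) (\<lambda>(k, l). G i l k)"
  let ?\<phi>' = "gens_map (length (F 0)) (\<lambda>l k. if k = 0 then e0 l else 0)"
  define \<phi> where "\<phi> f = gens_map (length (F 0)) (\<lambda>l k. e0 l) f 0" for f
  have \<phi>': "\<phi> f = ?\<phi>' f 0" for f by (simp add: \<phi>_def gens_map_def)
  have eps: "(?e *\<^sub>v vec (length (F 0)) f) $ 0 = \<phi> f" for f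
    unfolding mat_mult_vec_gens[OF e0] \<phi>' by simp
  have \<phi>_vcomp: "\<phi> (vcomp (F 0) e f) = hcomp 0 e (\<phi> f)" for e f
    unfolding \<phi>' gens_map_vcomp[OF e0] by (simp add: vcomp_def)
  have A1: "(\<forall>p\<in>poly_ring V. \<exists>v\<in>free_module V (F 0). p - (?e *\<^sub>v v) $ 0 \<in> mono_ideal V E) \<longleftrightarrow>
      (\<forall>p\<in>poly_ring V. \<exists>f\<in>free_fun V (F 0). p - \<phi> f \<in> mono_ideal V E)"
    unfolding free_module_eq bex_simps eps ..
  also have "\<dots> \<longleftrightarrow> (\<forall>e. \<forall>p\<in>hpoly V 0 e. \<exists>f\<in>free_part V (F 0) e. p - \<phi> f \<in> mono_ideal V E)" (is "?L \<longleftrightarrow> ?R")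
  proof
    assume L: ?L
    show ?R
    proof (intro allI ballI)
      fix e p assume p: "p \<in> (hpoly V 0 e :: ('v, 'k) mpoly set)"
      then obtain f where f: "f \<in> free_fun V (F 0)" "p - \<phi> f \<in> mono_ideal V E"
        using L hpoly_poly_ring by blast
      then have "hcomp 0 e (p - \<phi> f) \<in> mono_ideal V E" using mono_ideal_hcomp by blast
      then have "p - \<phi> (vcomp (F 0) e f) \<in> mono_ideal V E"
        by (simp add: hcomp_diff \<phi>_vcomp hcomp_hpoly_eq[OF p])
      then show "\<exists>f\<in>free_part V (F 0) e. p - \<phi> f \<in> mono_ideal V E"
        using vcomp_free_part[OF f(1)] by blast
    qed
  next
    assume R: ?R
    show ?L
    proof
      fix p assume p: "p \<in> (poly_ring V :: ('v, 'k) mpoly set)"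
      have "\<exists>f\<in>free_part V (F 0) e. hcomp 0 e p - \<phi> f \<in> mono_ideal V E" for e
        using R hcomp_hpoly[OF p] by blast
      then obtain g where g: "\<And>e. g e \<in> free_part V (F 0) e" "\<And>e. hcomp 0 e p - \<phi> (g e) \<in> mono_ideal V E"
        by metis
      \<comment> \<open>A polynomial is treated as a vector of length one, so that
        \<open>vcomp_sum\<close> also splits \<open>p\<close> into finitely many components.\<close>
      have "(\<lambda>k. if k = 0 then p else 0) \<in> free_fun V [0]"
        using p by (auto simp: free_fun_def fun_prod_def)
      then obtain N where "(\<lambda>k. if k = 0 then p else 0) = (\<lambda>k. \<Sum>e<N. vcomp [0] e (\<lambda>k. if k = 0 then p else 0) k)"
        by (rule vcomp_sum)
      from fun_cong[OF this, of 0] have N: "p = (\<Sum>e<N. hcomp 0 e p)" by (simp add: vcomp_def)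
      have "\<phi> (\<lambda>k. \<Sum>e<N. g e k) = (\<Sum>e<N. \<phi> (g e))" unfolding \<phi>_def gens_map_sum ..
      then have "p - \<phi> (\<lambda>k. \<Sum>e<N. g e k) = (\<Sum>e<N. hcomp 0 e p - \<phi> (g e))"
        by (subst N) (simp add: sum_subtractf)
      also have "\<dots> \<in> mono_ideal V E"
        using g(2) unfolding mono_ideal_lookup by (simp add: lookup_sum)
      finally have "p - \<phi> (\<lambda>k. \<Sum>e<N. g e k) \<in> mono_ideal V E" .
      moreover have "(\<lambda>k. \<Sum>e<N. g e k) \<in> free_fun V (F 0)"
        using g(1) free_part_free_fun by (intro free_fun_sum) blast
      ultimately show "\<exists>f\<in>free_fun V (F 0). p - \<phi> f \<in> mono_ideal V E" by blast
    qed
  qed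
  finally have A: "(\<forall>p\<in>poly_ring V. \<exists>v\<in>free_module V (F 0). p - (?e *\<^sub>v v) $ 0 \<in> mono_ideal V E) \<longleftrightarrow>
    (\<forall>e. \<forall>p\<in>hpoly V 0 e. \<exists>f\<in>free_part V (F 0) e. p - \<phi> f \<in> mono_ideal V E)" .
  have "(\<forall>v\<in>free_module V (F 0). (?e *\<^sub>v v) $ 0 \<in> mono_ideal V E \<longleftrightarrow> v \<in> (*\<^sub>v) (?D 0) ` free_module V (F (Suc 0)))
      \<longleftrightarrow> (\<forall>f\<in>free_fun V (F 0). \<phi> f \<in> mono_ideal V E \<longleftrightarrow> f \<in> gens_map (length (F (Suc 0))) (G 0) ` free_fun V (F (Suc 0)))"
    unfolding ball_free_module eps using mat_image_iff[OF G[of 0]] by auto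
  also have "\<dots> \<longleftrightarrow> (\<forall>e. gens_map (length (F (Suc 0))) (G 0) ` free_part V (F (Suc 0)) e = syzygies V E F e0 G 0 e)"
    unfolding syzygies.simps \<phi>_def[symmetric]
    by (rule exact_iff_exact_parts[OF G]) (unfold \<phi>_vcomp, rule mono_ideal_hcomp)
  finally have B: "(\<forall>v\<in>free_module V (F 0). (?e *\<^sub>v v) $ 0 \<in> mono_ideal V E \<longleftrightarrow> v \<in> (*\<^sub>v) (?D 0) ` free_module V (F (Suc 0)))
      \<longleftrightarrow> (\<forall>e. gens_map (length (F (Suc 0))) (G 0) ` free_part V (F (Suc 0)) e = syzygies V E F e0 G 0 e)" .
  have C: "(\<forall>v\<in>free_module V (F (Suc i)). ?D i *\<^sub>v v = 0\<^sub>v (length (F i)) \<longleftrightarrow>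
        v \<in> (*\<^sub>v) (?D (Suc i)) ` free_module V (F (Suc (Suc i))))
      \<longleftrightarrow> (\<forall>e. gens_map (length (F (Suc (Suc i)))) (G (Suc i)) ` free_part V (F (Suc (Suc i))) e
            = syzygies V E F e0 G (Suc i) e)" for i
  proof -
    have 0: "?D i *\<^sub>v vec (length (F (Suc i))) f = 0\<^sub>v (length (F i)) \<longleftrightarrow> gens_map (length (F (Suc i))) (G i) f = 0"
      if "f \<in> free_fun V (F (Suc i))" for f
    proof -
      have "0\<^sub>v (length (F i)) = vec (length (F i)) (0 :: nat \<Rightarrow> ('v, 'k) mpoly)" by auto
      moreover have "(0 :: nat \<Rightarrow> ('v, 'k) mpoly) \<in> free_fun V (F i)"
        by (simp add: free_fun_def fun_prod_def poly_ring_def)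
      ultimately show ?thesis
        using vec_eq_iff_free_fun[OF gens_map_free_fun[OF G that]] by (simp only: mat_mult_vec_gens[OF G])
    qed
    have "(\<forall>v\<in>free_module V (F (Suc i)). ?D i *\<^sub>v v = 0\<^sub>v (length (F i)) \<longleftrightarrow>
        v \<in> (*\<^sub>v) (?D (Suc i)) ` free_module V (F (Suc (Suc i)))) \<longleftrightarrow>
      (\<forall>f\<in>free_fun V (F (Suc i)). gens_map (length (F (Suc i))) (G i) f = 0 \<longleftrightarrow>
        f \<in> gens_map (length (F (Suc (Suc i)))) (G (Suc i)) ` free_fun V (F (Suc (Suc i))))"
      unfolding ball_free_module using mat_image_iff[OF G[of "Suc i"]] 0 by auto
    also have "\<dots> \<longleftrightarrow> (\<forall>e. gens_map (length (F (Suc (Suc i)))) (G (Suc i)) ` free_part V (F (Suc (Suc i))) e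
            = syzygies V E F e0 G (Suc i) e)"
      unfolding syzygies.simps
      by (rule exact_iff_exact_parts[OF G]) (use free_fun_eq_0_iff[OF gens_map_free_fun[OF G]] gens_map_vcomp[OF G] in auto)
    finally show ?thesis .
  qed
  have hom: "\<phi> f \<in> hpoly V 0 e" if "f \<in> free_part V (F 0) e" for e f
    using gens_map_free_part[OF e0 that] unfolding \<phi>' by (auto simp: free_part_def fun_prod_def split: if_splits dest: spec[of _ 0])
  have D: "(\<forall>i. \<forall>k<length (F i). \<forall>l<length (F (Suc i)). Poly_Mapping.lookup (?D i $$ (k, l)) 0 = 0) \<longleftrightarrow>
      (\<forall>i. \<forall>l<length (F (Suc i)). \<forall>k<length (F i). Poly_Mapping.lookup (G i l k) 0 = 0)"
    by auto
  have all: "(\<forall>i. P i) \<longleftrightarrow> P 0 \<and> (\<forall>i. P (Suc i))" for P :: "nat \<Rightarrow> bool"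
    by (metis not0_implies_Suc)
  have E: "(\<forall>i e. gens_map (length (F (Suc i))) (G i) ` free_part V (F (Suc i)) e = syzygies V E F e0 G i e) \<longleftrightarrow>
      (\<forall>e. gens_map (length (F (Suc 0))) (G 0) ` free_part V (F (Suc 0)) e = syzygies V E F e0 G 0 e) \<and>
      (\<forall>i e. gens_map (length (F (Suc (Suc i)))) (G (Suc i)) ` free_part V (F (Suc (Suc i))) e = syzygies V E F e0 G (Suc i) e)"
    by (rule all)
  have H: "\<forall>e. \<forall>f\<in>free_part V (F 0) e. \<phi> f \<in> hpoly V 0 e" using hom by blast
  note gh = graded_hom_gens[OF e0] graded_hom_gens[OF G]
  show ?thesis
    unfolding minimal_graded_free_resolution_def graded_resolution_def \<phi>_def[symmetric] E One_nat_def A B C D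
    by (simp only: eqTrueI[OF H] gh simp_thms conj_assoc)
qed

section \<open>Existence of minimal resolutions\<close>

text \<open>A basis of M / U expressed by representatives: extend a basis \<open>C\<close> of
  \<open>U\<close> to a basis \<open>D\<close> of \<open>M\<close> and keep
  \<open>D - C\<close>.\<close>

lemma (in vector_space) basis_modulo:
  assumes M: "subspace M" "local.findim M" and U: "subspace U" "U \<subseteq> M"
  obtains B where "finite B" "B \<subseteq> M" "\<And>x. x \<in> M \<Longrightarrow> \<exists>s\<in>span B. x - s \<in> U"
    "\<And>c b. (\<Sum>b\<in>B. scale (c b) b) \<in> U \<Longrightarrow> b \<in> B \<Longrightarrow> c b = 0"
    "card B + dim U = dim M"
proof -
  obtain C where C: "C \<subseteq> U" "finite C" "local.independent C" "U \<subseteq> span C"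
    and cardC: "card C = dim U"
    using findim_basis[OF findim_subset[OF M(2) U(2)]] by metis
  have "C \<subseteq> M" using C(1) U(2) by blast
  then obtain D where D: "C \<subseteq> D" "D \<subseteq> M" "local.independent D" "M \<subseteq> span D"
    using maximal_independent_subset_extend[OF _ C(3), of M] by metis
  obtain H where "finite H" "M \<subseteq> span H" using M(2) unfolding findim_def by blast
  then have finD: "finite D" using independent_span_bound[OF _ D(3), of H] D(2) by blast
  have spC: "span C = U" using C U(1) span_minimal by blast
  show thesis
  proof
    show "finite (D - C)" "D - C \<subseteq> M" using finD D(2) by auto
    fix x assume "x \<in> M"
    then have "x \<in> span ((D - C) \<union> C)" using D(1,4) by (auto simp: Un_absorb2)
    then obtain s y where sy: "x = s + y" "s \<in> span (D - C)" "y \<in> span C" unfolding span_Un by blast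
    then have "x - s \<in> U" using spC by simp
    then show "\<exists>s\<in>span (D - C). x - s \<in> U" using sy(2) by blast
  next
    fix c b assume c: "(\<Sum>b\<in>D - C. scale (c b) b) \<in> U" and b: "b \<in> D - C"
    obtain u where u: "(\<Sum>b\<in>D - C. scale (c b) b) = (\<Sum>b\<in>C. scale (u b) b)"
      using c unfolding spC[symmetric] span_finite[OF C(2)] by auto
    define w where "w b = (if b \<in> C then - u b else c b)" for b
    have "(\<Sum>b\<in>D. scale (w b) b) = (\<Sum>b\<in>D - C. scale (w b) b) + (\<Sum>b\<in>C. scale (w b) b)"
      using sum.subset_diff[OF D(1) finD] by blast
    also have "\<dots> = (\<Sum>b\<in>D - C. scale (c b) b) + (\<Sum>b\<in>C. - scale (u b) b)"
      by (intro arg_cong2[of _ _ _ _ "(+)"] sum.cong) (auto simp: w_def)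
    also have "\<dots> = 0" by (simp add: sum_negf u)
    finally have "w b = 0" using independentD[OF D(3) finD subset_refl, of w b] b by blast
    then show "c b = 0" using b by (simp add: w_def)
  next
    have "card D = dim M" using basis_card_eq_dim D by blast
    then show "card (D - C) + dim U = dim M"
      using cardC D(1) finD by (metis card_Diff_subset card_mono diff_add_inverse2 finite_subset le_add_diff_inverse2)
  qed
qed

text \<open>The degree-\<open>e\<close> part of mM, with m generated by the variables. In degree 0
  it must be zero; truncated subtraction would wrongly let \<open>M 0\<close> contribute
  there.\<close>

definition maximal_part ::
  "'v set \<Rightarrow> (nat \<Rightarrow> (nat \<Rightarrow> ('v, 'k::field) mpoly) set) \<Rightarrow> nat \<Rightarrow> (nat \<Rightarrow> ('v, 'k) mpoly) set" where
  "maximal_part V M e = {(\<lambda>k. \<Sum>v\<in>V. Poly_Mapping.single (Poly_Mapping.single v 1) 1 * h v k) |h.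
     \<forall>v\<in>V. if e = 0 then h v = 0 else h v \<in> M (e - 1)}"

lemma maximal_partI:
  assumes "f = (\<lambda>k. \<Sum>v\<in>V. Poly_Mapping.single (Poly_Mapping.single v 1) 1 * h v k)"
    and "\<And>v. v \<in> V \<Longrightarrow> if e = 0 then h v = 0 else h v \<in> M (e - 1)"
  shows "f \<in> maximal_part V M e"
  unfolding maximal_part_def using assms(2) by (intro CollectI exI[of _ h] conjI ballI assms(1)) auto

lemma maximal_part_subspace:
  assumes "graded_submodule V M"
  shows "module.subspace vsc (maximal_part V M e :: (nat \<Rightarrow> ('v, 'k::field) mpoly) set)"
proof -
  interpret vector_space "vsc :: 'k \<Rightarrow> (nat \<Rightarrow> ('v, 'k) mpoly) \<Rightarrow> _" by (rule vector_space_vsc)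
  have sub: "subspace (M e)" for e using assms by (simp add: graded_submodule_def)
  let ?x = "\<lambda>v. Poly_Mapping.single (Poly_Mapping.single v 1) 1 :: ('v, 'k) mpoly"
  let ?P = "\<lambda>h. \<forall>v\<in>V. if e = 0 then h v = 0 else h v \<in> M (e - 1)"
  have I: "f \<in> maximal_part V M e" if "f = (\<lambda>k. \<Sum>v\<in>V. ?x v * h v k)" "?P h" for f h
    using that(2) by (intro maximal_partI[OF that(1)]) blast
  show ?thesis
  proof (rule subspaceI)
    show "0 \<in> maximal_part V M e"
      by (rule I[of _ "\<lambda>_. 0"]) (simp_all add: fun_eq_iff subspace_0[OF sub])
  next
    fix f g assume "f \<in> maximal_part V M e" "g \<in> maximal_part V M e"
    then obtain h h' where h: "f = (\<lambda>k. \<Sum>v\<in>V. ?x v * h v k)" "?P h"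
      "g = (\<lambda>k. \<Sum>v\<in>V. ?x v * h' v k)" "?P h'" unfolding maximal_part_def by blast
    show "f + g \<in> maximal_part V M e"
      by (rule I[of _ "\<lambda>v. h v + h' v"])
        (use h subspace_add[OF sub] in \<open>auto simp: fun_eq_iff sum.distrib distrib_left\<close>)
  next
    fix c f assume "f \<in> maximal_part V M e"
    then obtain h where h: "f = (\<lambda>k. \<Sum>v\<in>V. ?x v * h v k)" "?P h" unfolding maximal_part_def by blast
    show "vsc c f \<in> maximal_part V M e"
      by (rule I[of _ "\<lambda>v. vsc c (h v)"])
        (use h subspace_scale[OF sub] in \<open>auto simp: fun_eq_iff fscale_apply psc_def sum_distrib_left mult.left_commute\<close>)
  qed
qed

lemma maximal_part_subset:
  assumes "graded_submodule V M"
  shows "maximal_part V M e \<subseteq> (M e :: (nat \<Rightarrow> ('v, 'k::field) mpoly) set)"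
proof
  interpret vector_space "vsc :: 'k \<Rightarrow> (nat \<Rightarrow> ('v, 'k) mpoly) \<Rightarrow> _" by (rule vector_space_vsc)
  have sub: "subspace (M e)" for e using assms by (simp add: graded_submodule_def)
  fix f assume "f \<in> maximal_part V M e"
  then obtain h where h: "f = (\<lambda>k. \<Sum>v\<in>V. Poly_Mapping.single (Poly_Mapping.single v 1) 1 * h v k)"
    "\<forall>v\<in>V. if e = 0 then h v = 0 else h v \<in> M (e - 1)" unfolding maximal_part_def by blast
  have "(\<lambda>k. Poly_Mapping.single (Poly_Mapping.single v 1) 1 * h v k) \<in> M e" if "v \<in> V" for v
  proof (cases "e = 0")
    case True
    then have "(\<lambda>k. Poly_Mapping.single (Poly_Mapping.single v 1) 1 * h v k) = 0"
      using h(2) that by (simp add: fun_eq_iff)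
    then show ?thesis using subspace_0[OF sub] by simp
  next
    case False
    then show ?thesis using h(2) that assms unfolding graded_submodule_def by (metis Suc_pred' neq0_conv)
  qed
  then have "(\<Sum>v\<in>V. (\<lambda>k. Poly_Mapping.single (Poly_Mapping.single v 1) 1 * h v k)) \<in> M e"
    by (rule subspace_sum[OF sub])
  moreover have "f = (\<Sum>v\<in>V. (\<lambda>k. Poly_Mapping.single (Poly_Mapping.single v 1) 1 * h v k))"
    by (simp add: h(1) fun_eq_iff sum_fun_apply)
  ultimately show "f \<in> M e" by (simp only:)
qed

lemma ksgn_empty [simp]: "ksgn \<iota> v {} = 1"
  by (simp add: ksgn_def)

text \<open>Degree-0 Koszul homology of M is M / mM. If it vanishes in degree \<open>e\<close>, the
  boundaries form a subspace of full dimension, so every element of \<open>M e\<close> is a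
  boundary, which is a combination of variables times elements of degree
  \<open>e - 1\<close>.\<close>

lemma maximal_part_eq_of_khdim:
  fixes M :: "nat \<Rightarrow> (nat \<Rightarrow> ('v, 'k::field) mpoly) set"
  assumes V: "finite V" and M: "graded_submodule V M" "\<And>e. vector_space.findim vsc (M e)"
    and 0: "khdim \<iota> V M 0 e = 0"
  shows "M e \<subseteq> maximal_part V M e"
proof
  interpret c: vector_space "csc :: 'k \<Rightarrow> ('v set \<Rightarrow> nat \<Rightarrow> ('v, 'k) mpoly) \<Rightarrow> _"
    by (rule vector_space_csc)
  interpret cc: vector_space_pair "csc :: 'k \<Rightarrow> ('v set \<Rightarrow> nat \<Rightarrow> ('v, 'k) mpoly) \<Rightarrow> _"
    "csc :: 'k \<Rightarrow> ('v set \<Rightarrow> nat \<Rightarrow> ('v, 'k) mpoly) \<Rightarrow> _" ..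
  fix x assume x: "x \<in> M e"
  have Z: "{g \<in> kchain V M 0 e. kdiff \<iota> V g = 0} = kchain V M 0 e"
    using kdiff_degree_0[OF V] by blast
  have "kdiff \<iota> V ` kchain V M (Suc 0) e = kchain V M 0 e"
  proof (rule c.findim_subspace_eqI)
    show "c.findim (kchain V M 0 e)" by (rule kchain_findim[OF V M])
    show "kdiff \<iota> V ` kchain V M (Suc 0) e \<subseteq> kchain V M 0 e" using kdiff_kchain[OF V M(1)] by blast
    show "c.subspace (kdiff \<iota> V ` kchain V M (Suc 0) e)"
      by (rule cc.linear_subspace_image[OF kdiff_linear kchain_subspace[OF M(1)]])
    show "c.dim (kchain V M 0 e) \<le> c.dim (kdiff \<iota> V ` kchain V M (Suc 0) e)"
      using 0 unfolding khdim_def Z by simp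
  qed
  moreover have "(\<lambda>S. if S = {} then x else 0) \<in> kchain V M 0 e"
  proof (rule kchainI)
    fix S assume "S \<subseteq> V" "card S = 0"
    then have "S = {}" using finite_subset[OF _ V] by auto
    then show "(if S = {} then x else 0) \<in> M (e - 0)" using x by simp
  qed auto
  ultimately obtain g where g: "g \<in> kchain V M (Suc 0) e" "(\<lambda>S. if S = {} then x else 0) = kdiff \<iota> V g"
    by blast
  have "x = kdiff \<iota> V g {}" using fun_cong[OF g(2), of "{}"] by simp
  then have "x = (\<lambda>k. \<Sum>v\<in>V. Poly_Mapping.single (Poly_Mapping.single v 1) 1 * g {v} k)"
    by (simp add: kdiff_def)
  moreover have "if e = 0 then g {v} = 0 else g {v} \<in> M (e - 1)" if "v \<in> V" for v
    using kchain_in[OF g(1), of "{v}"] kchain_zero[OF g(1), of "{v}"] that by auto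
  ultimately show "x \<in> maximal_part V M e" by (rule maximal_partI)
qed

lemma graded_submodule_mult_single:
  fixes M :: "nat \<Rightarrow> (nat \<Rightarrow> ('v, 'k::field) mpoly) set"
  assumes M: "graded_submodule V M" and g: "g \<in> M c" and m: "Poly_Mapping.keys m \<subseteq> V"
  shows "(\<lambda>k. Poly_Mapping.single m a * g k) \<in> M (mon_deg m + c)"
  using m
proof (induction "mon_deg m" arbitrary: m)
  case 0
  then have "m = 0" by (metis mon_deg_eq_0_iff)
  moreover have "vsc a g \<in> M c"
    using M g unfolding graded_submodule_def by (metis module.subspace_scale module_iff_vector_space vector_space_vsc)
  ultimately show ?case by (simp add: fscale_def psc_def)
next
  case (Suc n)
  then obtain v where v: "v \<in> Poly_Mapping.keys m" by (metis all_not_in_conv mon_deg_def nat.distinct(1) sum.empty)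
  define m' where "m' = m - Poly_Mapping.single v 1"
  have mm: "m = Poly_Mapping.single v 1 + m'" using single_add_diff[OF v] by (simp only: m'_def)
  have deg: "mon_deg m = Suc (mon_deg m')" by (subst mm) (simp add: mon_deg_add)
  have "Poly_Mapping.keys m' \<subseteq> Poly_Mapping.keys m" by (auto simp: m'_def in_keys_iff lookup_minus)
  then have "(\<lambda>k. Poly_Mapping.single m' a * g k) \<in> M (mon_deg m' + c)"
    using Suc deg by auto
  then have "(\<lambda>k. Poly_Mapping.single (Poly_Mapping.single v 1) 1 * (Poly_Mapping.single m' a * g k))
      \<in> M (Suc (mon_deg m' + c))"
    using M v Suc.prems unfolding graded_submodule_def by blast
  moreover have "Poly_Mapping.single (Poly_Mapping.single v 1) 1 * Poly_Mapping.single m' a = Poly_Mapping.single m a"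
    unfolding mult_single mm[symmetric] by simp
  ultimately show ?case by (simp add: deg mult.assoc[symmetric])
qed

lemma hpoly_mult_split:
  fixes p :: "('v, 'k::field) mpoly" and g :: "nat \<Rightarrow> ('v, 'k) mpoly"
  assumes N: "module.subspace vsc N" and p: "p \<in> hpoly V c e"
    and single: "\<And>m a. Poly_Mapping.keys m \<subseteq> V \<Longrightarrow> mon_deg m + c = e \<Longrightarrow>
      (\<lambda>k. Poly_Mapping.single m a * g k) \<in> N"
  shows "(\<lambda>k. p * g k) \<in> N"
proof -
  interpret vector_space "vsc :: 'k \<Rightarrow> (nat \<Rightarrow> ('v, 'k) mpoly) \<Rightarrow> _" by (rule vector_space_vsc)
  have "(\<lambda>k. p * g k) = (\<Sum>m\<in>Poly_Mapping.keys p. (\<lambda>k. Poly_Mapping.single m (Poly_Mapping.lookup p m) * g k))"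
    by (simp add: fun_eq_iff sum_fun_apply sum_distrib_right[symmetric] poly_mapping_sum_single)
  also have "\<dots> \<in> N" using p by (intro subspace_sum[OF N] single) (auto simp: hpoly_def)
  finally show ?thesis .
qed

lemma graded_submodule_mult:
  assumes "graded_submodule V M" "g \<in> M c" "p \<in> hpoly V c e"
  shows "(\<lambda>k. p * g k) \<in> M e"
  using assms(1) graded_submodule_mult_single[OF assms(1,2)]
  by (intro hpoly_mult_split[OF _ assms(3)]) (auto simp: graded_submodule_def)

text \<open>The condition c \<noteq> e gives every monomial of \<open>p\<close> positive degree, so
  a variable can be split off and the rest absorbed into the module element.\<close>

lemma maximal_part_mult:
  fixes M :: "nat \<Rightarrow> (nat \<Rightarrow> ('v, 'k::field) mpoly) set"
  assumes V: "finite V" and M: "graded_submodule V M" and g: "g \<in> M c" and p: "p \<in> hpoly V c e" and ce: "c \<noteq> e"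
  shows "(\<lambda>k. p * g k) \<in> maximal_part V M e"
proof (rule hpoly_mult_split[OF maximal_part_subspace[OF M] p])
  interpret vector_space "vsc :: 'k \<Rightarrow> (nat \<Rightarrow> ('v, 'k) mpoly) \<Rightarrow> _" by (rule vector_space_vsc)
  have sub: "subspace (M e)" for e using M by (simp add: graded_submodule_def)
  fix m :: "'v \<Rightarrow>\<^sub>0 nat" and a assume m: "Poly_Mapping.keys m \<subseteq> V" "mon_deg m + c = e"
  then have "mon_deg m \<noteq> 0" using ce by linarith
  then obtain v where v: "v \<in> Poly_Mapping.keys m" by (metis all_not_in_conv mon_deg_def sum.empty)
  define m' where "m' = m - Poly_Mapping.single v 1"
  have mm: "m = Poly_Mapping.single v 1 + m'" using single_add_diff[OF v] by (simp only: m'_def)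
  have deg: "mon_deg m = Suc (mon_deg m')" by (subst mm) (simp add: mon_deg_add)
  have "Poly_Mapping.keys m' \<subseteq> Poly_Mapping.keys m" by (auto simp: m'_def in_keys_iff lookup_minus)
  then have *: "(\<lambda>k. Poly_Mapping.single m' a * g k) \<in> M (mon_deg m' + c)"
    using m by (intro graded_submodule_mult_single[OF M g]) auto
  \<comment> \<open>The family is concentrated at the variable that was split off.\<close>
  define h where "h u = (if u = v then (\<lambda>k. Poly_Mapping.single m' a * g k) else 0)" for u
  have "(\<lambda>k. Poly_Mapping.single m a * g k) =
      (\<lambda>k. \<Sum>u\<in>V. Poly_Mapping.single (Poly_Mapping.single u 1) 1 * h u k)"
  proof
    fix k
    have "(\<Sum>u\<in>V. Poly_Mapping.single (Poly_Mapping.single u 1) 1 * h u k) =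
        (\<Sum>u\<in>V. if u = v then Poly_Mapping.single (Poly_Mapping.single v 1) 1 * (Poly_Mapping.single m' a * g k) else 0)"
      by (intro sum.cong) (auto simp: h_def)
    also have "\<dots> = Poly_Mapping.single (Poly_Mapping.single v 1) 1 * (Poly_Mapping.single m' a * g k)"
      using V v m(1) by auto
    also have "\<dots> = Poly_Mapping.single m a * g k"
      unfolding mult.assoc[symmetric] mult_single mm[symmetric] by simp
    finally show "Poly_Mapping.single m a * g k = (\<Sum>u\<in>V. Poly_Mapping.single (Poly_Mapping.single u 1) 1 * h u k)" ..
  qed
  moreover have "if e = 0 then h u = 0 else h u \<in> M (e - 1)" for u
    using * subspace_0[OF sub] deg m(2) by (auto simp: h_def)
  ultimately show "(\<lambda>k. Poly_Mapping.single m a * g k) \<in> maximal_part V M e"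
    by (rule maximal_partI)
qed

lemma graded_submoduleD:
  assumes "graded_submodule V M"
  shows "module.subspace vsc (M e)"
    and "v \<in> V \<Longrightarrow> f \<in> M e \<Longrightarrow> (\<lambda>k. Poly_Mapping.single (Poly_Mapping.single v 1) a * f k) \<in> M (Suc e)"
  using assms unfolding graded_submodule_def by blast+

lemma gens_map_unit:
  assumes "l < L" shows "gens_map L G (\<lambda>k. if k = l then 1 else 0) = G l"
proof
  fix k
  have "gens_map L G (\<lambda>k. if k = l then 1 else 0) k = (\<Sum>j<L. if j = l then G l k else 0)"
    unfolding gens_map_def by (intro sum.cong) auto
  then show "gens_map L G (\<lambda>k. if k = l then 1 else 0) k = G l k" using assms by simp
qed

text \<open>Graded Nakayama: lifts of bases of M / mM in each degree generate M, and no relation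
  among them has a constant coefficient. The hypothesis on degrees above \<open>N\<close> makes the
  number of lifts finite.\<close>

lemma minimal_generators:
  fixes M :: "nat \<Rightarrow> (nat \<Rightarrow> ('v, 'k::field) mpoly) set"
  assumes V: "finite V" and M: "graded_submodule V M" "\<And>e. vector_space.findim vsc (M e)"
    and 0: "\<And>e. e > N \<Longrightarrow> M e \<subseteq> maximal_part V M e"
  shows "\<exists>ds G. (\<forall>l<length ds. G l \<in> M (ds ! l)) \<and> (\<forall>e. gens_map (length ds) G ` free_part V ds e = M e) \<and>
    (\<forall>e. \<forall>f\<in>free_part V ds e. \<forall>k<length ds. gens_map (length ds) G f = 0 \<longrightarrow> Poly_Mapping.lookup (f k) 0 = 0)"
proof -
  interpret vector_space "vsc :: 'k \<Rightarrow> (nat \<Rightarrow> ('v, 'k) mpoly) \<Rightarrow> _" by (rule vector_space_vsc)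
  interpret vv: vector_space_pair "vsc :: 'k \<Rightarrow> (nat \<Rightarrow> ('v, 'k) mpoly) \<Rightarrow> _"
    "vsc :: 'k \<Rightarrow> (nat \<Rightarrow> ('v, 'k) mpoly) \<Rightarrow> _" ..
  have sub: "subspace (M e)" for e using M by (simp add: graded_submodule_def)
  define P where "P e B \<longleftrightarrow> finite B \<and> B \<subseteq> M e \<and> (\<forall>x\<in>M e. \<exists>s\<in>span B. x - s \<in> maximal_part V M e) \<and>
      (\<forall>c. (\<Sum>b\<in>B. vsc (c b) b) \<in> maximal_part V M e \<longrightarrow> (\<forall>b\<in>B. c b = 0))" for e B
  have "\<exists>B. P e B" for e
  proof -
    obtain B where B: "finite B" "B \<subseteq> M e" "\<And>x. x \<in> M e \<Longrightarrow> \<exists>s\<in>span B. x - s \<in> maximal_part V M e"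
      "\<And>c b. (\<Sum>b\<in>B. vsc (c b) b) \<in> maximal_part V M e \<Longrightarrow> b \<in> B \<Longrightarrow> c b = 0"
      by (rule basis_modulo[OF sub M(2) maximal_part_subspace[OF M(1)] maximal_part_subset[OF M(1)], of e])
        blast
    then show ?thesis unfolding P_def by (intro exI[of _ B] conjI ballI allI impI)
  qed
  then obtain B where P: "\<And>e. P e (B e)" by metis
  have B: "\<And>e. finite (B e)" "\<And>e. B e \<subseteq> M e"
    "\<And>e x. x \<in> M e \<Longrightarrow> \<exists>s\<in>span (B e). x - s \<in> maximal_part V M e"
    "\<And>e c b. (\<Sum>b\<in>B e. vsc (c b) b) \<in> maximal_part V M e \<Longrightarrow> b \<in> B e \<Longrightarrow> c b = 0"
    using P unfolding P_def by blast+
  \<comment> \<open>Above \<open>N\<close> a basis element would itself lie in the maximal part,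
    against its independence modulo that part.\<close>
  have B0: "B e = {}" if "e > N" for e
  proof (rule ccontr)
    assume "B e \<noteq> {}"
    then obtain b where b: "b \<in> B e" by blast
    have "(\<Sum>b'\<in>B e. vsc (if b' = b then 1 else 0) b') = (\<Sum>b'\<in>B e. if b' = b then b else 0)"
      by (intro sum.cong) auto
    also have "\<dots> = b" using b B(1) by simp
    also have "\<dots> \<in> maximal_part V M e" using b B(2) 0[OF that] by blast
    finally have "(if b = b then 1 else 0 :: 'k) = 0" by (rule B(4)[OF _ b])
    then show False by simp
  qed
  \<comment> \<open>Generators are listed together with their degrees, which become the shifts
    \<open>ds\<close>.\<close>
  have "\<exists>L. distinct L \<and> set L = (SIGMA e:{..N}. B e)"
    using finite_distinct_list[of "SIGMA e:{..N}. B e"] B(1) by blast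
  then obtain L where L: "distinct L" "set L = (SIGMA e:{..N}. B e)" by blast
  define ds where "ds = map fst L"
  define G where "G l = snd (L ! l)" for l
  have Ll: "L ! l = (ds ! l, G l)" if "l < length ds" for l
    using that by (simp add: ds_def G_def)
  have GB: "G l \<in> B (ds ! l)" if "l < length ds" for l
  proof -
    have "L ! l \<in> set L" using that by (simp add: ds_def)
    then show ?thesis using Ll[OF that] L(2) by auto
  qed
  have inj: "inj_on G {l. l < length ds \<and> ds ! l = e}" for e
  proof (rule inj_onI)
    fix l l' assume "l \<in> {l. l < length ds \<and> ds ! l = e}" "l' \<in> {l. l < length ds \<and> ds ! l = e}" "G l = G l'"
    then have "L ! l = L ! l'" "l < length L" "l' < length L" using Ll[of l] Ll[of l'] by (auto simp: ds_def)
    then show "l = l'" using L(1) by (simp add: nth_eq_iff_index_eq)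
  qed
  have img: "G ` {l. l < length ds \<and> ds ! l = e} = B e" for e
  proof
    show "G ` {l. l < length ds \<and> ds ! l = e} \<subseteq> B e" using GB by auto
    show "B e \<subseteq> G ` {l. l < length ds \<and> ds ! l = e}"
    proof
      fix b assume b: "b \<in> B e"
      then have "e \<le> N" using B0[of e] by force
      then have "(e, b) \<in> set L" using L(2) b by simp
      then obtain l where "l < length L" "L ! l = (e, b)" by (auto simp: in_set_conv_nth)
      then show "b \<in> G ` {l. l < length ds \<and> ds ! l = e}"
        by (intro image_eqI[of _ _ l]) (auto simp: ds_def G_def)
    qed
  qed
  let ?g = "gens_map (length ds) G"
  have GM: "G l \<in> M (ds ! l)" if "l < length ds" for l using GB[OF that] B(2) by blast
  have split: "?g f = (\<Sum>l<length ds. (\<lambda>k. f l * G l k))" for f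
    by (simp add: gens_map_def fun_eq_iff sum_fun_apply)
  have le: "?g f \<in> M e" if f: "f \<in> free_part V ds e" for f e
    unfolding split using f GM by (intro subspace_sum[OF sub] graded_submodule_mult[OF M(1)]) (auto simp: free_part_iff)
  have imsub: "subspace (?g ` free_part V ds e)" for e
    by (rule vv.linear_subspace_image[OF gens_map_linear graded_submoduleD(1)[OF free_part_submodule]])
  have Bim: "B e \<subseteq> ?g ` free_part V ds e" for e
  proof
    fix b assume "b \<in> B e"
    then obtain l where l: "l < length ds" "ds ! l = e" "b = G l" using img[of e] by blast
    have "(\<lambda>k. if k = l then 1 else 0) \<in> free_part V ds e"
      using l by (auto simp: free_part_iff hpoly_def)
    then show "b \<in> ?g ` free_part V ds e" using gens_map_unit[OF l(1), of G] l(3) by (metis image_eqI)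
  qed
  \<comment> \<open>Strong induction on the degree: modulo the span of \<open>B e\<close>, an
    element is a sum of variables times elements of degree \<open>e - 1\<close>, which are already
    reached.\<close>
  have ge: "M e \<subseteq> ?g ` free_part V ds e" for e
  proof (induction e rule: less_induct)
    case (less e)
    show ?case
    proof
      fix x assume "x \<in> M e"
      then obtain s where s: "s \<in> span (B e)" "x - s \<in> maximal_part V M e" using B(3) by blast
      have s_im: "s \<in> ?g ` free_part V ds e" using s(1) span_minimal[OF Bim imsub] by blast
      obtain h where h: "x - s = (\<lambda>k. \<Sum>v\<in>V. Poly_Mapping.single (Poly_Mapping.single v 1) 1 * h v k)"
        "\<forall>v\<in>V. if e = 0 then h v = 0 else h v \<in> M (e - 1)" using s(2) unfolding maximal_part_def by blast
      have "(\<lambda>k. Poly_Mapping.single (Poly_Mapping.single v 1) 1 * h v k) \<in> ?g ` free_part V ds e" if v: "v \<in> V" for v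
      proof (cases "e = 0")
        case True
        then have "(\<lambda>k. Poly_Mapping.single (Poly_Mapping.single v 1) 1 * h v k) = 0"
          using h(2) v by (simp add: fun_eq_iff)
        then show ?thesis using subspace_0[OF imsub] by simp
      next
        case False
        then have "h v \<in> ?g ` free_part V ds (e - 1)" using less[of "e - 1"] h(2) v by auto
        then obtain f where f: "f \<in> free_part V ds (e - 1)" "h v = ?g f" by blast
        have "(\<lambda>k. Poly_Mapping.single (Poly_Mapping.single v 1) 1 * f k) \<in> free_part V ds (Suc (e - 1))"
          by (rule graded_submoduleD(2)[OF free_part_submodule v f(1)])
        then show ?thesis using False by (simp add: f(2) gens_map_scale[symmetric])
      qed
      then have "(\<Sum>v\<in>V. (\<lambda>k. Poly_Mapping.single (Poly_Mapping.single v 1) 1 * h v k)) \<in> ?g ` free_part V ds e"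
        by (intro subspace_sum[OF imsub])
      moreover have "x - s = (\<Sum>v\<in>V. (\<lambda>k. Poly_Mapping.single (Poly_Mapping.single v 1) 1 * h v k))"
        unfolding h(1) by (simp add: fun_eq_iff sum_fun_apply)
      ultimately have "(x - s) + s \<in> ?g ` free_part V ds e"
        using s_im subspace_add[OF imsub] by simp
      then show "x \<in> ?g ` free_part V ds e" by simp
    qed
  qed
  have const: "Poly_Mapping.lookup (f l) 0 = 0"
    if f: "f \<in> free_part V ds e" "?g f = 0" and l: "l < length ds" for e f l
  proof (cases "ds ! l = e")
    case False
    then show ?thesis using f(1) l by (auto simp: free_part_iff hpoly_lookup)
  next
    case True
    let ?I = "{l. l < length ds \<and> ds ! l = e}"
    define c where "c b = Poly_Mapping.lookup (f (inv_into ?I G b)) 0" for b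
    have fl: "f j = Poly_Mapping.single 0 (Poly_Mapping.lookup (f j) 0)" if "j \<in> ?I" for j
      using that f(1) by (intro poly_mapping_eqI) (auto simp: free_part_iff hpoly_lookup lookup_single when_def)
    have "(\<Sum>b\<in>B e. vsc (c b) b) = (\<Sum>j\<in>?I. vsc (c (G j)) (G j))"
      unfolding img[symmetric] by (simp add: sum.reindex[OF inj])
    also have "\<dots> = (\<Sum>j\<in>?I. (\<lambda>k. f j * G j k))"
    proof (rule sum.cong[OF refl])
      fix j assume j: "j \<in> ?I"
      have "c (G j) = Poly_Mapping.lookup (f j) 0" unfolding c_def inv_into_f_f[OF inj j] ..
      then show "vsc (c (G j)) (G j) = (\<lambda>k. f j * G j k)"
        by (subst fl[OF j]) (simp add: fscale_def psc_def)
    qed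
    \<comment> \<open>The whole sum is the given relation, hence 0. The terms outside
      \<open>?I\<close> have coefficients of positive degree or zero, so they lie in the maximal
      part, and then so does the combination of the basis \<open>B e\<close>.\<close>
    also have "\<dots> = (\<Sum>j<length ds. (\<lambda>k. f j * G j k)) - (\<Sum>j\<in>{..<length ds} - ?I. (\<lambda>k. f j * G j k))"
    proof -
      have "?I \<subseteq> {..<length ds}" by auto
      then show ?thesis by (simp add: sum.subset_diff[of ?I "{..<length ds}"])
    qed
    also have "\<dots> \<in> maximal_part V M e"
      unfolding split[symmetric] f(2)
      using f(1) GM by (intro subspace_diff[OF maximal_part_subspace[OF M(1)]] subspace_sum[OF maximal_part_subspace[OF M(1)]]
          maximal_part_mult[OF V M(1)] subspace_0[OF maximal_part_subspace[OF M(1)]]) (auto simp: free_part_iff)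
    finally have "c (G l) = 0" by (rule B(4)) (use GB[OF l] True in simp)
    moreover have "l \<in> ?I" using l True by simp
    ultimately show ?thesis unfolding c_def inv_into_f_f[OF inj \<open>l \<in> ?I\<close>] by simp
  qed
  have "?g ` free_part V ds e = M e" for e using le ge by blast
  then show ?thesis using GM const by (intro exI[of _ ds] exI[of _ G] conjI allI ballI impI)
qed

lemma kernel_graded_submodule:
  "graded_submodule V (\<lambda>e. {f \<in> free_part V ds e. gens_map L G f = (0 :: nat \<Rightarrow> ('v, 'k::field) mpoly)})"
proof -
  interpret vector_space "vsc :: 'k \<Rightarrow> (nat \<Rightarrow> ('v, 'k) mpoly) \<Rightarrow> _" by (rule vector_space_vsc)
  interpret vv: vector_space_pair "vsc :: 'k \<Rightarrow> (nat \<Rightarrow> ('v, 'k) mpoly) \<Rightarrow> _"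
    "vsc :: 'k \<Rightarrow> (nat \<Rightarrow> ('v, 'k) mpoly) \<Rightarrow> _" ..
  show ?thesis unfolding graded_submodule_def
  proof (intro conjI allI impI)
    fix e
    have "subspace {f \<in> free_part V ds e. gens_map L G f \<in> {0}}"
      by (rule vv.subspace_kernel_on[OF gens_map_linear graded_submoduleD(1)[OF free_part_submodule] subspace_single_0])
    then show "subspace {f \<in> free_part V ds e. gens_map L G f = 0}" by simp
  next
    fix e v a f assume vf: "v \<in> V" "f \<in> {f \<in> free_part V ds e. gens_map L G f = 0}"
    let ?h = "\<lambda>k. Poly_Mapping.single (Poly_Mapping.single v 1) a * f k"
    have "?h \<in> free_part V ds (Suc e)"
      using vf by (intro graded_submoduleD(2)[OF free_part_submodule]) auto
    moreover have "gens_map L G ?h = 0"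
      using vf by (simp add: gens_map_scale fun_eq_iff)
    ultimately show "?h \<in> {f \<in> free_part V ds (Suc e). gens_map L G f = 0}" by blast
  qed
qed

text \<open>One stage of the construction. Vanishing of Koszul homology above \<open>N\<close> gives
  finitely many generators now and, by \<open>module_step\<close>, passes to the new kernel with the
  same bound.\<close>

lemma resolution_extend:
  fixes M :: "nat \<Rightarrow> (nat \<Rightarrow> ('v, 'k::field) mpoly) set"
  assumes V: "finite V" "inj_on \<iota> V"
    and M: "graded_submodule V M" "\<forall>e. M e \<subseteq> free_part V rs e"
    and const: "\<forall>e. \<forall>f\<in>M e. \<forall>k<length rs. Poly_Mapping.lookup (f k) 0 = 0"
    and van: "\<forall>j d. d > N \<longrightarrow> khdim \<iota> V M j d = 0"
  shows "\<exists>cs G. homogeneous_gens V cs rs G \<and> (\<forall>e. gens_map (length cs) G ` free_part V cs e = M e) \<and>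
    (\<forall>l<length cs. \<forall>k<length rs. Poly_Mapping.lookup (G l k) 0 = 0) \<and>
    (\<forall>e. \<forall>f\<in>free_part V cs e. \<forall>k<length cs. gens_map (length cs) G f = 0 \<longrightarrow> Poly_Mapping.lookup (f k) 0 = 0) \<and>
    (\<forall>j d. d > N \<longrightarrow> khdim \<iota> V (\<lambda>e. {f \<in> free_part V cs e. gens_map (length cs) G f = 0}) j d = 0)"
proof -
  interpret vector_space "vsc :: 'k \<Rightarrow> (nat \<Rightarrow> ('v, 'k) mpoly) \<Rightarrow> _" by (rule vector_space_vsc)
  have fd: "local.findim (M e)" for e by (rule findim_subset[OF free_part_findim[OF V(1)] M(2)[rule_format]])
  have mp: "M e \<subseteq> maximal_part V M e" if "e > N" for e
    by (rule maximal_part_eq_of_khdim[OF V(1) M(1) fd]) (use van that in blast)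
  obtain cs G where G: "\<forall>l<length cs. G l \<in> M (cs ! l)"
    "\<forall>e. gens_map (length cs) G ` free_part V cs e = M e"
    "\<forall>e. \<forall>f\<in>free_part V cs e. \<forall>k<length cs. gens_map (length cs) G f = 0 \<longrightarrow> Poly_Mapping.lookup (f k) 0 = 0"
    using minimal_generators[OF V(1) M(1) fd mp] by blast
  have "khdim \<iota> V (\<lambda>e. {f \<in> free_part V cs e. gens_map (length cs) G f = 0}) j d = 0" if "d > N" for j d
  proof -
    have "khdim \<iota> V (\<lambda>e. {f \<in> free_part V cs e. gens_map (length cs) G f = 0}) j d = khdim \<iota> V M (Suc j) d"
      by (rule module_step(1)[OF V G(2)[rule_format] refl, symmetric]) (use G(3) in blast)
    then show ?thesis using van that by simp
  qed
  moreover have "homogeneous_gens V cs rs G" unfolding homogeneous_gens_def using G(1) M(2) by blast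
  moreover have "\<forall>l<length cs. \<forall>k<length rs. Poly_Mapping.lookup (G l k) 0 = 0"
    using const G(1) by blast
  ultimately show ?thesis using G(2,3) by blast
qed

text \<open>The resolution is grown by dependent choice from pairs of a shift list and the kernel
  still to be covered; \<open>good\<close> is the invariant of such pairs and \<open>link\<close>
  the relation between consecutive ones.\<close>

theorem graded_resolution_exists:
  assumes V: "finite V" "inj_on \<iota> V" and E: "{} \<notin> E"
    and van: "\<And>j d. d > N \<Longrightarrow> qhdim TYPE('k::field) \<iota> V E j d = 0"
  shows "\<exists>F (e0 :: nat \<Rightarrow> ('v, 'k) mpoly) G.
    homogeneous_gens V (F 0) [0] (\<lambda>l k. if k = 0 then e0 l else 0) \<and>
    (\<forall>i. homogeneous_gens V (F (Suc i)) (F i) (G i)) \<and> graded_resolution V E F e0 G"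
proof -
  interpret vector_space "vsc :: 'k \<Rightarrow> (nat \<Rightarrow> ('v, 'k) mpoly) \<Rightarrow> _" by (rule vector_space_vsc)
  define good where "good ds M \<longleftrightarrow> graded_submodule V M \<and> (\<forall>e. M e \<subseteq> free_part V ds e) \<and>
    (\<forall>e f k. f \<in> M e \<longrightarrow> k < length ds \<longrightarrow> Poly_Mapping.lookup (f k) 0 = 0) \<and>
    (\<forall>j d. d > N \<longrightarrow> khdim \<iota> V M j d = 0)"
    for ds :: "nat list" and M :: "nat \<Rightarrow> (nat \<Rightarrow> ('v, 'k) mpoly) set"
  define link where "link rs M cs M' G \<longleftrightarrow> homogeneous_gens V cs rs G \<and>
    (\<forall>e. gens_map (length cs) G ` free_part V cs e = M e) \<and>
    M' = (\<lambda>e. {f \<in> free_part V cs e. gens_map (length cs) G f = 0}) \<and>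
    (\<forall>l<length cs. \<forall>k<length rs. Poly_Mapping.lookup (G l k) 0 = 0)"
    for rs cs :: "nat list" and M M' :: "nat \<Rightarrow> (nat \<Rightarrow> ('v, 'k) mpoly) set" and G
  have step: "\<exists>y. good (fst y) (snd y) \<and> (\<exists>G. link (fst x) (snd x) (fst y) (snd y) G)"
    if x: "good (fst x) (snd x)" for x
  proof -
    have g: "graded_submodule V (snd x)" "\<forall>e. snd x e \<subseteq> free_part V (fst x) e"
      "\<forall>e. \<forall>f\<in>snd x e. \<forall>k<length (fst x). Poly_Mapping.lookup (f k) 0 = 0"
      "\<forall>j d. d > N \<longrightarrow> khdim \<iota> V (snd x) j d = 0"
      using x unfolding good_def by blast+
    obtain cs G where cs: "homogeneous_gens V cs (fst x) G"
      "\<forall>e. gens_map (length cs) G ` free_part V cs e = snd x e"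
      "\<forall>l<length cs. \<forall>k<length (fst x). Poly_Mapping.lookup (G l k) 0 = 0"
      "\<forall>e. \<forall>f\<in>free_part V cs e. \<forall>k<length cs. gens_map (length cs) G f = 0 \<longrightarrow> Poly_Mapping.lookup (f k) 0 = 0"
      "\<forall>j d. d > N \<longrightarrow> khdim \<iota> V (\<lambda>e. {f \<in> free_part V cs e. gens_map (length cs) G f = 0}) j d = 0"
      using resolution_extend[OF V g] by blast
    let ?M = "\<lambda>e. {f \<in> free_part V cs e. gens_map (length cs) G f = 0}"
    have "good cs ?M"
      unfolding good_def using cs(4,5) kernel_graded_submodule by blast
    moreover have "link (fst x) (snd x) cs ?M G"
      unfolding link_def using cs(1-3) by blast
    ultimately show ?thesis by (intro exI[of _ "(cs, ?M)"]) auto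
  qed
  \<comment> \<open>The start is F_0 = R with the identity as lift of the augmentation, so the first
    kernel is the ideal itself.\<close>
  let ?e0 = "\<lambda>l::nat. 1 :: ('v, 'k) mpoly"
  define \<phi> :: "(nat \<Rightarrow> ('v, 'k) mpoly) \<Rightarrow> ('v, 'k) mpoly" where "\<phi> f = gens_map (length [0::nat]) (\<lambda>l k. ?e0 l) f 0" for f
  have \<phi>: "\<phi> f = f 0" for f by (simp add: \<phi>_def gens_map_def)
  define M0 where "M0 e = {f \<in> free_part V [0] e. \<phi> f \<in> mono_ideal V E}" for e
  \<comment> \<open>As the empty set is not in \<open>E\<close>, the ideal does not contain 1; this
    is minimality at the first stage.\<close>
  have const0: "Poly_Mapping.lookup (f k) 0 = 0" if "f \<in> M0 e" "k < length [0::nat]" for f k e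
  proof -
    have "\<not> nonface E (Poly_Mapping.keys (0 :: 'v \<Rightarrow>\<^sub>0 nat))" using E by (auto simp: nonface_def)
    then have "Poly_Mapping.lookup (f 0) 0 = 0" using that(1) unfolding M0_def \<phi> mono_ideal_lookup by blast
    then show ?thesis using that(2) by simp
  qed
  have "good [0] M0"
    unfolding good_def
  proof (intro conjI allI impI)
    show "graded_submodule V M0"
      unfolding graded_submodule_def
    proof (intro conjI allI impI)
      show "subspace (M0 e)" for e
      proof -
        have "subspace (free_part V [0] e)" by (rule graded_submoduleD(1)[OF free_part_submodule])
        then show ?thesis unfolding M0_def \<phi> subspace_def mono_ideal_lookup
          by (auto simp: lookup_add fscale_apply psc_def)
      qed
    next
      fix e v a f assume vf: "v \<in> V" "f \<in> M0 e"
      let ?h = "\<lambda>k. Poly_Mapping.single (Poly_Mapping.single v 1) a * f k"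
      have hf: "?h \<in> free_part V [0] (Suc e)" using vf by (intro graded_submoduleD(2)[OF free_part_submodule]) (auto simp: M0_def)
      have "?h 0 \<in> mono_ideal V E"
        unfolding mono_ideal_lookup
      proof (intro allI impI)
        fix m :: "'v \<Rightarrow>\<^sub>0 nat"
        assume m: "\<not> (Poly_Mapping.keys m \<subseteq> V \<and> nonface E (Poly_Mapping.keys m))"
        let ?n = "m - Poly_Mapping.single v 1"
        have "Poly_Mapping.lookup (f 0) ?n = 0" if v: "v \<in> Poly_Mapping.keys m"
        proof -
          have "Poly_Mapping.keys m \<subseteq> insert v (Poly_Mapping.keys ?n)" "Poly_Mapping.keys ?n \<subseteq> Poly_Mapping.keys m"
            by (auto simp: in_keys_iff lookup_minus lookup_single when_def split: if_splits)
          then have "\<not> (Poly_Mapping.keys ?n \<subseteq> V \<and> nonface E (Poly_Mapping.keys ?n))"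
            using m vf(1) nonface_mono by blast
          then show ?thesis using vf(2) unfolding M0_def \<phi> mono_ideal_lookup by blast
        qed
        then show "Poly_Mapping.lookup (?h 0) m = 0" unfolding lookup_single_var_mult by simp
      qed
      then show "?h \<in> M0 (Suc e)" using hf unfolding M0_def \<phi> by blast
    qed
    show "M0 e \<subseteq> free_part V [0] e" for e by (auto simp: M0_def)
    show "Poly_Mapping.lookup (f k) 0 = 0" if "f \<in> M0 e" "k < length [0::nat]" for e f k
      using const0[OF that] .
    fix j d assume d: "d > N"
    have "qhdim TYPE('k) \<iota> V E (Suc j) d = khdim \<iota> V M0 j d"
    proof (rule quotient_step(1)[OF V, where ds = "[0]" and ?e0.0 = ?e0, folded \<phi>_def])
      show "\<phi> f \<in> hpoly V 0 e" if "f \<in> free_part V [0] e" for e f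
        using that by (simp add: \<phi> free_part_iff)
      show "\<exists>f\<in>free_part V [0] e. p - \<phi> f \<in> mono_ideal V E" if "p \<in> hpoly V 0 e" for e p
        using that by (intro bexI[of _ "\<lambda>k. if k = 0 then p else 0"]) (auto simp: \<phi> free_part_iff mono_ideal_def)
    qed (use const0 in \<open>auto simp: M0_def\<close>)
    then show "khdim \<iota> V M0 j d = 0" using van[OF d] by simp
  qed
  then have "\<exists>x. good (fst x) (snd x) \<and> x = ([0], M0)" by auto
  then obtain f where f: "\<And>n. good (fst (f n)) (snd (f n)) \<and> (n = 0 \<longrightarrow> f n = ([0], M0))"
    "\<And>n. \<exists>G. link (fst (f n)) (snd (f n)) (fst (f (Suc n))) (snd (f (Suc n))) G"
    using dependent_nat_choice[of "\<lambda>n x. good (fst x) (snd x) \<and> (n = 0 \<longrightarrow> x = ([0], M0))"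
        "\<lambda>n x y. \<exists>G. link (fst x) (snd x) (fst y) (snd y) G"] step by (metis (no_types, lifting) nat.distinct(1))
  define F where "F n = fst (f n)" for n
  define M where "M n = snd (f n)" for n
  obtain G where G: "\<And>n. link (F n) (M n) (F (Suc n)) (M (Suc n)) (G n)"
    using f(2) unfolding F_def M_def by metis
  have F0: "F 0 = [0]" and M00: "M 0 = M0" using f(1)[of 0] by (auto simp: F_def M_def)
  have hom0: "homogeneous_gens V (F 0) [0] (\<lambda>l k. if k = 0 then ?e0 l else 0)"
    by (auto simp: F0 homogeneous_gens_def free_part_iff hpoly_def)
  have hom: "homogeneous_gens V (F (Suc i)) (F i) (G i)" for i using G unfolding link_def by blast
  have syz: "syzygies V E F ?e0 G i e = M i e" for i e
  proof (cases i)
    case 0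
    then show ?thesis by (simp add: F0 M00 M0_def \<phi>_def)
  next
    case (Suc n)
    then show ?thesis using G[of n] by (simp add: link_def)
  qed
  have "graded_resolution V E F ?e0 G"
    unfolding graded_resolution_def syz
  proof (intro conjI allI ballI impI)
    show "gens_map (length (F 0)) (\<lambda>l k. ?e0 l) f 0 \<in> hpoly V 0 e" if "f \<in> free_part V (F 0) e" for e f
      using that unfolding F0 \<phi>_def[symmetric] by (simp add: \<phi> free_part_iff)
    show "\<exists>f\<in>free_part V (F 0) e. p - gens_map (length (F 0)) (\<lambda>l k. ?e0 l) f 0 \<in> mono_ideal V E"
      if "p \<in> hpoly V 0 e" for e p
      using that unfolding F0 \<phi>_def[symmetric]
      by (intro bexI[of _ "\<lambda>k. if k = 0 then p else 0"]) (auto simp: \<phi> free_part_iff mono_ideal_def)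
    show "gens_map (length (F (Suc i))) (G i) ` free_part V (F (Suc i)) e = M i e" for i e
      using G[of i] unfolding link_def by blast
    show "Poly_Mapping.lookup (G i l k) 0 = 0" if "l < length (F (Suc i))" "k < length (F i)" for i l k
      using G[of i] that unfolding link_def by blast
  qed
  then show ?thesis using hom0 hom by (intro exI[of _ F] exI[of _ ?e0] exI[of _ G] conjI allI)
qed

lemma graded_hom_matD:
  fixes A :: "('v, 'k::field) mpoly mat"
  assumes A: "graded_hom V cs rs A"
  defines "G \<equiv> \<lambda>l k. if k < length rs \<and> l < length cs then A $$ (k, l) else 0"
  shows "homogeneous_gens V cs rs G" "A = mat (length rs) (length cs) (\<lambda>(k, l). G l k)"
  using A unfolding graded_hom_def homogeneous_gens_def free_part_iff G_def hpoly_def poly_ring_def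
  by (auto intro!: eq_matI)

text \<open>Both halves of the definite description are discharged:
  \<open>count_graded_resolution\<close> makes the count independent of the resolution, and
  \<open>graded_resolution_exists\<close> supplies one.\<close>

theorem graded_betti_eq_qhdim:
  fixes V :: "'v set"
  assumes V: "finite V" "inj_on \<iota> V" and E: "{} \<notin> E"
    and van: "\<And>j d. d > N \<Longrightarrow> qhdim TYPE('k::field) \<iota> V E j d = 0"
  shows "int (graded_betti V (mono_ideal V E :: ('v, 'k::field) mpoly set) i d) = qhdim TYPE('k) \<iota> V E i d"
proof -
  let ?min = "minimal_graded_free_resolution V (mono_ideal V E :: ('v, 'k) mpoly set)"
  have unique: "int (count_list (F i) d) = qhdim TYPE('k) \<iota> V E i d" if res: "?min F \<epsilon> D" for F \<epsilon> D
  proof -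
    define e0 where "e0 l = (if l < length (F 0) then \<epsilon> $$ (0, l) else 0)" for l
    define G where "G i l k = (if k < length (F i) \<and> l < length (F (Suc i)) then D i $$ (k, l) else 0)" for i l k
    have gh: "graded_hom V (F 0) [0] \<epsilon>" "\<And>i. graded_hom V (F (Suc i)) (F i) (D i)"
      using res unfolding minimal_graded_free_resolution_def by blast+
    have e0': "(\<lambda>l k. if k < length [0::nat] \<and> l < length (F 0) then \<epsilon> $$ (k, l) else 0) =
        (\<lambda>l k. if k = 0 then e0 l else 0)"
      by (auto simp: fun_eq_iff e0_def)
    note h0 = graded_hom_matD(1)[OF gh(1), unfolded e0']
    note hi = graded_hom_matD[OF gh(2), folded G_def]
    have "\<epsilon> = mat (length [0::nat]) (length (F 0)) (\<lambda>(k, l). if k = 0 then e0 l else 0)"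
      using gh(1) by (auto simp: graded_hom_def e0_def intro!: eq_matI)
    moreover have "D = (\<lambda>i. mat (length (F i)) (length (F (Suc i))) (\<lambda>(k, l). G i l k))"
      by (rule ext) (rule hi(2))
    ultimately have "?min F \<epsilon> D = ?min F (mat (length [0::nat]) (length (F 0)) (\<lambda>(k, l). if k = 0 then e0 l else 0))
        (\<lambda>i. mat (length (F i)) (length (F (Suc i))) (\<lambda>(k, l). G i l k))"
      by (rule arg_cong2[where f = "?min F"])
    then have "?min F (mat (length [0::nat]) (length (F 0)) (\<lambda>(k, l). if k = 0 then e0 l else 0))
        (\<lambda>i. mat (length (F i)) (length (F (Suc i))) (\<lambda>(k, l). G i l k))"
      using res by (rule iffD1)
    then have "graded_resolution V E F e0 G"
      using minimal_iff_graded_resolution[where F = F and G = G, OF h0 hi(1), of E] by simp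
    then show ?thesis by (rule count_graded_resolution[OF V])
  qed
  obtain F and e0 :: "nat \<Rightarrow> ('v, 'k) mpoly" and G where
    "homogeneous_gens V (F 0) [0] (\<lambda>l k. if k = 0 then e0 l else 0)"
    "\<forall>i. homogeneous_gens V (F (Suc i)) (F i) (G i)" "graded_resolution V E F e0 G"
    using graded_resolution_exists[OF V E van] by blast
  then have ex: "?min F (mat (length [0::nat]) (length (F 0)) (\<lambda>(k, l). if k = 0 then e0 l else 0))
        (\<lambda>i. mat (length (F i)) (length (F (Suc i))) (\<lambda>(k, l). G i l k))"
    using minimal_iff_graded_resolution[of V F e0 G E] by blast
  have "graded_betti V (mono_ideal V E :: ('v, 'k) mpoly set) i d = count_list (F i) d"
    unfolding graded_betti_def
  proof (rule the_equality)
    show "\<exists>F' \<epsilon> D. ?min F' \<epsilon> D \<and> count_list (F i) d = count_list (F' i) d" using ex by blast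
    fix m assume "\<exists>F' \<epsilon> D. ?min F' \<epsilon> D \<and> m = count_list (F' i) d"
    then obtain F' \<epsilon> D where "?min F' \<epsilon> D" "m = count_list (F' i) d" by blast
    then show "m = count_list (F i) d" using unique[of F' \<epsilon> D] unique[OF ex] by simp
  qed
  then show ?thesis using unique[OF ex] by simp
qed

section \<open>Hochster's formula\<close>

definition fhdim :: "'k::field itself \<Rightarrow> ('v \<Rightarrow> nat) \<Rightarrow> 'v set \<Rightarrow> ('v set \<Rightarrow> bool) \<Rightarrow> nat \<Rightarrow> int" where
  "fhdim K \<iota> W P j =
     int (vector_space.dim fsc {f \<in> fchain W P j :: ('v set \<Rightarrow> 'k) set. fdiff \<iota> W P f = 0})
     - int (vector_space.dim fsc (fdiff \<iota> W P ` (fchain W P (Suc j) :: ('v set \<Rightarrow> 'k) set)))"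

lemma fhdim_exact:
  fixes W :: "'v set"
  assumes "finite W" "inj_on \<iota> W" "w \<in> W"
    and P: "\<And>S. S \<subseteq> W \<Longrightarrow> w \<in> S \<Longrightarrow> P S \<longleftrightarrow> P (S - {w})"
    and up: "\<And>S v. P S \<Longrightarrow> v \<in> W \<Longrightarrow> S \<subseteq> W \<Longrightarrow> P (insert v S)"
  shows "fhdim TYPE('k::field) \<iota> W P j = 0"
proof -
  have "{f \<in> fchain W P j :: ('v set \<Rightarrow> 'k) set. fdiff \<iota> W P f = 0} = fdiff \<iota> W P ` fchain W P (Suc j)"
  proof
    show "{f \<in> fchain W P j. fdiff \<iota> W P f = 0} \<subseteq> fdiff \<iota> W P ` (fchain W P (Suc j) :: ('v set \<Rightarrow> 'k) set)"
    proof clarify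
      fix f :: "'v set \<Rightarrow> 'k" assume "f \<in> fchain W P j" "fdiff \<iota> W P f = 0"
      then show "f \<in> fdiff \<iota> W P ` fchain W P (Suc j)" using P by (intro fdiff_exact[OF assms(1-3)]) auto
    qed
    show "fdiff \<iota> W P ` (fchain W P (Suc j) :: ('v set \<Rightarrow> 'k) set) \<subseteq> {f \<in> fchain W P j. fdiff \<iota> W P f = 0}"
    proof clarify
      fix f :: "'v set \<Rightarrow> 'k" assume f: "f \<in> fchain W P (Suc j)"
      then show "fdiff \<iota> W P f \<in> fchain W P j \<and> fdiff \<iota> W P (fdiff \<iota> W P f) = 0"
        using fdiff_fchain[OF assms(1) f] fdiff_fdiff[where P = P, OF assms(1,2) f] up by blast
    qed
  qed
  then show ?thesis by (simp add: fhdim_def)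
qed

lemma fhdim_cong:
  assumes "\<And>S. S \<subseteq> W \<Longrightarrow> P S = Q S"
  shows "fhdim K \<iota> W P j = fhdim K \<iota> W Q j"
proof -
  have "fchain W P = (fchain W Q :: nat \<Rightarrow> ('a set \<Rightarrow> 'b) set)"
    unfolding fchain_def using assms by (intro ext) metis
  moreover have "fdiff \<iota> W P = (fdiff \<iota> W Q :: ('a set \<Rightarrow> 'b) \<Rightarrow> _)"
    unfolding fdiff_def using assms by (intro ext) auto
  ultimately show ?thesis by (simp add: fhdim_def)
qed

text \<open>The differential preserves the multidegree, so cycles and boundaries are products over
  the finitely many multidegrees of total degree \<open>d\<close>.\<close>

lemma qhdim_sum_fhdim:
  assumes V: "finite V"
  shows "qhdim TYPE('k::field) \<iota> V E j d =
    (\<Sum>\<alpha> | Poly_Mapping.keys \<alpha> \<subseteq> V \<and> mon_deg \<alpha> = d. fhdim TYPE('k) \<iota> (Poly_Mapping.keys \<alpha>) (face_at E \<alpha>) j)"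
proof -
  let ?A = "{\<alpha>. Poly_Mapping.keys \<alpha> \<subseteq> V \<and> mon_deg \<alpha> = d}"
  interpret f: vector_space "fsc :: 'k \<Rightarrow> ('a set \<Rightarrow> 'k) \<Rightarrow> _" by (rule vector_space_fsc)
  interpret ff: vector_space_pair "fsc :: 'k \<Rightarrow> ('a set \<Rightarrow> 'k) \<Rightarrow> _" "fsc :: 'k \<Rightarrow> ('a set \<Rightarrow> 'k) \<Rightarrow> _" ..
  have finA: "finite ?A" using finite_monomials[OF V, of 0 d] by simp
  let ?C = "\<lambda>\<alpha> j. fchain (Poly_Mapping.keys \<alpha>) (face_at E \<alpha>) j :: ('a set \<Rightarrow> 'k) set"
  let ?d = "\<lambda>\<alpha>. fdiff \<iota> (Poly_Mapping.keys \<alpha>) (face_at E \<alpha>) :: ('a set \<Rightarrow> 'k) \<Rightarrow> _"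
  let ?Z = "\<lambda>\<alpha>. {f \<in> ?C \<alpha> j. ?d \<alpha> f = 0}"
  let ?B = "\<lambda>\<alpha>. ?d \<alpha> ` ?C \<alpha> (Suc j)"
  have d0: "?d \<alpha> 0 = 0" for \<alpha> by (simp add: fdiff_def fun_eq_iff)
  have Z: "{q \<in> qchain V E j d. qdiff \<iota> E q = 0} = fun_prod ?A ?Z"
  proof (rule Set.set_eqI)
    fix q :: "('a \<Rightarrow>\<^sub>0 nat) \<Rightarrow> 'a set \<Rightarrow> 'k"
    have "qdiff \<iota> E q = 0 \<longleftrightarrow> (\<forall>\<alpha>. ?d \<alpha> (q \<alpha>) = 0)" by (auto simp: qdiff_def fun_eq_iff)
    moreover have "(\<forall>\<alpha>. ?d \<alpha> (q \<alpha>) = 0) \<longleftrightarrow> (\<forall>\<alpha>\<in>?A. ?d \<alpha> (q \<alpha>) = 0)"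
      if "\<And>\<alpha>. \<alpha> \<notin> ?A \<Longrightarrow> q \<alpha> = 0" using that d0 by metis
    ultimately show "q \<in> {q \<in> qchain V E j d. qdiff \<iota> E q = 0} \<longleftrightarrow> q \<in> fun_prod ?A ?Z"
      unfolding qchain_def fun_prod_def by auto
  qed
  have B: "qdiff \<iota> E ` qchain V E (Suc j) d = fun_prod ?A ?B"
  proof
    show "qdiff \<iota> E ` qchain V E (Suc j) d \<subseteq> fun_prod ?A ?B"
    proof clarify
      fix x :: "('a \<Rightarrow>\<^sub>0 nat) \<Rightarrow> 'a set \<Rightarrow> 'k" assume x: "x \<in> qchain V E (Suc j) d"
      show "qdiff \<iota> E x \<in> fun_prod ?A ?B"
        unfolding fun_prod_def
      proof (intro CollectI allI)
        fix \<alpha>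
        show "if \<alpha> \<in> ?A then qdiff \<iota> E x \<alpha> \<in> ?B \<alpha> else qdiff \<iota> E x \<alpha> = 0"
        proof (cases "\<alpha> \<in> ?A")
          case True
          then have "x \<alpha> \<in> ?C \<alpha> (Suc j)" using x by (simp add: qchain_def fun_prod_def)
          then show ?thesis using True by (simp add: qdiff_def)
        next
          case False
          then have "x \<alpha> = 0" using x by (simp add: qchain_def fun_prod_def)
          then show ?thesis using False d0 by (simp only: qdiff_def if_False)
        qed
      qed
    qed
    show "fun_prod ?A ?B \<subseteq> qdiff \<iota> E ` qchain V E (Suc j) d"
    proof
      fix q assume q: "q \<in> fun_prod ?A ?B"
      define R where "R \<alpha> x \<longleftrightarrow> (if \<alpha> \<in> ?A then x \<in> ?C \<alpha> (Suc j) else x = 0) \<and> q \<alpha> = ?d \<alpha> x" for \<alpha> x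
      have "\<exists>x. R \<alpha> x" for \<alpha>
      proof (cases "\<alpha> \<in> ?A")
        case True
        then have "q \<alpha> \<in> ?B \<alpha>" using q by (simp add: fun_prod_def)
        then show ?thesis using True by (auto simp: R_def)
      next
        case False
        then have "q \<alpha> = 0" using q by (simp add: fun_prod_def)
        then show ?thesis using False d0 by (auto simp: R_def)
      qed
      then obtain x where "\<And>\<alpha>. R \<alpha> (x \<alpha>)" by metis
      then have x: "\<And>\<alpha>. (if \<alpha> \<in> ?A then x \<alpha> \<in> ?C \<alpha> (Suc j) else x \<alpha> = 0) \<and> q \<alpha> = ?d \<alpha> (x \<alpha>)"
        unfolding R_def .
      have "x \<in> qchain V E (Suc j) d" unfolding qchain_def fun_prod_def
      proof (intro CollectI allI)
        fix \<alpha> show "if \<alpha> \<in> ?A then x \<alpha> \<in> ?C \<alpha> (Suc j) else x \<alpha> = 0" using x[of \<alpha>] by blast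
      qed
      moreover have "q = qdiff \<iota> E x" using x by (simp add: qdiff_def fun_eq_iff)
      ultimately show "q \<in> qdiff \<iota> E ` qchain V E (Suc j) d" by blast
    qed
  qed
  have subZ: "f.subspace (?Z \<alpha>)" for \<alpha>
    using ff.subspace_kernel_on[OF fdiff_linear fchain_subspace f.subspace_single_0] by simp
  have fdZ: "f.findim (?Z \<alpha>)" for \<alpha>
    by (rule f.findim_subset[OF fchain_findim[OF finite_keys]]) auto
  have subB: "f.subspace (?B \<alpha>)" for \<alpha>
    by (rule ff.linear_subspace_image[OF fdiff_linear fchain_subspace])
  have fdB: "f.findim (?B \<alpha>)" for \<alpha>
    by (rule ff.findim_image[OF fdiff_linear fchain_findim[OF finite_keys]])
  show ?thesis
    unfolding qhdim_def Z B fhdim_def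
    using findim_dim_fun_prod[OF vector_space_fsc finA, of ?Z] findim_dim_fun_prod[OF vector_space_fsc finA, of ?B]
      subZ fdZ subB fdB by (simp add: sum_subtractf)
qed

text \<open>Up to complementation, the reduced cohomology of the restriction to \<open>W\<close> of the complex
  whose nonfaces are the supersets of members of \<open>E\<close>; homological degree \<open>j\<close> corresponds to
  faces with \<open>card W - j\<close> elements.\<close>

definition hdim :: "'k::field itself \<Rightarrow> ('v \<Rightarrow> nat) \<Rightarrow> 'v set set \<Rightarrow> 'v set \<Rightarrow> nat \<Rightarrow> int" where
  "hdim K \<iota> E W j = fhdim K \<iota> W (\<lambda>S. \<not> nonface E (W - S)) j"

text \<open>If some vertex \<open>w\<close> has exponent at least 2 in \<alpha>, it stays in the
  support of \<alpha> - S whether or not \<open>S\<close> contains it; the piece is then a cone with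
  apex \<open>w\<close> and contributes 0. The squarefree multidegrees that remain are the subsets
  W.\<close>

theorem qhdim_Hochster:
  assumes V: "finite V" "inj_on \<iota> V"
  shows "qhdim TYPE('k::field) \<iota> V E j d = (\<Sum>W | W \<subseteq> V \<and> card W = d. hdim TYPE('k) \<iota> E W j)"
proof -
  let ?A = "{\<alpha>. Poly_Mapping.keys \<alpha> \<subseteq> V \<and> mon_deg \<alpha> = d}"
  let ?h = "\<lambda>\<alpha>. fhdim TYPE('k) \<iota> (Poly_Mapping.keys \<alpha>) (face_at E \<alpha>) j"
  have finA: "finite ?A" using finite_monomials[OF V(1), of 0 d] by simp
  have fin: "finite W" if "W \<subseteq> V" for W using that V(1) finite_subset by blast
  have "(\<Sum>\<alpha>\<in>?A. ?h \<alpha>) = (\<Sum>\<alpha>\<in>ind_mon ` {W. W \<subseteq> V \<and> card W = d}. ?h \<alpha>)"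
  proof (rule sum.mono_neutral_right[OF finA])
    show "ind_mon ` {W. W \<subseteq> V \<and> card W = d} \<subseteq> ?A" using fin by auto
    show "\<forall>\<alpha>\<in>?A - ind_mon ` {W. W \<subseteq> V \<and> card W = d}. ?h \<alpha> = 0"
    proof
      fix \<alpha> assume \<alpha>: "\<alpha> \<in> ?A - ind_mon ` {W. W \<subseteq> V \<and> card W = d}"
      let ?K = "Poly_Mapping.keys \<alpha>"
      have "\<exists>w\<in>?K. Poly_Mapping.lookup \<alpha> w \<noteq> 1"
      proof (rule ccontr)
        assume "\<not> (\<exists>w\<in>?K. Poly_Mapping.lookup \<alpha> w \<noteq> 1)"
        then have "\<alpha> = ind_mon ?K" by (intro poly_mapping_eqI) (auto simp: lookup_ind_mon in_keys_iff)
        moreover from this have "card ?K = d" using \<alpha> by (metis (mono_tags, lifting) DiffD1 finite_keys mem_Collect_eq mon_deg_ind_mon)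
        ultimately show False using \<alpha> by blast
      qed
      then obtain w where w: "w \<in> ?K" "Poly_Mapping.lookup \<alpha> w \<noteq> 1" by blast
      then have w2: "Poly_Mapping.lookup \<alpha> w \<ge> 2" by (auto simp: in_keys_iff)
      show "?h \<alpha> = 0"
      proof (rule fhdim_exact[OF finite_keys _ w(1)])
        show "inj_on \<iota> ?K" using \<alpha> V(2) inj_on_subset by blast
        fix S assume S: "S \<subseteq> ?K" "w \<in> S"
        then have "finite S" by (metis finite_keys finite_subset)
        then have "Poly_Mapping.keys (\<alpha> - ind_mon S) = Poly_Mapping.keys (\<alpha> - ind_mon (S - {w}))"
          using w2 S by (intro Set.set_eqI) (auto simp: in_keys_iff lookup_minus lookup_ind_mon of_bool_def split: if_splits)
        then show "face_at E \<alpha> S \<longleftrightarrow> face_at E \<alpha> (S - {w})" by (simp add: face_at_def)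
      next
        fix S v assume "face_at E \<alpha> S" "v \<in> ?K" "S \<subseteq> ?K"
        then show "face_at E \<alpha> (insert v S)" using face_at_insert[of E \<alpha> S v] by (cases "v \<in> S") (auto simp: insert_absorb)
      qed
    qed
  qed
  also have "\<dots> = (\<Sum>W | W \<subseteq> V \<and> card W = d. ?h (ind_mon W))"
  proof (rule sum.reindex_cong[OF _ refl refl])
    show "inj_on ind_mon {W. W \<subseteq> V \<and> card W = d}"
      by (rule inj_onI) (metis (mono_tags, lifting) fin keys_ind_mon mem_Collect_eq)
  qed
  also have "\<dots> = (\<Sum>W | W \<subseteq> V \<and> card W = d. hdim TYPE('k) \<iota> E W j)"
  proof (rule sum.cong[OF refl])
    fix W assume "W \<in> {W. W \<subseteq> V \<and> card W = d}"
    then have W: "finite W" using fin by blast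
    have "face_at E (ind_mon W) S \<longleftrightarrow> \<not> nonface E (W - S)" if "S \<subseteq> W" for S
    proof -
      have "finite S" using that W finite_subset by blast
      then have "Poly_Mapping.keys (ind_mon W - ind_mon S) = W - S"
        using W by (auto simp: in_keys_iff lookup_minus lookup_ind_mon)
      then show ?thesis by (simp add: face_at_def)
    qed
    then show "?h (ind_mon W) = hdim TYPE('k) \<iota> E W j"
      unfolding hdim_def keys_ind_mon[OF W] by (rule fhdim_cong)
  qed
  finally show ?thesis unfolding qhdim_sum_fhdim[OF V(1)] .
qed

section \<open>Edge ideals and Hochster's formula for graphs\<close>

lemma edge_ideal_eq:
  assumes G: "simple_graph G"
  shows "edge_ideal G = (mono_ideal (verts G) (edges G) :: ('v, 'k::field) mpoly set)"
proof -
  have finE: "finite (edges G)"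
    by (rule finite_subset[of _ "Pow (verts G)"]) (use G in \<open>auto simp: simple_graph_def\<close>)
  have e: "finite e" "e \<subseteq> verts G" if "e \<in> edges G" for e
    using that G finite_subset[of e "verts G"] by (auto simp: simple_graph_def)
  have var: "(\<Prod>v\<in>e. var v) = (Poly_Mapping.single (ind_mon e) 1 :: ('v, 'k) mpoly)" if "finite e" for e
    using that by (induction e rule: finite_induct) (simp_all add: ind_mon_insert var_def mult_single)
  show ?thesis
  proof
    show "edge_ideal G \<subseteq> (mono_ideal (verts G) (edges G) :: ('v, 'k) mpoly set)"
    proof
      fix p :: "('v, 'k) mpoly" assume "p \<in> edge_ideal G"
      then obtain q where q: "p = (\<Sum>e\<in>edges G. q e * (\<Prod>v\<in>e. var v))" "\<forall>e\<in>edges G. q e \<in> poly_ring (verts G)"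
        unfolding edge_ideal_def by blast
      have "q e * (\<Prod>v\<in>e. var v) \<in> mono_ideal (verts G) (edges G)" if "e \<in> edges G" for e
        unfolding mono_ideal_lookup var[OF e(1)[OF that]]
      proof (intro allI impI, rule ccontr)
        fix m assume m: "\<not> (Poly_Mapping.keys m \<subseteq> verts G \<and> nonface (edges G) (Poly_Mapping.keys m))"
          "Poly_Mapping.lookup (q e * Poly_Mapping.single (ind_mon e) 1) m \<noteq> 0"
        then have "(\<Sum>n\<in>Poly_Mapping.keys (q e). if ind_mon e + n = m then 1 * Poly_Mapping.lookup (q e) n else 0) \<noteq> 0"
          by (simp only: mult.commute[of "q e"] lookup_single_mult) simp
        then obtain n where n: "n \<in> Poly_Mapping.keys (q e)"
          "(if ind_mon e + n = m then 1 * Poly_Mapping.lookup (q e) n else 0) \<noteq> 0"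
          by (rule sum.not_neutral_contains_not_neutral)
        then have nm: "ind_mon e + n = m" by (simp split: if_splits)
        have "Poly_Mapping.keys m = e \<union> Poly_Mapping.keys n"
          using e(1)[OF that] by (auto simp: nm[symmetric] in_keys_iff lookup_add lookup_ind_mon)
        moreover have "Poly_Mapping.keys n \<subseteq> verts G" using q(2) that n(1) unfolding poly_ring_def by blast
        ultimately show False using m(1) that e(2)[OF that] unfolding nonface_def by blast
      qed
      then show "p \<in> mono_ideal (verts G) (edges G)"
        unfolding q(1) mono_ideal_lookup by (simp add: lookup_sum)
    qed
    show "(mono_ideal (verts G) (edges G) :: ('v, 'k) mpoly set) \<subseteq> edge_ideal G"
    proof
      fix p :: "('v, 'k) mpoly" assume p: "p \<in> mono_ideal (verts G) (edges G)"
      then have "\<forall>m\<in>Poly_Mapping.keys p. \<exists>e. e \<in> edges G \<and> e \<subseteq> Poly_Mapping.keys m"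
        unfolding mono_ideal_def nonface_def by blast
      \<comment> \<open>Each monomial of \<open>p\<close> is assigned one edge dividing it; grouping
        the terms by their edge gives the coefficients \<open>q\<close>.\<close>
      then obtain c where c: "\<And>m. m \<in> Poly_Mapping.keys p \<Longrightarrow> c m \<in> edges G \<and> c m \<subseteq> Poly_Mapping.keys m" by metis
      define q where "q e = (\<Sum>m\<in>{m \<in> Poly_Mapping.keys p. c m = e}. Poly_Mapping.single (m - ind_mon e) (Poly_Mapping.lookup p m))" for e
      have "q e * (\<Prod>v\<in>e. var v) = (\<Sum>m\<in>{m \<in> Poly_Mapping.keys p. c m = e}. Poly_Mapping.single m (Poly_Mapping.lookup p m))"
        if "e \<in> edges G" for e
        unfolding q_def var[OF e(1)[OF that]] sum_distrib_right
        using c by (intro sum.cong[OF refl]) (auto simp: mult_single minus_add_ind_mon)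
      then have "(\<Sum>e\<in>edges G. q e * (\<Prod>v\<in>e. var v)) =
          (\<Sum>e\<in>edges G. \<Sum>m\<in>{m \<in> Poly_Mapping.keys p. c m = e}. Poly_Mapping.single m (Poly_Mapping.lookup p m))"
        by simp
      also have "\<dots> = (\<Sum>m\<in>Poly_Mapping.keys p. Poly_Mapping.single m (Poly_Mapping.lookup p m))"
        by (rule sum.group[OF finite_keys finE]) (use c in blast)
      finally have "p = (\<Sum>e\<in>edges G. q e * (\<Prod>v\<in>e. var v))" by (simp add: poly_mapping_sum_single)
      moreover have "q e \<in> poly_ring (verts G)" for e
        unfolding q_def
      proof (rule poly_ring_sum)
        fix m assume "m \<in> {m \<in> Poly_Mapping.keys p. c m = e}"
        then have "Poly_Mapping.keys m \<subseteq> verts G" using p by (auto simp: mono_ideal_def)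
        moreover have "Poly_Mapping.keys (m - ind_mon e) \<subseteq> Poly_Mapping.keys m"
          by (auto simp: in_keys_iff lookup_minus)
        ultimately show "Poly_Mapping.single (m - ind_mon e) (Poly_Mapping.lookup p m) \<in> poly_ring (verts G)"
          by (auto simp: poly_ring_def split: if_splits)
      qed
      ultimately show "p \<in> edge_ideal G" unfolding edge_ideal_def by blast
    qed
  qed
qed

theorem graph_betti_Hochster:
  assumes G: "simple_graph G" and \<iota>: "inj_on \<iota> (verts G)"
  shows "int (graph_betti TYPE('k::field) G (int i) (int d)) =
    (\<Sum>W | W \<subseteq> verts G \<and> card W = d. hdim TYPE('k) \<iota> (edges G) W i)"
proof -
  have V: "finite (verts G)" using G by (simp add: simple_graph_def)
  have "{} \<notin> edges G" using G by (auto simp: simple_graph_def)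
  \<comment> \<open>The bound needed for the existence of a resolution: no W has more elements than
    there are vertices. There is no circularity, since \<open>qhdim\<close> is defined without
    resolutions.\<close>
  moreover have "qhdim TYPE('k) \<iota> (verts G) (edges G) j e = 0" if "e > card (verts G)" for j e
  proof -
    have "\<not> (W \<subseteq> verts G \<and> card W = e)" for W using card_mono[OF V, of W] that by auto
    then show ?thesis unfolding qhdim_Hochster[OF V \<iota>] by (simp only: Collect_empty_eq[THEN iffD2] not_False_eq_True simp_thms sum.empty)
  qed
  ultimately have "int (graded_betti (verts G) (edge_ideal G :: (_, 'k) mpoly set) i d) =
      qhdim TYPE('k) \<iota> (verts G) (edges G) i d"
    unfolding edge_ideal_eq[OF G] by (intro graded_betti_eq_qhdim[OF V \<iota>])
  then show ?thesis by (simp add: graph_betti_def qhdim_Hochster[OF V \<iota>])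
qed

section \<open>Reduced cohomology of induced subcomplexes\<close>

text \<open>Chains indexed by the size \<open>p\<close> of the face \<open>W - S\<close>.\<close>

definition pchain :: "'v set \<Rightarrow> ('v set \<Rightarrow> bool) \<Rightarrow> nat \<Rightarrow> ('v set \<Rightarrow> 'k::field) set" where
  "pchain W P p = {f. \<forall>S. f S \<noteq> 0 \<longrightarrow> S \<subseteq> W \<and> P S \<and> card S + p = card W}"

definition pcycle :: "('v \<Rightarrow> nat) \<Rightarrow> 'v set \<Rightarrow> ('v set \<Rightarrow> bool) \<Rightarrow> nat \<Rightarrow> ('v set \<Rightarrow> 'k::field) set" where
  "pcycle \<iota> W P p = {f \<in> pchain W P p. fdiff \<iota> W P f = 0}"

definition zdim :: "'k::field itself \<Rightarrow> ('v \<Rightarrow> nat) \<Rightarrow> 'v set \<Rightarrow> ('v set \<Rightarrow> bool) \<Rightarrow> nat \<Rightarrow> nat" where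
  "zdim K \<iota> W P p = vector_space.dim fsc (pcycle \<iota> W P p :: ('v set \<Rightarrow> 'k) set)"

definition fnum :: "'v set \<Rightarrow> ('v set \<Rightarrow> bool) \<Rightarrow> nat \<Rightarrow> nat" where
  "fnum W P p = card {S. S \<subseteq> W \<and> P S \<and> card S + p = card W}"

text \<open>Reduced cohomology in dimension \<open>p - 1\<close>, as faces of size \<open>p\<close>
  have that dimension. By rank-nullity the coboundaries have dimension equal to the number of faces
  of size \<open>p - 1\<close> minus the cocycles there, so face numbers and cocycle dimensions
  suffice.\<close>

definition rhdim :: "'k::field itself \<Rightarrow> ('v \<Rightarrow> nat) \<Rightarrow> 'v set \<Rightarrow> ('v set \<Rightarrow> bool) \<Rightarrow> nat \<Rightarrow> int" where
  "rhdim K \<iota> W P p = int (zdim K \<iota> W P p) -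
     (case p of 0 \<Rightarrow> 0 | Suc q \<Rightarrow> int (fnum W P q) - int (zdim K \<iota> W P q))"

lemma pchain_eq_fchain:
  assumes "j \<le> card W"
  shows "pchain W P (card W - j) = (fchain W P j :: ('v set \<Rightarrow> 'k::field) set)"
  using assms unfolding pchain_def fchain_def by fastforce

lemma pchain_fun_prod: "pchain W P p = fun_prod {S. S \<subseteq> W \<and> P S \<and> card S + p = card W} (\<lambda>_. UNIV)"
  unfolding pchain_def fun_prod_def by auto

lemma pchain_subspace: "module.subspace fsc (pchain W P p)"
proof -
  interpret vector_space fsc by (rule vector_space_fsc)
  have *: "pchain W P p = {f. \<forall>S. \<not> (S \<subseteq> W \<and> P S \<and> card S + p = card W) \<longrightarrow> f S = 0}"
    by (auto simp: pchain_def)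
  show ?thesis unfolding * subspace_def by (auto simp: fscale_apply)
qed

lemma pchain_findim_dim:
  assumes "finite W"
  shows "vector_space.findim fsc (pchain W P p :: ('v set \<Rightarrow> 'k::field) set)"
    and "vector_space.dim fsc (pchain W P p :: ('v set \<Rightarrow> 'k::field) set) = fnum W P p"
proof -
  have "finite {S. S \<subseteq> W \<and> P S \<and> card S + p = card W}"
    by (rule finite_subset[of _ "Pow W"]) (use assms in auto)
  from dim_fun_prod_UNIV[OF this]
  show "vector_space.findim fsc (pchain W P p :: ('v set \<Rightarrow> 'k) set)"
    and "vector_space.dim fsc (pchain W P p :: ('v set \<Rightarrow> 'k) set) = fnum W P p"
    by (simp_all add: pchain_fun_prod fnum_def)
qed

lemma pcycle_subspace: "module.subspace fsc (pcycle \<iota> W P p :: ('v set \<Rightarrow> 'k::field) set)"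
proof -
  interpret f: vector_space "fsc :: 'k \<Rightarrow> ('v set \<Rightarrow> 'k) \<Rightarrow> _" by (rule vector_space_fsc)
  interpret ff: vector_space_pair "fsc :: 'k \<Rightarrow> ('v set \<Rightarrow> 'k) \<Rightarrow> _" "fsc :: 'k \<Rightarrow> ('v set \<Rightarrow> 'k) \<Rightarrow> _" ..
  show ?thesis using ff.subspace_kernel_on[OF fdiff_linear pchain_subspace f.subspace_single_0]
    by (simp add: pcycle_def)
qed

lemma pcycle_findim:
  assumes "finite W"
  shows "vector_space.findim fsc (pcycle \<iota> W P p :: ('v set \<Rightarrow> 'k::field) set)"
proof -
  interpret f: vector_space "fsc :: 'k \<Rightarrow> ('v set \<Rightarrow> 'k) \<Rightarrow> _" by (rule vector_space_fsc)
  show ?thesis by (rule f.findim_subset[OF pchain_findim_dim(1)[OF assms]]) (auto simp: pcycle_def)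
qed

lemma fdiff_pchain:
  fixes f :: "'v set \<Rightarrow> 'k::field"
  assumes "finite W" "f \<in> pchain W P p"
  shows "fdiff \<iota> W P f \<in> pchain W P (Suc p)"
proof (cases "p < card W")
  case True
  then have "f \<in> fchain W P (Suc (card W - Suc p))"
    using assms(2) pchain_eq_fchain[of "card W - p" W P, where 'k = 'k] by (simp add: Suc_diff_Suc)
  from fdiff_fchain[OF assms(1) this] show ?thesis
    using pchain_eq_fchain[of "card W - Suc p" W P, where 'k = 'k] True by (auto simp: Suc_diff_Suc)
next
  case False
  have "f (insert v S) = 0" if "v \<in> W - S" "S \<subseteq> W" for v S
  proof (rule ccontr)
    assume "f (insert v S) \<noteq> 0"
    then have "card (insert v S) = 0" "insert v S \<subseteq> W" using assms(2) False unfolding pchain_def by auto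
    then show False using finite_subset[of "insert v S" W] assms(1) by auto
  qed
  then have "fdiff \<iota> W P f = 0" by (auto simp: fdiff_def fun_eq_iff)
  then show ?thesis by (simp add: pchain_def)
qed

lemma fdiff_fdiff_pchain:
  assumes W: "finite W" "inj_on \<iota> W" and f: "f \<in> pchain W P p"
    and P: "\<And>S v. P S \<Longrightarrow> v \<in> W \<Longrightarrow> S \<subseteq> W \<Longrightarrow> P (insert v S)"
  shows "fdiff \<iota> W P (fdiff \<iota> W P f) = 0"
proof (rule fdiff_fdiff[OF W])
  show "f \<in> fchain W P (card W - p)" using f unfolding pchain_def fchain_def by fastforce
qed (rule P)

lemma fnum_rank:
  assumes "finite W"
  shows "fnum W P q = zdim TYPE('k::field) \<iota> W P q +
    vector_space.dim fsc (fdiff \<iota> W P ` (pchain W P q :: ('v set \<Rightarrow> 'k) set))"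
proof -
  interpret ff: vector_space_pair "fsc :: 'k \<Rightarrow> ('v set \<Rightarrow> 'k) \<Rightarrow> _" "fsc :: 'k \<Rightarrow> ('v set \<Rightarrow> 'k) \<Rightarrow> _"
    by (intro vector_space_pair.intro vector_space_fsc)
  show ?thesis
    using ff.rank_nullity[OF fdiff_linear[of \<iota> W P] pchain_subspace[of W P q] pchain_findim_dim(1)[OF assms]]
      pchain_findim_dim(2)[OF assms, of P q, where 'k = 'k]
    by (simp add: zdim_def pcycle_def)
qed

text \<open>A change of index from \<open>card S\<close> to the face size, with the boundary
  dimension replaced through \<open>fnum_rank\<close>.\<close>

lemma fhdim_eq_rhdim:
  assumes W: "finite W"
  shows "fhdim TYPE('k::field) \<iota> W P j = (if j \<le> card W then rhdim TYPE('k) \<iota> W P (card W - j) else 0)"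
proof -
  interpret f: vector_space "fsc :: 'k \<Rightarrow> ('a set \<Rightarrow> 'k) \<Rightarrow> _" by (rule vector_space_fsc)
  have big: "fchain W P i = {0 :: 'a set \<Rightarrow> 'k}" if "i > card W" for i
    unfolding fchain_def using that card_mono[OF W] by (auto simp: fun_eq_iff) (metis leD)
  have d0: "fdiff \<iota> W P (0 :: 'a set \<Rightarrow> 'k) = 0" by (simp add: fdiff_def fun_eq_iff)
  show ?thesis
  proof (cases "j \<le> card W")
    case True
    have Z: "int (f.dim {g \<in> fchain W P j :: ('a set \<Rightarrow> 'k) set. fdiff \<iota> W P g = 0}) =
        int (zdim TYPE('k) \<iota> W P (card W - j))"
      by (simp add: zdim_def pcycle_def pchain_eq_fchain[OF True])
    show ?thesis
    proof (cases "card W - j")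
      case 0
      then have "fchain W P (Suc j) = {0 :: 'a set \<Rightarrow> 'k}" using True by (intro big) simp
      then show ?thesis using Z True 0 d0 by (simp add: fhdim_def rhdim_def f.dim_zero_space)
    next
      case (Suc q)
      then have q: "card W - Suc j = q" "Suc j \<le> card W" by auto
      have "fchain W P (Suc j) = (pchain W P q :: ('a set \<Rightarrow> 'k) set)"
        using pchain_eq_fchain[OF q(2), of P, where 'k = 'k] q(1) by simp
      then show ?thesis using Z True Suc fnum_rank[OF W, of P q \<iota>, where 'k = 'k]
        by (simp add: fhdim_def rhdim_def)
    qed
  next
    case False
    then have "{g \<in> fchain W P j :: ('a set \<Rightarrow> 'k) set. fdiff \<iota> W P g = 0} = {0}"
      using big[of j] d0 by auto
    moreover have "fchain W P (Suc j) = {0 :: 'a set \<Rightarrow> 'k}" using False by (intro big) simp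
    ultimately show ?thesis using False d0 by (simp add: fhdim_def f.dim_zero_space)
  qed
qed

text \<open>The face condition in complement form, which is closed upwards in
  \<open>S\<close>.\<close>

definition face_pred :: "'v set set \<Rightarrow> 'v set \<Rightarrow> 'v set \<Rightarrow> bool" where
  "face_pred E W S \<longleftrightarrow> \<not> nonface E (W - S)"

lemma face_pred_insert: "face_pred E W S \<Longrightarrow> face_pred E W (insert v S)"
  unfolding face_pred_def using nonface_mono[of E "W - insert v S" "W - S"] by blast

lemma hdim_eq_rhdim:
  "finite W \<Longrightarrow> hdim TYPE('k::field) \<iota> E W j =
    (if j \<le> card W then rhdim TYPE('k) \<iota> W (face_pred E W) (card W - j) else 0)"
  unfolding hdim_def using fhdim_eq_rhdim[of W \<iota> "\<lambda>S. \<not> nonface E (W - S)" j, where 'k = 'k]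
  by (simp add: face_pred_def[abs_def])

lemma rhdim_cong:
  assumes "\<And>S. S \<subseteq> W \<Longrightarrow> P S = Q S"
  shows "rhdim K \<iota> W P p = rhdim K \<iota> W Q p"
proof -
  have "pchain W P = (pchain W Q :: nat \<Rightarrow> ('a set \<Rightarrow> 'b) set)"
    unfolding pchain_def using assms by (intro ext) metis
  moreover have "fdiff \<iota> W P = (fdiff \<iota> W Q :: ('a set \<Rightarrow> 'b) \<Rightarrow> _)"
    unfolding fdiff_def using assms by (intro ext) auto
  moreover have "fnum W P = fnum W Q"
    unfolding fnum_def using assms by (intro ext arg_cong[where f = card]) auto
  ultimately show ?thesis by (cases p) (simp_all add: rhdim_def zdim_def pcycle_def)
qed

lemma rhdim_simplex:
  assumes "finite W" "inj_on \<iota> W" "W \<noteq> {}"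
  shows "rhdim TYPE('k::field) \<iota> W (\<lambda>_. True) p = 0"
proof (cases "p \<le> card W")
  case True
  obtain w where "w \<in> W" using assms(3) by blast
  then have "fhdim TYPE('k) \<iota> W (\<lambda>_. True) (card W - p) = 0" by (intro fhdim_exact[OF assms(1,2)]) auto
  then show ?thesis using True by (simp add: fhdim_eq_rhdim[OF assms(1)])
next
  \<comment> \<open>Above the top dimension there are no chains, so it remains to see that every
    chain one size below is a cycle.\<close>
  case False
  interpret f: vector_space "fsc :: 'k \<Rightarrow> ('a set \<Rightarrow> 'k) \<Rightarrow> _" by (rule vector_space_fsc)
  have d0: "fdiff \<iota> W P (0 :: 'a set \<Rightarrow> 'k) = 0" for P by (simp add: fdiff_def fun_eq_iff)
  have z: "pchain W (\<lambda>_. True) p = {0 :: 'a set \<Rightarrow> 'k}" using False by (auto simp: pchain_def fun_eq_iff)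
  then have "zdim TYPE('k) \<iota> W (\<lambda>_. True) p = 0"
    by (simp add: zdim_def pcycle_def d0 f.dim_zero_space cong: conj_cong)
  moreover obtain q where q: "p = Suc q" using False by (cases p) auto
  have "pchain W (\<lambda>_. True) q = (pcycle \<iota> W (\<lambda>_. True) q :: ('a set \<Rightarrow> 'k) set)"
    using fdiff_pchain[OF assms(1), of _ "\<lambda>_. True" q \<iota>, where 'k = 'k] z unfolding q pcycle_def by auto
  then have "fnum W (\<lambda>_. True) q = zdim TYPE('k) \<iota> W (\<lambda>_. True) q"
    using pchain_findim_dim(2)[OF assms(1), of "\<lambda>_. True" q, where 'k = 'k] by (simp add: zdim_def)
  ultimately show ?thesis by (simp add: rhdim_def q)
qed

text \<open>If the vertices of \<open>W\<close> are faces, then there is no reduced cohomology in degree \<open>-1\<close>.\<close>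

lemma zdim_0:
  assumes W: "finite W" "w \<in> W" and P: "P (W - {w})"
  shows "zdim TYPE('k::field) \<iota> W P 0 = 0"
proof -
  interpret f: vector_space "fsc :: 'k \<Rightarrow> ('a set \<Rightarrow> 'k) \<Rightarrow> _" by (rule vector_space_fsc)
  have "f = 0" if f: "f \<in> pcycle \<iota> W P 0" for f :: "'a set \<Rightarrow> 'k"
  proof
    fix S
    have sup: "S = W" if "f S \<noteq> 0" for S
      using that f W(1) by (auto simp: pcycle_def pchain_def card_subset_eq)
    have "W - (W - {w}) = {w}" "insert w (W - {w}) = W" using W by auto
    moreover have "fdiff \<iota> W P f (W - {w}) = 0" using f by (simp add: pcycle_def)
    ultimately have "f W = 0" using P by (auto simp: fdiff_def)
    then show "f S = 0 S" using sup[of S] by auto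
  qed
  moreover have "0 \<in> (pcycle \<iota> W P 0 :: ('a set \<Rightarrow> 'k) set)"
    by (simp add: pcycle_def pchain_def fdiff_def fun_eq_iff)
  ultimately have "pcycle \<iota> W P 0 = {0 :: 'a set \<Rightarrow> 'k}" by blast
  then show ?thesis by (simp add: zdim_def f.dim_zero_space)
qed

lemma fnum_0:
  assumes "finite W" "P W" shows "fnum W P 0 = 1"
proof -
  have "{S. S \<subseteq> W \<and> P S \<and> card S + 0 = card W} = {W}"
    using card_subset_eq[OF assms(1)] assms(2) by auto
  then show ?thesis by (simp add: fnum_def)
qed

text \<open>Pulling the numbering back along \<phi> leaves every sign unchanged, so the induced map
  \<open>R\<close> on cochains is an isomorphism of complexes without any monotonicity of
  \<phi>.\<close>

lemma rhdim_relabel: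
  fixes \<phi> :: "'v \<Rightarrow> 'w"
  assumes \<phi>: "inj_on \<phi> W" and W: "finite W"
  shows "rhdim TYPE('k::field) \<iota> (\<phi> ` W) P p = rhdim TYPE('k) (\<iota> \<circ> \<phi>) W (\<lambda>S. P (\<phi> ` S)) p"
proof -
  interpret fv: vector_space "fsc :: 'k \<Rightarrow> ('v set \<Rightarrow> 'k) \<Rightarrow> _" by (rule vector_space_fsc)
  interpret fw: vector_space "fsc :: 'k \<Rightarrow> ('w set \<Rightarrow> 'k) \<Rightarrow> _" by (rule vector_space_fsc)
  interpret wv: vector_space_pair "fsc :: 'k \<Rightarrow> ('w set \<Rightarrow> 'k) \<Rightarrow> _" "fsc :: 'k \<Rightarrow> ('v set \<Rightarrow> 'k) \<Rightarrow> _" ..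
  let ?Q = "\<lambda>S. P (\<phi> ` S)"
  have card: "card (\<phi> ` S) = card S" if "S \<subseteq> W" for S
    using card_image inj_on_subset[OF \<phi> that] by blast
  have inj: "\<phi> ` S = \<phi> ` T \<longleftrightarrow> S = T" if "S \<subseteq> W" "T \<subseteq> W" for S T
    using inj_on_image_eq_iff[OF \<phi> that] .
  define R where "R f = (\<lambda>S. if S \<subseteq> W then f (\<phi> ` S) else 0)" for f :: "'w set \<Rightarrow> 'k"
  have lin: "Vector_Spaces.linear fsc fsc R"
    unfolding Vector_Spaces.linear_iff using fv.vector_space_axioms fw.vector_space_axioms
    by (simp add: R_def fun_eq_iff fscale_apply)
  have ks: "ksgn \<iota> (\<phi> v) (\<phi> ` S) = (ksgn (\<iota> \<circ> \<phi>) v S :: 'k)" if "S \<subseteq> W" for S v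
  proof -
    have "{u \<in> \<phi> ` S. \<iota> u < \<iota> (\<phi> v)} = \<phi> ` {u \<in> S. (\<iota> \<circ> \<phi>) u < (\<iota> \<circ> \<phi>) v}" by auto
    moreover have "card (\<phi> ` {u \<in> S. (\<iota> \<circ> \<phi>) u < (\<iota> \<circ> \<phi>) v}) = card {u \<in> S. (\<iota> \<circ> \<phi>) u < (\<iota> \<circ> \<phi>) v}"
      by (rule card) (use that in blast)
    ultimately show ?thesis by (simp only: ksgn_def)
  qed
  have diff: "fdiff (\<iota> \<circ> \<phi>) W ?Q (R f) = R (fdiff \<iota> (\<phi> ` W) P f)" for f
  proof
    fix S
    show "fdiff (\<iota> \<circ> \<phi>) W ?Q (R f) S = R (fdiff \<iota> (\<phi> ` W) P f) S"
    proof (cases "S \<subseteq> W \<and> ?Q S")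
      case True
      have "\<phi> ` W - \<phi> ` S = \<phi> ` (W - S)" using inj_on_image_set_diff[OF \<phi>, of W S] True by auto
      moreover have "inj_on \<phi> (W - S)" using \<phi> inj_on_subset by blast
      ultimately have "R (fdiff \<iota> (\<phi> ` W) P f) S =
          (\<Sum>v\<in>W - S. ksgn \<iota> (\<phi> v) (\<phi> ` S) * f (insert (\<phi> v) (\<phi> ` S)))"
        using True by (auto simp: R_def fdiff_def sum.reindex)
      also have "\<dots> = fdiff (\<iota> \<circ> \<phi>) W ?Q (R f) S"
        using True ks by (auto simp: R_def fdiff_def intro!: sum.cong)
      finally show ?thesis ..
    qed (auto simp: R_def fdiff_def)
  qed
  have pin: "R f \<in> pchain W ?Q p" if "f \<in> pchain (\<phi> ` W) P p" for f p
    using that card card[OF subset_refl] unfolding pchain_def R_def by auto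
  have eq0: "f = 0" if f: "f \<in> pchain (\<phi> ` W) P p" "R f = 0" for f p
  proof
    fix S show "f S = 0 S"
    proof (rule ccontr)
      assume nz: "f S \<noteq> 0 S"
      then have "S \<subseteq> \<phi> ` W" using f(1) by (simp add: pchain_def)
      then obtain T where "T \<subseteq> W" "S = \<phi> ` T" by (meson subset_imageE)
      then show False using fun_cong[OF f(2), of T] nz by (simp add: R_def)
    qed
  qed
  have surj: "\<exists>f\<in>pchain (\<phi> ` W) P p. R f = g" if g: "g \<in> pchain W ?Q p" for g p
  proof
    define f where "f S = (if S \<subseteq> \<phi> ` W then g (inv_into W \<phi> ` S) else 0)" for S
    have fR: "f (\<phi> ` S) = g S" if "S \<subseteq> W" for S
      using that inv_into_image_cancel[OF \<phi> that] by (auto simp: f_def)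
    show "R f = g" using fR g by (auto simp: R_def fun_eq_iff pchain_def)
    show "f \<in> pchain (\<phi> ` W) P p"
      unfolding pchain_def
    proof (intro CollectI allI impI)
      fix S assume nz: "f S \<noteq> 0"
      then have "S \<subseteq> \<phi> ` W" by (auto simp: f_def split: if_splits)
      then obtain T where T: "T \<subseteq> W" "S = \<phi> ` T" by (meson subset_imageE)
      then have "g T \<noteq> 0" using nz fR by simp
      then show "S \<subseteq> \<phi> ` W \<and> P S \<and> card S + p = card (\<phi> ` W)"
        using g T card[OF T(1)] card[OF subset_refl] by (auto simp: pchain_def)
    qed
  qed
  have z: "zdim TYPE('k) \<iota> (\<phi> ` W) P p = zdim TYPE('k) (\<iota> \<circ> \<phi>) W ?Q p" for p
  proof -
    have "R ` pcycle \<iota> (\<phi> ` W) P p = pcycle (\<iota> \<circ> \<phi>) W ?Q p"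
    proof
      have "R 0 = 0" by (simp add: R_def fun_eq_iff)
      then show "R ` pcycle \<iota> (\<phi> ` W) P p \<subseteq> pcycle (\<iota> \<circ> \<phi>) W ?Q p" using pin diff by (auto simp: pcycle_def)
      show "pcycle (\<iota> \<circ> \<phi>) W ?Q p \<subseteq> R ` pcycle \<iota> (\<phi> ` W) P p"
      proof
        fix g :: "'v set \<Rightarrow> 'k" assume g: "g \<in> pcycle (\<iota> \<circ> \<phi>) W ?Q p"
        then obtain f where f: "f \<in> pchain (\<phi> ` W) P p" "R f = g" using surj by (auto simp: pcycle_def)
        have "R (fdiff \<iota> (\<phi> ` W) P f) = 0" using g diff[of f] f(2) by (simp add: pcycle_def)
        then have "fdiff \<iota> (\<phi> ` W) P f = 0"
          using eq0[OF fdiff_pchain[OF finite_imageI[OF W] f(1)]] by blast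
        then show "g \<in> R ` pcycle \<iota> (\<phi> ` W) P p" using f by (auto simp: pcycle_def)
      qed
    qed
    moreover have "fv.dim (R ` pcycle \<iota> (\<phi> ` W) P p) = fw.dim (pcycle \<iota> (\<phi> ` W) P p)"
      by (rule wv.dim_image_inj[OF lin pcycle_subspace pcycle_findim[OF finite_imageI[OF W]]])
        (auto simp: pcycle_def intro: eq0)
    ultimately show ?thesis by (simp add: zdim_def)
  qed
  have n: "fnum (\<phi> ` W) P p = fnum W ?Q p" for p
  proof -
    have "{S. S \<subseteq> \<phi> ` W \<and> P S \<and> card S + p = card (\<phi> ` W)} =
        image \<phi> ` {S. S \<subseteq> W \<and> ?Q S \<and> card S + p = card W}"
      using card card[OF subset_refl] by (auto simp: subset_image_iff)
    moreover have "inj_on (image \<phi>) {S. S \<subseteq> W \<and> ?Q S \<and> card S + p = card W}"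
      by (rule inj_onI) (use inj in blast)
    ultimately show ?thesis by (simp add: fnum_def card_image)
  qed
  show ?thesis unfolding rhdim_def z n ..
qed

lemma ksgn_Un_left:
  assumes "\<And>u. u \<in> T \<Longrightarrow> \<iota> v < \<iota> u"
  shows "ksgn \<iota> v (S \<union> T) = ksgn \<iota> v S"
proof -
  have "{u \<in> S \<union> T. \<iota> u < \<iota> v} = {u \<in> S. \<iota> u < \<iota> v}" using assms by (auto dest: less_asym)
  then show ?thesis by (simp only: ksgn_def)
qed

lemma ksgn_Un_right:
  assumes "finite S" "finite T" "S \<inter> T = {}" "\<And>u. u \<in> S \<Longrightarrow> \<iota> u < \<iota> v"
  shows "ksgn \<iota> v (S \<union> T) = (-1) ^ card S * ksgn \<iota> v T"
proof -
  have "{u \<in> S \<union> T. \<iota> u < \<iota> v} = S \<union> {u \<in> T. \<iota> u < \<iota> v}" using assms by auto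
  moreover have "card (S \<union> {u \<in> T. \<iota> u < \<iota> v}) = card S + card {u \<in> T. \<iota> u < \<iota> v}"
    using assms by (intro card_Un_disjoint) auto
  ultimately show ?thesis by (simp only: ksgn_def power_add)
qed

section \<open>Disjoint unions of complexes\<close>

text \<open>In complement form, the faces inside \<open>C\<close> correspond to sets containing
  \<open>D\<close>. Thus this is restriction of a cochain to the subcomplex on \<open>C\<close>, and
  \<open>unpart\<close> is extension by zero.\<close>

definition part :: "'v set \<Rightarrow> 'v set \<Rightarrow> ('v set \<Rightarrow> 'k::field) \<Rightarrow> 'v set \<Rightarrow> 'k" where
  "part C D f = (\<lambda>T. if T \<subseteq> C then f (T \<union> D) else 0)"

definition unpart :: "'v set \<Rightarrow> 'v set \<Rightarrow> ('v set \<Rightarrow> 'k::field) \<Rightarrow> 'v set \<Rightarrow> 'k" where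
  "unpart C D g = (\<lambda>S. if D \<subseteq> S \<and> S \<subseteq> C \<union> D then g (S - D) else 0)"

lemma part_linear: "Vector_Spaces.linear fsc fsc (part C D)"
  unfolding Vector_Spaces.linear_iff
  by (simp add: vector_space_fsc part_def fun_eq_iff fscale_apply)

text \<open>The constant \<open>e\<close> is the sign caused by the complement always containing
  \<open>D\<close>: 1 if \<open>D\<close> comes after \<open>C\<close> in the numbering, and a power
  of -1 if it comes before.\<close>

lemma
  fixes e :: "'k::field"
  assumes fin: "finite C" "finite D" and disj: "C \<inter> D = {}" and W: "W = C \<union> D"
    and P: "\<And>T. T \<subseteq> C \<Longrightarrow> P (T \<union> D) \<longleftrightarrow> Q T"
    and e: "\<And>T v. T \<subseteq> C \<Longrightarrow> v \<in> C \<Longrightarrow> ksgn \<iota> v (T \<union> D) = e * ksgn \<iota> v T"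
  shows part_fdiff: "part C D (fdiff \<iota> W P f) = (\<lambda>T. e * fdiff \<iota> C Q (part C D f) T)"
    and part_pchain: "f \<in> pchain W P p \<Longrightarrow> part C D f \<in> pchain C Q p"
    and part_unpart: "g \<in> pchain C Q p \<Longrightarrow> part C D (unpart C D g) = g"
    and unpart_pchain: "g \<in> pchain C Q p \<Longrightarrow> unpart C D g \<in> pchain W P p"
proof -
  have card: "card (T \<union> D) = card T + card D" if "T \<subseteq> C" for T
    using that fin disj finite_subset[of T C] by (intro card_Un_disjoint) auto
  have TD: "T \<union> D - D = T" if "T \<subseteq> C" for T using that disj by blast
  show "part C D (fdiff \<iota> W P f) = (\<lambda>T. e * fdiff \<iota> C Q (part C D f) T)"
  proof
    fix T
    show "part C D (fdiff \<iota> W P f) T = e * fdiff \<iota> C Q (part C D f) T"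
    proof (cases "T \<subseteq> C \<and> Q T")
      case True
      have "W - (T \<union> D) = C - T" using W disj by blast
      then show ?thesis using True P[of T] W e
        by (auto simp: part_def fdiff_def sum_distrib_left mult.assoc intro!: sum.cong)
    qed (use P W in \<open>auto simp: part_def fdiff_def\<close>)
  qed
  show "f \<in> pchain W P p \<Longrightarrow> part C D f \<in> pchain C Q p"
    unfolding pchain_def part_def using P card card[OF subset_refl] W by auto
  show "g \<in> pchain C Q p \<Longrightarrow> part C D (unpart C D g) = g"
    using TD by (auto simp: part_def unpart_def pchain_def fun_eq_iff)
  show "unpart C D g \<in> pchain W P p" if g: "g \<in> pchain C Q p"
    unfolding pchain_def
  proof (intro CollectI allI impI)
    fix S assume nz: "unpart C D g S \<noteq> 0"
    then have S: "D \<subseteq> S" "S \<subseteq> C \<union> D" "g (S - D) \<noteq> 0" by (auto simp: unpart_def split: if_splits)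
    then have T: "S - D \<subseteq> C" "Q (S - D)" "card (S - D) + p = card C" using g by (auto simp: pchain_def)
    define T where "T = S - D"
    have SD: "S = T \<union> D" using S by (auto simp: T_def)
    show "S \<subseteq> W \<and> P S \<and> card S + p = card W"
      using T P[OF T(1)] card[OF T(1)] card[OF subset_refl] W unfolding T_def[symmetric] SD by auto
  qed
qed

text \<open>By \<open>P3\<close> no face meets both \<open>C\<close> and \<open>D\<close>, so
  extension by zero creates no mixed terms in the coboundary. The empty face belongs to both sides,
  which is why p = 0 is excluded.\<close>

lemma unpart_pcycle:
  fixes g :: "'v set \<Rightarrow> 'k::field" and e :: 'k
  assumes fin: "finite C" "finite D" and disj: "C \<inter> D = {}" and W: "W = C \<union> D"
    and P: "\<And>T. T \<subseteq> C \<Longrightarrow> P (T \<union> D) \<longleftrightarrow> Q T"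
    and e: "\<And>T v. T \<subseteq> C \<Longrightarrow> v \<in> C \<Longrightarrow> ksgn \<iota> v (T \<union> D) = e * ksgn \<iota> v T"
    and P3: "\<And>S. S \<subseteq> W \<Longrightarrow> P S \<Longrightarrow> C \<subseteq> S \<or> D \<subseteq> S"
    and g: "g \<in> pcycle \<iota> C Q p" and p: "p \<noteq> 0"
  shows "unpart C D g \<in> pcycle \<iota> W P p"
proof -
  note pt = fin disj W P e
  have gp: "g \<in> pchain C Q p" "fdiff \<iota> C Q g = 0" using g by (auto simp: pcycle_def)
  have up: "unpart C D g \<in> pchain W P p"
    by (rule unpart_pchain[where P = P and Q = Q and e = e and \<iota> = \<iota>, OF pt gp(1)])
  have fW: "finite W" using fin W by simp
  have "fdiff \<iota> W P (unpart C D g) S = 0" for S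
  proof (rule ccontr)
    assume nz: "fdiff \<iota> W P (unpart C D g) S \<noteq> 0"
    then have S: "S \<subseteq> W" "P S" "card S + Suc p = card W"
      using fdiff_pchain[OF fW up, of \<iota>] by (auto simp: pchain_def)
    show False
    proof (cases "D \<subseteq> S")
      case True
      define T where "T = S - D"
      have T: "T \<subseteq> C" "S = T \<union> D" using S(1) W True by (auto simp: T_def)
      have "fdiff \<iota> W P (unpart C D g) S = part C D (fdiff \<iota> W P (unpart C D g)) T"
        using T by (simp add: part_def)
      also have "\<dots> = e * fdiff \<iota> C Q (part C D (unpart C D g)) T"
        by (simp only: part_fdiff[where P = P and Q = Q and e = e and \<iota> = \<iota> and f = "unpart C D g", OF pt])
      also have "\<dots> = 0"
        using part_unpart[where P = P and Q = Q and e = e and \<iota> = \<iota>, OF pt gp(1)] gp(2) by simp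
      finally show False using nz by simp
    next
      case False
      then have CS: "C \<subseteq> S" using P3 S by blast
      \<comment> \<open>Were \<open>D\<close> contained in \<open>insert v S\<close>, that set would
        be all of \<open>W\<close>, and the count for \<open>S\<close> would force p = 0.\<close>
      have "unpart C D g (insert v S) = 0" if v: "v \<in> W - S" for v
      proof (rule ccontr)
        assume "unpart C D g (insert v S) \<noteq> 0"
        then have "D \<subseteq> insert v S" by (auto simp: unpart_def split: if_splits)
        then have "W = insert v S" using CS W S(1) v by blast
        moreover have "finite S" using S(1) fW finite_subset by blast
        ultimately have "card W = Suc (card S)" using v by simp
        then show False using S(3) p by simp
      qed
      then show False using nz by (auto simp: fdiff_def split: if_splits)
    qed
  qed
  then show ?thesis using up by (simp add: pcycle_def fun_eq_iff)
qed

text \<open>For p > 0 cocycles and faces of a disjoint union add up. For p = 0 the two parts share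
  their single empty face, and this discrepancy is the extra class at p = 1. The simplex on
  \<open>A\<close> contributes nothing else.\<close>

lemma rhdim_join_simplex:
  fixes K :: "'k::field itself"
  assumes fin: "finite A" "finite B" and ne: "A \<noteq> {}" "B \<noteq> {}" and disj: "A \<inter> B = {}"
    and inj: "inj_on \<iota> A" and ord: "\<And>a b. a \<in> A \<Longrightarrow> b \<in> B \<Longrightarrow> \<iota> b < \<iota> a"
    and P1: "\<And>T. T \<subseteq> A \<Longrightarrow> P (T \<union> B)" and P2: "\<And>T. T \<subseteq> B \<Longrightarrow> P (T \<union> A) \<longleftrightarrow> Q T"
    and P3: "\<And>S. S \<subseteq> A \<union> B \<Longrightarrow> P S \<Longrightarrow> A \<subseteq> S \<or> B \<subseteq> S"
    and Q: "\<And>b. b \<in> B \<Longrightarrow> Q (B - {b})"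
  shows "rhdim TYPE('k) \<iota> (A \<union> B) P p = rhdim TYPE('k) \<iota> B Q p + of_bool (p = 1)"
proof -
  interpret ff: vector_space_pair "fsc :: 'k \<Rightarrow> ('v set \<Rightarrow> 'k) \<Rightarrow> _" "fsc :: 'k \<Rightarrow> ('v set \<Rightarrow> 'k) \<Rightarrow> _"
    by (intro vector_space_pair.intro vector_space_fsc)
  let ?W = "A \<union> B" and ?t = "\<lambda>_ :: 'a set. True"
  have fW: "finite ?W" using fin by simp
  have eA: "ksgn \<iota> v (T \<union> B) = (-1) ^ card B * (ksgn \<iota> v T :: 'k)" if "T \<subseteq> A" "v \<in> A" for T v
  proof -
    have "ksgn \<iota> v (B \<union> T) = (-1) ^ card B * (ksgn \<iota> v T :: 'k)"
      using that fin disj ord finite_subset[of T A] by (intro ksgn_Un_right) auto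
    then show ?thesis by (simp add: Un_commute)
  qed
  have eB: "ksgn \<iota> v (T \<union> A) = 1 * (ksgn \<iota> v T :: 'k)" if "T \<subseteq> B" "v \<in> B" for T v
    using that ord ksgn_Un_left[of A \<iota> v T, where 'b = 'k] by auto
  have PA: "P (T \<union> B) \<longleftrightarrow> True" if "T \<subseteq> A" for T using P1 that by blast
  have P3': "B \<subseteq> S \<or> A \<subseteq> S" if "S \<subseteq> ?W" "P S" for S using P3[OF that] by blast
  have disj': "B \<inter> A = {}" using disj by blast
  have W': "?W = B \<union> A" by blast
  note A = fin(1,2) disj refl PA eA
  note B = fin(2,1) disj' W' P2 eB
  have rB0: "part B A f = 0 \<and> part A B f = 0 \<Longrightarrow> f = 0" if f: "f \<in> pchain ?W P p" for f :: "'a set \<Rightarrow> 'k" and p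
  proof
    assume *: "part B A f = 0 \<and> part A B f = 0"
    fix S show "f S = 0 S"
    proof (rule ccontr)
      assume nz: "f S \<noteq> 0 S"
      then have S: "S \<subseteq> ?W" "P S" using f by (auto simp: pchain_def)
      from P3[OF this] show False
      proof
        assume "A \<subseteq> S"
        then have "S - A \<subseteq> B" "(S - A) \<union> A = S" using S by auto
        then have "part B A f (S - A) = f S" by (simp add: part_def)
        then show False using * nz by simp
      next
        assume "B \<subseteq> S"
        then have "S - B \<subseteq> A" "(S - B) \<union> B = S" using S by auto
        then have "part A B f (S - B) = f S" by (simp add: part_def)
        then show False using * nz by simp
      qed
    qed
  qed
  have cyc: "part C D f \<in> pcycle \<iota> C R p"
    if "part C D (fdiff \<iota> ?W P f) = (\<lambda>T. e * fdiff \<iota> C R (part C D f) T)" "e \<noteq> 0" "part C D f \<in> pchain C R p"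
      "f \<in> pcycle \<iota> ?W P p" for C D R p and e :: 'k and f :: "'a set \<Rightarrow> 'k"
  proof -
    have "part C D (fdiff \<iota> ?W P f) = 0" using that(4) by (simp add: pcycle_def part_def fun_eq_iff)
    then show ?thesis using that(1-3) by (simp add: pcycle_def fun_eq_iff)
  qed
  have z: "zdim TYPE('k) \<iota> ?W P p = zdim TYPE('k) \<iota> A ?t p + zdim TYPE('k) \<iota> B Q p" if p: "p \<noteq> 0" for p
  proof -
    let ?Z = "pcycle \<iota> ?W P p :: ('a set \<Rightarrow> 'k) set"
    \<comment> \<open>Restriction to \<open>B\<close> is onto the cocycles there, and its kernel
      \<open>?N\<close> is carried isomorphically to the cocycles on \<open>A\<close>.\<close>
    let ?N = "{f \<in> ?Z. part B A f = 0}"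
    have imB: "part B A ` ?Z = pcycle \<iota> B Q p"
    proof
      show "part B A ` ?Z \<subseteq> pcycle \<iota> B Q p"
      proof (rule image_subsetI)
        fix f :: "'a set \<Rightarrow> 'k" assume f: "f \<in> ?Z"
        then show "part B A f \<in> pcycle \<iota> B Q p"
          by (intro cyc[OF part_fdiff[where P = P and Q = Q and e = 1 and \<iota> = \<iota>, OF B]]
              part_pchain[where P = P and Q = Q and e = 1 and \<iota> = \<iota>, OF B]) (auto simp: pcycle_def)
      qed
      show "pcycle \<iota> B Q p \<subseteq> part B A ` ?Z"
      proof
        fix g :: "'a set \<Rightarrow> 'k" assume g: "g \<in> pcycle \<iota> B Q p"
        have "unpart B A g \<in> ?Z"
          by (rule unpart_pcycle[where P = P and Q = Q and e = 1 and \<iota> = \<iota>, OF B P3' g p])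
        moreover have "part B A (unpart B A g) = g"
          using g by (intro part_unpart[where P = P and Q = Q and e = 1 and \<iota> = \<iota>, OF B]) (auto simp: pcycle_def)
        ultimately show "g \<in> part B A ` ?Z" by (metis image_eqI)
      qed
    qed
    have imA: "part A B ` ?N = pcycle \<iota> A ?t p"
    proof
      show "part A B ` ?N \<subseteq> pcycle \<iota> A ?t p"
      proof (rule image_subsetI)
        fix f :: "'a set \<Rightarrow> 'k" assume f: "f \<in> ?N"
        then show "part A B f \<in> pcycle \<iota> A ?t p"
          by (intro cyc[OF part_fdiff[where P = P and Q = ?t and e = "(-1) ^ card B" and \<iota> = \<iota>, OF A]]
              part_pchain[where P = P and Q = ?t and e = "(-1) ^ card B" and \<iota> = \<iota>, OF A]) (auto simp: pcycle_def)
      qed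
      show "pcycle \<iota> A ?t p \<subseteq> part A B ` ?N"
      proof
        fix g :: "'a set \<Rightarrow> 'k" assume g: "g \<in> pcycle \<iota> A ?t p"
        have "unpart A B g \<in> ?Z"
          by (rule unpart_pcycle[where P = P and Q = ?t and e = "(-1) ^ card B" and \<iota> = \<iota>, OF A P3 g p])
        moreover have "part A B (unpart A B g) = g"
          using g by (intro part_unpart[where P = P and Q = ?t and e = "(-1) ^ card B" and \<iota> = \<iota>, OF A]) (auto simp: pcycle_def)
        moreover have "part B A (unpart A B g) = 0"
        proof
          fix T
          have gA: "g A = 0" using g p by (auto simp: pcycle_def pchain_def)
          have "T \<union> A - B = A" if "B \<subseteq> T \<union> A" "T \<subseteq> B" using that disj by blast
          then show "part B A (unpart A B g) T = 0 T" using gA by (auto simp: part_def unpart_def)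
        qed
        ultimately show "g \<in> part A B ` ?N" by (intro image_eqI[of _ _ "unpart A B g"]) auto
      qed
    qed
    have subN: "ff.vs1.subspace ?N"
      using ff.subspace_kernel_on[OF part_linear[of B A] pcycle_subspace[of \<iota> ?W P p] ff.vs1.subspace_single_0] by simp
    have "ff.vs1.dim ?Z = ff.vs1.dim ?N + ff.vs1.dim (part B A ` ?Z)"
      by (rule ff.rank_nullity[OF part_linear pcycle_subspace pcycle_findim[OF fW]])
    moreover have "ff.vs1.dim (part A B ` ?N) = ff.vs1.dim ?N"
    proof (rule ff.dim_image_inj[OF part_linear subN])
      show "ff.vs1.findim ?N" by (rule ff.vs1.findim_subset[OF pcycle_findim[OF fW, of \<iota> P p]]) auto
      show "f = 0" if "f \<in> ?N" "part A B f = 0" for f using that rB0[of f p] by (auto simp: pcycle_def)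
    qed
    ultimately show ?thesis unfolding imA imB by (simp add: zdim_def)
  qed
  have n: "fnum ?W P p = fnum A ?t p + fnum B Q p" if p: "p \<noteq> 0" for p
  proof -
    let ?FA = "{S. S \<subseteq> A \<and> True \<and> card S + p = card A}" and ?FB = "{S. S \<subseteq> B \<and> Q S \<and> card S + p = card B}"
    have cA: "card (S \<union> B) = card S + card B" if "S \<subseteq> A" for S
      using that fin disj finite_subset[of S A] by (intro card_Un_disjoint) auto
    have cB: "card (S \<union> A) = card S + card A" if "S \<subseteq> B" for S
      using that fin disj finite_subset[of S B] by (intro card_Un_disjoint) auto
    have "{S. S \<subseteq> ?W \<and> P S \<and> card S + p = card ?W} = (\<lambda>S. S \<union> B) ` ?FA \<union> (\<lambda>S. S \<union> A) ` ?FB"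
    proof (intro equalityI subsetI)
      fix S assume S: "S \<in> {S. S \<subseteq> ?W \<and> P S \<and> card S + p = card ?W}"
      then consider "A \<subseteq> S" | "B \<subseteq> S" using P3 by blast
      then show "S \<in> (\<lambda>S. S \<union> B) ` ?FA \<union> (\<lambda>S. S \<union> A) ` ?FB"
      proof cases
        case 1
        define T where "T = S - A"
        have T: "T \<subseteq> B" "S = T \<union> A" using S 1 by (auto simp: T_def)
        have "card (T \<union> A) + p = card A + card B" "P (T \<union> A)"
          using S cA[OF subset_refl] unfolding T(2) by auto
        then have "T \<in> ?FB" using P2[OF T(1)] cB[OF T(1)] T(1) by simp
        then show ?thesis using T(2) by blast
      next
        case 2
        define T where "T = S - B"
        have T: "T \<subseteq> A" "S = T \<union> B" using S 2 by (auto simp: T_def)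
        have "card (T \<union> B) + p = card A + card B"
          using S cA[OF subset_refl] unfolding T(2) by auto
        then have "T \<in> ?FA" using cA[OF T(1)] T(1) by simp
        then show ?thesis using T(2) by blast
      qed
    next
      fix S assume "S \<in> (\<lambda>S. S \<union> B) ` ?FA \<union> (\<lambda>S. S \<union> A) ` ?FB"
      then show "S \<in> {S. S \<subseteq> ?W \<and> P S \<and> card S + p = card ?W}"
        using P1 P2 cA cB cA[of A] by auto
    qed
    moreover have "((\<lambda>S. S \<union> B) ` ?FA) \<inter> ((\<lambda>S. S \<union> A) ` ?FB) = {}"
    proof (rule ccontr)
      assume "((\<lambda>S. S \<union> B) ` ?FA) \<inter> ((\<lambda>S. S \<union> A) ` ?FB) \<noteq> {}"
      then obtain S T where "S \<in> ?FA" "T \<in> ?FB" "S \<union> B = T \<union> A" by auto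
      then have "S = A" "card S + p = card A" using disj by auto
      then show False using p by simp
    qed
    moreover have "inj_on (\<lambda>S. S \<union> B) ?FA" "inj_on (\<lambda>S. S \<union> A) ?FB"
      using disj by (auto simp: inj_on_def)
    moreover have "finite ?FA" by (rule finite_subset[of _ "Pow A"]) (use fin in auto)
    moreover have "finite ?FB" by (rule finite_subset[of _ "Pow B"]) (use fin in auto)
    ultimately show ?thesis by (simp add: fnum_def card_Un_disjoint card_image)
  qed
  obtain a b where ab: "a \<in> A" "b \<in> B" using ne by blast
  have zW0: "zdim TYPE('k) \<iota> ?W P 0 = 0"
  proof (rule zdim_0[OF fW])
    show "a \<in> ?W" using ab by blast
    have "?W - {a} = (A - {a}) \<union> B" using ab disj by blast
    then show "P (?W - {a})" using P1[of "A - {a}"] by auto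
  qed
  have zA0: "zdim TYPE('k) \<iota> A ?t 0 = 0" by (rule zdim_0[OF fin(1) ab(1)]) simp
  have zB0: "zdim TYPE('k) \<iota> B Q 0 = 0" by (rule zdim_0[where P = Q, OF fin(2) ab(2) Q[OF ab(2)]])
  have QB: "Q B" using P2[of B] P1[of A] by (simp add: Un_commute)
  have nW0: "fnum ?W P 0 = 1" using P1[of A] fW by (intro fnum_0) auto
  have nA0: "fnum A ?t 0 = 1" using fin by (intro fnum_0) auto
  have nB0: "fnum B Q 0 = 1" using fin QB by (intro fnum_0) auto
  have rA: "rhdim TYPE('k) \<iota> A ?t p = 0" for p by (rule rhdim_simplex[OF fin(1) inj ne(1)])
  show ?thesis
  proof (cases p)
    case 0
    then show ?thesis by (simp add: rhdim_def zW0 zB0)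
  next
    case (Suc q)
    then show ?thesis
      using rA[of p] z[of p] z[of q] n[of q] by (cases q) (auto simp: rhdim_def zW0 zB0 zA0 nW0 nA0 nB0)
  qed
qed

section \<open>The Kuenneth formula\<close>

text \<open>The first complex is split by bases: \<open>U q\<close> represents cohomology,
  \<open>G q\<close> spans a complement of the cocycles, and \<open>d1\<close> of
  \<open>G (q - 1)\<close> gives the coboundaries. The second factor needs no such
  splitting.\<close>

locale join_complex =
  fixes \<iota> :: "'v \<Rightarrow> nat" and W1 W2 :: "'v set" and P1 P2 P :: "'v set \<Rightarrow> bool"
    and U G :: "nat \<Rightarrow> ('v set \<Rightarrow> 'k::field) set"
  assumes fin1: "finite W1" and fin2: "finite W2" and disj: "W1 \<inter> W2 = {}"
    and inj: "inj_on \<iota> (W1 \<union> W2)" and ord: "\<And>u v. u \<in> W1 \<Longrightarrow> v \<in> W2 \<Longrightarrow> \<iota> u < \<iota> v"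
    and P: "\<And>S. S \<subseteq> W1 \<union> W2 \<Longrightarrow> P S \<longleftrightarrow> P1 (S \<inter> W1) \<and> P2 (S \<inter> W2)"
    and up1: "\<And>S v. P1 S \<Longrightarrow> v \<in> W1 \<Longrightarrow> S \<subseteq> W1 \<Longrightarrow> P1 (insert v S)"
    and up2: "\<And>S v. P2 S \<Longrightarrow> v \<in> W2 \<Longrightarrow> S \<subseteq> W2 \<Longrightarrow> P2 (insert v S)"
    and U: "\<And>q. finite (U q)" "\<And>q. U q \<subseteq> pcycle \<iota> W1 P1 q"
    and G: "\<And>q. finite (G q)" "\<And>q. G q \<subseteq> pchain W1 P1 q"
    and spanG: "\<And>q x. x \<in> pchain W1 P1 q \<Longrightarrow> \<exists>\<beta>. x - (\<Sum>g\<in>G q. fsc (\<beta> g) g) \<in> pcycle \<iota> W1 P1 q"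
    and indG: "\<And>q \<beta> g. (\<Sum>g\<in>G q. fsc (\<beta> g) g) \<in> pcycle \<iota> W1 P1 q \<Longrightarrow> g \<in> G q \<Longrightarrow> \<beta> g = 0"
    and spanU: "\<And>q x. x \<in> pcycle \<iota> W1 P1 q \<Longrightarrow> \<exists>\<alpha>. x - (\<Sum>u\<in>U q. fsc (\<alpha> u) u) \<in>
        (if q = 0 then {0} else fdiff \<iota> W1 P1 ` pchain W1 P1 (q - 1))"
    and indU: "\<And>q \<alpha> u. (\<Sum>u\<in>U q. fsc (\<alpha> u) u) \<in>
        (if q = 0 then {0} else fdiff \<iota> W1 P1 ` pchain W1 P1 (q - 1)) \<Longrightarrow> u \<in> U q \<Longrightarrow> \<alpha> u = 0"
begin

abbreviation "W \<equiv> W1 \<union> W2"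
abbreviation "d1 \<equiv> fdiff \<iota> W1 P1 :: ('v set \<Rightarrow> 'k) \<Rightarrow> _"
abbreviation "d2 \<equiv> fdiff \<iota> W2 P2 :: ('v set \<Rightarrow> 'k) \<Rightarrow> _"
abbreviation "D \<equiv> fdiff \<iota> W P :: ('v set \<Rightarrow> 'k) \<Rightarrow> _"
abbreviation "C1 q \<equiv> pchain W1 P1 q :: ('v set \<Rightarrow> 'k) set"
abbreviation "C2 q \<equiv> pchain W2 P2 q :: ('v set \<Rightarrow> 'k) set"

definition tens :: "('v set \<Rightarrow> 'k) \<Rightarrow> ('v set \<Rightarrow> 'k) \<Rightarrow> 'v set \<Rightarrow> 'k" where
  "tens y c S = (if S \<subseteq> W then y (S \<inter> W1) * c (S \<inter> W2) else 0)"

text \<open>The sign of passing the part of \<open>S\<close> inside \<open>W1\<close>, which has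
  \<open>card W1 - q\<close> elements when its complement in \<open>W1\<close> is a face of size
  \<open>q\<close>.\<close>

definition sgn1 :: "nat \<Rightarrow> 'k" where
  "sgn1 q = (-1) ^ (card W1 - q)"

sublocale f: vector_space "fsc :: 'k \<Rightarrow> ('v set \<Rightarrow> 'k) \<Rightarrow> _"
  by (rule vector_space_fsc)

sublocale ff: vector_space_pair "fsc :: 'k \<Rightarrow> ('v set \<Rightarrow> 'k) \<Rightarrow> _" "fsc :: 'k \<Rightarrow> ('v set \<Rightarrow> 'k) \<Rightarrow> _" ..

lemma finW: "finite W" using fin1 fin2 by simp

lemma card_split: "S \<subseteq> W \<Longrightarrow> card S = card (S \<inter> W1) + card (S \<inter> W2)"
proof -
  assume "S \<subseteq> W"
  then have "S = (S \<inter> W1) \<union> (S \<inter> W2)" by blast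
  then show ?thesis using fin1 fin2 disj card_Un_disjoint[of "S \<inter> W1" "S \<inter> W2"] by fastforce
qed

lemma cardW: "card W = card W1 + card W2"
  using fin1 fin2 disj by (rule card_Un_disjoint)

lemma sgn1_sq [simp]: "sgn1 q * sgn1 q = 1" "sgn1 q * (sgn1 q * x) = x"
  by (simp_all add: sgn1_def mult.assoc[symmetric] power_mult_distrib[symmetric])

lemma tens_pchain:
  assumes "y \<in> C1 q" "c \<in> C2 r"
  shows "tens y c \<in> pchain W P (q + r)"
  unfolding pchain_def
proof (intro CollectI allI impI)
  fix S assume "tens y c S \<noteq> 0"
  then have S: "S \<subseteq> W" "y (S \<inter> W1) \<noteq> 0" "c (S \<inter> W2) \<noteq> 0" by (auto simp: tens_def split: if_splits)
  then have "P1 (S \<inter> W1) \<and> card (S \<inter> W1) + q = card W1" "P2 (S \<inter> W2) \<and> card (S \<inter> W2) + r = card W2"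
    using assms unfolding pchain_def by blast+
  then show "S \<subseteq> W \<and> P S \<and> card S + (q + r) = card W"
    using S(1) P[OF S(1)] card_split[OF S(1)] cardW by auto
qed

lemma tens_add: "tens y (c + c') = tens y c + tens y c'"
  by (simp add: tens_def fun_eq_iff distrib_left)

lemma tens_scale: "tens y (fsc a c) = fsc a (tens y c)"
  by (simp add: tens_def fun_eq_iff fscale_apply)

lemma tens_diff: "tens y (c - c') = tens y c - tens y c'"
  by (simp add: tens_def fun_eq_iff right_diff_distrib)

lemma tens_0 [simp]: "tens y 0 = 0" "tens 0 c = 0"
  by (simp_all add: tens_def fun_eq_iff)

text \<open>Vertices of \<open>W1\<close> come first: adding one of them ignores the
  \<open>W2\<close> part, while adding one of \<open>W2\<close> passes the whole \<open>W1\<close>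
  part and picks up \<open>sgn1\<close>.\<close>

lemma leibniz:
  assumes y: "y \<in> C1 q" and c: "c \<in> C2 r"
  shows "D (tens y c) = tens (d1 y) c + fsc (sgn1 q) (tens y (d2 c))"
proof
  fix S
  show "D (tens y c) S = (tens (d1 y) c + fsc (sgn1 q) (tens y (d2 c))) S"
  proof (cases "S \<subseteq> W \<and> P S")
    case False
    moreover have "tens (d1 y) c S = 0 \<and> tens y (d2 c) S = 0" if "S \<subseteq> W"
    proof -
      have "\<not> P1 (S \<inter> W1) \<or> \<not> P2 (S \<inter> W2)" using False that P by blast
      then have "(d1 y (S \<inter> W1) = 0 \<and> y (S \<inter> W1) = 0) \<or> (c (S \<inter> W2) = 0 \<and> d2 c (S \<inter> W2) = 0)"
        using y c by (auto simp: fdiff_def pchain_def)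
      then show ?thesis by (auto simp: tens_def)
    qed
    ultimately show ?thesis by (auto simp: fdiff_def fscale_apply tens_def)
  next
    case True
    let ?S1 = "S \<inter> W1" and ?S2 = "S \<inter> W2"
    have S12: "P1 ?S1" "P2 ?S2" "S = ?S1 \<union> ?S2" using True P by auto
    have fS: "finite ?S1" "finite ?S2" using fin1 fin2 by auto
    have WS: "W - S = (W1 - ?S1) \<union> (W2 - ?S2)" "(W1 - ?S1) \<inter> (W2 - ?S2) = {}" using disj by auto
    have "D (tens y c) S = (\<Sum>v\<in>W1 - ?S1. ksgn \<iota> v S * tens y c (insert v S)) +
        (\<Sum>v\<in>W2 - ?S2. ksgn \<iota> v S * tens y c (insert v S))"
      using True fin1 fin2 WS(2) by (simp only: fdiff_def simp_thms if_True WS(1)) (rule sum.union_disjoint, auto)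
    also have "(\<Sum>v\<in>W1 - ?S1. ksgn \<iota> v S * tens y c (insert v S)) =
        (\<Sum>v\<in>W1 - ?S1. ksgn \<iota> v ?S1 * y (insert v ?S1)) * c ?S2"
      unfolding sum_distrib_right
    proof (rule sum.cong[OF refl])
      fix v assume v: "v \<in> W1 - ?S1"
      have "insert v S \<inter> W1 = insert v ?S1" "insert v S \<inter> W2 = ?S2" using v disj by auto
      moreover have "ksgn \<iota> v (?S1 \<union> ?S2) = (ksgn \<iota> v ?S1 :: 'k)"
        using v ord by (intro ksgn_Un_left) auto
      ultimately show "ksgn \<iota> v S * tens y c (insert v S) = ksgn \<iota> v ?S1 * y (insert v ?S1) * c ?S2"
        using True v S12(3) by (auto simp: tens_def)
    qed
    also have "(\<Sum>v\<in>W2 - ?S2. ksgn \<iota> v S * tens y c (insert v S)) =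
        sgn1 q * (y ?S1 * (\<Sum>v\<in>W2 - ?S2. ksgn \<iota> v ?S2 * c (insert v ?S2)))"
      unfolding sum_distrib_left
    proof (rule sum.cong[OF refl])
      fix v assume v: "v \<in> W2 - ?S2"
      have *: "insert v S \<inter> W1 = ?S1" "insert v S \<inter> W2 = insert v ?S2" using v disj by auto
      have "ksgn \<iota> v (?S1 \<union> ?S2) = (-1) ^ card ?S1 * (ksgn \<iota> v ?S2 :: 'k)"
        using v ord fS disj by (intro ksgn_Un_right) auto
      moreover have "y ?S1 \<noteq> 0 \<Longrightarrow> card ?S1 = card W1 - q"
        using y by (auto simp: pchain_def)
      ultimately show "ksgn \<iota> v S * tens y c (insert v S) = sgn1 q * (y ?S1 * (ksgn \<iota> v ?S2 * c (insert v ?S2)))"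
        using True v S12(3) * by (cases "y ?S1 = 0") (auto simp: tens_def sgn1_def)
    qed
    finally show ?thesis using True S12(1,2) by (simp add: tens_def fdiff_def fscale_apply)
  qed
qed

lemma sum_degree:
  fixes N q :: nat
  assumes "\<And>q'. finite (A q')" "\<And>q' x. q' \<le> N \<Longrightarrow> q' \<noteq> q \<Longrightarrow> x \<in> A q' \<Longrightarrow> h (q', x) = (0 :: 'k)"
  shows "(\<Sum>x\<in>Sigma {..N} A. h x) = (if q \<le> N then \<Sum>x\<in>A q. h (q, x) else 0)"
proof -
  have "(\<Sum>x\<in>Sigma {..N} A. h x) = (\<Sum>q'\<le>N. \<Sum>x\<in>A q'. h (q', x))"
    using assms(1) by (subst sum.Sigma) auto
  also have "\<dots> = (\<Sum>q'\<le>N. if q' = q then \<Sum>x\<in>A q. h (q, x) else 0)"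
    using assms(2) by (intro sum.cong) auto
  finally show ?thesis by simp
qed

lemma d1_chain: "y \<in> C1 q \<Longrightarrow> d1 y \<in> C1 (Suc q)"
  by (rule fdiff_pchain[OF fin1])

lemma d1_d1: "y \<in> C1 q \<Longrightarrow> d1 (d1 y) = 0"
  using up1 inj by (intro fdiff_fdiff_pchain[OF fin1]) (auto intro: inj_on_subset)

lemma U_chain: "u \<in> U q \<Longrightarrow> u \<in> C1 q" "u \<in> U q \<Longrightarrow> d1 u = 0"
  using U(2) by (auto simp: pcycle_def)

lemma d1_sum: "d1 (\<Sum>x\<in>A. fsc (c x) (h x)) = (\<Sum>x\<in>A. fsc (c x) (d1 (h x)))"
  by (simp add: ff.linear_sum[OF fdiff_linear] ff.linear_scale[OF fdiff_linear])

lemma pchain_sum: "(\<And>x. x \<in> A \<Longrightarrow> h x \<in> C1 q) \<Longrightarrow> (\<Sum>x\<in>A. fsc (c x) (h x)) \<in> C1 q"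
  by (intro f.subspace_sum[OF pchain_subspace] f.subspace_scale[OF pchain_subspace])

lemma pchain_eval: "y \<in> C1 q \<Longrightarrow> card S + q \<noteq> card W1 \<Longrightarrow> y S = 0"
  by (auto simp: pchain_def)

text \<open>After separation by degree the coefficients disappear in turn: those of \<open>G\<close>
  because the rest is a cocycle, those of \<open>U\<close> because the rest is a coboundary, and
  finally those of \<open>d1 g\<close>, since a combination of \<open>G\<close> killed by
  \<open>d1\<close> is a cocycle.\<close>

lemma independent_scalars:
  assumes eq: "\<And>S. (\<Sum>x\<in>Sigma {..N} U. \<alpha> x * snd x S) + (\<Sum>x\<in>Sigma {..N} G. \<beta> x * snd x S) +
      (\<Sum>x\<in>Sigma {..N} G. \<gamma> x * d1 (snd x) S) = 0"
  shows "x \<in> Sigma {..N} U \<Longrightarrow> \<alpha> x = 0" "x \<in> Sigma {..N} G \<Longrightarrow> \<beta> x = 0 \<and> \<gamma> x = 0"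
proof -
  define fu where "fu q = (\<Sum>u\<in>U q. fsc (\<alpha> (q, u)) u)" for q
  define fg where "fg q = (\<Sum>g\<in>G q. fsc (\<beta> (q, g)) g)" for q
  define fd where "fd q = (\<Sum>g\<in>G q. fsc (\<gamma> (q, g)) g)" for q
  have fdC: "fd q \<in> C1 q" for q unfolding fd_def using G(2) by (intro pchain_sum) auto
  have fgC: "fg q \<in> C1 q" for q unfolding fg_def using G(2) by (intro pchain_sum) auto
  have fuZ: "fu q \<in> pcycle \<iota> W1 P1 q" for q
    unfolding fu_def using U(2) by (intro f.subspace_sum[OF pcycle_subspace] f.subspace_scale[OF pcycle_subspace]) auto
  \<comment> \<open>The size of \<open>S\<close> determines the only degree whose elements can be
    nonzero at \<open>S\<close>, so the relation between mixed degrees splits.\<close>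
  have degree: "(if q \<le> N then fu q + fg q else 0) + (if q \<noteq> 0 \<and> q - 1 \<le> N then d1 (fd (q - 1)) else 0) = 0" for q
  proof
    fix S
    show "((if q \<le> N then fu q + fg q else 0) + (if q \<noteq> 0 \<and> q - 1 \<le> N then d1 (fd (q - 1)) else 0)) S = 0 S"
    proof (cases "card S + q = card W1")
      case False
      have "fu q S = 0" "fg q S = 0" using fuZ[of q] fgC[of q] False pchain_eval by (auto simp: pcycle_def)
      moreover have "q \<noteq> 0 \<Longrightarrow> d1 (fd (q - 1)) S = 0"
        using d1_chain[OF fdC[of "q - 1"]] False pchain_eval by simp
      ultimately show ?thesis by (cases "q = 0") auto
    next
      case True
      have zu: "u S = 0" if "u \<in> U r" "r \<noteq> q" for u r
        using pchain_eval[OF U_chain(1)[OF that(1)], of S] True that(2) by simp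
      have zg: "g S = 0" if "g \<in> G r" "r \<noteq> q" for g r
        using pchain_eval[of g r S] G(2)[of r] True that by auto
      have 1: "(\<Sum>x\<in>Sigma {..N} U. \<alpha> x * snd x S) = (if q \<le> N then fu q S else 0)"
        using zu U(1)
        by (subst sum_degree[where q = q]) (auto simp: fu_def sum_fun_apply fscale_apply)
      have 2: "(\<Sum>x\<in>Sigma {..N} G. \<beta> x * snd x S) = (if q \<le> N then fg q S else 0)"
        using zg G(1)
        by (subst sum_degree[where q = q]) (auto simp: fg_def sum_fun_apply fscale_apply)
      have 3: "(\<Sum>x\<in>Sigma {..N} G. \<gamma> x * d1 (snd x) S) = (if q \<noteq> 0 \<and> q - 1 \<le> N then d1 (fd (q - 1)) S else 0)"
      proof -
        have zd: "d1 g S = 0" if "g \<in> G r" "Suc r \<noteq> q" for g r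
        proof -
          have "g \<in> C1 r" using that(1) G(2) by blast
          then show ?thesis using pchain_eval[OF d1_chain, of g r S] True that(2) by simp
        qed
        show ?thesis
        proof (cases q)
          case 0
          then have "d1 (snd x) S = 0" if "x \<in> Sigma {..N} G" for x
            using zd[of "snd x" "fst x"] that by auto
          then show ?thesis using 0 by simp
        next
          case (Suc q')
          then show ?thesis unfolding fd_def d1_sum using G(1) zd
            by (subst sum_degree[where q = q']) (auto simp: sum_fun_apply fscale_apply)
        qed
      qed
      show ?thesis using eq[of S] unfolding 1 2 3 by auto
    qed
  qed
  have dz: "d1 (fd q) \<in> pcycle \<iota> W1 P1 (Suc q)" for q
    using d1_chain[OF fdC] d1_d1[OF fdC] by (simp add: pcycle_def)
  have B: "\<beta> (q, g) = 0" if "q \<le> N" "g \<in> G q" for q g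
  proof -
    have "q - 1 \<le> N" using that(1) by simp
    then have "fg q + (fu q + (if q \<noteq> 0 then d1 (fd (q - 1)) else 0)) = 0"
      using degree[of q] that(1) by (simp only: if_True simp_thms add_ac)
    then have "fg q = - (fu q + (if q \<noteq> 0 then d1 (fd (q - 1)) else 0))"
      by (simp only: eq_neg_iff_add_eq_0)
    also have "\<dots> \<in> pcycle \<iota> W1 P1 q"
      using fuZ[of q] dz[of "q - 1"] f.subspace_0[OF pcycle_subspace]
      by (intro f.subspace_neg[OF pcycle_subspace] f.subspace_add[OF pcycle_subspace]) auto
    finally show ?thesis unfolding fg_def using indG[where q = q and \<beta> = "\<lambda>g. \<beta> (q, g)" and g = g] that(2) by simp
  qed
  then have fg0: "q \<le> N \<Longrightarrow> fg q = 0" for q by (simp add: fg_def)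
  have A: "\<alpha> (q, u) = 0" if "q \<le> N" "u \<in> U q" for q u
  proof -
    have "q - 1 \<le> N" using that(1) by simp
    then have "fu q + (if q \<noteq> 0 then d1 (fd (q - 1)) else 0) = 0"
      using degree[of q] that(1) fg0[OF that(1)] by (simp only: if_True simp_thms add_0_right)
    then have "fu q = - (if q \<noteq> 0 then d1 (fd (q - 1)) else 0)"
      by (simp only: eq_neg_iff_add_eq_0)
    also have "\<dots> = (if q \<noteq> 0 then - d1 (fd (q - 1)) else 0)" by simp
    also have "\<dots> \<in> (if q = 0 then {0} else d1 ` C1 (q - 1))"
      using fdC[of "q - 1"] f.subspace_neg[OF pchain_subspace, of "fd (q - 1)"] ff.linear_neg[OF fdiff_linear, of \<iota> W1 P1 "fd (q - 1)"]
      by (auto intro!: image_eqI[of _ _ "- fd (q - 1)"])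
    finally show ?thesis unfolding fu_def using indU[where q = q and \<alpha> = "\<lambda>u. \<alpha> (q, u)" and u = u] that(2) by simp
  qed
  then have fu0: "q \<le> N \<Longrightarrow> fu q = 0" for q by (simp add: fu_def)
  have C: "\<gamma> (q, g) = 0" if "q \<le> N" "g \<in> G q" for q g
  proof -
    have "d1 (fd q) = 0" using degree[of "Suc q"] that(1) fg0 fu0 by (auto split: if_splits)
    then have "fd q \<in> pcycle \<iota> W1 P1 q" using fdC by (simp add: pcycle_def)
    then show ?thesis unfolding fd_def using indG[where q = q and \<beta> = "\<lambda>g. \<gamma> (q, g)" and g = g] that(2) by simp
  qed
  show "x \<in> Sigma {..N} U \<Longrightarrow> \<alpha> x = 0" "x \<in> Sigma {..N} G \<Longrightarrow> \<beta> x = 0 \<and> \<gamma> x = 0"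
    using A B C by auto
qed

text \<open>Fixing the part \<open>S2\<close> inside \<open>W2\<close> turns the tensor relation
  into one with scalar coefficients.\<close>

lemma independent_tens:
  assumes eq: "\<And>S. (\<Sum>x\<in>Sigma {..N} U. tens (snd x) (a x) S) + (\<Sum>x\<in>Sigma {..N} G. tens (snd x) (b x) S) +
      (\<Sum>x\<in>Sigma {..N} G. tens (d1 (snd x)) (c x) S) = 0"
    and sup: "\<And>x S. x \<in> Sigma {..N} U \<Longrightarrow> a x S \<noteq> 0 \<Longrightarrow> S \<subseteq> W2"
      "\<And>x S. x \<in> Sigma {..N} G \<Longrightarrow> b x S \<noteq> 0 \<Longrightarrow> S \<subseteq> W2" "\<And>x S. x \<in> Sigma {..N} G \<Longrightarrow> c x S \<noteq> 0 \<Longrightarrow> S \<subseteq> W2"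
  shows "x \<in> Sigma {..N} U \<Longrightarrow> a x = 0" "x \<in> Sigma {..N} G \<Longrightarrow> b x = 0 \<and> c x = 0"
proof -
  have *: "(x \<in> Sigma {..N} U \<longrightarrow> a x S2 = 0) \<and> (x \<in> Sigma {..N} G \<longrightarrow> b x S2 = 0 \<and> c x S2 = 0)"
    if S2: "S2 \<subseteq> W2" for x S2
  proof -
    have "(\<Sum>x\<in>Sigma {..N} U. a x S2 * snd x S) + (\<Sum>x\<in>Sigma {..N} G. b x S2 * snd x S) +
        (\<Sum>x\<in>Sigma {..N} G. c x S2 * d1 (snd x) S) = 0" for S
    proof (cases "S \<subseteq> W1")
      case True
      have "(S \<union> S2) \<inter> W1 = S" "(S \<union> S2) \<inter> W2 = S2" "S \<union> S2 \<subseteq> W" using True S2 disj by auto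
      then show ?thesis using eq[of "S \<union> S2"] by (simp add: tens_def mult.commute)
    next
      case False
      have "snd x S = 0" if "x \<in> Sigma {..N} U" for x
      proof -
        have "snd x \<in> C1 (fst x)" using that U_chain(1)[of "snd x" "fst x"] by auto
        then show ?thesis using False unfolding pchain_def by blast
      qed
      moreover have "snd x S = 0" "d1 (snd x) S = 0" if "x \<in> Sigma {..N} G" for x
      proof -
        have "snd x \<in> C1 (fst x)" using that G(2)[of "fst x"] by auto
        then show "snd x S = 0" using False unfolding pchain_def by blast
        show "d1 (snd x) S = 0" using False by (simp add: fdiff_def)
      qed
      ultimately show ?thesis by simp
    qed
    from independent_scalars[where \<alpha> = "\<lambda>x. a x S2" and \<beta> = "\<lambda>x. b x S2" and \<gamma> = "\<lambda>x. c x S2", OF this]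
    show ?thesis by blast
  qed
  have out: "(x \<in> Sigma {..N} U \<longrightarrow> a x S2 = 0) \<and> (x \<in> Sigma {..N} G \<longrightarrow> b x S2 = 0 \<and> c x S2 = 0)"
    if "\<not> S2 \<subseteq> W2" for x S2 using sup that by blast
  show "x \<in> Sigma {..N} U \<Longrightarrow> a x = 0" "x \<in> Sigma {..N} G \<Longrightarrow> b x = 0 \<and> c x = 0"
    using * out by (auto simp: fun_eq_iff) metis+
qed

text \<open>Remove a combination of \<open>G\<close> to reach a cocycle, then one of
  \<open>U\<close> to reach a coboundary \<open>d1 w\<close>; expanding \<open>w\<close> modulo
  cocycles leaves only multiples of \<open>d1 g\<close>.\<close>

lemma expand:
  assumes x: "x \<in> C1 q"
  shows "\<exists>\<alpha> \<beta> \<gamma>. x = (\<Sum>u\<in>U q. fsc (\<alpha> u) u) + (\<Sum>g\<in>G q. fsc (\<beta> g) g) +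
    (if q = 0 then 0 else \<Sum>g\<in>G (q - 1). fsc (\<gamma> g) (d1 g))"
proof -
  obtain \<beta> where \<beta>: "x - (\<Sum>g\<in>G q. fsc (\<beta> g) g) \<in> pcycle \<iota> W1 P1 q" using spanG[OF x] by blast
  obtain \<alpha> where \<alpha>: "x - (\<Sum>g\<in>G q. fsc (\<beta> g) g) - (\<Sum>u\<in>U q. fsc (\<alpha> u) u) \<in>
      (if q = 0 then {0} else d1 ` C1 (q - 1))" (is "?r \<in> _") using spanU[OF \<beta>] by blast
  have "\<exists>\<gamma>. ?r = (if q = 0 then 0 else \<Sum>g\<in>G (q - 1). fsc (\<gamma> g) (d1 g))"
  proof (cases "q = 0")
    case True
    then show ?thesis using \<alpha> by simp
  next
    case False
    then obtain w where w: "w \<in> C1 (q - 1)" "?r = d1 w" using \<alpha> by auto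
    obtain \<gamma> where "w - (\<Sum>g\<in>G (q - 1). fsc (\<gamma> g) g) \<in> pcycle \<iota> W1 P1 (q - 1)" using spanG[OF w(1)] by blast
    then have "d1 (w - (\<Sum>g\<in>G (q - 1). fsc (\<gamma> g) g)) = 0" by (simp add: pcycle_def)
    then have "d1 w = (\<Sum>g\<in>G (q - 1). fsc (\<gamma> g) (d1 g))"
      by (simp add: ff.linear_diff[OF fdiff_linear] d1_sum)
    then show ?thesis using False w(2) by auto
  qed
  then obtain \<gamma> where "?r = (if q = 0 then 0 else \<Sum>g\<in>G (q - 1). fsc (\<gamma> g) (d1 g))" by blast
  then have "x = (\<Sum>u\<in>U q. fsc (\<alpha> u) u) + (\<Sum>g\<in>G q. fsc (\<beta> g) g) +
      (if q = 0 then 0 else \<Sum>g\<in>G (q - 1). fsc (\<gamma> g) (d1 g))"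
    by (simp only: diff_eq_eq add_ac)
  then show ?thesis by blast
qed

text \<open>For each fixed \<open>S2\<close> the column of \<open>F\<close> is a cochain on
  \<open>W1\<close> and has an expansion; its coefficients, as functions of \<open>S2\<close>, are
  cochains on \<open>W2\<close>.\<close>

lemma expand_tens:
  assumes F: "F \<in> pchain W P p"
  shows "\<exists>a b c. (\<forall>q u. q \<le> p \<longrightarrow> a (q, u) \<in> C2 (p - q)) \<and> (\<forall>q g. q \<le> p \<longrightarrow> b (q, g) \<in> C2 (p - q)) \<and>
    (\<forall>q g. q < p \<longrightarrow> c (q, g) \<in> C2 (p - 1 - q)) \<and> (\<forall>q g. \<not> q < p \<longrightarrow> c (q, g) = 0) \<and>
    (\<forall>S. F S = (\<Sum>x\<in>Sigma {..p} U. tens (snd x) (a x) S) + (\<Sum>x\<in>Sigma {..p} G. tens (snd x) (b x) S) +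
      (\<Sum>x\<in>Sigma {..p} G. tens (d1 (snd x)) (c x) S))"
proof -
  define col where "col q S2 = (\<lambda>S1. if S1 \<subseteq> W1 \<and> card S1 + q = card W1 then F (S1 \<union> S2) else 0)" for q S2
  have colC: "col q S2 \<in> C1 q" if S2: "S2 \<subseteq> W2" for q S2
    unfolding pchain_def
  proof (intro CollectI allI impI)
    fix S1 assume "col q S2 S1 \<noteq> 0"
    then have S1: "S1 \<subseteq> W1" "card S1 + q = card W1" "F (S1 \<union> S2) \<noteq> 0" by (auto simp: col_def split: if_splits)
    have "P (S1 \<union> S2)" "S1 \<union> S2 \<subseteq> W" using S1(3) F by (auto simp: pchain_def)
    moreover have "(S1 \<union> S2) \<inter> W1 = S1" using S1(1) S2 disj by blast
    ultimately show "S1 \<subseteq> W1 \<and> P1 S1 \<and> card S1 + q = card W1" using S1 P by auto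
  qed
  define R where "R q S2 \<alpha> \<beta> \<gamma> \<longleftrightarrow> (S2 \<subseteq> W2 \<longrightarrow> col q S2 = (\<Sum>u\<in>U q. fsc (\<alpha> u) u) + (\<Sum>g\<in>G q. fsc (\<beta> g) g) +
    (if q = 0 then 0 else \<Sum>g\<in>G (q - 1). fsc (\<gamma> g) (d1 g)))" for q S2 \<alpha> \<beta> \<gamma>
  have "\<exists>\<alpha> \<beta> \<gamma>. R q S2 \<alpha> \<beta> \<gamma>" for q S2
    unfolding R_def using expand[OF colC] by blast
  then obtain \<alpha> \<beta> \<gamma> where "\<And>q S2. R q S2 (\<alpha> q S2) (\<beta> q S2) (\<gamma> q S2)"
    by metis
  then have exp: "\<And>q S2. S2 \<subseteq> W2 \<Longrightarrow> col q S2 = (\<Sum>u\<in>U q. fsc (\<alpha> q S2 u) u) +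
      (\<Sum>g\<in>G q. fsc (\<beta> q S2 g) g) + (if q = 0 then 0 else \<Sum>g\<in>G (q - 1). fsc (\<gamma> q S2 g) (d1 g))"
    unfolding R_def by blast
  define ok where "ok r S2 \<longleftrightarrow> S2 \<subseteq> W2 \<and> P2 S2 \<and> card S2 + r = card W2" for r S2
  define a where "a x = (\<lambda>S2. if ok (p - fst x) S2 then \<alpha> (fst x) S2 (snd x) else 0)" for x :: "nat \<times> ('v set \<Rightarrow> 'k)"
  define b where "b x = (\<lambda>S2. if ok (p - fst x) S2 then \<beta> (fst x) S2 (snd x) else 0)" for x :: "nat \<times> ('v set \<Rightarrow> 'k)"
  \<comment> \<open>Here \<open>d1 g\<close> already has degree q + 1, hence the degree p - 1 - q
    and the value 0 when q = p.\<close>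
  define c where "c x = (\<lambda>S2. if fst x < p \<and> ok (p - 1 - fst x) S2 then \<gamma> (Suc (fst x)) S2 (snd x) else 0)"
    for x :: "nat \<times> ('v set \<Rightarrow> 'k)"
  have aC: "a (q, u) \<in> C2 (p - q)" and bC: "b (q, u) \<in> C2 (p - q)" for q u
    by (auto simp: a_def b_def ok_def pchain_def)
  have cC: "c (q, g) \<in> C2 (p - 1 - q)" for q g
    by (auto simp: c_def ok_def pchain_def)
  have c0: "c (q, g) = 0" if "\<not> q < p" for q g using that by (simp add: c_def fun_eq_iff)
  have tC: "tens (snd x) (a x) \<in> pchain W P p" if "x \<in> Sigma {..p} U" for x
    using that tens_pchain[OF U_chain(1) aC, of "snd x" "fst x" "fst x" "snd x"] by auto
  have tC2: "tens (snd x) (b x) \<in> pchain W P p" if "x \<in> Sigma {..p} G" for x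
    using that G(2)[of "fst x"] tens_pchain[OF _ bC, of "snd x" "fst x" "fst x" "snd x"] by auto
  have tC3: "tens (d1 (snd x)) (c x) \<in> pchain W P p" if "x \<in> Sigma {..p} G" for x
  proof (cases "fst x < p")
    case True
    then have "Suc (fst x) + (p - 1 - fst x) = p" by simp
    then show ?thesis using that G(2)[of "fst x"] tens_pchain[OF d1_chain cC, of "snd x" "fst x" "fst x" "snd x"] by auto
  next
    case False
    then have "c x = 0" using c0[of "fst x" "snd x"] by simp
    then show ?thesis using f.subspace_0[OF pchain_subspace] by simp
  qed
  have main: "F S = (\<Sum>x\<in>Sigma {..p} U. tens (snd x) (a x) S) + (\<Sum>x\<in>Sigma {..p} G. tens (snd x) (b x) S) +
      (\<Sum>x\<in>Sigma {..p} G. tens (d1 (snd x)) (c x) S)" for S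
  proof (cases "S \<subseteq> W \<and> P S \<and> card S + p = card W")
    case False
    have z: "h S = 0" if "h \<in> pchain W P p" for h :: "'v set \<Rightarrow> 'k" using that False by (auto simp: pchain_def)
    have "(\<Sum>x\<in>Sigma {..p} U. tens (snd x) (a x) S) = 0" by (rule sum.neutral) (use z[OF tC] in blast)
    moreover have "(\<Sum>x\<in>Sigma {..p} G. tens (snd x) (b x) S) = 0" by (rule sum.neutral) (use z[OF tC2] in blast)
    moreover have "(\<Sum>x\<in>Sigma {..p} G. tens (d1 (snd x)) (c x) S) = 0" by (rule sum.neutral) (use z[OF tC3] in blast)
    ultimately show ?thesis using z[OF F] by (simp only: add_0_right)
  next
    case True
    let ?S1 = "S \<inter> W1" and ?S2 = "S \<inter> W2"
    define q where "q = card W1 - card ?S1"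
    have le: "card ?S1 \<le> card W1" "card ?S2 \<le> card W2" using fin1 fin2 by (auto intro: card_mono)
    have q: "card ?S1 + q = card W1" using le by (simp add: q_def)
    have qp: "q \<le> p" "card ?S2 + (p - q) = card W2"
      using True card_split[of S] cardW q le by auto
    have ok: "ok (p - q) ?S2" using True P qp(2) by (auto simp: ok_def)
    have SS: "S = ?S1 \<union> ?S2" using True by blast
    have zu: "u ?S1 = 0" if "u \<in> U r" "r \<noteq> q" for u r
      using pchain_eval[OF U_chain(1)[OF that(1)], of ?S1] q that(2) by simp
    have zg: "g ?S1 = 0" if "g \<in> G r" "r \<noteq> q" for g r
      using pchain_eval[of g r ?S1] G(2)[of r] q that by auto
    have "F S = col q ?S2 ?S1" using q SS by (simp add: col_def)
    also have "\<dots> = (\<Sum>u\<in>U q. \<alpha> q ?S2 u * u ?S1) + (\<Sum>g\<in>G q. \<beta> q ?S2 g * g ?S1) +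
        (if q = 0 then 0 else \<Sum>g\<in>G (q - 1). \<gamma> q ?S2 g * d1 g ?S1)"
      by (subst exp) (auto simp: sum_fun_apply fscale_apply)
    also have "(\<Sum>u\<in>U q. \<alpha> q ?S2 u * u ?S1) = (\<Sum>x\<in>Sigma {..p} U. tens (snd x) (a x) S)"
      using U(1) zu qp ok True
      by (subst sum_degree[where q = q]) (auto simp: tens_def a_def mult.commute intro!: sum.cong)
    also have "(\<Sum>g\<in>G q. \<beta> q ?S2 g * g ?S1) = (\<Sum>x\<in>Sigma {..p} G. tens (snd x) (b x) S)"
      using G(1) zg qp ok True
      by (subst sum_degree[where q = q]) (auto simp: tens_def b_def mult.commute intro!: sum.cong)
    also have "(if q = 0 then 0 else \<Sum>g\<in>G (q - 1). \<gamma> q ?S2 g * d1 g ?S1) =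
        (\<Sum>x\<in>Sigma {..p} G. tens (d1 (snd x)) (c x) S)"
    proof -
      have z: "d1 g ?S1 = 0" if "g \<in> G r" "Suc r \<noteq> q" for g r
      proof -
        have "g \<in> C1 r" using that(1) G(2) by blast
        then show ?thesis using pchain_eval[OF d1_chain, of g r ?S1] q that(2) by simp
      qed
      show ?thesis
      proof (cases q)
        case 0
        then have "tens (d1 (snd x)) (c x) S = 0" if "x \<in> Sigma {..p} G" for x
          using that z[of "snd x" "fst x"] by (auto simp: tens_def)
        then show ?thesis using 0 by simp
      next
        case (Suc r)
        then have r: "r < p" "p - 1 - r = p - q" using qp(1) by auto
        have "(\<Sum>x\<in>Sigma {..p} G. tens (d1 (snd x)) (c x) S) = (\<Sum>g\<in>G r. tens (d1 g) (c (r, g)) S)"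
          using G(1) z Suc r(1) by (subst sum_degree[where q = r]) (auto simp: tens_def)
        also have "\<dots> = (\<Sum>g\<in>G r. \<gamma> q ?S2 g * d1 g ?S1)"
          using True r ok Suc by (intro sum.cong) (auto simp: tens_def c_def)
        finally show ?thesis using Suc by simp
      qed
    qed
    finally show ?thesis .
  qed
  show ?thesis
    by (intro exI[of _ a] exI[of _ b] exI[of _ c] conjI allI impI aC bC cC c0 main)
qed

end

section \<open>Cocycles of the join\<close>

lemma fun_prodD: "f \<in> fun_prod I U \<Longrightarrow> i \<in> I \<Longrightarrow> f i \<in> U i"
  by (simp add: fun_prod_def)

lemma fun_prod_outside: "f \<in> fun_prod I U \<Longrightarrow> i \<notin> I \<Longrightarrow> f i = 0"
  by (simp add: fun_prod_def)

context join_complex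
begin

lemma G_chain: "g \<in> G q \<Longrightarrow> g \<in> C1 q"
  using G(2) by blast

lemma up: "P S \<Longrightarrow> v \<in> W \<Longrightarrow> S \<subseteq> W \<Longrightarrow> P (insert v S)"
proof -
  assume S: "P S" "v \<in> W" "S \<subseteq> W"
  have "P1 (S \<inter> W1)" "P2 (S \<inter> W2)" using S P by auto
  moreover have "insert v S \<inter> W1 = (if v \<in> W1 then insert v (S \<inter> W1) else S \<inter> W1)"
    "insert v S \<inter> W2 = (if v \<in> W2 then insert v (S \<inter> W2) else S \<inter> W2)" by auto
  ultimately show ?thesis using P[of "insert v S"] S up1[of "S \<inter> W1" v] up2[of "S \<inter> W2" v] by auto
qed

lemma D_D: "y \<in> pchain W P q \<Longrightarrow> D (D y) = 0"
  using up by (intro fdiff_fdiff_pchain[OF finW inj]) auto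

lemma d2_chain: "y \<in> C2 q \<Longrightarrow> d2 y \<in> C2 (Suc q)"
  by (rule fdiff_pchain[OF fin2])

lemma D_tens_cycle: "u \<in> U q \<Longrightarrow> c \<in> C2 r \<Longrightarrow> D (tens u c) = fsc (sgn1 q) (tens u (d2 c))"
  using leibniz[OF U_chain(1)] U_chain(2) by simp

text \<open>A parametrisation of the cocycles of the join: representatives of cohomology tensor
  cocycles, plus coboundaries of \<open>G\<close> tensor arbitrary cochains. The second sum stops
  before \<open>p\<close> because \<open>D\<close> raises the degree by one.\<close>

definition assemble :: "nat \<Rightarrow> ((nat \<times> ('v set \<Rightarrow> 'k)) + (nat \<times> ('v set \<Rightarrow> 'k)) \<Rightarrow> 'v set \<Rightarrow> 'k) \<Rightarrow> 'v set \<Rightarrow> 'k" where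
  "assemble p c = (\<Sum>x\<in>Sigma {..p} U. tens (snd x) (c (Inl x))) +
     (\<Sum>x\<in>Sigma {..<p} G. D (tens (snd x) (c (Inr x))))"

definition coeff_space :: "nat \<Rightarrow> (nat \<times> ('v set \<Rightarrow> 'k)) + (nat \<times> ('v set \<Rightarrow> 'k)) \<Rightarrow> ('v set \<Rightarrow> 'k) set" where
  "coeff_space p = case_sum (\<lambda>x. pcycle \<iota> W2 P2 (p - fst x)) (\<lambda>x. C2 (p - 1 - fst x))"

abbreviation "cindex p \<equiv> Sigma {..p} U <+> Sigma {..<p} G"

lemma assemble_linear: "Vector_Spaces.linear qsc fsc (assemble p)"
proof -
  have "assemble p (x + y) = assemble p x + assemble p y" for x y
    by (simp add: assemble_def tens_add ff.linear_add[OF fdiff_linear] sum.distrib)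
  moreover have "assemble p (qsc a x) = fsc a (assemble p x)" for a x
    by (simp add: assemble_def fscale_apply[of fsc] tens_scale ff.linear_scale[OF fdiff_linear]
        f.scale_right_distrib f.scale_sum_right)
  ultimately show ?thesis
    unfolding Vector_Spaces.linear_iff using vector_space_qsc vector_space_fsc by blast
qed

lemma assemble_cycle:
  assumes c: "c \<in> fun_prod (cindex p) (coeff_space p)"
  shows "assemble p c \<in> pcycle \<iota> W P p"
  unfolding assemble_def
proof (intro f.subspace_add[OF pcycle_subspace] f.subspace_sum[OF pcycle_subspace])
  fix x assume x: "x \<in> Sigma {..p} U"
  then have "c (Inl x) \<in> pcycle \<iota> W2 P2 (p - fst x)"
    using fun_prodD[OF c, of "Inl x"] by (auto simp: coeff_space_def)
  then have cx: "c (Inl x) \<in> C2 (p - fst x)" "d2 (c (Inl x)) = 0" by (auto simp: pcycle_def)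
  have u: "snd x \<in> U (fst x)" "fst x \<le> p" using x by auto
  show "tens (snd x) (c (Inl x)) \<in> pcycle \<iota> W P p"
    using tens_pchain[OF U_chain(1)[OF u(1)] cx(1)] u(2) D_tens_cycle[OF u(1) cx(1)] cx(2)
    by (simp add: pcycle_def f.scale_zero_right)
next
  fix x assume x: "x \<in> Sigma {..<p} G"
  then have cx: "c (Inr x) \<in> C2 (p - 1 - fst x)"
    using fun_prodD[OF c, of "Inr x"] by (auto simp: coeff_space_def)
  have g: "snd x \<in> C1 (fst x)" "fst x < p" using x G_chain by auto
  have t: "tens (snd x) (c (Inr x)) \<in> pchain W P (p - 1)"
    using tens_pchain[OF g(1) cx] g(2) by simp
  have "D (tens (snd x) (c (Inr x))) \<in> pchain W P p"
    using fdiff_pchain[OF finW t, of \<iota>] g(2) by simp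
  then show "D (tens (snd x) (c (Inr x))) \<in> pcycle \<iota> W P p"
    using D_D[OF t] by (simp add: pcycle_def)
qed

lemma D_tens_sum: "(\<Sum>x\<in>A. D (tens (snd x) (c x))) S =
    (\<Sum>x\<in>A. tens (d1 (snd x)) (c x) S) + (\<Sum>x\<in>A. tens (snd x) (fsc (sgn1 (fst x)) (d2 (c x))) S)"
  if "\<And>x. x \<in> A \<Longrightarrow> snd x \<in> C1 (fst x) \<and> (\<exists>r. c x \<in> C2 r)" for c :: "nat \<times> ('v set \<Rightarrow> 'k) \<Rightarrow> _" and A S
proof -
  have "D (tens (snd x) (c x)) S = tens (d1 (snd x)) (c x) S + tens (snd x) (fsc (sgn1 (fst x)) (d2 (c x))) S"
    if x: "x \<in> A" for x
  proof -
    obtain r where "c x \<in> C2 r" "snd x \<in> C1 (fst x)" using \<open>\<And>x. x \<in> A \<Longrightarrow> _\<close>[OF x] by blast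
    then show ?thesis by (simp add: leibniz tens_scale)
  qed
  then show ?thesis by (simp add: sum_fun_apply sum.distrib)
qed

text \<open>By the Leibniz rule each coboundary term contains its coefficient next to
  \<open>d1 g\<close>, and these tensors are independent of all others.\<close>

lemma assemble_inj:
  assumes c: "c \<in> fun_prod (cindex p) (coeff_space p)" and 0: "assemble p c = 0"
  shows "c = 0"
proof -
  have out: "c i = 0" if "i \<notin> cindex p" for i
    by (rule fun_prod_outside[OF c that])
  have inl: "c (Inl x) \<in> C2 (p - fst x)" if "x \<in> Sigma {..p} U" for x
    using fun_prodD[OF c, of "Inl x"] that by (auto simp: coeff_space_def pcycle_def)
  have inr: "c (Inr x) \<in> C2 (p - 1 - fst x)" for x
  proof (cases "x \<in> Sigma {..<p} G")
    case True
    then show ?thesis using fun_prodD[OF c, of "Inr x"] by (auto simp: coeff_space_def)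
  next
    case False
    then have "c (Inr x) = 0" by (intro out) auto
    then show ?thesis using f.subspace_0[OF pchain_subspace] by simp
  qed
  have sub: "Sigma {..<p} G \<subseteq> Sigma {..p} G" "finite (Sigma {..p} G)" using G(1) by auto
  \<comment> \<open>The coefficients at q = p are 0, so both sums may run over the same index set
    before independence is applied.\<close>
  have extend: "(\<Sum>x\<in>Sigma {..<p} G. D (tens (snd x) (c (Inr x)))) = (\<Sum>x\<in>Sigma {..p} G. D (tens (snd x) (c (Inr x))))"
  proof (rule sum.mono_neutral_left[OF sub(2,1)])
    show "\<forall>x\<in>Sigma {..p} G - Sigma {..<p} G. D (tens (snd x) (c (Inr x))) = 0"
    proof
      fix x assume "x \<in> Sigma {..p} G - Sigma {..<p} G"
      then have "c (Inr x) = 0" by (intro out) auto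
      then show "D (tens (snd x) (c (Inr x))) = 0" by (simp add: ff.linear_0[OF fdiff_linear])
    qed
  qed
  have G': "snd x \<in> C1 (fst x) \<and> (\<exists>r. c (Inr x) \<in> C2 r)" if "x \<in> Sigma {..p} G" for x
    using that G_chain inr[of x] by auto
  have "(\<Sum>x\<in>Sigma {..p} U. tens (snd x) (c (Inl x)) S) +
      (\<Sum>x\<in>Sigma {..p} G. tens (snd x) (fsc (sgn1 (fst x)) (d2 (c (Inr x)))) S) +
      (\<Sum>x\<in>Sigma {..p} G. tens (d1 (snd x)) (c (Inr x)) S) = 0" for S
    using fun_cong[OF 0, of S] D_tens_sum[of "Sigma {..p} G" "\<lambda>x. c (Inr x)" S, OF G']
    unfolding assemble_def extend by (simp add: sum_fun_apply add_ac)
  note ind = independent_tens[where a = "\<lambda>x. c (Inl x)" and c = "\<lambda>x. c (Inr x)" and N = p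
      and b = "\<lambda>x. fsc (sgn1 (fst x)) (d2 (c (Inr x)))", OF this]
  have s1: "\<And>x S. x \<in> Sigma {..p} U \<Longrightarrow> c (Inl x) S \<noteq> 0 \<Longrightarrow> S \<subseteq> W2" using inl unfolding pchain_def by blast
  have s2: "\<And>x S. x \<in> Sigma {..p} G \<Longrightarrow> fsc (sgn1 (fst x)) (d2 (c (Inr x))) S \<noteq> 0 \<Longrightarrow> S \<subseteq> W2"
    by (auto simp: fscale_apply fdiff_def split: if_splits)
  have s3: "\<And>x S. x \<in> Sigma {..p} G \<Longrightarrow> c (Inr x) S \<noteq> 0 \<Longrightarrow> S \<subseteq> W2" using inr unfolding pchain_def by blast
  have zl: "c (Inl x) = 0" if "x \<in> Sigma {..p} U" for x using that
    by (rule ind(1)[rotated 3]) (erule (1) s1 | erule (1) s2 | erule (1) s3)+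
  have zr: "c (Inr x) = 0" if "x \<in> Sigma {..p} G" for x
  proof -
    have "fsc (sgn1 (fst x)) (d2 (c (Inr x))) = 0 \<and> c (Inr x) = 0" using that
      by (rule ind(2)[rotated 3]) (erule (1) s1 | erule (1) s2 | erule (1) s3)+
    then show ?thesis ..
  qed
  have "c i = 0" for i
  proof (cases "i \<in> cindex p")
    case True
    then show ?thesis using zl zr by auto
  qed (rule out)
  then show ?thesis by (simp add: fun_eq_iff)
qed

text \<open>After subtracting the coboundary of the terms g tensor c, only u tensor a and g tensor
  b' remain. Being a cocycle forces b' = 0, as b' reappears next to \<open>d1 g\<close>, and then
  \<open>d2 a = 0\<close>.\<close>

lemma assemble_surj:
  assumes F: "F \<in> pcycle \<iota> W P p"
  shows "F \<in> assemble p ` fun_prod (cindex p) (coeff_space p)"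
proof -
  have FC: "F \<in> pchain W P p" "D F = 0" using F by (auto simp: pcycle_def)
  obtain a b c where abc': "\<forall>q u. q \<le> p \<longrightarrow> a (q, u) \<in> C2 (p - q)" "\<forall>q g. q \<le> p \<longrightarrow> b (q, g) \<in> C2 (p - q)"
    "\<forall>q g. q < p \<longrightarrow> c (q, g) \<in> C2 (p - 1 - q)" "\<forall>q g. \<not> q < p \<longrightarrow> c (q, g) = 0"
    "\<forall>S. F S = (\<Sum>x\<in>Sigma {..p} U. tens (snd x) (a x) S) + (\<Sum>x\<in>Sigma {..p} G. tens (snd x) (b x) S) +
      (\<Sum>x\<in>Sigma {..p} G. tens (d1 (snd x)) (c x) S)"
    using expand_tens[OF FC(1)] by (elim exE conjE) (rule that; assumption)
  note abc = abc'[rule_format]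
  define b' where "b' x = b x - fsc (sgn1 (fst x)) (d2 (c x))" for x
  have cC: "c x \<in> C2 (p - 1 - fst x)" for x
    using abc(3)[of "fst x" "snd x"] abc(4)[of "fst x" "snd x"] f.subspace_0[OF pchain_subspace] by (cases "fst x < p") auto
  have dc: "d2 (c x) \<in> C2 (p - fst x)" if "fst x \<le> p" for x
  proof (cases "fst x < p")
    case True
    then have "Suc (p - 1 - fst x) = p - fst x" by simp
    then show ?thesis using d2_chain[OF cC[of x]] by (simp only:)
  next
    case False
    then have "c x = 0" using abc(4)[of "fst x" "snd x"] by simp
    then show ?thesis using f.subspace_0[OF pchain_subspace] by (simp add: ff.linear_0[OF fdiff_linear])
  qed
  have b'C: "b' x \<in> C2 (p - fst x)" if "fst x \<le> p" for x
    unfolding b'_def using abc(2)[of "fst x" "snd x"] dc[of x] that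
    by (intro f.subspace_diff[OF pchain_subspace] f.subspace_scale[OF pchain_subspace]) auto
  have aC: "a x \<in> C2 (p - fst x)" if "fst x \<le> p" for x using abc(1)[of "fst x" "snd x"] that by simp
  have G': "snd x \<in> C1 (fst x) \<and> (\<exists>r. c x \<in> C2 r)" if "x \<in> Sigma {..p} G" for x
    using that G_chain cC[of x] by auto
  let ?B = "\<Sum>x\<in>Sigma {..p} G. D (tens (snd x) (c x))"
  have F': "F - ?B = (\<Sum>x\<in>Sigma {..p} U. tens (snd x) (a x)) + (\<Sum>x\<in>Sigma {..p} G. tens (snd x) (b' x))"
  proof
    fix S
    show "(F - ?B) S = ((\<Sum>x\<in>Sigma {..p} U. tens (snd x) (a x)) + (\<Sum>x\<in>Sigma {..p} G. tens (snd x) (b' x))) S"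
      using D_tens_sum[of "Sigma {..p} G" c S, OF G'] abc(5)[of S]
      by (simp add: sum_fun_apply b'_def tens_diff sum_subtractf)
  qed
  have tG: "tens (snd x) (c x) \<in> pchain W P (p - 1)" if "x \<in> Sigma {..<p} G" for x
    using tens_pchain[of "snd x" "fst x" "c x", OF _ cC] that G_chain by auto
  have DDG: "D (D (tens (snd x) (c x))) = 0" if x: "x \<in> Sigma {..p} G" for x
  proof (cases "fst x < p")
    case True
    then show ?thesis using x by (intro D_D[OF tG]) auto
  next
    case False
    then have "c x = 0" using abc(4)[of "fst x" "snd x"] by simp
    then show ?thesis by (simp add: ff.linear_0[OF fdiff_linear])
  qed
  have "D (F - ?B) = 0"
    using FC(2) DDG by (simp add: ff.linear_diff[OF fdiff_linear] ff.linear_sum[OF fdiff_linear])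
  then have D0: "(\<Sum>x\<in>Sigma {..p} U. D (tens (snd x) (a x))) + (\<Sum>x\<in>Sigma {..p} G. D (tens (snd x) (b' x))) = 0"
    unfolding F' by (simp add: ff.linear_add[OF fdiff_linear] ff.linear_sum[OF fdiff_linear])
  have U': "D (tens (snd x) (a x)) = tens (snd x) (fsc (sgn1 (fst x)) (d2 (a x)))" if "x \<in> Sigma {..p} U" for x
    using that D_tens_cycle[of "snd x" "fst x" "a x", OF _ aC] by (auto simp: tens_scale)
  have G'': "snd x \<in> C1 (fst x) \<and> (\<exists>r. b' x \<in> C2 r)" if "x \<in> Sigma {..p} G" for x
    using that G_chain b'C[of x] by auto
  have "(\<Sum>x\<in>Sigma {..p} U. tens (snd x) (fsc (sgn1 (fst x)) (d2 (a x))) S) +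
      (\<Sum>x\<in>Sigma {..p} G. tens (snd x) (fsc (sgn1 (fst x)) (d2 (b' x))) S) +
      (\<Sum>x\<in>Sigma {..p} G. tens (d1 (snd x)) (b' x) S) = 0" for S
    using fun_cong[OF D0, of S] D_tens_sum[of "Sigma {..p} G" b' S, OF G''] U'
    by (simp add: sum_fun_apply add_ac)
  note ind = independent_tens[where a = "\<lambda>x. fsc (sgn1 (fst x)) (d2 (a x))" and c = b' and N = p
      and b = "\<lambda>x. fsc (sgn1 (fst x)) (d2 (b' x))", OF this]
  have s1: "\<And>x S. x \<in> Sigma {..p} U \<Longrightarrow> fsc (sgn1 (fst x)) (d2 (a x)) S \<noteq> 0 \<Longrightarrow> S \<subseteq> W2"
    "\<And>x S. x \<in> Sigma {..p} G \<Longrightarrow> fsc (sgn1 (fst x)) (d2 (b' x)) S \<noteq> 0 \<Longrightarrow> S \<subseteq> W2"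
    by (auto simp: fscale_apply fdiff_def split: if_splits)
  have s3: "\<And>x S. x \<in> Sigma {..p} G \<Longrightarrow> b' x S \<noteq> 0 \<Longrightarrow> S \<subseteq> W2"
  proof -
    fix x S assume x: "x \<in> Sigma {..p} G" "b' x S \<noteq> 0"
    then have "b' x \<in> C2 (p - fst x)" by (intro b'C) auto
    then show "S \<subseteq> W2" using x(2) unfolding pchain_def by blast
  qed
  have b'0: "b' x = 0" if "x \<in> Sigma {..p} G" for x
  proof -
    have "fsc (sgn1 (fst x)) (d2 (b' x)) = 0 \<and> b' x = 0" using that
      by (rule ind(2)[rotated 3]) (erule (1) s1(1) | erule (1) s1(2) | erule (1) s3)+
    then show ?thesis ..
  qed
  have a0: "d2 (a x) = 0" if "x \<in> Sigma {..p} U" for x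
  proof -
    have "fsc (sgn1 (fst x)) (d2 (a x)) = 0" using that
      by (rule ind(1)[rotated 3]) (erule (1) s1(1) | erule (1) s1(2) | erule (1) s3)+
    then show ?thesis by (simp add: sgn1_def)
  qed
  define C where "C i = (case i of Inl x \<Rightarrow> if x \<in> Sigma {..p} U then a x else 0
      | Inr x \<Rightarrow> if x \<in> Sigma {..<p} G then c x else 0)" for i
  have "C \<in> fun_prod (cindex p) (coeff_space p)"
    unfolding fun_prod_def
  proof (intro CollectI allI)
    fix i
    show "if i \<in> cindex p then C i \<in> coeff_space p i else C i = 0"
      using aC a0 cC by (cases i) (auto simp: C_def coeff_space_def pcycle_def)
  qed
  moreover have "F = assemble p C"
  proof -
    have "?B = (\<Sum>x\<in>Sigma {..<p} G. D (tens (snd x) (c x)))"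
    proof (rule sum.mono_neutral_right)
      show "\<forall>x\<in>Sigma {..p} G - Sigma {..<p} G. D (tens (snd x) (c x)) = 0"
        using abc(4) by (auto simp: ff.linear_0[OF fdiff_linear])
    qed (use G(1) in auto)
    moreover have "F = (\<Sum>x\<in>Sigma {..p} U. tens (snd x) (a x)) + ?B"
      using F' b'0 by (simp add: diff_eq_eq)
    ultimately show ?thesis by (simp add: assemble_def C_def cong: sum.cong)
  qed
  ultimately show ?thesis by blast
qed

lemma zdim_total:
  "zdim TYPE('k) \<iota> W P p = (\<Sum>q\<le>p. card (U q) * zdim TYPE('k) \<iota> W2 P2 (p - q)) +
     (\<Sum>q<p. card (G q) * fnum W2 P2 (p - 1 - q))"
proof -
  interpret q: vector_space "qsc :: 'k \<Rightarrow> ((nat \<times> ('v set \<Rightarrow> 'k)) + (nat \<times> ('v set \<Rightarrow> 'k)) \<Rightarrow> 'v set \<Rightarrow> 'k) \<Rightarrow> _"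
    by (rule vector_space_qsc)
  interpret qf: vector_space_pair "qsc :: 'k \<Rightarrow> ((nat \<times> ('v set \<Rightarrow> 'k)) + (nat \<times> ('v set \<Rightarrow> 'k)) \<Rightarrow> 'v set \<Rightarrow> 'k) \<Rightarrow> _"
    "fsc :: 'k \<Rightarrow> ('v set \<Rightarrow> 'k) \<Rightarrow> _" ..
  let ?L = "fun_prod (cindex p) (coeff_space p)"
  have finI: "finite (cindex p)" using U(1) G(1) by auto
  have sp: "f.subspace (coeff_space p i) \<and> f.findim (coeff_space p i)" for i
    using pcycle_subspace pcycle_findim[OF fin2] pchain_subspace pchain_findim_dim(1)[OF fin2]
    by (cases i) (auto simp: coeff_space_def)
  have L: "q.findim ?L" "q.dim ?L = (\<Sum>i\<in>cindex p. f.dim (coeff_space p i))"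
    using findim_dim_fun_prod[OF vector_space_fsc finI, of "coeff_space p"] sp by blast+
  have subL: "q.subspace ?L" by (rule subspace_fun_prod[OF vector_space_fsc]) (use sp in blast)
  have "assemble p ` ?L = pcycle \<iota> W P p" using assemble_cycle assemble_surj by blast
  then have "zdim TYPE('k) \<iota> W P p = f.dim (assemble p ` ?L)" by (simp add: zdim_def)
  also have "\<dots> = q.dim ?L"
    by (rule qf.dim_image_inj[OF assemble_linear subL L(1)]) (rule assemble_inj)
  also have "\<dots> = (\<Sum>x\<in>Sigma {..p} U. zdim TYPE('k) \<iota> W2 P2 (p - fst x)) + (\<Sum>x\<in>Sigma {..<p} G. fnum W2 P2 (p - 1 - fst x))"
    unfolding L(2) using U(1) G(1)
    by (subst sum.Plus) (auto simp: coeff_space_def zdim_def pchain_findim_dim(2)[OF fin2])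
  also have "(\<Sum>x\<in>Sigma {..p} U. zdim TYPE('k) \<iota> W2 P2 (p - fst x)) = (\<Sum>q\<le>p. card (U q) * zdim TYPE('k) \<iota> W2 P2 (p - q))"
    using U(1) sum.Sigma[of "{..p}" U "\<lambda>q u. zdim TYPE('k) \<iota> W2 P2 (p - q)"] by (simp add: case_prod_unfold)
  also have "(\<Sum>x\<in>Sigma {..<p} G. fnum W2 P2 (p - 1 - fst x)) = (\<Sum>q<p. card (G q) * fnum W2 P2 (p - 1 - q))"
    using G(1) sum.Sigma[of "{..<p}" G "\<lambda>q u. fnum W2 P2 (p - 1 - q)"] by (simp add: case_prod_unfold)
  finally show ?thesis .
qed

lemma fnum_total: "fnum W P p = (\<Sum>q\<le>p. fnum W1 P1 q * fnum W2 P2 (p - q))"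
proof -
  let ?A = "\<lambda>q. {S. S \<subseteq> W1 \<and> P1 S \<and> card S + q = card W1}"
  let ?B = "\<lambda>q. {S. S \<subseteq> W2 \<and> P2 S \<and> card S + q = card W2}"
  have fin: "finite (?A q \<times> ?B r)" for q r
    by (rule finite_subset[of _ "Pow W1 \<times> Pow W2"]) (use fin1 fin2 in auto)
  have "bij_betw (\<lambda>x. fst (snd x) \<union> snd (snd x)) (SIGMA q:{..p}. ?A q \<times> ?B (p - q))
      {S. S \<subseteq> W \<and> P S \<and> card S + p = card W}"
    unfolding bij_betw_def
  proof
    show "inj_on (\<lambda>x. fst (snd x) \<union> snd (snd x)) (SIGMA q:{..p}. ?A q \<times> ?B (p - q))"
    proof (rule inj_onI, clarsimp)
      fix q S1 S2 q' T1 T2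
      assume *: "S1 \<subseteq> W1" "S2 \<subseteq> W2" "T1 \<subseteq> W1" "T2 \<subseteq> W2" "S1 \<union> S2 = T1 \<union> T2"
        "card S1 + q = card W1" "card T1 + q' = card W1"
      then have "S1 = T1" "S2 = T2" using disj by blast+
      then show "q = q' \<and> S1 = T1 \<and> S2 = T2" using * by auto
    qed
    show "(\<lambda>x. fst (snd x) \<union> snd (snd x)) ` (SIGMA q:{..p}. ?A q \<times> ?B (p - q)) =
        {S. S \<subseteq> W \<and> P S \<and> card S + p = card W}"
    proof (intro equalityI subsetI)
      fix S assume "S \<in> (\<lambda>x. fst (snd x) \<union> snd (snd x)) ` (SIGMA q:{..p}. ?A q \<times> ?B (p - q))"
      then obtain q S1 S2 where S: "q \<le> p" "S1 \<in> ?A q" "S2 \<in> ?B (p - q)" "S = S1 \<union> S2" by auto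
      then have i: "S \<inter> W1 = S1" "S \<inter> W2 = S2" "S \<subseteq> W" using disj by auto
      then show "S \<in> {S. S \<subseteq> W \<and> P S \<and> card S + p = card W}"
        using S P[OF i(3)] card_split[OF i(3)] cardW by auto
    next
      fix S assume S: "S \<in> {S. S \<subseteq> W \<and> P S \<and> card S + p = card W}"
      define q where "q = card W1 - card (S \<inter> W1)"
      have le: "card (S \<inter> W1) \<le> card W1" "card (S \<inter> W2) \<le> card W2" using fin1 fin2 by (auto intro: card_mono)
      have "q \<le> p" "card (S \<inter> W1) + q = card W1" "card (S \<inter> W2) + (p - q) = card W2"
        using S card_split[of S] cardW le by (auto simp: q_def)
      then have "(q, S \<inter> W1, S \<inter> W2) \<in> (SIGMA q:{..p}. ?A q \<times> ?B (p - q))" using S P by auto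
      moreover have "S = S \<inter> W1 \<union> S \<inter> W2" using S by blast
      ultimately show "S \<in> (\<lambda>x. fst (snd x) \<union> snd (snd x)) ` (SIGMA q:{..p}. ?A q \<times> ?B (p - q))"
        by (intro image_eqI[of _ _ "(q, S \<inter> W1, S \<inter> W2)"]) auto
    qed
  qed
  from bij_betw_same_card[OF this]
  have "fnum W P p = card (SIGMA q:{..p}. ?A q \<times> ?B (p - q))" by (simp only: fnum_def)
  also have "\<dots> = (\<Sum>q\<le>p. card (?A q \<times> ?B (p - q)))" by (rule card_SigmaI) (simp, intro ballI fin)
  finally show ?thesis by (simp only: card_cartesian_product fnum_def)
qed

text \<open>What \<open>G\<close> adds to the cocycles of degrees p and p - 1 equals what it adds to
  the cochains of degree p - 1, so only the terms of \<open>U\<close> survive.\<close>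

lemma rhdim_total:
  assumes card: "\<And>q. fnum W1 P1 q = card (U q) + card (G q) + (if q = 0 then 0 else card (G (q - 1)))"
  shows "rhdim TYPE('k) \<iota> W P p = (\<Sum>q\<le>p. int (card (U q)) * rhdim TYPE('k) \<iota> W2 P2 (p - q))"
proof (cases p)
  case 0
  then show ?thesis by (simp add: rhdim_def zdim_total)
next
  case (Suc m)
  let ?u = "\<lambda>q. int (card (U q))" and ?g = "\<lambda>q. int (card (G q))"
  let ?z = "\<lambda>q. int (zdim TYPE('k) \<iota> W2 P2 q)" and ?f = "\<lambda>q. int (fnum W2 P2 q)"
  have z: "int (zdim TYPE('k) \<iota> W P p) = (\<Sum>q\<le>p. ?u q * ?z (p - q)) + (\<Sum>q<p. ?g q * ?f (p - 1 - q))" for p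
    by (simp add: zdim_total)
  \<comment> \<open>The coboundaries of degree q are counted by \<open>G\<close> in degree q - 1;
    this moves the index by one.\<close>
  have shift: "(\<Sum>q\<le>m. (if q = 0 then 0 else ?g (q - 1)) * ?f (m - q)) = (\<Sum>q<m. ?g q * ?f (m - 1 - q))"
  proof (cases m)
    case (Suc k)
    have "(\<Sum>q\<le>Suc k. (if q = 0 then 0 else ?g (q - 1)) * ?f (Suc k - q)) = (\<Sum>q\<le>k. ?g q * ?f (k - q))"
      by (subst sum.atMost_Suc_shift) simp
    then show ?thesis using Suc by (simp add: lessThan_Suc_atMost)
  qed simp
  have "int (fnum W P m) = (\<Sum>q\<le>m. (?u q + ?g q + (if q = 0 then 0 else ?g (q - 1))) * ?f (m - q))"
    unfolding fnum_total of_nat_sum of_nat_mult card by (intro sum.cong) auto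
  also have "\<dots> = (\<Sum>q\<le>m. ?u q * ?f (m - q)) + (\<Sum>q\<le>m. ?g q * ?f (m - q)) + (\<Sum>q<m. ?g q * ?f (m - 1 - q))"
    unfolding shift[symmetric] by (simp add: sum.distrib[symmetric] distrib_right)
  finally have f: "int (fnum W P m) = (\<Sum>q\<le>m. ?u q * ?f (m - q)) + (\<Sum>q\<le>m. ?g q * ?f (m - q)) +
      (\<Sum>q<m. ?g q * ?f (m - 1 - q))" .
  have "rhdim TYPE('k) \<iota> W P p = (\<Sum>q\<le>m. ?u q * ?z (Suc m - q)) + ?u (Suc m) * ?z 0
      - (\<Sum>q\<le>m. ?u q * (?f (m - q) - ?z (m - q)))"
    unfolding Suc rhdim_def nat.case f z
    by (simp add: lessThan_Suc_atMost right_diff_distrib sum_subtractf)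
  also have "\<dots> = (\<Sum>q\<le>m. ?u q * (?z (Suc m - q) - (?f (m - q) - ?z (m - q)))) + ?u (Suc m) * ?z 0"
    by (simp add: right_diff_distrib sum_subtractf)
  also have "\<dots> = (\<Sum>q\<le>m. ?u q * rhdim TYPE('k) \<iota> W2 P2 (Suc m - q)) + ?u (Suc m) * rhdim TYPE('k) \<iota> W2 P2 0"
    by (intro arg_cong2[of _ _ _ _ "(+)"] sum.cong) (auto simp: rhdim_def Suc_diff_le)
  finally show ?thesis by (simp add: Suc)
qed

end

text \<open>The families of the locale come from \<open>basis_modulo\<close>: \<open>G\<close> from
  cochains modulo cocycles and \<open>U\<close> from cocycles modulo coboundaries, so
  \<open>card (U q)\<close> is the cohomology dimension of the first factor.\<close>

theorem kunneth:
  assumes fin: "finite W1" "finite W2" and disj: "W1 \<inter> W2 = {}"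
    and inj: "inj_on \<iota> (W1 \<union> W2)" and ord: "\<And>u v. u \<in> W1 \<Longrightarrow> v \<in> W2 \<Longrightarrow> \<iota> u < \<iota> v"
    and P: "\<And>S. S \<subseteq> W1 \<union> W2 \<Longrightarrow> P S \<longleftrightarrow> P1 (S \<inter> W1) \<and> P2 (S \<inter> W2)"
    and up1: "\<And>S v. P1 S \<Longrightarrow> v \<in> W1 \<Longrightarrow> S \<subseteq> W1 \<Longrightarrow> P1 (insert v S)"
    and up2: "\<And>S v. P2 S \<Longrightarrow> v \<in> W2 \<Longrightarrow> S \<subseteq> W2 \<Longrightarrow> P2 (insert v S)"
  shows "rhdim TYPE('k::field) \<iota> (W1 \<union> W2) P p =
    (\<Sum>q\<le>p. rhdim TYPE('k) \<iota> W1 P1 q * rhdim TYPE('k) \<iota> W2 P2 (p - q))"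
proof -
  interpret f: vector_space "fsc :: 'k \<Rightarrow> ('a set \<Rightarrow> 'k) \<Rightarrow> _" by (rule vector_space_fsc)
  interpret ff: vector_space_pair "fsc :: 'k \<Rightarrow> ('a set \<Rightarrow> 'k) \<Rightarrow> _" "fsc :: 'k \<Rightarrow> ('a set \<Rightarrow> 'k) \<Rightarrow> _" ..
  let ?C = "\<lambda>q. pchain W1 P1 q :: ('a set \<Rightarrow> 'k) set" and ?Z = "\<lambda>q. pcycle \<iota> W1 P1 q :: ('a set \<Rightarrow> 'k) set"
  let ?B = "\<lambda>q. if q = 0 then {0} else fdiff \<iota> W1 P1 ` ?C (q - 1)"
  have subB: "f.subspace (?B q)" for q
    using ff.linear_subspace_image[OF fdiff_linear pchain_subspace] f.subspace_single_0 by simp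
  have BZ: "?B q \<subseteq> ?Z q" for q
  proof (cases q)
    case (Suc r)
    have inj1: "inj_on \<iota> W1" using inj inj_on_subset by blast
    show ?thesis
    proof
      fix x assume "x \<in> ?B q"
      then obtain y where y: "y \<in> ?C r" "x = fdiff \<iota> W1 P1 y" using Suc by auto
      have "fdiff \<iota> W1 P1 (fdiff \<iota> W1 P1 y) = 0"
        by (rule fdiff_fdiff_pchain[where P = P1, OF fin(1) inj1 y(1) up1])
      then show "x \<in> ?Z q" using fdiff_pchain[OF fin(1) y(1), of \<iota>] y(2) Suc by (simp add: pcycle_def)
    qed
  qed (use f.subspace_0[OF pcycle_subspace] in auto)
  have ZC: "?Z q \<subseteq> ?C q" for q by (auto simp: pcycle_def)
  define PG where "PG q A \<longleftrightarrow> finite A \<and> A \<subseteq> ?C q \<and> (\<forall>x\<in>?C q. \<exists>s\<in>f.span A. x - s \<in> ?Z q) \<and>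
      (\<forall>c. (\<Sum>b\<in>A. fsc (c b) b) \<in> ?Z q \<longrightarrow> (\<forall>b\<in>A. c b = 0)) \<and> card A + f.dim (?Z q) = f.dim (?C q)" for q A
  define PU where "PU q A \<longleftrightarrow> finite A \<and> A \<subseteq> ?Z q \<and> (\<forall>x\<in>?Z q. \<exists>s\<in>f.span A. x - s \<in> ?B q) \<and>
      (\<forall>c. (\<Sum>b\<in>A. fsc (c b) b) \<in> ?B q \<longrightarrow> (\<forall>b\<in>A. c b = 0)) \<and> card A + f.dim (?B q) = f.dim (?Z q)" for q A
  have "\<exists>A. PG q A" for q
  proof -
    obtain A where A: "finite A" "A \<subseteq> ?C q" "\<And>x. x \<in> ?C q \<Longrightarrow> \<exists>s\<in>f.span A. x - s \<in> ?Z q"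
      "\<And>c b. (\<Sum>b\<in>A. fsc (c b) b) \<in> ?Z q \<Longrightarrow> b \<in> A \<Longrightarrow> c b = 0" "card A + f.dim (?Z q) = f.dim (?C q)"
      by (rule f.basis_modulo[OF pchain_subspace pchain_findim_dim(1)[OF fin(1)] pcycle_subspace ZC, of q]) blast
    then show ?thesis unfolding PG_def by (intro exI[of _ A] conjI ballI allI impI)
  qed
  then obtain G where G: "\<And>q. PG q (G q)" by metis
  have "\<exists>A. PU q A" for q
  proof -
    obtain A where A: "finite A" "A \<subseteq> ?Z q" "\<And>x. x \<in> ?Z q \<Longrightarrow> \<exists>s\<in>f.span A. x - s \<in> ?B q"
      "\<And>c b. (\<Sum>b\<in>A. fsc (c b) b) \<in> ?B q \<Longrightarrow> b \<in> A \<Longrightarrow> c b = 0" "card A + f.dim (?B q) = f.dim (?Z q)"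
      by (rule f.basis_modulo[OF pcycle_subspace pcycle_findim[OF fin(1)] subB BZ, of q]) blast
    then show ?thesis unfolding PU_def by (intro exI[of _ A] conjI ballI allI impI)
  qed
  then obtain U where U: "\<And>q. PU q (U q)" by metis
  note G' = G[unfolded PG_def] and U' = U[unfolded PU_def]
  note G1 = G'[THEN conjunct1] and G2 = G'[THEN conjunct2, THEN conjunct1]
    and G3 = G'[THEN conjunct2, THEN conjunct2, THEN conjunct1, rule_format]
    and G4 = G'[THEN conjunct2, THEN conjunct2, THEN conjunct2, THEN conjunct1, rule_format]
    and G5 = G'[THEN conjunct2, THEN conjunct2, THEN conjunct2, THEN conjunct2]
  note U1 = U'[THEN conjunct1] and U2 = U'[THEN conjunct2, THEN conjunct1]
    and U3 = U'[THEN conjunct2, THEN conjunct2, THEN conjunct1, rule_format]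
    and U4 = U'[THEN conjunct2, THEN conjunct2, THEN conjunct2, THEN conjunct1, rule_format]
    and U5 = U'[THEN conjunct2, THEN conjunct2, THEN conjunct2, THEN conjunct2]
  have spanG: "\<exists>\<beta>. x - (\<Sum>g\<in>G q. fsc (\<beta> g) g) \<in> ?Z q" if x: "x \<in> ?C q" for q x
  proof -
    obtain s where s: "s \<in> f.span (G q)" "x - s \<in> ?Z q" using G3[OF x] by (rule bexE)
    obtain \<beta> where "s = (\<Sum>g\<in>G q. fsc (\<beta> g) g)" using s(1) unfolding f.span_finite[OF G1] by (rule imageE)
    then show ?thesis using s(2) by (intro exI[of _ \<beta>]) (simp only:)
  qed
  have spanU: "\<exists>\<alpha>. x - (\<Sum>u\<in>U q. fsc (\<alpha> u) u) \<in> ?B q" if x: "x \<in> ?Z q" for q x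
  proof -
    obtain s where s: "s \<in> f.span (U q)" "x - s \<in> ?B q" using U3[OF x] by (rule bexE)
    obtain \<alpha> where "s = (\<Sum>u\<in>U q. fsc (\<alpha> u) u)" using s(1) unfolding f.span_finite[OF U1] by (rule imageE)
    then show ?thesis using s(2) by (intro exI[of _ \<alpha>]) (simp only:)
  qed
  interpret J: join_complex \<iota> W1 W2 P1 P2 P U G
    by unfold_locales (fact fin disj inj U1 U2 G1 G2 | rule ord P up1 up2 spanG spanU G4 U4; assumption)+
  have cG: "card (G q) + zdim TYPE('k) \<iota> W1 P1 q = fnum W1 P1 q" for q
    using G5[of q] pchain_findim_dim(2)[OF fin(1), of P1 q, where 'k = 'k] by (simp only: zdim_def)
  have cU: "card (U q) + (if q = 0 then 0 else card (G (q - 1))) = zdim TYPE('k) \<iota> W1 P1 q" for q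
  proof (cases q)
    case 0
    then show ?thesis using U5[of q] by (simp add: zdim_def f.dim_zero_space)
  next
    case (Suc r)
    then have "card (U q) + f.dim (fdiff \<iota> W1 P1 ` ?C r) = zdim TYPE('k) \<iota> W1 P1 q"
      using U5[of q] by (simp add: zdim_def)
    then show ?thesis using fnum_rank[OF fin(1), of P1 r \<iota>, where 'k = 'k] cG[of r] Suc by simp
  qed
  have "int (card (U q)) = rhdim TYPE('k) \<iota> W1 P1 q" for q
    using cU[of q] cG[of "q - 1"] by (cases q) (auto simp: rhdim_def)
  moreover have "fnum W1 P1 q = card (U q) + card (G q) + (if q = 0 then 0 else card (G (q - 1)))" for q
    using cU[of q] cG[of q] by simp
  ultimately show ?thesis using J.rhdim_total[of p] by simp
qed

section \<open>Betti numbers of disjoint unions\<close>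

text \<open>Hochster's sum indexed by d and by the face size p = d - i; both indices add under
  disjoint unions of graphs.\<close>

definition bsum :: "'k::field itself \<Rightarrow> ('v \<Rightarrow> nat) \<Rightarrow> 'v set \<Rightarrow> 'v set set \<Rightarrow> nat \<Rightarrow> nat \<Rightarrow> int" where
  "bsum K \<iota> V E d p = (\<Sum>W | W \<subseteq> V \<and> card W = d. rhdim K \<iota> W (face_pred E W) p)"

lemma graph_betti_bsum:
  assumes G: "simple_graph G" and \<iota>: "inj_on \<iota> (verts G)"
  shows "int (graph_betti TYPE('k::field) G (int i) (int d)) =
    (if i \<le> d then bsum TYPE('k) \<iota> (verts G) (edges G) d (d - i) else 0)"
proof -
  have "hdim TYPE('k) \<iota> (edges G) W i = (if i \<le> d then rhdim TYPE('k) \<iota> W (face_pred (edges G) W) (d - i) else 0)"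
    if "W \<subseteq> verts G \<and> card W = d" for W
  proof -
    have "finite W" using that G finite_subset by (auto simp: simple_graph_def)
    then show ?thesis using that by (simp add: hdim_eq_rhdim)
  qed
  then have "(\<Sum>W | W \<subseteq> verts G \<and> card W = d. hdim TYPE('k) \<iota> (edges G) W i) =
      (\<Sum>W | W \<subseteq> verts G \<and> card W = d. if i \<le> d then rhdim TYPE('k) \<iota> W (face_pred (edges G) W) (d - i) else 0)"
    by (intro sum.cong) auto
  then show ?thesis unfolding graph_betti_Hochster[OF assms] bsum_def by simp
qed

text \<open>A set is independent in a disjoint union exactly when both of its parts are, so
  \<open>kunneth\<close> applies to each W, and W is determined by its two parts.\<close>

lemma bsum_union:
  assumes fin: "finite V1" "finite V2" and disj: "V1 \<inter> V2 = {}"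
    and inj: "inj_on \<iota> (V1 \<union> V2)" and ord: "\<And>u v. u \<in> V1 \<Longrightarrow> v \<in> V2 \<Longrightarrow> \<iota> u < \<iota> v"
    and E1: "\<And>e. e \<in> E1 \<Longrightarrow> e \<subseteq> V1" and E2: "\<And>e. e \<in> E2 \<Longrightarrow> e \<subseteq> V2"
  shows "bsum TYPE('k::field) \<iota> (V1 \<union> V2) (E1 \<union> E2) d p =
    (\<Sum>e\<le>d. \<Sum>q\<le>p. bsum TYPE('k) \<iota> V1 E1 e q * bsum TYPE('k) \<iota> V2 E2 (d - e) (p - q))"
proof -
  let ?r1 = "\<lambda>W q. rhdim TYPE('k) \<iota> W (face_pred E1 W) q" and ?r2 = "\<lambda>W q. rhdim TYPE('k) \<iota> W (face_pred E2 W) q"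
  let ?A = "\<lambda>e. {W. W \<subseteq> V1 \<and> card W = e}" and ?B = "\<lambda>e. {W. W \<subseteq> V2 \<and> card W = e}"
  have finA: "finite (?A e)" "finite (?B e)" for e
    using fin by auto
  have K: "rhdim TYPE('k) \<iota> (W1 \<union> W2) (face_pred (E1 \<union> E2) (W1 \<union> W2)) p = (\<Sum>q\<le>p. ?r1 W1 q * ?r2 W2 (p - q))"
    if W: "W1 \<subseteq> V1" "W2 \<subseteq> V2" for W1 W2
  proof (rule kunneth)
    show "finite W1" "finite W2" using W fin finite_subset by blast+
    show "W1 \<inter> W2 = {}" using W disj by blast
    show "inj_on \<iota> (W1 \<union> W2)" using inj W by (meson Un_mono inj_on_subset)
    show "\<iota> u < \<iota> v" if "u \<in> W1" "v \<in> W2" for u v using ord W that by blast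
    show "face_pred (E1 \<union> E2) (W1 \<union> W2) S \<longleftrightarrow> face_pred E1 W1 (S \<inter> W1) \<and> face_pred E2 W2 (S \<inter> W2)"
      if "S \<subseteq> W1 \<union> W2" for S
    proof -
      have "e \<subseteq> W1 \<union> W2 - S \<longleftrightarrow> e \<subseteq> W1 - S \<inter> W1" if "e \<in> E1" for e using E1[OF that] W disj by blast
      moreover have "e \<subseteq> W1 \<union> W2 - S \<longleftrightarrow> e \<subseteq> W2 - S \<inter> W2" if "e \<in> E2" for e using E2[OF that] W disj by blast
      ultimately show ?thesis unfolding face_pred_def nonface_def
        by (simp only: bex_Un de_Morgan_disj cong: bex_cong)
    qed
  qed (rule face_pred_insert, assumption)+
  have bij: "bij_betw (\<lambda>x. fst (snd x) \<union> snd (snd x)) (SIGMA e:{..d}. ?A e \<times> ?B (d - e)) {W. W \<subseteq> V1 \<union> V2 \<and> card W = d}"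
    unfolding bij_betw_def
  proof
    have card: "card (W1 \<union> W2) = card W1 + card W2" if "W1 \<subseteq> V1" "W2 \<subseteq> V2" for W1 W2
      using that fin disj finite_subset by (intro card_Un_disjoint) blast+
    show "inj_on (\<lambda>x. fst (snd x) \<union> snd (snd x)) (SIGMA e:{..d}. ?A e \<times> ?B (d - e))"
    proof (rule inj_onI, clarsimp)
      fix S1 S2 T1 T2 assume *: "S1 \<subseteq> V1" "S2 \<subseteq> V2" "T1 \<subseteq> V1" "T2 \<subseteq> V2" "S1 \<union> S2 = T1 \<union> T2"
      then have "S1 = T1" "S2 = T2" using disj by blast+
      then show "card S1 = card T1 \<and> S1 = T1 \<and> S2 = T2" by simp
    qed
    show "(\<lambda>x. fst (snd x) \<union> snd (snd x)) ` (SIGMA e:{..d}. ?A e \<times> ?B (d - e)) = {W. W \<subseteq> V1 \<union> V2 \<and> card W = d}"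
    proof (intro equalityI subsetI)
      fix W assume "W \<in> (\<lambda>x. fst (snd x) \<union> snd (snd x)) ` (SIGMA e:{..d}. ?A e \<times> ?B (d - e))"
      then show "W \<in> {W. W \<subseteq> V1 \<union> V2 \<and> card W = d}" using card by auto
    next
      fix W assume W: "W \<in> {W. W \<subseteq> V1 \<union> V2 \<and> card W = d}"
      then have "W = (W \<inter> V1) \<union> (W \<inter> V2)" by blast
      moreover from this have "card W = card (W \<inter> V1) + card (W \<inter> V2)" using card[of "W \<inter> V1" "W \<inter> V2"] by simp
      ultimately show "W \<in> (\<lambda>x. fst (snd x) \<union> snd (snd x)) ` (SIGMA e:{..d}. ?A e \<times> ?B (d - e))"
        using W by (intro image_eqI[of _ _ "(card (W \<inter> V1), W \<inter> V1, W \<inter> V2)"]) auto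
    qed
  qed
  have "bsum TYPE('k) \<iota> (V1 \<union> V2) (E1 \<union> E2) d p =
      (\<Sum>x\<in>(SIGMA e:{..d}. ?A e \<times> ?B (d - e)). \<Sum>q\<le>p. ?r1 (fst (snd x)) q * ?r2 (snd (snd x)) (p - q))"
    unfolding bsum_def sum.reindex_bij_betw[OF bij, symmetric] by (intro sum.cong) (auto simp: K)
  also have "\<dots> = (\<Sum>e\<le>d. \<Sum>y\<in>?A e \<times> ?B (d - e). \<Sum>q\<le>p. ?r1 (fst y) q * ?r2 (snd y) (p - q))"
    using finA by (subst sum.Sigma) (auto simp: case_prod_unfold)
  also have "\<dots> = (\<Sum>e\<le>d. \<Sum>q\<le>p. \<Sum>y\<in>?A e \<times> ?B (d - e). ?r1 (fst y) q * ?r2 (snd y) (p - q))"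
    by (intro sum.cong[OF refl] sum.swap)
  also have "\<dots> = (\<Sum>e\<le>d. \<Sum>q\<le>p. bsum TYPE('k) \<iota> V1 E1 e q * bsum TYPE('k) \<iota> V2 E2 (d - e) (p - q))"
    unfolding bsum_def sum_product sum.cartesian_product by (simp add: case_prod_unfold)
  finally show ?thesis .
qed

section \<open>Complexes of dimension at most one\<close>

text \<open>After multiplication by signs, a 1-cocycle is a function on the vertices which is constant
  on the connected components; the classes of \<open>c\<close> are these components.\<close>

lemma zdim_1:
  fixes c :: "'v \<Rightarrow> 'l"
  assumes W: "finite W" "inj_on \<iota> W" and P1: "\<And>v. v \<in> W \<Longrightarrow> P (W - {v})"
    and c: "\<And>u v. u \<in> W \<Longrightarrow> v \<in> W \<Longrightarrow> u \<noteq> v \<Longrightarrow> P (W - {u, v}) \<Longrightarrow> c u = c v"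
    and conn: "\<And>(\<psi> :: 'v \<Rightarrow> 'k::field) u v.
      (\<And>u v. u \<in> W \<Longrightarrow> v \<in> W \<Longrightarrow> u \<noteq> v \<Longrightarrow> P (W - {u, v}) \<Longrightarrow> \<psi> u = \<psi> v) \<Longrightarrow>
      u \<in> W \<Longrightarrow> v \<in> W \<Longrightarrow> c u = c v \<Longrightarrow> \<psi> u = \<psi> v"
  shows "zdim TYPE('k) \<iota> W P 1 = card (c ` W)"
proof -
  interpret fl: vector_space "fsc :: 'k \<Rightarrow> ('l \<Rightarrow> 'k) \<Rightarrow> _" by (rule vector_space_fsc)
  interpret fv: vector_space "fsc :: 'k \<Rightarrow> ('v set \<Rightarrow> 'k) \<Rightarrow> _" by (rule vector_space_fsc)
  interpret lv: vector_space_pair "fsc :: 'k \<Rightarrow> ('l \<Rightarrow> 'k) \<Rightarrow> _" "fsc :: 'k \<Rightarrow> ('v set \<Rightarrow> 'k) \<Rightarrow> _" ..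
  let ?s = "\<lambda>v. ksgn \<iota> v (W - {v}) :: 'k"
  let ?F = "fun_prod (c ` W) (\<lambda>_. UNIV) :: ('l \<Rightarrow> 'k) set"
  \<comment> \<open>Undoes the sign normalisation: a function on the classes becomes a cochain on
    the vertices.\<close>
  define T where "T g S = (if S \<subseteq> W \<and> card S + 1 = card W then \<Sum>v\<in>W - S. ksgn \<iota> v S * g (c v) else 0)"
    for g :: "'l \<Rightarrow> 'k" and S
  have lin: "Vector_Spaces.linear fsc fsc T"
    unfolding Vector_Spaces.linear_iff using fl.vector_space_axioms fv.vector_space_axioms
    by (simp add: T_def fun_eq_iff fscale_apply distrib_left sum.distrib sum_distrib_left mult.left_commute)
  have compl: "W - (W - {v}) = {v}" if "v \<in> W" for v using that by blast
  have T1: "T g (W - {v}) = ?s v * g (c v)" if "v \<in> W" for g v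
  proof -
    have "card (W - {v}) + 1 = card W" using card.remove[OF W(1) that] by simp
    then show ?thesis using that by (simp add: T_def compl Diff_subset)
  qed
  have vert: "\<exists>v\<in>W. S = W - {v}" if S: "S \<subseteq> W" "card S + 1 = card W" for S
  proof -
    have "card (W - S) = 1" using card_Diff_subset[OF finite_subset[OF S(1) W(1)] S(1)] S(2) by simp
    then obtain v where "W - S = {v}" by (rule card_1_singletonE)
    then show ?thesis using S(1) by (intro bexI[of _ v]) blast+
  qed
  have edge: "\<exists>u v. u \<in> W \<and> v \<in> W \<and> u \<noteq> v \<and> S = W - {u, v}" if S: "S \<subseteq> W" "card S + 2 = card W" for S
  proof -
    have "card (W - S) = 2" using card_Diff_subset[OF finite_subset[OF S(1) W(1)] S(1)] S(2) by simp
    then obtain u v where "W - S = {u, v}" "u \<noteq> v" by (meson card_2_iff)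
    then show ?thesis using S(1) by (intro exI[of _ u] exI[of _ v]) blast
  qed
  \<comment> \<open>Of the two signs at the edge, the one of the later vertex flips when the other
    vertex is added. After this normalisation the cocycle condition says that both ends have equal
    values.\<close>
  have d: "fdiff \<iota> W P f (W - {u, v}) = 0 \<longleftrightarrow> ?s u * f (W - {u}) = ?s v * f (W - {v})"
    if uv: "u \<in> W" "v \<in> W" "u \<noteq> v" "P (W - {u, v})" for u v and f :: "'v set \<Rightarrow> 'k"
  proof -
    let ?S = "W - {u, v}"
    have i: "insert u ?S = W - {v}" "insert v ?S = W - {u}" "W - ?S = {u, v}" using uv by auto
    have ne: "\<iota> u \<noteq> \<iota> v" using inj_onD[OF W(2)] uv by blast
    have fS: "finite ?S" using W(1) by simp
    have F: "fdiff \<iota> W P f ?S = ksgn \<iota> u ?S * f (W - {v}) + ksgn \<iota> v ?S * f (W - {u})"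
      using uv(3,4) by (simp add: fdiff_def i)
    have sv: "?s v = (if \<iota> u < \<iota> v then - ksgn \<iota> v ?S else ksgn \<iota> v ?S)"
      using ksgn_insert[OF fS, of u \<iota> v, where 'b = 'k] by (simp add: i)
    have su: "?s u = (if \<iota> v < \<iota> u then - ksgn \<iota> u ?S else ksgn \<iota> u ?S)"
      using ksgn_insert[OF fS, of v \<iota> u, where 'b = 'k] by (simp add: i)
    have sq: "x * f' + y * f'' = 0 \<longleftrightarrow> y * f' = - (x * f'')"
      if "x * x = 1" "y * y = 1" for x y f' f'' :: 'k
    proof
      assume "x * f' + y * f'' = 0"
      then have "x * y * (x * f' + y * f'') = 0" by simp
      then have "(x * x) * (y * f') + (y * y) * (x * f'') = 0" by (simp add: algebra_simps)
      then show "y * f' = - (x * f'')" using that by (simp add: eq_neg_iff_add_eq_0)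
    next
      assume "y * f' = - (x * f'')"
      then have "x * y * (y * f' + x * f'') = 0" by simp
      then have "(y * y) * (x * f') + (x * x) * (y * f'') = 0" by (simp add: algebra_simps)
      then show "x * f' + y * f'' = 0" using that by simp
    qed
    have m: "y = - x \<longleftrightarrow> x = - y" "y = - x \<longleftrightarrow> - x = y" for x y :: 'k by auto
    have e: "fdiff \<iota> W P f ?S = 0 \<longleftrightarrow> ksgn \<iota> v ?S * f (W - {v}) = - (ksgn \<iota> u ?S * f (W - {u}))"
      unfolding F by (rule sq) simp_all
    show ?thesis
    proof (cases "\<iota> u < \<iota> v")
      case True
      then show ?thesis unfolding e su sv by (simp add: m(1))
    next
      case False
      then have "\<iota> v < \<iota> u" using ne by simp
      then show ?thesis using False unfolding e su sv by (simp add: m(2))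
    qed
  qed
  have "T ` ?F = pcycle \<iota> W P 1"
  proof (intro equalityI subsetI)
    fix f assume "f \<in> T ` ?F"
    then obtain g where g: "f = T g" by (rule imageE)
    have pc: "T g \<in> pchain W P 1"
      unfolding pchain_def
    proof (intro CollectI allI impI)
      fix S assume "T g S \<noteq> 0"
      then have S: "S \<subseteq> W" "card S + 1 = card W" by (simp_all add: T_def split: if_splits)
      then obtain v where "v \<in> W" "S = W - {v}" using vert by blast
      then show "S \<subseteq> W \<and> P S \<and> card S + 1 = card W" using S P1 by simp
    qed
    have "fdiff \<iota> W P (T g) S = 0" for S
    proof (rule ccontr)
      assume nz: "fdiff \<iota> W P (T g) S \<noteq> 0"
      then have S: "S \<subseteq> W" "P S" "card S + 2 = card W"
        using fdiff_pchain[OF W(1) pc, of \<iota>] by (auto simp: pchain_def)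
      then obtain u v where uv: "u \<in> W" "v \<in> W" "u \<noteq> v" "S = W - {u, v}" using edge by blast
      then have "c u = c v" using c S(2) by blast
      then have "?s u * T g (W - {u}) = ?s v * T g (W - {v})" using uv T1 by simp
      then show False using d[of u v "T g"] uv S(2) nz by simp
    qed
    then show "f \<in> pcycle \<iota> W P 1" unfolding g pcycle_def using pc by (auto simp: fun_eq_iff)
  next
    fix f :: "'v set \<Rightarrow> 'k" assume f: "f \<in> pcycle \<iota> W P 1"
    let ?\<psi> = "\<lambda>v. ?s v * f (W - {v})"
    have \<psi>: "?\<psi> u = ?\<psi> v" if "u \<in> W" "v \<in> W" "c u = c v" for u v
    proof (rule conn[OF _ that])
      fix u v assume "u \<in> W" "v \<in> W" "u \<noteq> v" "P (W - {u, v})"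
      from d[OF this, of f] show "?\<psi> u = ?\<psi> v" using f by (simp add: pcycle_def)
    qed
    define g where "g l = (if l \<in> c ` W then ?\<psi> (inv_into W c l) else 0)" for l
    have g: "g (c v) = ?\<psi> v" if "v \<in> W" for v
    proof -
      have l: "c v \<in> c ` W" using that by (rule imageI)
      have "?\<psi> (inv_into W c (c v)) = ?\<psi> v"
        by (rule \<psi>[OF inv_into_into[OF l] that f_inv_into_f[OF l]])
      then show ?thesis unfolding g_def if_P[OF l] .
    qed
    have "T g = f"
    proof
      fix S show "T g S = f S"
      proof (cases "S \<subseteq> W \<and> card S + 1 = card W")
        case True
        then obtain v where v: "v \<in> W" "S = W - {v}" using vert by blast
        then show ?thesis using T1[OF v(1), of g] g[OF v(1)] by simp
      next
        case False
        then have "f S = 0" using f by (auto simp: pcycle_def pchain_def)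
        then show ?thesis using False by (auto simp: T_def)
      qed
    qed
    moreover have "g \<in> ?F" by (simp add: fun_prod_def g_def)
    ultimately show "f \<in> T ` ?F" by blast
  qed
  moreover have "fv.dim (T ` ?F) = fl.dim ?F"
  proof (rule lv.dim_image_inj[OF lin])
    show "fl.subspace ?F" by (intro fl.subspaceI) (auto simp: fun_prod_def fscale_apply)
    show "fl.findim ?F" using dim_fun_prod_UNIV[OF finite_imageI[OF W(1)], of c, where 'k = 'k] by blast
    show "g = 0" if "g \<in> ?F" "T g = 0" for g
    proof
      fix l show "g l = 0 l"
      proof (cases "l \<in> c ` W")
        case True
        then obtain v where v: "v \<in> W" "l = c v" by blast
        then show ?thesis using T1[of v g] that(2) by simp
      next
        case False then show ?thesis using that(1) by (simp add: fun_prod_def)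
      qed
    qed
  qed
  ultimately show ?thesis using dim_fun_prod_UNIV(2)[OF finite_imageI[OF W(1)], of c, where 'k = 'k] by (simp add: zdim_def)
qed

text \<open>With at most two vertices in a face, every cochain on edges is a cocycle. So the top
  dimension is the number of edges minus vertices plus components, and degree 0 is components minus
  one.\<close>

lemma rhdim_dim_1:
  assumes W: "finite W" "W \<noteq> {}" and P: "P W" "\<And>v. v \<in> W \<Longrightarrow> P (W - {v})"
    and big: "\<And>S. S \<subseteq> W \<Longrightarrow> P S \<Longrightarrow> card W \<le> card S + 2"
  shows "rhdim TYPE('k::field) \<iota> W P 0 = 0"
    and "rhdim TYPE('k) \<iota> W P 1 = int (zdim TYPE('k) \<iota> W P 1) - 1"
    and "rhdim TYPE('k) \<iota> W P 2 = int (fnum W P 2) - int (card W) + int (zdim TYPE('k) \<iota> W P 1)"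
    and "p \<ge> 3 \<Longrightarrow> rhdim TYPE('k) \<iota> W P p = 0"
proof -
  interpret f: vector_space "fsc :: 'k \<Rightarrow> ('a set \<Rightarrow> 'k) \<Rightarrow> _" by (rule vector_space_fsc)
  obtain w where w: "w \<in> W" using W by blast
  have z0: "zdim TYPE('k) \<iota> W P 0 = 0" by (rule zdim_0[where w = w, OF W(1) w]) (rule P(2)[OF w])
  have f0: "fnum W P 0 = 1" by (rule fnum_0[where P = P, OF W(1) P(1)])
  have "{S. S \<subseteq> W \<and> P S \<and> card S + 1 = card W} = (\<lambda>v. W - {v}) ` W"
  proof (intro equalityI subsetI)
    fix S assume S: "S \<in> {S. S \<subseteq> W \<and> P S \<and> card S + 1 = card W}"
    then have "card (W - S) = 1" using card_Diff_subset[of S W] finite_subset[of S W] W(1) by auto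
    then obtain v where "W - S = {v}" by (rule card_1_singletonE)
    then show "S \<in> (\<lambda>v. W - {v}) ` W" using S by (intro image_eqI[of _ _ v]) blast+
  next
    fix S assume "S \<in> (\<lambda>v. W - {v}) ` W"
    then obtain v where v: "v \<in> W" "S = W - {v}" by blast
    then show "S \<in> {S. S \<subseteq> W \<and> P S \<and> card S + 1 = card W}" using P(2) card.remove[OF W(1) v(1)] by auto
  qed
  moreover have "inj_on (\<lambda>v. W - {v}) W" by (rule inj_onI) blast
  ultimately have f1: "fnum W P 1 = card W" by (simp add: fnum_def card_image)
  have f3: "fnum W P p = 0" if "p \<ge> 3" for p
  proof -
    have "card S + p \<noteq> card W" if "S \<subseteq> W" "P S" for S using big[OF that] \<open>p \<ge> 3\<close> by simp
    then have "{S. S \<subseteq> W \<and> P S \<and> card S + p = card W} = {}" by blast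
    then show ?thesis unfolding fnum_def by (simp only: card.empty)
  qed
  have zf: "zdim TYPE('k) \<iota> W P p \<le> fnum W P p" for p
    using fnum_rank[OF W(1), of P p \<iota>, where 'k = 'k] by simp
  have "pcycle \<iota> W P 2 = (pchain W P 2 :: ('a set \<Rightarrow> 'k) set)"
  proof -
    have "fdiff \<iota> W P f S = 0" if f: "f \<in> pchain W P 2" for f :: "'a set \<Rightarrow> 'k" and S
    proof (rule ccontr)
      assume "fdiff \<iota> W P f S \<noteq> 0"
      then have "S \<subseteq> W" "P S" "card S + 3 = card W"
        using fdiff_pchain[OF W(1) f, of \<iota>] by (simp_all add: pchain_def)
      then show False using big[of S] by simp
    qed
    then show ?thesis by (auto simp: pcycle_def fun_eq_iff)
  qed
  then have z2: "zdim TYPE('k) \<iota> W P 2 = fnum W P 2"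
    using pchain_findim_dim(2)[OF W(1), of P 2, where 'k = 'k] by (simp add: zdim_def)
  show "rhdim TYPE('k) \<iota> W P 0 = 0" using z0 by (simp add: rhdim_def)
  show "rhdim TYPE('k) \<iota> W P 1 = int (zdim TYPE('k) \<iota> W P 1) - 1"
    using z0 f0 by (simp add: rhdim_def)
  show "rhdim TYPE('k) \<iota> W P 2 = int (fnum W P 2) - int (card W) + int (zdim TYPE('k) \<iota> W P 1)"
    using z2 f1 by (simp add: rhdim_def numeral_2_eq_2)
  show "rhdim TYPE('k) \<iota> W P p = 0" if "p \<ge> 3" for p
  proof -
    obtain q where q: "p = Suc q" "q \<ge> 2" using \<open>p \<ge> 3\<close> by (cases p) auto
    have "zdim TYPE('k) \<iota> W P q = fnum W P q"
      using z2 f3[of q] zf[of q] q(2) by (cases "q = 2") auto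
    then show ?thesis using zf[of p] f3[OF \<open>p \<ge> 3\<close>] q by (simp add: rhdim_def)
  qed
qed

section \<open>The graph B\<close>

lemma B_graph_edges:
  "1 \<le> i \<Longrightarrow> i < j \<Longrightarrow> j \<le> b \<Longrightarrow> {Inl i, Inl j} \<in> edges (B_graph b)"
  "1 \<le> i \<Longrightarrow> i < j \<Longrightarrow> j \<le> b \<Longrightarrow> {Inr i, Inr j} \<in> edges (B_graph b)"
  "1 \<le> i \<Longrightarrow> i \<le> b \<Longrightarrow> {Inl i, Inr i} \<in> edges (B_graph b)"
  unfolding B_graph_def ugraph.select_convs by blast+

lemma not_nonface_B:
  assumes "T \<subseteq> {1..b} <+> {1..b}"
  shows "\<not> nonface (edges (B_graph b)) T \<longleftrightarrow>
    (\<forall>i j. Inl i \<in> T \<longrightarrow> Inl j \<in> T \<longrightarrow> i = j) \<and> (\<forall>i j. Inr i \<in> T \<longrightarrow> Inr j \<in> T \<longrightarrow> i = j) \<and>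
    (\<forall>i. Inl i \<in> T \<longrightarrow> Inr i \<notin> T)" (is "?L \<longleftrightarrow> ?R")
proof
  have range: "1 \<le> i \<and> i \<le> b" if "Inl i \<in> T \<or> Inr i \<in> T" for i using assms that by auto
  assume L: ?L
  then have no: "\<not> e \<subseteq> T" if "e \<in> edges (B_graph b)" for e using that unfolding nonface_def by blast
  have l: False if "Inl i \<in> T" "Inl j \<in> T" "i < j" for i j
    using no[OF B_graph_edges(1)[of i j b]] that range[of i] range[of j] by simp
  have r: False if "Inr i \<in> T" "Inr j \<in> T" "i < j" for i j
    using no[OF B_graph_edges(2)[of i j b]] that range[of i] range[of j] by simp
  have m: False if "Inl i \<in> T" "Inr i \<in> T" for i
    using no[OF B_graph_edges(3)[of i b]] that range[of i] by simp
  show ?R using l r m by (metis linorder_neqE_nat)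
next
  assume R: ?R
  show ?L
  proof
    assume "nonface (edges (B_graph b)) T"
    then obtain e where e: "e \<in> edges (B_graph b)" "e \<subseteq> T" by (auto simp: nonface_def)
    from e(1) show False unfolding B_graph_def ugraph.select_convs
    proof (elim UnE CollectE exE conjE)
      fix i j assume "e = {Inl i, Inl j}" "i < j"
      moreover from this have "Inl i \<in> T" "Inl j \<in> T" using e(2) by simp_all
      ultimately show False using R by blast
    next
      fix i j assume "e = {Inr i, Inr j}" "i < j"
      moreover from this have "Inr i \<in> T" "Inr j \<in> T" using e(2) by simp_all
      ultimately show False using R by blast
    next
      fix i assume "e = {Inl i, Inr i}"
      then have "Inl i \<in> T" "Inr i \<in> T" using e(2) by simp_all
      then show False using R by blast
    qed
  qed
qed

abbreviation "faceB b W \<equiv> face_pred (edges (B_graph b)) W"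

lemma faceB_compl:
  assumes "W \<subseteq> {1..b} <+> {1..b}" "T \<subseteq> W"
  shows "faceB b W (W - T) \<longleftrightarrow>
    (\<forall>i j. Inl i \<in> T \<longrightarrow> Inl j \<in> T \<longrightarrow> i = j) \<and> (\<forall>i j. Inr i \<in> T \<longrightarrow> Inr j \<in> T \<longrightarrow> i = j) \<and>
    (\<forall>i. Inl i \<in> T \<longrightarrow> Inr i \<notin> T)"
proof -
  have "W - (W - T) = T" using assms(2) by blast
  then show ?thesis unfolding face_pred_def using not_nonface_B[of T b] assms by auto
qed

text \<open>The faces with two vertices are the pairs x_i, y_j with i \<noteq> j. The labelling
  \<open>c\<close> is constant on edges, and \<open>conn\<close> says that each of its classes is
  connected.\<close>

lemma zdim_B:
  fixes c :: "nat + nat \<Rightarrow> 'l"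
  assumes AB: "A \<subseteq> {1..b}" "B \<subseteq> {1..b}" and \<iota>: "inj_on \<iota> (A <+> B)"
    and c: "\<And>i j. i \<in> A \<Longrightarrow> j \<in> B \<Longrightarrow> i \<noteq> j \<Longrightarrow> c (Inl i) = c (Inr j)"
    and conn: "\<And>(\<psi> :: nat + nat \<Rightarrow> 'k::field) u v.
      (\<And>i j. i \<in> A \<Longrightarrow> j \<in> B \<Longrightarrow> i \<noteq> j \<Longrightarrow> \<psi> (Inl i) = \<psi> (Inr j)) \<Longrightarrow>
      u \<in> A <+> B \<Longrightarrow> v \<in> A <+> B \<Longrightarrow> c u = c v \<Longrightarrow> \<psi> u = \<psi> v"
  shows "zdim TYPE('k) \<iota> (A <+> B) (faceB b (A <+> B)) 1 = card (c ` (A <+> B))"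
proof (rule zdim_1)
  let ?W = "A <+> B"
  have W: "?W \<subseteq> {1..b} <+> {1..b}" using AB by auto
  show "finite ?W" by (rule finite_subset[OF W]) simp
  show "inj_on \<iota> ?W" by (rule \<iota>)
  show "faceB b ?W (?W - {v})" if "v \<in> ?W" for v
    using faceB_compl[OF W, of "{v}"] that by auto
  show "c u = c v" if uv: "u \<in> ?W" "v \<in> ?W" "u \<noteq> v" "faceB b ?W (?W - {u, v})" for u v
  proof -
    have "(\<exists>i j. i \<in> A \<and> j \<in> B \<and> i \<noteq> j \<and> (u = Inl i \<and> v = Inr j \<or> v = Inl i \<and> u = Inr j))"
      using faceB_compl[OF W, of "{u, v}"] uv by (cases u; cases v) auto
    then show ?thesis using c by metis
  qed
  show "\<psi> u = \<psi> v" if "\<And>u v. u \<in> ?W \<Longrightarrow> v \<in> ?W \<Longrightarrow> u \<noteq> v \<Longrightarrow> faceB b ?W (?W - {u, v}) \<Longrightarrow> \<psi> u = \<psi> v"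
    and uv: "u \<in> ?W" "v \<in> ?W" "c u = c v" for \<psi> :: "nat + nat \<Rightarrow> 'k" and u v
  proof (rule conn[OF _ uv])
    fix i j assume ij: "i \<in> A" "j \<in> B" "i \<noteq> j"
    show "\<psi> (Inl i) = \<psi> (Inr j)"
      using faceB_compl[OF W, of "{Inl i, Inr j}"] ij by (intro that(1)) auto
  qed
qed

text \<open>Components minus one of the bipartite graph with edges x_i y_j, i \<noteq> j. The
  summands are: only isolated vertices; \<open>A\<close> = {i} leaving y_i isolated;
  \<open>B\<close> = {j} leaving x_j isolated, unless this was just counted; and \<open>A\<close> =
  \<open>B\<close> of size 2, giving two disjoint edges.\<close>

definition compB :: "nat set \<Rightarrow> nat set \<Rightarrow> nat" where
  "compB A B = (if A = {} \<or> B = {} then card A + card B - 1 else 0) + of_bool (card A = 1 \<and> A \<subseteq> B) +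
    of_bool (card B = 1 \<and> B \<subseteq> A \<and> card A \<noteq> 1) + of_bool (A = B \<and> card A = 2)"

lemma zdim_compB:
  assumes AB: "A \<subseteq> {1..b}" "B \<subseteq> {1..b}" and \<iota>: "inj_on \<iota> (A <+> B)" and ne: "A <+> B \<noteq> {}"
  shows "zdim TYPE('k::field) \<iota> (A <+> B) (faceB b (A <+> B)) 1 = compB A B + 1"
proof -
  have fin: "finite A" "finite B" using AB finite_subset by blast+
  note Z = zdim_B[where 'k = 'k, OF AB \<iota>]
  consider "A = {} \<or> B = {}" | "\<exists>i. A = {i} \<and> i \<in> B"
    | "\<not> (\<exists>i. A = {i} \<and> i \<in> B)" "\<exists>j. B = {j} \<and> j \<in> A"
    | "\<exists>i j. i \<noteq> j \<and> A = {i, j} \<and> B = {i, j}"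
    | "\<not> (A = {} \<or> B = {})" "\<not> (\<exists>i. A = {i} \<and> i \<in> B)" "\<not> (\<exists>j. B = {j} \<and> j \<in> A)"
      "\<not> (\<exists>i j. i \<noteq> j \<and> A = {i, j} \<and> B = {i, j})"
    by satx
  then show ?thesis
  proof cases
    case 1
    have "card A + card B \<noteq> 0" using ne fin by auto
    then have "compB A B = card A + card B - 1"
      using 1 fin by (auto simp: compB_def)
    moreover have "zdim TYPE('k) \<iota> (A <+> B) (faceB b (A <+> B)) 1 = card ((\<lambda>v. v) ` (A <+> B))"
      by (rule Z) (use 1 in auto)
    moreover have "card ((\<lambda>v. v) ` (A <+> B)) = card A + card B" using fin by (simp add: card_Plus)
    ultimately show ?thesis using \<open>card A + card B \<noteq> 0\<close> by arith
  next
    case 2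
    then obtain i where 2: "A = {i}" "i \<in> B" by blast
    have "zdim TYPE('k) \<iota> (A <+> B) (faceB b (A <+> B)) 1 = card ((\<lambda>v. v = Inr i) ` (A <+> B))"
    proof (rule Z)
      fix \<psi> :: "nat + nat \<Rightarrow> 'k" and u v
      assume \<psi>: "\<And>k j. k \<in> A \<Longrightarrow> j \<in> B \<Longrightarrow> k \<noteq> j \<Longrightarrow> \<psi> (Inl k) = \<psi> (Inr j)"
        and uv: "u \<in> A <+> B" "v \<in> A <+> B" "(u = Inr i) = (v = Inr i)"
      have "\<psi> w = \<psi> (Inl i)" if "w \<in> A <+> B" "w \<noteq> Inr i" for w
        using that \<psi>[of i] 2 by (cases w) auto
      then show "\<psi> u = \<psi> v" using uv by metis
    qed (use 2 in auto)
    moreover have "(\<lambda>v. v = Inr i) ` (A <+> B) = {True, False}" using 2 by (auto simp: image_iff)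
    moreover have "compB A B = 1" using 2 by (auto simp: compB_def)
    ultimately show ?thesis by simp
  next
    case 3
    then obtain j where j: "B = {j}" "j \<in> A" by blast
    have "card A \<noteq> 1"
    proof
      assume "card A = 1"
      then obtain i where i: "A = {i}" by (rule card_1_singletonE)
      then have "i = j" using j(2) by simp
      then show False using 3(1) i j(1) by simp
    qed
    note 3 = j \<open>card A \<noteq> 1\<close>
    have "zdim TYPE('k) \<iota> (A <+> B) (faceB b (A <+> B)) 1 = card ((\<lambda>v. v = Inl j) ` (A <+> B))"
    proof (rule Z)
      fix \<psi> :: "nat + nat \<Rightarrow> 'k" and u v
      assume \<psi>: "\<And>k l. k \<in> A \<Longrightarrow> l \<in> B \<Longrightarrow> k \<noteq> l \<Longrightarrow> \<psi> (Inl k) = \<psi> (Inr l)"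
        and uv: "u \<in> A <+> B" "v \<in> A <+> B" "(u = Inl j) = (v = Inl j)"
      have "\<psi> w = \<psi> (Inr j)" if "w \<in> A <+> B" "w \<noteq> Inl j" for w
        using that \<psi>[of _ j] 3 by (cases w) auto
      then show "\<psi> u = \<psi> v" using uv by metis
    qed (use 3 in auto)
    moreover have "(\<lambda>v. v = Inl j) ` (A <+> B) = {True, False}" using 3 by (auto simp: image_iff)
    moreover have "compB A B = 1" using 3 by (auto simp: compB_def)
    ultimately show ?thesis by simp
  next
    case 4
    then obtain i j where 4: "A = {i, j}" "B = {i, j}" "i \<noteq> j" by blast
    \<comment> \<open>The labelling separates the edge x_i y_j from the edge x_j y_i.\<close>
    have "zdim TYPE('k) \<iota> (A <+> B) (faceB b (A <+> B)) 1 = card ((\<lambda>v. v = Inl i \<or> v = Inr j) ` (A <+> B))"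
    proof (rule Z)
      fix \<psi> :: "nat + nat \<Rightarrow> 'k" and u v
      assume \<psi>: "\<And>k l. k \<in> A \<Longrightarrow> l \<in> B \<Longrightarrow> k \<noteq> l \<Longrightarrow> \<psi> (Inl k) = \<psi> (Inr l)"
        and uv: "u \<in> A <+> B" "v \<in> A <+> B" "(u = Inl i \<or> u = Inr j) = (v = Inl i \<or> v = Inr j)"
      show "\<psi> u = \<psi> v" using uv \<psi>[of i j] \<psi>[of j i] 4 by auto
    qed (use 4 in auto)
    moreover have "(\<lambda>v. v = Inl i \<or> v = Inr j) ` (A <+> B) = {True, False}" using 4 by (auto simp: image_iff)
    moreover have "compB A B = 1" using 4 by (auto simp: compB_def)
    ultimately show ?thesis by simp
  next
    case 5
    then have 5: "A \<noteq> {}" "B \<noteq> {}" "\<And>i. A = {i} \<Longrightarrow> i \<notin> B" "\<And>i. B = {i} \<Longrightarrow> i \<notin> A"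
      "\<And>i j. i \<noteq> j \<Longrightarrow> A = {i, j} \<Longrightarrow> B \<noteq> {i, j}"
      by blast+
    have "zdim TYPE('k) \<iota> (A <+> B) (faceB b (A <+> B)) 1 = card ((\<lambda>v. 0 :: nat) ` (A <+> B))"
    proof (rule Z)
      fix \<psi> :: "nat + nat \<Rightarrow> 'k" and u v
      assume \<psi>: "\<And>k l. k \<in> A \<Longrightarrow> l \<in> B \<Longrightarrow> k \<noteq> l \<Longrightarrow> \<psi> (Inl k) = \<psi> (Inr l)"
        and uv: "u \<in> A <+> B" "v \<in> A <+> B"
      have e: "\<psi> (Inl k) = \<psi> (Inr l)" if kl: "k \<in> A" "l \<in> B" for k l
      proof (cases "k = l")
        case True
        \<comment> \<open>Only x_k and y_k are not adjacent; they are joined through y_l' and x_k'.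
          Suitable k' \<noteq> l' exist unless \<open>A\<close> and \<open>B\<close> are the same
          pair, which is an earlier case.\<close>
        have "\<exists>k'\<in>A - {k}. \<exists>l'\<in>B - {k}. k' \<noteq> l'"
        proof (rule ccontr)
          assume N: "\<not> ?thesis"
          obtain k' where k': "k' \<in> A" "k' \<noteq> k" using 5(3)[of k] kl True by blast
          obtain l' where l': "l' \<in> B" "l' \<noteq> k" using 5(4)[of k] kl True by blast
          have N': "x = y" if "x \<in> A" "x \<noteq> k" "y \<in> B" "y \<noteq> k" for x y
            using N that by (meson Diff_iff singletonD)
          have a: "x = k'" if "x \<in> A" "x \<noteq> k" for x using N'[OF that l'] N'[OF k' l'] by simp
          have b: "x = k'" if "x \<in> B" "x \<noteq> k" for x using N'[OF k' that] by simp
          have "k' \<in> B" "k \<in> B" using N'[OF k' l'] l'(1) kl(2) True by simp_all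
          then have "A = {k, k'}" "B = {k, k'}"
            using a b kl(1) k'(1) by (metis (no_types, lifting) Set.set_eqI insert_iff singletonD)+
          then show False using 5(5)[of k k'] k'(2) by simp
        qed
        then obtain k' l' where kl': "k' \<in> A" "k' \<noteq> k" "l' \<in> B" "l' \<noteq> k" "k' \<noteq> l'" by blast
        then have "\<psi> (Inl k) = \<psi> (Inr l')" "\<psi> (Inl k') = \<psi> (Inr l')" "\<psi> (Inl k') = \<psi> (Inr k)"
          using \<psi> kl kl' True by blast+
        then show ?thesis using True by simp
      qed (use \<psi> that in blast)
      obtain k l where kl: "k \<in> A" "l \<in> B" using 5(1,2) by blast
      have "\<psi> w = \<psi> (Inl k)" if "w \<in> A <+> B" for w
        using that e[OF kl(1)] e[OF _ kl(2)] e[OF kl] by (cases w) auto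
      then show "\<psi> u = \<psi> v" using uv by metis
    qed auto
    moreover have "(\<lambda>v. 0 :: nat) ` (A <+> B) = {0}" using ne by blast
    moreover have "compB A B = 0"
    proof -
      have "\<not> (card A = 1 \<and> A \<subseteq> B)"
      proof
        assume *: "card A = 1 \<and> A \<subseteq> B"
        then obtain i where i: "A = {i}" by (meson is_singleton_altdef is_singleton_the_elem)
        then show False using 5(3)[OF i] * by simp
      qed
      moreover have "\<not> (card B = 1 \<and> B \<subseteq> A)"
      proof
        assume *: "card B = 1 \<and> B \<subseteq> A"
        then obtain i where i: "B = {i}" by (meson is_singleton_altdef is_singleton_the_elem)
        then show False using 5(4)[OF i] * by simp
      qed
      moreover have "\<not> (A = B \<and> card A = 2)" using 5(5) unfolding card_2_iff by blast
      ultimately show ?thesis using 5(1,2) by (auto simp: compB_def)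
    qed
    ultimately show ?thesis by simp
  qed
qed

section \<open>Summing the component counts over all vertex sets\<close>

lemma card_supersets:
  assumes "finite V" "T \<subseteq> V" "card T \<le> d"
  shows "card {W. T \<subseteq> W \<and> W \<subseteq> V \<and> card W = d} = (card V - card T) choose (d - card T)"
proof -
  have fT: "finite T" by (rule finite_subset[OF assms(2,1)])
  have 1: "card (U \<union> T) = d" if U: "U \<subseteq> V - T" "card U = d - card T" for U
  proof -
    have "finite U" by (rule finite_subset[OF U(1)]) (simp add: assms(1))
    moreover have "U \<inter> T = {}" using U(1) by blast
    ultimately show ?thesis using U(2) assms(3) fT by (simp add: card_Un_disjoint)
  qed
  have 2: "card (W - T) = d - card T" if "T \<subseteq> W" "card W = d" for W
    using card_Diff_subset[OF fT that(1)] that(2) by simp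
  have "bij_betw (\<lambda>U. U \<union> T) {U. U \<subseteq> V - T \<and> card U = d - card T} {W. T \<subseteq> W \<and> W \<subseteq> V \<and> card W = d}"
  proof (rule bij_betw_byWitness[where f' = "\<lambda>W. W - T"])
    show "\<forall>U\<in>{U. U \<subseteq> V - T \<and> card U = d - card T}. U \<union> T - T = U" by blast
    show "\<forall>W\<in>{W. T \<subseteq> W \<and> W \<subseteq> V \<and> card W = d}. W - T \<union> T = W" by blast
    show "(\<lambda>U. U \<union> T) ` {U. U \<subseteq> V - T \<and> card U = d - card T} \<subseteq> {W. T \<subseteq> W \<and> W \<subseteq> V \<and> card W = d}"
    proof (rule image_subsetI)
      fix U assume U: "U \<in> {U. U \<subseteq> V - T \<and> card U = d - card T}"
      then have "card (U \<union> T) = d" by (intro 1) simp_all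
      moreover have "U \<union> T \<subseteq> V" using U assms(2) by blast
      ultimately show "U \<union> T \<in> {W. T \<subseteq> W \<and> W \<subseteq> V \<and> card W = d}" by simp
    qed
    show "(\<lambda>W. W - T) ` {W. T \<subseteq> W \<and> W \<subseteq> V \<and> card W = d} \<subseteq> {U. U \<subseteq> V - T \<and> card U = d - card T}"
    proof (rule image_subsetI)
      fix W assume W: "W \<in> {W. T \<subseteq> W \<and> W \<subseteq> V \<and> card W = d}"
      then have "card (W - T) = d - card T" by (intro 2) simp_all
      moreover have "W - T \<subseteq> V - T" using W by blast
      ultimately show "W - T \<in> {U. U \<subseteq> V - T \<and> card U = d - card T}" by simp
    qed
  qed
  from bij_betw_same_card[OF this]
  have "card {W. T \<subseteq> W \<and> W \<subseteq> V \<and> card W = d} = card {U. U \<subseteq> V - T \<and> card U = d - card T}" by (rule sym)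
  also have "\<dots> = card (V - T) choose (d - card T)" by (rule n_subsets) (simp add: assms(1))
  finally show ?thesis by (simp add: card_Diff_subset[OF fT assms(2)])
qed

definition card_pairs :: "'a set \<Rightarrow> nat \<Rightarrow> ('a set \<times> 'a set) set" where
  "card_pairs V d = {(A, B). A \<subseteq> V \<and> B \<subseteq> V \<and> card A + card B = d}"

lemma finite_card_pairs: "finite V \<Longrightarrow> finite (card_pairs V d)"
  by (rule finite_subset[of _ "Pow V \<times> Pow V"]) (auto simp: card_pairs_def)

lemma Plus_vimage: "Inl -` W <+> Inr -` W = W"
  by (auto simp: Plus_def image_iff) (metis sum.exhaust)

lemma sum_Plus:
  assumes "finite V"
  shows "(\<Sum>W | W \<subseteq> V <+> V \<and> card W = d. f W) = (\<Sum>(A, B)\<in>card_pairs V d. f (A <+> B))"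
proof (rule sum.reindex_bij_witness[where i = "\<lambda>(A, B). A <+> B" and j = "\<lambda>W. (Inl -` W, Inr -` W)"])
  fix W assume W: "W \<in> {W. W \<subseteq> V <+> V \<and> card W = d}"
  then have s: "Inl -` W \<subseteq> V" "Inr -` W \<subseteq> V" by auto
  then have "card (Inl -` W <+> Inr -` W) = card (Inl -` W) + card (Inr -` W)"
    using assms by (intro card_Plus) (auto intro: finite_subset)
  then show "(Inl -` W, Inr -` W) \<in> card_pairs V d" using W s by (simp add: Plus_vimage card_pairs_def)
next
  fix x assume x: "x \<in> card_pairs V d"
  obtain A B where AB: "x = (A, B)" by (cases x)
  then have s: "A \<subseteq> V" "B \<subseteq> V" "card A + card B = d" using x by (simp_all add: card_pairs_def)
  then have "card (A <+> B) = card A + card B"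
    using assms by (intro card_Plus) (auto intro: finite_subset)
  then show "(case x of (A, B) \<Rightarrow> A <+> B) \<in> {W. W \<subseteq> V <+> V \<and> card W = d}" using s AB by auto
  show "(Inl -` (case x of (A, B) \<Rightarrow> A <+> B), Inr -` (case x of (A, B) \<Rightarrow> A <+> B)) = x" using AB by auto
qed (simp_all add: Plus_vimage)

lemma sum_of_bool_card: "finite D \<Longrightarrow> (\<Sum>x\<in>D. of_bool (Q x)) = card {x \<in> D. Q x}"
  by (simp add: of_bool_def sum.If_cases Int_def)

text \<open>Choose the vertex, then a superset of size \<open>d - 1\<close>. The case d < 2 is
  separate because truncated \<open>d - 2\<close> would yield a nonzero binomial.\<close>

lemma card_pairs_singleton:
  assumes "finite V"
  shows "card {x \<in> card_pairs V d. card (fst x) = 1 \<and> fst x \<subseteq> snd x} =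
    (if d < 2 then 0 else card V * ((card V - 1) choose (d - 2)))"
proof -
  let ?S = "SIGMA i:V. {B. {i} \<subseteq> B \<and> B \<subseteq> V \<and> card B = d - 1}"
  have bw: "finite B" if "B \<subseteq> V" for B by (rule finite_subset[OF that assms])
  show ?thesis
  proof (cases "d < 2")
    case True
    have "\<not> (card (fst x) = 1 \<and> fst x \<subseteq> snd x)" if "x \<in> card_pairs V d" for x
    proof
      assume *: "card (fst x) = 1 \<and> fst x \<subseteq> snd x"
      have "finite (snd x)" "card (fst x) + card (snd x) = d" using that bw by (auto simp: card_pairs_def)
      then have "card (fst x) \<le> card (snd x)" "card (snd x) = 0" using * True by (auto intro: card_mono)
      then show False using * by simp
    qed
    then have "{x \<in> card_pairs V d. card (fst x) = 1 \<and> fst x \<subseteq> snd x} = {}" by blast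
    then show ?thesis using True by (simp only: card.empty if_True)
  next
    case False
    have "{x \<in> card_pairs V d. card (fst x) = 1 \<and> fst x \<subseteq> snd x} = (\<lambda>(i, B). ({i}, B)) ` ?S"
    proof (intro equalityI subsetI)
      fix x assume "x \<in> {x \<in> card_pairs V d. card (fst x) = 1 \<and> fst x \<subseteq> snd x}"
      then have x: "fst x \<subseteq> V" "snd x \<subseteq> V" "card (fst x) + card (snd x) = d" "card (fst x) = 1" "fst x \<subseteq> snd x"
        by (auto simp: card_pairs_def)
      obtain i where "fst x = {i}" using x(4) by (rule card_1_singletonE)
      then show "x \<in> (\<lambda>(i, B). ({i}, B)) ` ?S" using x by (intro image_eqI[of _ _ "(i, snd x)"]) (auto simp: prod_eq_iff)
    next
      fix x assume "x \<in> (\<lambda>(i, B). ({i}, B)) ` ?S"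
      then show "x \<in> {x \<in> card_pairs V d. card (fst x) = 1 \<and> fst x \<subseteq> snd x}" using False by (auto simp: card_pairs_def)
    qed
    moreover have "inj_on (\<lambda>(i, B). ({i}, B)) ?S" by (auto simp: inj_on_def)
    ultimately have "card {x \<in> card_pairs V d. card (fst x) = 1 \<and> fst x \<subseteq> snd x} = card ?S"
      by (simp add: card_image)
    also have "\<dots> = (\<Sum>i\<in>V. card {B. {i} \<subseteq> B \<and> B \<subseteq> V \<and> card B = d - 1})"
      by (rule card_SigmaI) (use assms in auto)
    also have "\<dots> = (\<Sum>i\<in>V. (card V - 1) choose (d - 2))"
    proof (rule sum.cong[OF refl])
      fix i assume "i \<in> V"
      then show "card {B. {i} \<subseteq> B \<and> B \<subseteq> V \<and> card B = d - 1} = (card V - 1) choose (d - 2)"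
        using card_supersets[OF assms, of "{i}" "d - 1"] False by (simp add: numeral_2_eq_2)
    qed
    finally show ?thesis using False by simp
  qed
qed

text \<open>One summand for each kind of disconnectedness in \<open>compB\<close>. The third starts
  only at d = 3: for d = 2 its pairs are \<open>A\<close> = \<open>B\<close> = {i}, already in the
  second.\<close>

lemma sum_compB:
  assumes V: "finite V" and d: "d \<ge> 1"
  shows "(\<Sum>(A, B)\<in>card_pairs V d. compB A B) = 2 * (d - 1) * (card V choose d) +
    (if d < 2 then 0 else card V * ((card V - 1) choose (d - 2))) +
    (if d < 3 then 0 else card V * ((card V - 1) choose (d - 2))) + (if d = 4 then card V choose 2 else 0)"
proof -
  let ?D = "card_pairs V d"
  have fD: "finite ?D" by (rule finite_card_pairs[OF V])
  have "(\<Sum>(A, B)\<in>?D. compB A B) = (\<Sum>x\<in>?D. (d - 1) * of_bool (fst x = {} \<or> snd x = {})) +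
      (\<Sum>x\<in>?D. of_bool (card (fst x) = 1 \<and> fst x \<subseteq> snd x)) +
      (\<Sum>x\<in>?D. of_bool (card (snd x) = 1 \<and> snd x \<subseteq> fst x \<and> card (fst x) \<noteq> 1)) +
      (\<Sum>x\<in>?D. of_bool (fst x = snd x \<and> card (fst x) = 2))"
    unfolding sum.distrib[symmetric]
  proof (rule sum.cong[OF refl])
    fix x assume x: "x \<in> ?D"
    obtain A B where AB: "x = (A, B)" by (cases x)
    then have "card A + card B = d" using x by (simp add: card_pairs_def)
    then have "(if A = {} \<or> B = {} then card A + card B - 1 else 0) = (d - 1) * of_bool (A = {} \<or> B = {})"
      by simp
    then show "(case x of (A, B) \<Rightarrow> compB A B) = (d - 1) * of_bool (fst x = {} \<or> snd x = {}) +
        of_bool (card (fst x) = 1 \<and> fst x \<subseteq> snd x) + of_bool (card (snd x) = 1 \<and> snd x \<subseteq> fst x \<and> card (fst x) \<noteq> 1) +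
        of_bool (fst x = snd x \<and> card (fst x) = 2)"
      by (simp only: AB compB_def prod.case fst_conv snd_conv)
  qed
  also have "(\<Sum>x\<in>?D. (d - 1) * of_bool (fst x = {} \<or> snd x = {})) = 2 * (d - 1) * (card V choose d)"
  proof -
    let ?K = "{A. A \<subseteq> V \<and> card A = d}" and ?f = "Pair {} :: nat set \<Rightarrow> nat set \<times> nat set"
      and ?g = "\<lambda>A. (A, {}) :: nat set \<times> nat set"
    have "{x \<in> ?D. fst x = {} \<or> snd x = {}} = ?f ` ?K \<union> ?g ` ?K"
      by (auto simp: card_pairs_def)
    moreover have "card (?f ` ?K \<union> ?g ` ?K) = card (?f ` ?K) + card (?g ` ?K)"
    proof (rule card_Un_disjoint)
      show "finite (?f ` ?K)" "finite (?g ` ?K)" using V by simp_all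
      show "?f ` ?K \<inter> ?g ` ?K = {}" using d by auto
    qed
    moreover have "card (?f ` ?K) = card ?K" "card (?g ` ?K) = card ?K"
      by (auto intro!: card_image inj_onI)
    ultimately have "card {x \<in> ?D. fst x = {} \<or> snd x = {}} = 2 * (card V choose d)"
      using n_subsets[OF V, of d] by simp
    then show ?thesis unfolding sum_distrib_left[symmetric] sum_of_bool_card[OF fD] by simp
  qed
  also have "(\<Sum>x\<in>?D. of_bool (card (fst x) = 1 \<and> fst x \<subseteq> snd x)) =
      (if d < 2 then 0 else card V * ((card V - 1) choose (d - 2)))"
    unfolding sum_of_bool_card[OF fD] by (rule card_pairs_singleton[OF V])
  also have "(\<Sum>x\<in>?D. of_bool (card (snd x) = 1 \<and> snd x \<subseteq> fst x \<and> card (fst x) \<noteq> 1)) =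
      (if d < 3 then 0 else card V * ((card V - 1) choose (d - 2)))"
  proof (cases "d = 2")
    case True
    then have "{x \<in> ?D. card (snd x) = 1 \<and> snd x \<subseteq> fst x \<and> card (fst x) \<noteq> 1} = {}"
      by (auto simp: card_pairs_def)
    then show ?thesis using True unfolding sum_of_bool_card[OF fD] by (simp only: card.empty) simp
  next
    case False
    then have "{x \<in> ?D. card (snd x) = 1 \<and> snd x \<subseteq> fst x \<and> card (fst x) \<noteq> 1} =
        prod.swap ` {x \<in> ?D. card (fst x) = 1 \<and> fst x \<subseteq> snd x}"
      by (auto simp: card_pairs_def image_iff)
    moreover have "card (prod.swap ` {x \<in> ?D. card (fst x) = 1 \<and> fst x \<subseteq> snd x}) =
        card {x \<in> ?D. card (fst x) = 1 \<and> fst x \<subseteq> snd x}"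
      by (rule card_image) (auto simp: inj_on_def)
    ultimately show ?thesis
      using False card_pairs_singleton[OF V, of d] unfolding sum_of_bool_card[OF fD] by auto
  qed
  also have "(\<Sum>x\<in>?D. of_bool (fst x = snd x \<and> card (fst x) = 2)) = (if d = 4 then card V choose 2 else 0)"
  proof (cases "d = 4")
    case True
    then have "{x \<in> ?D. fst x = snd x \<and> card (fst x) = 2} = (\<lambda>A. (A, A)) ` {A. A \<subseteq> V \<and> card A = 2}"
      by (auto simp: card_pairs_def)
    moreover have "card ((\<lambda>A. (A, A)) ` {A. A \<subseteq> V \<and> card A = 2}) = card {A. A \<subseteq> V \<and> card A = 2}"
      by (rule card_image) (auto simp: inj_on_def)
    ultimately show ?thesis using True n_subsets[OF V, of 2] unfolding sum_of_bool_card[OF fD] by simp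
  next
    case False
    then have "{x \<in> ?D. fst x = snd x \<and> card (fst x) = 2} = {}" by (auto simp: card_pairs_def)
    then show ?thesis using False unfolding sum_of_bool_card[OF fD] by (simp only: card.empty if_False)
  qed
  finally show ?thesis .
qed

text \<open>This explains \<open>lam\<close> with i = d - 1. One-sided sets give the term with
  \<open>b choose (i + 1)\<close> and isolated vertices the term with the factor b. The exception at
  i = 1 is the double count of x_i, y_i, and the one at i = 3 comes from the pairs of disjoint
  edges.\<close>

lemma sum_compB_lam:
  assumes "b \<ge> 3" "d \<ge> 1"
  shows "(\<Sum>(A, B)\<in>card_pairs {1..b} d. compB A B) = lam b (d - 1)"
proof -
  have S: "(\<Sum>(A, B)\<in>card_pairs {1..b} d. compB A B) = 2 * (d - 1) * (b choose d) +
    (if d < 2 then 0 else b * ((b - 1) choose (d - 2))) +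
    (if d < 3 then 0 else b * ((b - 1) choose (d - 2))) + (if d = 4 then b choose 2 else 0)"
    proof -
    have cV: "card {1..b} = b" by simp
    show ?thesis using sum_compB[OF finite_atLeastAtMost assms(2), of 1 b] unfolding cV .
  qed
  consider "d = 1" | "d = 2" | "d = 4" | "d \<ge> 2 * b" "d \<noteq> 4" | "3 \<le> d" "d < 2 * b" "d \<noteq> 4"
    using assms by linarith
  then show ?thesis
  proof cases
    case 1
    then show ?thesis unfolding S by (simp add: lam_def)
  next
    case 2
    have "\<not> 2 * b - 2 < 1" using assms(1) by linarith
    then show ?thesis using 2 unfolding S by (simp add: lam_def)
  next
    case 3
    have "\<not> 2 * b - 2 < 3" using assms(1) by linarith
    moreover have "d - 1 = 3" "d - 2 = 2" using 3 by simp_all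
    ultimately show ?thesis using 3 unfolding S by (simp add: lam_def)
  next
    case 4
    then have "b choose d = 0" "(b - 1) choose (d - 2) = 0" using assms by (auto intro!: binomial_eq_0)
    moreover have "lam b (d - 1) = 0"
    proof -
      have "2 * b - 2 < d - 1" using assms 4 by linarith
      then show ?thesis by (simp add: lam_def)
    qed
    ultimately show ?thesis using 4 unfolding S by simp
  next
    case 5
    then have "d - 1 - 1 = d - 2" "d - 1 + 1 = d" "\<not> d - 1 < 1" "\<not> d - 1 > 2 * b - 2" "d - 1 \<noteq> 1" "d - 1 \<noteq> 3" by linarith+
    then have "lam b (d - 1) = 2 * (d - 1) * (b choose d) + 2 * b * ((b - 1) choose (d - 2))"
      unfolding lam_def by (simp only: if_False simp_thms)
    then show ?thesis using 5 unfolding S by simp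
  qed
qed

section \<open>Counting edges of the complex; the Euler characteristic\<close>

definition nonedges :: "nat \<Rightarrow> (nat + nat) set set" where
  "nonedges b = (\<lambda>(i, j). {Inl i, Inr j}) ` (SIGMA i:{1..b}. {1..b} - {i})"

lemma card_nonedges: "card (nonedges b) = b * b - b"
proof -
  let ?f = "\<lambda>x. {Inl (fst x), Inr (snd x)} :: (nat + nat) set" and ?S = "SIGMA i:{1..b}. {1..b} - {i}"
  have inj: "inj_on ?f ?S"
  proof (rule inj_onI)
    fix x y :: "nat \<times> nat" assume "?f x = ?f y"
    then show "x = y" by (simp add: doubleton_eq_iff prod_eq_iff)
  qed
  have "card (nonedges b) = card (?f ` ?S)" by (simp only: nonedges_def case_prod_unfold)
  also have "\<dots> = card ?S" by (rule card_image[OF inj])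
  also have "\<dots> = (\<Sum>i\<in>{1..b}. card ({1..b} - {i}))" by (rule card_SigmaI) simp_all
  also have "\<dots> = (\<Sum>i\<in>{1..b}. b - 1)" by (rule sum.cong) simp_all
  also have "\<dots> = b * b - b" by (simp add: diff_mult_distrib2)
  finally show ?thesis .
qed

lemma nonedges_props:
  assumes "T \<in> nonedges b"
  shows "card T = 2" "T \<subseteq> {1..b} <+> {1..b}" "finite T"
  using assms by (auto simp: nonedges_def)

lemma fnum_B:
  assumes W: "W \<subseteq> {1..b} <+> {1..b}"
  shows "fnum W (faceB b W) 2 = card {T \<in> nonedges b. T \<subseteq> W}"
proof -
  have fW: "finite W" by (rule finite_subset[OF W]) simp
  have dd: "W - (W - S) = S" if "S \<subseteq> W" for S using that by blast
  have "bij_betw (\<lambda>S. W - S) {S. S \<subseteq> W \<and> faceB b W S \<and> card S + 2 = card W} {T \<in> nonedges b. T \<subseteq> W}"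
  proof (rule bij_betw_byWitness[where f' = "\<lambda>S. W - S"])
    show "(\<lambda>S. W - S) ` {S. S \<subseteq> W \<and> faceB b W S \<and> card S + 2 = card W} \<subseteq> {T \<in> nonedges b. T \<subseteq> W}"
    proof (rule image_subsetI)
      fix S assume S: "S \<in> {S. S \<subseteq> W \<and> faceB b W S \<and> card S + 2 = card W}"
      then have SW: "S \<subseteq> W" by simp
      have "card (W - S) = 2" using card_Diff_subset[OF finite_subset[OF SW fW] SW] S by auto
      then obtain u v where uv: "W - S = {u, v}" "u \<noteq> v" unfolding card_2_iff by (elim exE conjE)
      have f: "faceB b W (W - {u, v})" using S dd[OF SW] uv(1) by simp
      have i: "u \<in> W" "v \<in> W" using uv by blast+
      then have "u \<in> {1..b} <+> {1..b}" "v \<in> {1..b} <+> {1..b}" using W by blast+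
      then have "\<exists>i j. (u = Inl i \<and> v = Inr j \<or> v = Inl i \<and> u = Inr j) \<and> i \<in> {1..b} \<and> j \<in> {1..b} \<and> i \<noteq> j"
        using faceB_compl[OF W, of "{u, v}"] f uv(2) i by (cases u; cases v) auto
      then obtain i j where ij: "u = Inl i \<and> v = Inr j \<or> v = Inl i \<and> u = Inr j" "i \<in> {1..b}" "j \<in> {1..b}" "i \<noteq> j"
        by (elim exE conjE)
      from ij(1) have "{u, v} = {Inl i, Inr j}" by auto
      then have "{u, v} \<in> nonedges b" unfolding nonedges_def using ij(2-4) by (intro image_eqI[of _ _ "(i, j)"]) auto
      then show "W - S \<in> {T \<in> nonedges b. T \<subseteq> W}" using uv(1) i by simp
    qed
    show "(\<lambda>S. W - S) ` {T \<in> nonedges b. T \<subseteq> W} \<subseteq> {S. S \<subseteq> W \<and> faceB b W S \<and> card S + 2 = card W}"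
    proof (rule image_subsetI)
      fix T assume T: "T \<in> {T \<in> nonedges b. T \<subseteq> W}"
      then obtain i j where ij: "T = {Inl i, Inr j}" "i \<noteq> j" by (auto simp: nonedges_def)
      have TW: "T \<subseteq> W" using T by simp
      have "faceB b W (W - T)" unfolding faceB_compl[OF W TW] using ij by auto
      moreover have "card (W - T) + 2 = card W"
      proof -
        have "card T = 2" using ij by simp
        then show ?thesis using card_Diff_subset[OF finite_subset[OF TW fW] TW] card_mono[OF fW TW] by simp
      qed
      ultimately show "W - T \<in> {S. S \<subseteq> W \<and> faceB b W S \<and> card S + 2 = card W}" by simp
    qed
  qed (simp_all add: dd)
  then show ?thesis unfolding fnum_def by (rule bij_betw_same_card)
qed

text \<open>Double counting of the pairs of an edge and a set of size \<open>d\<close> containing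
  it.\<close>

lemma sum_fnum_B:
  "(\<Sum>W | W \<subseteq> {1..b} <+> {1..b} \<and> card W = d. fnum W (faceB b W) 2) =
    (if d < 2 then 0 else (b * b - b) * ((2 * b - 2) choose (d - 2)))"
proof -
  let ?V = "{1..b} <+> {1..b}"
  let ?D = "{W. W \<subseteq> ?V \<and> card W = d}"
  have fV: "finite ?V" by simp
  have cV: "card ?V = 2 * b" by (simp add: card_Plus)
  have fD: "finite ?D" using fV by simp
  have fN: "finite (nonedges b)" by (simp add: nonedges_def)
  have "(\<Sum>W\<in>?D. fnum W (faceB b W) 2) = (\<Sum>W\<in>?D. \<Sum>T\<in>nonedges b. of_bool (T \<subseteq> W))"
    by (rule sum.cong) (simp_all add: fnum_B sum_of_bool_card[OF fN])
  also have "\<dots> = (\<Sum>T\<in>nonedges b. \<Sum>W\<in>?D. of_bool (T \<subseteq> W))" by (rule sum.swap)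
  also have "\<dots> = (\<Sum>T\<in>nonedges b. if d < 2 then 0 else (2 * b - 2) choose (d - 2))"
  proof (rule sum.cong[OF refl])
    fix T assume "T \<in> nonedges b"
    note T = nonedges_props[OF this]
    have e: "{W \<in> ?D. T \<subseteq> W} = {W. T \<subseteq> W \<and> W \<subseteq> ?V \<and> card W = d}" by blast
    show "(\<Sum>W\<in>?D. of_bool (T \<subseteq> W)) = (if d < 2 then 0 else (2 * b - 2) choose (d - 2))"
    proof (cases "d < 2")
      case True
      have "\<not> (T \<subseteq> W \<and> W \<subseteq> ?V \<and> card W = d)" for W
      proof
        assume *: "T \<subseteq> W \<and> W \<subseteq> ?V \<and> card W = d"
        then have "card T \<le> card W" using finite_subset[OF _ fV] by (intro card_mono) blast+
        then show False using * T(1) True by simp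
      qed
      then show ?thesis unfolding sum_of_bool_card[OF fD] e using True by simp
    next
      case False
      then show ?thesis unfolding sum_of_bool_card[OF fD] e
        using card_supersets[OF fV T(2), of d] T(1) by (metis cV verit_comp_simplify1(3))
    qed
  qed
  also have "\<dots> = (if d < 2 then 0 else (b * b - b) * ((2 * b - 2) choose (d - 2)))"
    by (simp add: card_nonedges)
  finally show ?thesis .
qed

lemma faceB_card:
  assumes W: "W \<subseteq> {1..b} <+> {1..b}" and S: "S \<subseteq> W" "faceB b W S"
  shows "card W \<le> card S + 2"
proof -
  \<comment> \<open>The choices name the only possible vertex on each side; if a side has none, an
    arbitrary element does no harm to the bound.\<close>
  let ?T = "W - S" and ?u = "Inl (SOME i. Inl i \<in> W - S)" and ?v = "Inr (SOME i. Inr i \<in> W - S)"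
  have fW: "finite W" by (rule finite_subset[OF W]) simp
  have "W - ?T = S" using S(1) by blast
  then have *: "\<forall>i j. Inl i \<in> ?T \<longrightarrow> Inl j \<in> ?T \<longrightarrow> i = j" "\<forall>i j. Inr i \<in> ?T \<longrightarrow> Inr j \<in> ?T \<longrightarrow> i = j"
    using faceB_compl[OF W, of ?T] S(2) by auto
  have "?T \<subseteq> {?u, ?v}"
  proof
    fix x assume x: "x \<in> ?T"
    show "x \<in> {?u, ?v}"
    proof (cases x)
      case (Inl i)
      then have "Inl (SOME i. Inl i \<in> ?T) \<in> ?T" using x by (intro someI[of "\<lambda>i. Inl i \<in> ?T" i]) simp
      then have "(SOME i. Inl i \<in> ?T) = i" using *(1) x Inl by blast
      then show ?thesis using Inl by simp
    next
      case (Inr i)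
      then have "Inr (SOME i. Inr i \<in> ?T) \<in> ?T" using x by (intro someI[of "\<lambda>i. Inr i \<in> ?T" i]) simp
      then have "(SOME i. Inr i \<in> ?T) = i" using *(2) x Inr by blast
      then show ?thesis using Inr by simp
    qed
  qed
  then have "card ?T \<le> card {?u, ?v}" by (rule card_mono[rotated]) simp
  then have "card ?T \<le> 2" by simp
  then show ?thesis using card_Diff_subset[OF finite_subset[OF S(1) fW] S(1)] by simp
qed

text \<open>The right side sums, over all W of size r + 2, components minus one plus edges minus (r
  + 1), which is the first cohomology. Pascal's rule and absorption with N = 2b - 2 remove the
  factor r + 1 and lead to the form of \<open>mu\<close>.\<close>

lemma mu_eq:
  assumes "b \<ge> 1"
  shows "mu b r = int (lam b (r + 1)) + int (b * b - b) * int ((2 * b - 2) choose r) - int (r + 1) * int ((2 * b) choose (r + 2))"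
proof -
  define N where "N = 2 * b - 2"
  have N: "2 * b = N + 2" using assms by (simp add: N_def)
  \<comment> \<open>Trades the factor k + 1 for a lower binomial; beyond N both sides are 0.\<close>
  have absorb: "int (k + 1) * int (N choose (k + 1)) = (int N - int k) * int (N choose k)" for k
  proof (cases "k \<le> N")
    case True
    have "Suc k * (N choose Suc k) = (N - k) * (N choose k)"
      using binomial_absorb_comp[of N k] binomial_absorption[of k N] by (cases N) simp_all
    then have "int (Suc k * (N choose Suc k)) = int ((N - k) * (N choose k))" by (rule arg_cong)
    then show ?thesis using True by (simp only: of_nat_mult of_nat_diff Suc_eq_plus1)
  next
    case False
    then show ?thesis by (simp add: binomial_eq_0)
  qed
  let ?c0 = "int (N choose r)" and ?c1 = "int (N choose (r + 1))" and ?c2 = "int (N choose (r + 2))"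
  have "(N + 2) choose (r + 2) = (N choose (r + 2)) + 2 * (N choose (r + 1)) + (N choose r)"
    by (simp add: numeral_2_eq_2)
  then have c: "int ((2 * b) choose (r + 2)) = ?c2 + 2 * ?c1 + ?c0" unfolding N by simp
  have a1: "(int r + 1) * ?c1 = (int N - int r) * ?c0" using absorb[of r] by (metis int_ops(2,5))
  have a2: "(int r + 2) * ?c2 = (int N - int r - 1) * ?c1" using absorb[of "r + 1"] by (simp add: algebra_simps)
  have "b \<le> b * b" by simp
  then have bb: "int (b * b - b) = int b * int b - int b" by (simp add: of_nat_diff)
  have iN: "2 * int b - 2 = int N" using assms by (simp add: N_def)
  have "int (r + 1) * (?c2 + 2 * ?c1 + ?c0) = int N * ?c1 + (int N + 1) * ?c0 - ?c2"
  proof -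
    have "int (r + 1) * (?c2 + 2 * ?c1 + ?c0) + ?c2 = (int r + 2) * ?c2 + (int r + 1) * ?c1 + (int r + 1) * ?c1 + (int r + 1) * ?c0"
      by (simp add: algebra_simps)
    also have "\<dots> = int N * ?c1 + (int N + 1) * ?c0"
      unfolding a2 using a1 by (simp add: algebra_simps)
    finally show ?thesis by simp
  qed
  then show ?thesis unfolding mu_def c N_def[symmetric] iN bb
    by (simp add: iN[symmetric] power2_eq_square algebra_simps)
qed

section \<open>Coefficients regraded by d and p = d - r\<close>

definition bcoef :: "int poly poly \<Rightarrow> nat \<Rightarrow> nat \<Rightarrow> int" where
  "bcoef P d p = (if p \<le> d then poly.coeff (poly.coeff P (d - p)) d else 0)"

text \<open>No monomial has a larger exponent in u than in v. This is what allows the nonnegative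
  index p = d - r of \<open>bcoef\<close> to see every coefficient.\<close>

definition upper :: "int poly poly \<Rightarrow> bool" where
  "upper P \<longleftrightarrow> (\<forall>r q. q < r \<longrightarrow> poly.coeff (poly.coeff P r) q = 0)"

lemma coeff_coeff_mult:
  fixes P Q :: "int poly poly"
  shows "poly.coeff (poly.coeff (P * Q) r) d =
    (\<Sum>e\<le>d. \<Sum>i\<le>r. poly.coeff (poly.coeff P i) e * poly.coeff (poly.coeff Q (r - i)) (d - e))"
proof -
  have "poly.coeff (poly.coeff (P * Q) r) d =
      (\<Sum>i\<le>r. \<Sum>e\<le>d. poly.coeff (poly.coeff P i) e * poly.coeff (poly.coeff Q (r - i)) (d - e))"
    by (simp only: coeff_mult coeff_sum)
  also have "\<dots> = (\<Sum>e\<le>d. \<Sum>i\<le>r. poly.coeff (poly.coeff P i) e * poly.coeff (poly.coeff Q (r - i)) (d - e))"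
    by (rule sum.swap)
  finally show ?thesis .
qed

lemma upper_1: "upper 1"
  by (auto simp: upper_def coeff_1)

lemma upper_mult: assumes "upper P" "upper Q" shows "upper (P * Q)"
  unfolding upper_def
proof (intro allI impI)
  fix r d :: nat assume "d < r"
  have "poly.coeff (poly.coeff P i) e * poly.coeff (poly.coeff Q (r - i)) (d - e) = 0" if "e \<le> d" "i \<le> r" for e i
  proof (cases "e < i")
    case True then show ?thesis using assms(1) by (simp add: upper_def)
  next
    case False
    then have "d - e < r - i" using that \<open>d < r\<close> by linarith
    then show ?thesis using assms(2) by (simp add: upper_def)
  qed
  then show "poly.coeff (poly.coeff (P * Q) r) d = 0"
    unfolding coeff_coeff_mult by (intro sum.neutral ballI) (simp del: mult_eq_0_iff)
qed

lemma upper_power: "upper P \<Longrightarrow> upper (P ^ n)"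
  by (induction n) (simp_all add: upper_1 upper_mult)

text \<open>The substitution q = e - i turns the product rule in powers of u into one in p;
  \<open>upper\<close> kills the terms for which it would leave the naturals.\<close>

lemma bcoef_mult:
  assumes P: "upper P" and Q: "upper Q"
  shows "bcoef (P * Q) d p = (\<Sum>e\<le>d. \<Sum>q\<le>p. bcoef P e q * bcoef Q (d - e) (p - q))"
proof (cases "p \<le> d")
  case True
  let ?P = "\<lambda>r q. poly.coeff (poly.coeff P r) q" and ?Q = "\<lambda>r q. poly.coeff (poly.coeff Q r) q"
  have "(\<Sum>i\<le>d - p. ?P i e * ?Q (d - p - i) (d - e)) = (\<Sum>q\<le>p. bcoef P e q * bcoef Q (d - e) (p - q))"
    if e: "e \<le> d" for e
  proof -
    let ?I = "{i. i \<le> d - p \<and> i \<le> e \<and> e \<le> p + i}" and ?J = "{q. q \<le> p \<and> q \<le> e \<and> p - q \<le> d - e}"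
    have "(\<Sum>i\<le>d - p. ?P i e * ?Q (d - p - i) (d - e)) = (\<Sum>i\<in>?I. ?P i e * ?Q (d - p - i) (d - e))"
    proof (rule sum.mono_neutral_right)
      show "\<forall>i\<in>{..d - p} - ?I. ?P i e * ?Q (d - p - i) (d - e) = 0"
      proof
        fix i assume i: "i \<in> {..d - p} - ?I"
        then have "e < i \<or> d - e < d - p - i" using e True by auto
        then show "?P i e * ?Q (d - p - i) (d - e) = 0" using P Q by (auto simp: upper_def)
      qed
    qed auto
    also have "\<dots> = (\<Sum>q\<in>?J. bcoef P e q * bcoef Q (d - e) (p - q))"
    proof (rule sum.reindex_bij_witness[where i = "\<lambda>q. e - q" and j = "\<lambda>i. e - i"])
      fix i assume i: "i \<in> ?I"
      then show "e - (e - i) = i" by simp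
      show "e - i \<in> ?J" using i e True by auto
      have "(d - e) - (p - (e - i)) = d - p - i" "e - (e - i) = i" "e - i \<le> e" "p - (e - i) \<le> d - e" using i e True by auto
      then show "bcoef P e (e - i) * bcoef Q (d - e) (p - (e - i)) = ?P i e * ?Q (d - p - i) (d - e)"
        unfolding bcoef_def by simp
    next
      fix q assume q: "q \<in> ?J"
      then show "e - (e - q) = q" by simp
      show "e - q \<in> ?I" using q e True by auto
    qed
    also have "\<dots> = (\<Sum>q\<le>p. bcoef P e q * bcoef Q (d - e) (p - q))"
      by (rule sum.mono_neutral_left) (auto simp: bcoef_def)
    finally show ?thesis .
  qed
  then show ?thesis using True unfolding bcoef_def[of "P * Q"] coeff_coeff_mult by simp
next
  case False
  have Z: "bcoef P e q * bcoef Q (d - e) (p - q) = 0" if "e \<le> d" "q \<le> p" for e q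
    using that False by (auto simp: bcoef_def)
  have "(\<Sum>e\<le>d. \<Sum>q\<le>p. bcoef P e q * bcoef Q (d - e) (p - q)) = 0"
    by (intro sum.neutral ballI Z) simp_all
  then show ?thesis using False unfolding bcoef_def[of "P * Q"] by simp
qed

lemma coeff_P_poly:
  "poly.coeff (poly.coeff (P_poly b) r) q = of_bool (r = 0 \<and> q = 0) +
    (if 1 \<le> r \<and> r \<le> 2 * b - 2 \<and> q = r + 1 then int (lam b r) else 0) +
    (if 1 \<le> r \<and> r \<le> 2 * b - 2 \<and> q = r + 2 then mu b r else 0)"
proof -
  have M: "poly.coeff (poly.coeff (\<Sum>s = 1..m. monom (monom (f s) (s + k)) s) r) q =
      (if 1 \<le> r \<and> r \<le> m \<and> q = r + k then f r else 0)" for m k and f :: "nat \<Rightarrow> int"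
  proof -
    have "poly.coeff (poly.coeff (\<Sum>s = 1..m. monom (monom (f s) (s + k)) s) r) q =
        (\<Sum>s = 1..m. if s = r then (if q = r + k then f r else 0) else 0)"
      unfolding coeff_sum by (rule sum.cong) auto
    then show ?thesis by (simp add: sum.delta)
  qed
  have O1: "poly.coeff (poly.coeff (1 :: int poly poly) r) q = of_bool (r = 0 \<and> q = 0)"
    by (simp add: coeff_1)
  note M1 = M[where m = "2 * b - 2" and k = 1 and f = "\<lambda>r. int (lam b r)"]
  note M2 = M[where m = "2 * b - 2" and k = 2 and f = "mu b"]
  show ?thesis by (simp only: P_poly_def coeff_add M1 M2 O1)
qed

lemma upper_P_poly: "upper (P_poly b)"
  by (auto simp: upper_def coeff_P_poly)

lemma zdim_top:
  assumes "finite W" "card W \<le> q"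
  shows "zdim TYPE('k::field) \<iota> W P q = fnum W P q"
proof -
  have "fdiff \<iota> W P f S = 0" if f: "f \<in> pchain W P q" for f :: "'a set \<Rightarrow> 'k" and S
  proof (rule ccontr)
    assume "fdiff \<iota> W P f S \<noteq> 0"
    then have "card S + Suc q = card W" using fdiff_pchain[OF assms(1) f, of \<iota>] by (simp add: pchain_def)
    then show False using assms(2) by simp
  qed
  then have "pcycle \<iota> W P q = (pchain W P q :: ('a set \<Rightarrow> 'k) set)" by (auto simp: pcycle_def fun_eq_iff)
  then show ?thesis using pchain_findim_dim(2)[OF assms(1), of P q, where 'k = 'k] by (simp add: zdim_def)
qed

lemma fnum_top: "card W < p \<Longrightarrow> fnum W P p = 0"
  by (simp add: fnum_def)

lemma rhdim_top:
  assumes "finite W" "card W < p"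
  shows "rhdim TYPE('k::field) \<iota> W P p = 0"
proof -
  obtain q where "p = Suc q" "card W \<le> q" using assms(2) by (cases p) auto
  then show ?thesis using zdim_top[OF assms(1), of p, where 'k = 'k] zdim_top[OF assms(1), of q, where 'k = 'k] fnum_top[OF assms(2)] assms(2)
    by (simp add: rhdim_def)
qed

lemma rhdim_empty:
  assumes "P {}"
  shows "rhdim TYPE('k::field) \<iota> {} P p = of_bool (p = 0)"
proof (cases p)
  case 0
  have "zdim TYPE('k) \<iota> {} P 0 = fnum {} P 0" by (rule zdim_top) simp_all
  moreover have "fnum {} P 0 = 1" by (rule fnum_0[where P = P]) (simp_all add: assms)
  ultimately show ?thesis using 0 by (simp add: rhdim_def)
next
  case (Suc q)
  then show ?thesis using rhdim_top[of "{}" p, where 'k = 'k] by simp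
qed

lemma bsum_0:
  assumes V: "finite V" and E: "{} \<notin> E"
  shows "bsum TYPE('k::field) \<iota> V E 0 p = of_bool (p = 0)"
proof -
  have "{W. W \<subseteq> V \<and> card W = 0} = {{}}" using V by (auto dest: finite_subset)
  moreover have "face_pred E {} {}" using E by (auto simp: face_pred_def nonface_def)
  ultimately show ?thesis using rhdim_empty[of "face_pred E {}", where 'k = 'k] by (simp add: bsum_def)
qed

lemma bsum_top:
  assumes "finite V" "d < p"
  shows "bsum TYPE('k::field) \<iota> V E d p = 0"
  unfolding bsum_def
proof (rule sum.neutral, rule ballI)
  fix W assume "W \<in> {W. W \<subseteq> V \<and> card W = d}"
  then show "rhdim TYPE('k) \<iota> W (face_pred E W) p = 0"
    using assms finite_subset[of W V] by (intro rhdim_top) auto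
qed

lemma verts_B: "verts (B_graph b) = {1..b} <+> {1..b}"
  by (simp add: B_graph_def)

lemma empty_notin_edges: "simple_graph G \<Longrightarrow> {} \<notin> edges G"
  by (auto simp: simple_graph_def)

lemma rhdim_B:
  assumes W: "W \<subseteq> {1..b} <+> {1..b}" "W \<noteq> {}" and \<iota>: "inj_on \<iota> W"
  shows "rhdim TYPE('k::field) \<iota> W (faceB b W) p =
    (if p = 1 then int (compB (Inl -` W) (Inr -` W))
     else if p = 2 then int (compB (Inl -` W) (Inr -` W)) + int (fnum W (faceB b W) 2) - (int (card W) - 1) else 0)"
proof -
  have fW: "finite W" by (rule finite_subset[OF W(1)]) simp
  have s: "Inl -` W \<subseteq> {1..b}" "Inr -` W \<subseteq> {1..b}" using W(1) by auto
  have z: "zdim TYPE('k) \<iota> W (faceB b W) 1 = compB (Inl -` W) (Inr -` W) + 1"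
    using zdim_compB[OF s, of \<iota>, where 'k = 'k] \<iota> W(2) by (simp only: Plus_vimage simp_thms)
  have t: "faceB b W W" using faceB_compl[OF W(1), of "{}"] by simp
  have v: "faceB b W (W - {v})" if "v \<in> W" for v using faceB_compl[OF W(1), of "{v}"] that by auto
  have big: "card W \<le> card S + 2" if "S \<subseteq> W" "faceB b W S" for S by (rule faceB_card[OF W(1) that])
  have R1: "rhdim TYPE('k) \<iota> W (faceB b W) 0 = 0"
    by (rule rhdim_dim_1(1)[where P = "faceB b W", OF fW W(2)]) (rule t | erule v | (rule big; assumption))+
  have R2: "rhdim TYPE('k) \<iota> W (faceB b W) 1 = int (zdim TYPE('k) \<iota> W (faceB b W) 1) - 1"
    by (rule rhdim_dim_1(2)[where P = "faceB b W", OF fW W(2)]) (rule t | erule v | (rule big; assumption))+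
  have R3: "rhdim TYPE('k) \<iota> W (faceB b W) 2 = int (fnum W (faceB b W) 2) - int (card W) + int (zdim TYPE('k) \<iota> W (faceB b W) 1)"
    by (rule rhdim_dim_1(3)[where P = "faceB b W", OF fW W(2)]) (rule t | erule v | (rule big; assumption))+
  have R4: "rhdim TYPE('k) \<iota> W (faceB b W) p = 0" if "p \<ge> 3"
    by (rule rhdim_dim_1(4)[where P = "faceB b W", OF fW W(2)]) (rule t | erule v | (rule big; assumption) | rule that)+
  consider "p = 0" | "p = 1" | "p = 2" | "p \<ge> 3" by linarith
  then show ?thesis
  proof cases
    case 1
    show ?thesis unfolding 1 using R1 by simp
  next
    case 2
    show ?thesis unfolding 2 using R2 z by simp
  next
    case 3
    show ?thesis unfolding 3 using R3 z by simp
  next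
    case 4
    then show ?thesis using R4 by simp
  qed
qed

text \<open>In the index p = d - r, the \<lambda>-terms of \<open>P_poly\<close> sit at p = 1 and
  the \<mu>-terms at p = 2. They match components minus one and first cohomology, summed over the
  sets of size d.\<close>

lemma bsum_B:
  assumes b: "b \<ge> 3" and \<iota>: "inj_on \<iota> (verts (B_graph b))"
  shows "bsum TYPE('k::field) \<iota> (verts (B_graph b)) (edges (B_graph b)) d p = bcoef (P_poly b) d p"
proof (cases "d = 0")
  case True
  have "bsum TYPE('k) \<iota> (verts (B_graph b)) (edges (B_graph b)) 0 p = of_bool (p = 0)"
    by (rule bsum_0) (simp_all add: verts_B empty_notin_edges simple_graph_B_graph)
  then show ?thesis using True by (simp add: bcoef_def coeff_P_poly)
next
  case False
  let ?V = "{1..b} <+> {1..b}"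
  let ?D = "{W. W \<subseteq> ?V \<and> card W = d}"
  have S1: "(\<Sum>W\<in>?D. compB (Inl -` W) (Inr -` W)) = lam b (d - 1)"
  proof -
    have "(\<Sum>W\<in>?D. compB (Inl -` W) (Inr -` W)) = (\<Sum>(A, B)\<in>card_pairs {1..b} d. compB (Inl -` (A <+> B)) (Inr -` (A <+> B)))"
      by (rule sum_Plus) simp
    also have "\<dots> = (\<Sum>(A, B)\<in>card_pairs {1..b} d. compB A B)"
    proof (rule sum.cong[OF refl])
      have "Inl -` (A <+> B) = A" "Inr -` (A <+> B) = B" for A B :: "nat set" by auto
      then show "(case x of (A, B) \<Rightarrow> compB (Inl -` (A <+> B)) (Inr -` (A <+> B))) = (case x of (A, B) \<Rightarrow> compB A B)" for x
        by (simp only:)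
    qed
    also have "\<dots> = lam b (d - 1)" by (rule sum_compB_lam) (use b False in auto)
    finally show ?thesis .
  qed
  have cD: "card ?D = (2 * b) choose d"
    using n_subsets[of ?V d] by (simp add: card_Plus mult_2)
  have R: "rhdim TYPE('k) \<iota> W (faceB b W) p = (if p = 1 then int (compB (Inl -` W) (Inr -` W))
     else if p = 2 then int (compB (Inl -` W) (Inr -` W)) + int (fnum W (faceB b W) 2) - (int d - 1) else 0)"
    if "W \<in> ?D" for W
  proof -
    have W: "W \<subseteq> ?V" "card W = d" "W \<noteq> {}" using that False by auto
    have "inj_on \<iota> W" using \<iota> W(1) unfolding verts_B by (rule inj_on_subset)
    from rhdim_B[OF W(1,3) this, of p, where 'k = 'k] show ?thesis unfolding W(2) .
  qed
  have "bsum TYPE('k) \<iota> (verts (B_graph b)) (edges (B_graph b)) d p = (\<Sum>W\<in>?D. rhdim TYPE('k) \<iota> W (faceB b W) p)"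
    by (simp only: bsum_def verts_B)
  also have "\<dots> = (\<Sum>W\<in>?D. if p = 1 then int (compB (Inl -` W) (Inr -` W))
     else if p = 2 then int (compB (Inl -` W) (Inr -` W)) + int (fnum W (faceB b W) 2) - (int d - 1) else 0)"
    by (rule sum.cong[OF refl R])
  also have "\<dots> = (if p = 1 then int (lam b (d - 1)) else if p = 2 then int (lam b (d - 1)) +
      int (if d < 2 then 0 else (b * b - b) * ((2 * b - 2) choose (d - 2))) - (int d - 1) * int ((2 * b) choose d) else 0)"
  proof -
    have s1: "(\<Sum>W\<in>?D. int (compB (Inl -` W) (Inr -` W))) = int (lam b (d - 1))"
      unfolding S1[symmetric] by simp
    have s2: "(\<Sum>W\<in>?D. int (fnum W (faceB b W) 2)) = int (if d < 2 then 0 else (b * b - b) * ((2 * b - 2) choose (d - 2)))"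
      unfolding sum_fnum_B[symmetric] by simp
    have s3: "(\<Sum>W\<in>?D. int d - 1) = (int d - 1) * int ((2 * b) choose d)"
      by (simp only: sum_constant cD mult.commute)
    show ?thesis
    proof (cases "p = 1")
      case True
      show ?thesis unfolding if_P[OF True] by (rule s1)
    next
      case p1: False
      show ?thesis
      proof (cases "p = 2")
        case True
        have "(\<Sum>W\<in>?D. int (compB (Inl -` W) (Inr -` W)) + int (fnum W (faceB b W) 2) - (int d - 1)) =
            (\<Sum>W\<in>?D. int (compB (Inl -` W) (Inr -` W))) + (\<Sum>W\<in>?D. int (fnum W (faceB b W) 2)) - (\<Sum>W\<in>?D. int d - 1)"
          by (simp only: sum_subtractf sum.distrib)
        then show ?thesis unfolding if_not_P[OF p1] if_P[OF True] s1 s2 s3 .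
      next
        case False
        show ?thesis unfolding if_not_P[OF p1] if_not_P[OF False] by (rule sum.neutral_const)
      qed
    qed
  qed
  also have "\<dots> = bcoef (P_poly b) d p"
  proof -
    have lam0: "lam b i = 0" if "i < 1 \<or> i > 2 * b - 2" for i using that by (simp add: lam_def)
    consider "p = 0" | "p = 1" | "p = 2" "d = 1" | "p = 2" "d = 2" | "p = 2" "d \<ge> 3" | "p \<ge> 3" using False by linarith
    then show ?thesis
    proof cases
      case 1 then show ?thesis using False by (simp add: bcoef_def coeff_P_poly)
    next
      case 2 then show ?thesis using False lam0[of "d - 1"] by (auto simp: bcoef_def coeff_P_poly)
    next
      case 3 then show ?thesis using lam0[of 0] by (simp add: bcoef_def)
    next
      \<comment> \<open>For d = 2 the power of u would be 0, where only the constant term of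
        \<open>P_poly\<close> lives. A complex on two vertices has no cycle, so the Euler count
        vanishes as well.\<close>
      case 4
      have c2: "2 * (m choose 2) = m * (m - 1)" for m :: nat
        using times_binomial_minus1_eq[of 2 m] by simp
      have bb: "b \<le> b * b" by simp
      have "\<not> 2 * b - 2 < 1" using b by linarith
      then have "lam b 1 = 2 * (b choose 2) + b" by (simp add: lam_def)
      also have "\<dots> = b * b" unfolding c2 using bb by (simp add: diff_mult_distrib2)
      finally have l: "lam b 1 = b * b" .
      have "2 * ((2 * b) choose 2) = 2 * (b * (2 * b - 1))" unfolding c2 by (simp only: mult.assoc)
      then have "(2 * b) choose 2 = b * (2 * b - 1)" by simp
      also have "\<dots> = 2 * (b * b) - b" by (simp add: diff_mult_distrib2)
      finally have "(2 * b) choose 2 = b * b + (b * b - b)" using bb by linarith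
      then have E: "int (lam b 1) + int (b * b - b) - int ((2 * b) choose 2) = 0" unfolding l by (simp only: of_nat_add diff_self)
      have "bcoef (P_poly b) 2 2 = 0" by (simp add: bcoef_def coeff_P_poly)
      then show ?thesis using 4 E by simp
    next
      case 5
      then have d: "d - 2 + 1 = d - 1" "d - 2 + 2 = d" "int (d - 2 + 1) = int d - 1" "\<not> d < 2" by auto
      have d': "int (d - 1) = int d - 1" using 5 by simp
      have m: "mu b (d - 2) = int (lam b (d - 1)) + int (b * b - b) * int ((2 * b - 2) choose (d - 2)) - (int d - 1) * int ((2 * b) choose d)"
        using mu_eq[of b "d - 2"] b unfolding d d' by simp
      show ?thesis
      proof (cases "d \<le> 2 * b")
        case True
        obtain r where r: "d = r + 2" using le_Suc_ex[of 2 d] 5(2) by (auto simp: add.commute)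
        have r1: "1 \<le> r" "r \<le> 2 * b - 2" using True 5(2) r by linarith+
        have "bcoef (P_poly b) (r + 2) 2 = mu b r" using r1 by (simp add: bcoef_def coeff_P_poly)
        then have "bcoef (P_poly b) d p = mu b (d - 2)" by (simp add: r 5(1))
        then show ?thesis using 5 m d(4) by simp
      next
        case False
        then have z: "lam b (d - 1) = 0" "(2 * b - 2) choose (d - 2) = 0" "(2 * b) choose d = 0" "bcoef (P_poly b) d p = 0"
          using 5 b by (auto simp: bcoef_def coeff_P_poly intro!: lam0 binomial_eq_0)
        show ?thesis unfolding z using 5(1) d(4) by simp
      qed
    next
      case 6 then show ?thesis using False by (auto simp: bcoef_def coeff_P_poly)
    qed
  qed
  finally show ?thesis .
qed

section \<open>Disjoint copies and joins\<close>

lemma bsum_relabel: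
  assumes \<phi>: "inj_on \<phi> V" and V: "finite V" and E: "\<And>e. e \<in> E \<Longrightarrow> e \<subseteq> V"
  shows "bsum TYPE('k::field) \<iota> (\<phi> ` V) (image \<phi> ` E) d p = bsum TYPE('k) (\<iota> \<circ> \<phi>) V E d p"
proof -
  let ?D = "{W. W \<subseteq> V \<and> card W = d}"
  have card: "card (\<phi> ` W) = card W" if "W \<subseteq> V" for W
    by (rule card_image[OF inj_on_subset[OF \<phi> that]])
  have D: "{W. W \<subseteq> \<phi> ` V \<and> card W = d} = image \<phi> ` ?D"
  proof (intro equalityI subsetI)
    fix W assume W: "W \<in> {W. W \<subseteq> \<phi> ` V \<and> card W = d}"
    then have "W \<subseteq> \<phi> ` V" by simp
    then obtain U where U: "U \<subseteq> V" "W = \<phi> ` U" by (rule subset_imageE)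
    then have "card U = d" using card[OF U(1)] W by simp
    then show "W \<in> image \<phi> ` ?D" using U by (intro image_eqI[of _ _ U]) simp_all
  next
    fix W assume "W \<in> image \<phi> ` ?D"
    then obtain U where U: "U \<subseteq> V" "card U = d" "W = \<phi> ` U" by auto
    then show "W \<in> {W. W \<subseteq> \<phi> ` V \<and> card W = d}" using card[OF U(1)] by (simp add: image_mono)
  qed
  have inj: "inj_on (image \<phi>) ?D"
  proof (rule inj_onI)
    fix S T assume "S \<in> ?D" "T \<in> ?D" "\<phi> ` S = \<phi> ` T"
    then show "S = T" using inj_on_image_eq_iff[OF \<phi>, of S T] by simp
  qed
  have r: "rhdim TYPE('k) \<iota> (\<phi> ` W) (face_pred (image \<phi> ` E) (\<phi> ` W)) p = rhdim TYPE('k) (\<iota> \<circ> \<phi>) W (face_pred E W) p"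
    if W: "W \<in> ?D" for W
  proof -
    have WV: "W \<subseteq> V" using W by simp
    have "rhdim TYPE('k) \<iota> (\<phi> ` W) (face_pred (image \<phi> ` E) (\<phi> ` W)) p =
        rhdim TYPE('k) (\<iota> \<circ> \<phi>) W (\<lambda>S. face_pred (image \<phi> ` E) (\<phi> ` W) (\<phi> ` S)) p"
      by (rule rhdim_relabel[OF inj_on_subset[OF \<phi> WV] finite_subset[OF WV V]])
    also have "\<dots> = rhdim TYPE('k) (\<iota> \<circ> \<phi>) W (face_pred E W) p"
    proof (rule rhdim_cong)
      fix S assume S: "S \<subseteq> W"
      have "\<phi> ` W - \<phi> ` S = \<phi> ` (W - S)"
        by (rule inj_on_image_set_diff[OF \<phi>, symmetric]) (use S WV in auto)
      moreover have "\<phi> ` e \<subseteq> \<phi> ` (W - S) \<longleftrightarrow> e \<subseteq> W - S" if e: "e \<in> E" for e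
      proof
        assume L: "\<phi> ` e \<subseteq> \<phi> ` (W - S)"
        show "e \<subseteq> W - S"
        proof
          fix x assume x: "x \<in> e"
          then have "\<phi> x \<in> \<phi> ` (W - S)" using L by blast
          then obtain y where y: "y \<in> W - S" "\<phi> x = \<phi> y" by blast
          have "x = y" by (rule inj_onD[OF \<phi> y(2)]) (use x y(1) E[OF e] WV in blast)+
          then show "x \<in> W - S" using y(1) by simp
        qed
      qed (rule image_mono)
      ultimately show "face_pred (image \<phi> ` E) (\<phi> ` W) (\<phi> ` S) = face_pred E W S"
        by (auto simp: face_pred_def nonface_def)
    qed
    finally show ?thesis .
  qed
  show ?thesis unfolding bsum_def D sum.reindex[OF inj, unfolded comp_def] by (rule sum.cong[OF refl r])
qed

lemma copies_0: "verts (disjoint_copies 0 G) = {}" "edges (disjoint_copies 0 G) = {}"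
  by (simp_all add: disjoint_copies_def)

lemma copies_Suc:
  "verts (disjoint_copies (Suc n) G) = verts (disjoint_copies n G) \<union> Pair (Suc n) ` verts G"
  "edges (disjoint_copies (Suc n) G) = edges (disjoint_copies n G) \<union> image (Pair (Suc n)) ` edges G"
proof -
  have i: "{1..Suc n} = insert (Suc n) {1..n}" by auto
  show "verts (disjoint_copies (Suc n) G) = verts (disjoint_copies n G) \<union> Pair (Suc n) ` verts G"
    unfolding disjoint_copies_def ugraph.select_convs i by blast
  show "edges (disjoint_copies (Suc n) G) = edges (disjoint_copies n G) \<union> image (Pair (Suc n)) ` edges G"
    unfolding disjoint_copies_def ugraph.select_convs i by blast
qed

text \<open>The hypothesis \<open>base\<close> is required for every numbering, because each copy
  inherits its own from \<iota>. By \<open>ord\<close> earlier copies precede the last one, as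
  \<open>bsum_union\<close> demands.\<close>

lemma bsum_copies:
  fixes G :: "'v ugraph"
  assumes G: "simple_graph G" and P: "upper P"
    and base: "\<And>(\<iota> :: 'v \<Rightarrow> nat) d p. inj_on \<iota> (verts G) \<Longrightarrow> bsum TYPE('k::field) \<iota> (verts G) (edges G) d p = bcoef P d p"
    and inj: "inj_on \<iota> (verts (disjoint_copies n G))"
    and ord: "\<And>k l u v. k < l \<Longrightarrow> u \<in> verts G \<Longrightarrow> v \<in> verts G \<Longrightarrow> \<iota> (k, u) < \<iota> (l, v)"
  shows "bsum TYPE('k) \<iota> (verts (disjoint_copies n G)) (edges (disjoint_copies n G)) d p = bcoef (P ^ n) d p"
  using inj
proof (induction n arbitrary: d p)
  case 0
  show ?case
  proof (cases "d = 0")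
    case True
    then show ?thesis using bsum_0[of "{}" "{}" \<iota> p, where 'k = 'k] by (simp add: copies_0 bcoef_def)
  next
    case False
    then have e: "{W :: (nat \<times> 'v) set. W \<subseteq> {} \<and> card W = d} = {}" by auto
    show ?thesis unfolding copies_0 bsum_def e power_0 using False by (simp add: bcoef_def coeff_1)
  qed
next
  case (Suc n)
  let ?H = "disjoint_copies n G"
  have H: "simple_graph ?H" by (rule simple_graph_disjoint_copies[OF G])
  have fin: "finite (verts ?H)" "finite (verts G)" using H G by (simp_all add: simple_graph_def)
  have injH: "inj_on \<iota> (verts ?H)" and injP: "inj_on \<iota> (Pair (Suc n) ` verts G)"
    using Suc.prems unfolding copies_Suc by (rule inj_on_subset; blast)+
  have base': "bsum TYPE('k) \<iota> (Pair (Suc n) ` verts G) (image (Pair (Suc n)) ` edges G) d p = bcoef P d p" for d p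
  proof -
    have "inj_on (Pair (Suc n)) (verts G)" by (simp add: inj_on_def)
    moreover have "inj_on (\<iota> \<circ> Pair (Suc n)) (verts G)" using injP by (intro comp_inj_on) (simp_all add: inj_on_def)
    moreover have "e \<subseteq> verts G" if "e \<in> edges G" for e using G that by (simp add: simple_graph_def)
    ultimately show ?thesis using bsum_relabel[of "Pair (Suc n)" "verts G" "edges G" \<iota> d p, where 'k = 'k] base fin by simp
  qed
  have "bsum TYPE('k) \<iota> (verts (disjoint_copies (Suc n) G)) (edges (disjoint_copies (Suc n) G)) d p =
      (\<Sum>e\<le>d. \<Sum>q\<le>p. bsum TYPE('k) \<iota> (verts ?H) (edges ?H) e q *
        bsum TYPE('k) \<iota> (Pair (Suc n) ` verts G) (image (Pair (Suc n)) ` edges G) (d - e) (p - q))"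
    unfolding copies_Suc
  proof (rule bsum_union)
    show "finite (verts ?H)" "finite (Pair (Suc n) ` verts G)" using fin by simp_all
    show "verts ?H \<inter> Pair (Suc n) ` verts G = {}" by (auto simp: disjoint_copies_def)
    show "inj_on \<iota> (verts ?H \<union> Pair (Suc n) ` verts G)" using Suc.prems unfolding copies_Suc .
    show "\<iota> u < \<iota> v" if uv: "u \<in> verts ?H" "v \<in> Pair (Suc n) ` verts G" for u v
    proof -
      obtain k x where u: "u = (k, x)" "k \<le> n" "x \<in> verts G" using uv(1) by (auto simp: disjoint_copies_def)
      obtain y where v: "v = (Suc n, y)" "y \<in> verts G" using uv(2) by auto
      have "k < Suc n" using u(2) by simp
      then show ?thesis unfolding u(1) v(1) using u(3) v(2) by (rule ord)
    qed
    show "e \<subseteq> verts ?H" if "e \<in> edges ?H" for e using H that by (simp add: simple_graph_def)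
    show "e \<subseteq> Pair (Suc n) ` verts G" if "e \<in> image (Pair (Suc n)) ` edges G" for e
      using G that by (auto simp: simple_graph_def)
  qed
  also have "\<dots> = (\<Sum>e\<le>d. \<Sum>q\<le>p. bcoef (P ^ n) e q * bcoef P (d - e) (p - q))"
    unfolding base' Suc.IH[OF injH] ..
  also have "\<dots> = bcoef (P ^ Suc n) d p"
    unfolding power_Suc2 by (rule bcoef_mult[OF upper_power[OF P] P, symmetric])
  finally show ?case .
qed

lemma graph_betti_copies:
  fixes G :: "'v ugraph"
  assumes G: "simple_graph G" and P: "upper P"
    and base: "\<And>(\<iota> :: 'v \<Rightarrow> nat) d p. inj_on \<iota> (verts G) \<Longrightarrow> bsum TYPE('k::field) \<iota> (verts G) (edges G) d p = bcoef P d p"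
  shows "int (graph_betti TYPE('k) (disjoint_copies n G) i d) = coeff_uv (P ^ n) i d"
proof (cases "i < 0 \<or> d < 0")
  case True
  then show ?thesis by (auto simp: graph_betti_def coeff_uv_def)
next
  case False
  define i' d' where "i' = nat i" and "d' = nat d"
  have id: "i = int i'" "d = int d'" using False by (simp_all add: i'_def d'_def)
  have "finite (verts G)" using G by (simp add: simple_graph_def)
  then obtain \<kappa> M where \<kappa>: "\<kappa> ` verts G = {i. i < (M :: nat)}" "inj_on \<kappa> (verts G)"
    using finite_imp_inj_to_nat_seg by metis
  have lt: "\<kappa> v < M" if "v \<in> verts G" for v using \<kappa>(1) that by blast
  \<comment> \<open>Lexicographic numbering: copy k occupies a block of length M starting at k times
    M.\<close>
  define \<iota> where "\<iota> x = fst x * M + \<kappa> (snd x)" for x :: "nat \<times> 'v"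
  have ord: "\<iota> (k, u) < \<iota> (l, v)" if "k < l" "u \<in> verts G" "v \<in> verts G" for k l u v
  proof -
    have "\<iota> (k, u) < Suc k * M" using lt[OF that(2)] by (simp add: \<iota>_def)
    also have "\<dots> \<le> l * M" using that(1) by (intro mult_right_mono) simp_all
    also have "\<dots> \<le> \<iota> (l, v)" by (simp add: \<iota>_def)
    finally show ?thesis .
  qed
  have inj: "inj_on \<iota> (verts (disjoint_copies n G))"
  proof (rule inj_onI)
    fix x y assume xy: "x \<in> verts (disjoint_copies n G)" "y \<in> verts (disjoint_copies n G)" "\<iota> x = \<iota> y"
    obtain k u l v where kl: "x = (k, u)" "y = (l, v)" by (cases x, cases y)
    then have uv: "u \<in> verts G" "v \<in> verts G" using xy by (auto simp: disjoint_copies_def)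
    have "k = l" using ord[of k l u v] ord[of l k v u] uv xy(3) kl by (metis linorder_neqE_nat less_irrefl)
    then have "\<kappa> u = \<kappa> v" using xy(3) kl by (simp add: \<iota>_def)
    then show "x = y" using inj_onD[OF \<kappa>(2)] uv kl \<open>k = l\<close> by simp
  qed
  have "int (graph_betti TYPE('k) (disjoint_copies n G) (int i') (int d')) =
      (if i' \<le> d' then bcoef (P ^ n) d' (d' - i') else 0)"
    using graph_betti_bsum[OF simple_graph_disjoint_copies[OF G] inj, of i' d', where 'k = 'k]
      bsum_copies[OF G P base inj ord, of d' "d' - i'"] by simp
  \<comment> \<open>If i' exceeds d', the left side is 0 and the coefficient vanishes because the
    power is \<open>upper\<close>.\<close>
  also have "\<dots> = coeff_uv (P ^ n) (int i') (int d')"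
    using upper_power[OF P, of n] by (auto simp: bcoef_def coeff_uv_def upper_def)
  finally show ?thesis unfolding id .
qed

section \<open>Joins with an edgeless graph\<close>

lemma sum_Plus_card:
  assumes "finite V" "finite V'"
  shows "(\<Sum>W | W \<subseteq> V <+> V' \<and> card W = d. f W) =
    (\<Sum>j\<le>d. \<Sum>A | A \<subseteq> V \<and> card A = j. \<Sum>B | B \<subseteq> V' \<and> card B = d - j. f (A <+> B))"
proof -
  let ?A = "\<lambda>j. {A. A \<subseteq> V \<and> card A = j}" and ?B = "\<lambda>j. {B. B \<subseteq> V' \<and> card B = d - j}"
  have card: "card (A <+> B) = card A + card B" if "A \<subseteq> V" "B \<subseteq> V'" for A B
    by (rule card_Plus[OF finite_subset[OF that(1) assms(1)] finite_subset[OF that(2) assms(2)]])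
  have fin: "finite (?A j)" "finite (?B j)" for j using assms by simp_all
  have "(\<Sum>W | W \<subseteq> V <+> V' \<and> card W = d. f W) =
      (\<Sum>x\<in>(SIGMA j:{..d}. ?A j \<times> ?B j). f (fst (snd x) <+> snd (snd x)))"
  proof (rule sum.reindex_bij_witness[where i = "\<lambda>x. fst (snd x) <+> snd (snd x)" and j = "\<lambda>W. (card (Inl -` W), Inl -` W, Inr -` W)"])
    fix W assume W: "W \<in> {W. W \<subseteq> V <+> V' \<and> card W = d}"
    then have s: "Inl -` W \<subseteq> V" "Inr -` W \<subseteq> V'" by auto
    then have "card (Inl -` W) + card (Inr -` W) = d" using card[OF s] W by (simp add: Plus_vimage)
    then show "(card (Inl -` W), Inl -` W, Inr -` W) \<in> (SIGMA j:{..d}. ?A j \<times> ?B j)" using s by auto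
  next
    fix x assume x: "x \<in> (SIGMA j:{..d}. ?A j \<times> ?B j)"
    obtain j A B where jAB: "x = (j, A, B)" by (cases x)
    then have s: "A \<subseteq> V" "B \<subseteq> V'" "card A = j" "card B = d - j" "j \<le> d" using x by auto
    have v: "Inl -` (A <+> B) = A" "Inr -` (A <+> B) = B" by auto
    show "(card (Inl -` (fst (snd x) <+> snd (snd x))), Inl -` (fst (snd x) <+> snd (snd x)), Inr -` (fst (snd x) <+> snd (snd x))) = x"
      using s(3) by (simp add: jAB v)
    have "A <+> B \<subseteq> V <+> V'" using s by auto
    then show "fst (snd x) <+> snd (snd x) \<in> {W. W \<subseteq> V <+> V' \<and> card W = d}"
      using card[OF s(1,2)] s by (simp add: jAB)
  qed (simp_all add: Plus_vimage)
  also have "\<dots> = (\<Sum>j\<le>d. \<Sum>y\<in>?A j \<times> ?B j. f (fst y <+> snd y))"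
    using fin by (subst sum.Sigma) (auto simp: case_prod_unfold)
  also have "\<dots> = (\<Sum>j\<le>d. \<Sum>A\<in>?A j. \<Sum>B\<in>?B j. f (A <+> B))"
    by (simp only: sum.cartesian_product case_prod_unfold)
  finally show ?thesis .
qed

text \<open>A single vertex is a simplex and has no reduced cohomology. This is why the sum over j
  in the final formula can stop at d - 2.\<close>

lemma bsum_1:
  assumes G: "simple_graph G" and \<iota>: "inj_on \<iota> (verts G)"
  shows "bsum TYPE('k::field) \<iota> (verts G) (edges G) 1 p = 0"
  unfolding bsum_def
proof (rule sum.neutral, rule ballI)
  fix W assume "W \<in> {W. W \<subseteq> verts G \<and> card W = 1}"
  then have W: "W \<subseteq> verts G" "card W = 1" by simp_all
  obtain w where w: "W = {w}" using W(2) by (rule card_1_singletonE)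
  have "rhdim TYPE('k) \<iota> W (face_pred (edges G) W) p = rhdim TYPE('k) \<iota> W (\<lambda>_. True) p"
  proof (rule rhdim_cong)
    fix S assume "S \<subseteq> W"
    have "\<not> e \<subseteq> W - S" if "e \<in> edges G" for e
    proof
      assume "e \<subseteq> W - S"
      then have "card e \<le> card W" using w by (intro card_mono) auto
      then show False using G that W(2) by (simp add: simple_graph_def)
    qed
    then show "face_pred (edges G) W S = True" by (simp add: face_pred_def nonface_def)
  qed
  also have "\<dots> = 0"
    by (rule rhdim_simplex) (use w inj_on_subset[OF \<iota> W(1)] in simp_all)
  finally show "rhdim TYPE('k) \<iota> W (face_pred (edges G) W) p = 0" .
qed

text \<open>All edges between the two parts are present, so an independent set lies on one side; on
  the edgeless side there is no further condition.\<close>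

lemma face_pred_join:
  assumes T: "A \<subseteq> {1..a}" "B \<subseteq> verts H" "T \<subseteq> A <+> B"
  shows "face_pred (edges (graph_join (edgeless_graph a) H)) (A <+> B) (A <+> B - T) \<longleftrightarrow>
    (Inl -` T = {} \<or> Inr -` T = {}) \<and> \<not> nonface (edges H) (Inr -` T)"
proof -
  let ?E = "edges (graph_join (edgeless_graph a) H)"
  have E: "?E = image Inr ` edges H \<union> {{Inl x, Inr y} | x y. x \<in> {1..a} \<and> y \<in> verts H}"
    by (simp add: graph_join_def edgeless_graph_def)
  have "nonface ?E T \<longleftrightarrow> nonface (edges H) (Inr -` T) \<or> (Inl -` T \<noteq> {} \<and> Inr -` T \<noteq> {})"
  proof
    assume "nonface ?E T"
    then obtain e where e: "e \<in> ?E" "e \<subseteq> T" unfolding nonface_def by (rule bexE)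
    from e(1) show "nonface (edges H) (Inr -` T) \<or> (Inl -` T \<noteq> {} \<and> Inr -` T \<noteq> {})" unfolding E
    proof (elim UnE CollectE exE conjE imageE)
      fix e' assume "e = Inr ` e'" "e' \<in> edges H"
      then show ?thesis using e(2) unfolding nonface_def by (auto simp: image_subset_iff_subset_vimage)
    next
      fix x y assume "e = {Inl x, Inr y}"
      then have "x \<in> Inl -` T" "y \<in> Inr -` T" using e(2) by simp_all
      then show ?thesis by blast
    qed
  next
    assume "nonface (edges H) (Inr -` T) \<or> (Inl -` T \<noteq> {} \<and> Inr -` T \<noteq> {})"
    then show "nonface ?E T"
    proof
      assume "nonface (edges H) (Inr -` T)"
      then obtain e where "e \<in> edges H" "e \<subseteq> Inr -` T" unfolding nonface_def by (rule bexE)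
      then have "Inr ` e \<in> ?E" "Inr ` e \<subseteq> T" unfolding E by auto
      then show ?thesis unfolding nonface_def by (rule bexI[rotated])
    next
      assume "Inl -` T \<noteq> {} \<and> Inr -` T \<noteq> {}"
      then obtain x y where xy: "Inl x \<in> T" "Inr y \<in> T" by blast
      then have "x \<in> {1..a}" "y \<in> verts H" using T by auto
      then have "{Inl x, Inr y} \<in> ?E" unfolding E by blast
      moreover have "{Inl x, Inr y} \<subseteq> T" using xy by simp
      ultimately show ?thesis unfolding nonface_def by (rule bexI[rotated])
    qed
  qed
  moreover have "A <+> B - (A <+> B - T) = T" using T(3) by blast
  ultimately show ?thesis unfolding face_pred_def by auto
qed

text \<open>If both parts are nonempty, a simplex on \<open>A\<close> is added disjointly. If only
  \<open>A\<close> is nonempty the complex is a simplex, and the last term cancels the class that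
  the complex of the empty set \<open>B\<close> has at p = 0.\<close>

lemma rhdim_join:
  assumes H: "simple_graph H" and A: "A \<subseteq> {1..a}" and B: "B \<subseteq> verts H"
    and \<kappa>: "inj_on (\<iota> \<circ> Inl) A" "inj_on (\<iota> \<circ> Inr) B" and ord: "\<And>i v. i \<in> A \<Longrightarrow> v \<in> B \<Longrightarrow> \<iota> (Inr v) < \<iota> (Inl i)"
  shows "rhdim TYPE('k::field) \<iota> (A <+> B) (face_pred (edges (graph_join (edgeless_graph a) H)) (A <+> B)) p =
    rhdim TYPE('k) (\<iota> \<circ> Inr) B (face_pred (edges H) B) p + of_bool (p = 1 \<and> A \<noteq> {} \<and> B \<noteq> {}) - of_bool (p = 0 \<and> A \<noteq> {} \<and> B = {})"
proof -
  let ?P = "face_pred (edges (graph_join (edgeless_graph a) H)) (A <+> B)"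
  have fin: "finite A" "finite B" using finite_subset[OF A] finite_subset[OF B] H by (simp_all add: simple_graph_def)
  have P: "?P S \<longleftrightarrow> (A - Inl -` S = {} \<or> B - Inr -` S = {}) \<and> face_pred (edges H) B (Inr -` S)" if S: "S \<subseteq> A <+> B" for S
  proof -
    have T: "A <+> B - S \<subseteq> A <+> B" "A <+> B - (A <+> B - S) = S" using S by blast+
    have "Inl -` (A <+> B - S) = A - Inl -` S" "Inr -` (A <+> B - S) = B - Inr -` S" by auto
    then show ?thesis using face_pred_join[OF A B T(1)] unfolding T(2) by (simp add: face_pred_def)
  qed
  have e0: "{} \<notin> edges H" by (rule empty_notin_edges[OF H])
  have PL: "A <+> B = Inl ` A \<union> Inr ` B" by (simp add: Plus_def)
  have relabel: "rhdim TYPE('k) \<iota> (Inr ` B) (\<lambda>S. face_pred (edges H) B (Inr -` S)) p = rhdim TYPE('k) (\<iota> \<circ> Inr) B (face_pred (edges H) B) p"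
  proof -
    from rhdim_relabel[OF inj_Inr fin(2), of \<iota> "\<lambda>S. face_pred (edges H) B (Inr -` S)" p, where 'k = 'k]
    show ?thesis by (simp only: inj_vimage_image_eq[OF inj_Inr])
  qed
  consider "A = {}" | "A \<noteq> {}" "B = {}" | "A \<noteq> {}" "B \<noteq> {}" by blast
  then show ?thesis
  proof cases
    case 1
    have "rhdim TYPE('k) \<iota> (A <+> B) ?P p = rhdim TYPE('k) \<iota> (A <+> B) (\<lambda>S. face_pred (edges H) B (Inr -` S)) p"
    proof (rule rhdim_cong)
      fix S assume "S \<subseteq> A <+> B"
      from P[OF this] show "?P S = face_pred (edges H) B (Inr -` S)" using 1 by simp
    qed
    moreover have "A <+> B = Inr ` B" unfolding PL 1 by auto
    ultimately show ?thesis using relabel 1 by simp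
  next
    case 2
    have f: "face_pred (edges H) {} X" for X using e0 by (simp add: face_pred_def nonface_def)
    have "rhdim TYPE('k) \<iota> (A <+> B) ?P p = rhdim TYPE('k) \<iota> (A <+> B) (\<lambda>_. True) p"
    proof (rule rhdim_cong)
      fix S assume "S \<subseteq> A <+> B"
      from P[OF this] show "?P S = True" using 2(2) f by simp
    qed
    also have "\<dots> = 0"
    proof (rule rhdim_simplex)
      have "A <+> B = Inl ` A" unfolding PL 2 by auto
      then show "finite (A <+> B)" "inj_on \<iota> (A <+> B)" "A <+> B \<noteq> {}"
        using fin 2 inj_on_imageI[OF \<kappa>(1)] by simp_all
    qed
    finally show ?thesis using rhdim_empty[of "face_pred (edges H) {}" "\<iota> \<circ> Inr" p, where 'k = 'k] e0 2
      by (simp add: face_pred_def nonface_def)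
  next
    case 3
    have "rhdim TYPE('k) \<iota> (Inl ` A \<union> Inr ` B) ?P p =
        rhdim TYPE('k) \<iota> (Inr ` B) (\<lambda>S. face_pred (edges H) B (Inr -` S)) p + of_bool (p = 1)"
    proof (rule rhdim_join_simplex)
      show "finite (Inl ` A)" "finite (Inr ` B)" "Inl ` A \<noteq> {}" "Inr ` B \<noteq> {}" using fin 3 by simp_all
      show "Inl ` A \<inter> Inr ` B = {}" by auto
      show "inj_on \<iota> (Inl ` A)" by (rule inj_on_imageI[OF \<kappa>(1)])
      show "\<iota> v < \<iota> u" if "u \<in> Inl ` A" "v \<in> Inr ` B" for u v using that ord by auto
      show "?P (T \<union> Inr ` B)" if T: "T \<subseteq> Inl ` A" for T
      proof -
        have v: "Inr -` (T \<union> Inr ` B) = B" using T by auto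
        have sub: "T \<union> Inr ` B \<subseteq> A <+> B" using T unfolding PL by blast
        have g: "face_pred (edges H) B B" using e0 by (simp add: face_pred_def nonface_def)
        show ?thesis unfolding P[OF sub] v using g by simp
      qed
      show "?P (T \<union> Inl ` A) \<longleftrightarrow> face_pred (edges H) B (Inr -` T)" if T: "T \<subseteq> Inr ` B" for T
      proof -
        have "Inr -` (T \<union> Inl ` A) = Inr -` T" "A - Inl -` (T \<union> Inl ` A) = {}" by auto
        moreover have "T \<union> Inl ` A \<subseteq> A <+> B" using T unfolding PL by blast
        ultimately show ?thesis by (simp add: P)
      qed
      show "Inl ` A \<subseteq> S \<or> Inr ` B \<subseteq> S" if S: "S \<subseteq> Inl ` A \<union> Inr ` B" "?P S" for S
        using S P[of S] unfolding PL[symmetric] by auto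
      show "face_pred (edges H) B (Inr -` (Inr ` B - {v}))" if v: "v \<in> Inr ` B" for v
      proof -
        obtain w where w: "v = Inr w" "w \<in> B" using v by (rule imageE)
        have "\<not> e \<subseteq> {w}" if "e \<in> edges H" for e
        proof
          assume "e \<subseteq> {w}"
          then have "card e \<le> card {w}" by (intro card_mono) simp_all
          then show False using H that by (simp add: simple_graph_def)
        qed
        moreover have "B - Inr -` (Inr ` B - {v}) = {w}" using w by auto
        ultimately show ?thesis by (simp add: face_pred_def nonface_def)
      qed
    qed
    then show ?thesis unfolding PL[symmetric] relabel using 3 by simp
  qed
qed

text \<open>W is split into j vertices of the edgeless part and d - j of \<open>H\<close>. The shift
  by M numbers the edgeless part last, the order required by \<open>rhdim_join\<close>.\<close>

lemma bsum_join:
  assumes H: "simple_graph H" and \<kappa>: "inj_on \<kappa> (verts H)" "\<And>v. v \<in> verts H \<Longrightarrow> \<kappa> v < M" and d: "d \<ge> 1"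
  shows "bsum TYPE('k::field) (case_sum (\<lambda>i. M + i) \<kappa>) (verts (graph_join (edgeless_graph a) H)) (edges (graph_join (edgeless_graph a) H)) d p =
    (\<Sum>j<d - 1. int (a choose j) * bsum TYPE('k) \<kappa> (verts H) (edges H) (d - j) p) +
    of_bool (p = 1) * (\<Sum>j = 1..d - 1. int (a choose j) * int (card (verts H) choose (d - j)))"
proof -
  let ?\<iota> = "case_sum (\<lambda>i. M + i) \<kappa>" and ?J = "graph_join (edgeless_graph a) H" and ?N = "card (verts H)"
  let ?b = "\<lambda>e. bsum TYPE('k) \<kappa> (verts H) (edges H) e p"
  \<comment> \<open>The correction of \<open>rhdim_join\<close> depends on the two parts only
    through their sizes j and d - j.\<close>
  let ?x = "\<lambda>j. of_bool (p = 1 \<and> j \<noteq> 0 \<and> j \<noteq> d) - of_bool (p = 0 \<and> j = d) :: int"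
  have fH: "finite (verts H)" using H by (simp add: simple_graph_def)
  have vJ: "verts ?J = {1..a} <+> verts H" by (simp add: graph_join_def edgeless_graph_def)
  have "bsum TYPE('k) ?\<iota> (verts ?J) (edges ?J) d p =
      (\<Sum>j\<le>d. \<Sum>A | A \<subseteq> {1..a} \<and> card A = j. \<Sum>B | B \<subseteq> verts H \<and> card B = d - j.
        rhdim TYPE('k) ?\<iota> (A <+> B) (face_pred (edges ?J) (A <+> B)) p)"
    unfolding bsum_def vJ by (rule sum_Plus_card[OF _ fH]) simp
  also have "\<dots> = (\<Sum>j\<le>d. \<Sum>A | A \<subseteq> {1..a} \<and> card A = j. \<Sum>B | B \<subseteq> verts H \<and> card B = d - j.
        rhdim TYPE('k) \<kappa> B (face_pred (edges H) B) p + ?x j)"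
  proof (intro sum.cong refl)
    fix j A B assume "j \<in> {..d}" "A \<in> {A. A \<subseteq> {1..a} \<and> card A = j}" "B \<in> {B. B \<subseteq> verts H \<and> card B = d - j}"
    then have j: "j \<le> d" and A: "A \<subseteq> {1..a}" "card A = j" and B: "B \<subseteq> verts H" "card B = d - j" by simp_all
    have fin: "finite A" "finite B" using finite_subset[OF A(1)] finite_subset[OF B(1) fH] by simp_all
    have "A \<noteq> {} \<longleftrightarrow> j \<noteq> 0" "B \<noteq> {} \<longleftrightarrow> j \<noteq> d" using A(2) B(2) fin j by auto
    moreover have "?\<iota> \<circ> Inr = \<kappa>" by (simp add: fun_eq_iff)
    moreover have "rhdim TYPE('k) ?\<iota> (A <+> B) (face_pred (edges ?J) (A <+> B)) p =
        rhdim TYPE('k) (?\<iota> \<circ> Inr) B (face_pred (edges H) B) p + of_bool (p = 1 \<and> A \<noteq> {} \<and> B \<noteq> {}) - of_bool (p = 0 \<and> A \<noteq> {} \<and> B = {})"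
    proof (rule rhdim_join[OF H A(1) B(1)])
      show "inj_on (?\<iota> \<circ> Inl) A" by (simp add: inj_on_def)
      show "inj_on (?\<iota> \<circ> Inr) B" using inj_on_subset[OF \<kappa>(1) B(1)] by (simp add: inj_on_def)
      show "?\<iota> (Inr v) < ?\<iota> (Inl i)" if "i \<in> A" "v \<in> B" for i v
        using \<kappa>(2)[of v] that B(1) by (simp add: subset_iff trans_less_add1)
    qed
    ultimately show "rhdim TYPE('k) ?\<iota> (A <+> B) (face_pred (edges ?J) (A <+> B)) p =
        rhdim TYPE('k) \<kappa> B (face_pred (edges H) B) p + ?x j"
      using d by auto
  qed
  also have "\<dots> = (\<Sum>j\<le>d. int (a choose j) * (?b (d - j) + int (?N choose (d - j)) * ?x j))"
  proof (rule sum.cong[OF refl])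
    fix j
    have "(\<Sum>B | B \<subseteq> verts H \<and> card B = d - j. rhdim TYPE('k) \<kappa> B (face_pred (edges H) B) p + ?x j) =
        ?b (d - j) + int (?N choose (d - j)) * ?x j"
      by (simp only: sum.distrib bsum_def sum_constant n_subsets[OF fH])
    moreover have "card {A. A \<subseteq> {1..a} \<and> card A = j} = a choose j" using n_subsets[of "{1..a}" j] by simp
    ultimately show "(\<Sum>A | A \<subseteq> {1..a} \<and> card A = j. \<Sum>B | B \<subseteq> verts H \<and> card B = d - j.
        rhdim TYPE('k) \<kappa> B (face_pred (edges H) B) p + ?x j) =
        int (a choose j) * (?b (d - j) + int (?N choose (d - j)) * ?x j)"
      by (simp only: sum_constant)
  qed
  also have "\<dots> = (\<Sum>j\<le>d. int (a choose j) * ?b (d - j)) + (\<Sum>j\<le>d. int (a choose j) * int (?N choose (d - j)) * ?x j)"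
    by (simp only: distrib_left sum.distrib mult.assoc)
  \<comment> \<open>The term j = d - 1 vanishes by \<open>bsum_1\<close>; the term j = d is the
    empty set of \<open>H\<close>, cancelled later by the negative part of
    \<open>?x\<close>.\<close>
  also have "(\<Sum>j\<le>d. int (a choose j) * ?b (d - j)) = (\<Sum>j<d - 1. int (a choose j) * ?b (d - j)) + int (a choose d) * of_bool (p = 0)"
  proof -
    obtain e where e: "d = Suc e" using d by (cases d) simp_all
    have "?b (d - e) = 0" using bsum_1[OF H \<kappa>(1), of p, where 'k = 'k] by (simp add: e)
    moreover have "?b (d - d) = of_bool (p = 0)" using bsum_0[OF fH empty_notin_edges[OF H], of \<kappa> p, where 'k = 'k] by simp
    moreover have "(\<Sum>j\<le>d. int (a choose j) * ?b (d - j)) = (\<Sum>j<e. int (a choose j) * ?b (d - j)) + int (a choose e) * ?b (d - e) + int (a choose d) * ?b (d - d)"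
      unfolding e by (simp only: sum.atMost_Suc lessThan_Suc_atMost[symmetric] sum.lessThan_Suc)
    ultimately show ?thesis by (simp add: e)
  qed
  also have "(\<Sum>j\<le>d. int (a choose j) * int (?N choose (d - j)) * ?x j) =
      of_bool (p = 1) * (\<Sum>j = 1..d - 1. int (a choose j) * int (?N choose (d - j))) - int (a choose d) * of_bool (p = 0)"
  proof -
    have "(\<Sum>j\<le>d. int (a choose j) * int (?N choose (d - j)) * ?x j) =
        (\<Sum>j\<le>d. of_bool (p = 1) * (of_bool (j \<noteq> 0 \<and> j \<noteq> d) * (int (a choose j) * int (?N choose (d - j))))) -
        (\<Sum>j\<le>d. if j = d then int (a choose d) * of_bool (p = 0) else 0)"
      unfolding sum_subtractf[symmetric] by (rule sum.cong) auto
    moreover have "(\<Sum>j\<le>d. of_bool (j \<noteq> 0 \<and> j \<noteq> d) * (int (a choose j) * int (?N choose (d - j)))) =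
        (\<Sum>j = 1..d - 1. int (a choose j) * int (?N choose (d - j)))"
      by (rule sum.mono_neutral_cong_right) auto
    ultimately show ?thesis by (simp add: sum_distrib_left[symmetric])
  qed
  finally show ?thesis by simp
qed

text \<open>Subtracting j from both i and d leaves p = d - i unchanged, so \<open>bsum_join\<close>
  at fixed p is already the formula for Betti numbers; d = i + 1 is the case p = 1.\<close>

lemma graph_betti_join:
  fixes H :: "'v ugraph"
  assumes H: "simple_graph H" and "i \<ge> 0" "d \<ge> 0" "(i, d) \<noteq> (0, 0)"
  shows "int (graph_betti TYPE('k::field) (graph_join (edgeless_graph a) H) i d) =
    (\<Sum>j = 0..d - 2. int (a choose nat j) * int (graph_betti TYPE('k) H (i - j) (d - j))) +
    of_bool (d = i + 1) * (\<Sum>j = 1..d - 1. int (a choose nat j) * int (card (verts H) choose nat (d - j)))"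
proof -
  let ?J = "graph_join (edgeless_graph a) H"
  define i' d' where "i' = nat i" and "d' = nat d"
  have id: "i = int i'" "d = int d'" using assms by (simp_all add: i'_def d'_def)
  have J: "simple_graph ?J" by (rule simple_graph_graph_join[OF simple_graph_edgeless_graph H])
  have "finite (verts H)" using H by (simp add: simple_graph_def)
  then obtain \<kappa> M where \<kappa>: "\<kappa> ` verts H = {i. i < (M :: nat)}" "inj_on \<kappa> (verts H)"
    using finite_imp_inj_to_nat_seg by metis
  have lt: "\<kappa> v < M" if "v \<in> verts H" for v using \<kappa>(1) that by blast
  let ?\<iota> = "case_sum (\<lambda>i. M + i) \<kappa>"
  have inj: "inj_on ?\<iota> (verts ?J)"
  proof (rule inj_onI)
    fix x y assume xy: "x \<in> verts ?J" "y \<in> verts ?J" "?\<iota> x = ?\<iota> y"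
    have k: "\<kappa> v < M" if "Inr v = x \<or> Inr v = y" for v
      using that xy(1,2) lt[of v] by (auto simp: graph_join_def)
    have e: "u = v" if "x = Inr u" "y = Inr v" for u v
      using that xy inj_onD[OF \<kappa>(2), of u v] by (auto simp: graph_join_def)
    show "x = y"
    proof (cases x)
      case x: (Inl i)
      show ?thesis
      proof (cases y)
        case y: (Inl j)
        then show ?thesis using xy(3) x by simp
      next
        case y: (Inr v)
        have "M + i = \<kappa> v" using xy(3) x y by simp
        moreover have "\<kappa> v < M" by (rule k) (simp add: y)
        ultimately show ?thesis by linarith
      qed
    next
      case x: (Inr u)
      show ?thesis
      proof (cases y)
        case y: (Inl j)
        have "M + j = \<kappa> u" using xy(3) x y by simp
        moreover have "\<kappa> u < M" by (rule k) (simp add: x)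
        ultimately show ?thesis by linarith
      next
        case y: (Inr v)
        show ?thesis unfolding x y using e[OF x y] by simp
      qed
    qed
  qed
  have bJ: "int (graph_betti TYPE('k) ?J (int i') (int d')) = (if i' \<le> d' then bsum TYPE('k) ?\<iota> (verts ?J) (edges ?J) d' (d' - i') else 0)"
    by (rule graph_betti_bsum[OF J inj])
  \<comment> \<open>For j > i' the homological degree is negative and the Betti number is 0 by
    convention; the right side agrees because the face size d' - i' then exceeds the number d' - j
    of vertices.\<close>
  have bH: "int (graph_betti TYPE('k) H (int i' - int j) (int d' - int j)) =
      (if i' \<le> d' then bsum TYPE('k) \<kappa> (verts H) (edges H) (d' - j) (d' - i') else 0)" if j: "j < d' - 1" for j
  proof (cases "j \<le> i'")
    case True
    have "int i' - int j = int (i' - j)" "int d' - int j = int (d' - j)" using True j by auto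
    moreover have "i' - j \<le> d' - j \<longleftrightarrow> i' \<le> d'" "i' \<le> d' \<Longrightarrow> (d' - j) - (i' - j) = d' - i'" using True j by auto
    ultimately show ?thesis using graph_betti_bsum[OF H \<kappa>(2), of "i' - j" "d' - j", where 'k = 'k] by argo
  next
    case False
    then have "graph_betti TYPE('k) H (int i' - int j) (int d' - int j) = 0" by (simp add: graph_betti_def)
    moreover have "bsum TYPE('k) \<kappa> (verts H) (edges H) (d' - j) (d' - i') = 0" if "i' \<le> d'"
      by (rule bsum_top) (use False that j \<open>finite (verts H)\<close> in auto)
    ultimately show ?thesis by simp
  qed
  \<comment> \<open>For d' \<le> 1 both sets are empty: the integer bound is negative and truncated
    \<open>d' - 1\<close> is 0.\<close>
  have i1: "{0..int d' - 2} = int ` {..<d' - 1}"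
  proof -
    have "{0..int d' - 2} = {int 0..<int (d' - 1)}"
      by (rule Set.set_eqI, unfold atLeastAtMost_iff atLeastLessThan_iff, presburger)
    then show ?thesis by (simp only: image_int_atLeastLessThan[symmetric] lessThan_atLeast0)
  qed
  have i2: "{1..int d' - 1} = int ` {1..d' - 1}"
  proof -
    have "{1..int d' - 1} = {int 1..int (d' - 1)}"
      by (rule Set.set_eqI, unfold atLeastAtMost_iff, presburger)
    then show ?thesis by (simp only: image_int_atLeastAtMost[symmetric])
  qed
  have s1: "(\<Sum>j = 0..int d' - 2. f j) = (\<Sum>j<d' - 1. f (int j))" for f :: "int \<Rightarrow> int"
    unfolding i1 by (subst sum.reindex) simp_all
  have s2: "(\<Sum>j = 1..int d' - 1. f j) = (\<Sum>j = 1..d' - 1. f (int j))" for f :: "int \<Rightarrow> int"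
    unfolding i2 by (subst sum.reindex) simp_all
  have n: "nat (int d' - int j) = d' - j" for j by linarith
  show ?thesis
  proof (cases "d' = 0")
    case True
    then show ?thesis using assms(4) bJ unfolding id by simp
  next
    case False
    have "int (graph_betti TYPE('k) ?J (int i') (int d')) =
      (\<Sum>j<d' - 1. int (a choose j) * int (graph_betti TYPE('k) H (int i' - int j) (int d' - int j))) +
      of_bool (int d' = int i' + 1) * (\<Sum>j = 1..d' - 1. int (a choose j) * int (card (verts H) choose (d' - j)))"
    proof (cases "i' \<le> d'")
      case True
      have e: "d' - i' = 1 \<longleftrightarrow> int d' = int i' + 1" using True by auto
      have bj: "bsum TYPE('k) ?\<iota> (verts ?J) (edges ?J) d' (d' - i') =
          (\<Sum>j<d' - 1. int (a choose j) * bsum TYPE('k) \<kappa> (verts H) (edges H) (d' - j) (d' - i')) +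
          of_bool (d' - i' = 1) * (\<Sum>j = 1..d' - 1. int (a choose j) * int (card (verts H) choose (d' - j)))"
        by (rule bsum_join[OF H \<kappa>(2) lt]) (use False in simp_all)
      have s: "(\<Sum>j<d' - 1. int (a choose j) * int (graph_betti TYPE('k) H (int i' - int j) (int d' - int j))) =
          (\<Sum>j<d' - 1. int (a choose j) * bsum TYPE('k) \<kappa> (verts H) (edges H) (d' - j) (d' - i'))"
      proof (rule sum.cong[OF refl])
        fix j assume "j \<in> {..<d' - 1}"
        then have "j < d' - 1" by (simp only: lessThan_iff)
        from bH[OF this] show "int (a choose j) * int (graph_betti TYPE('k) H (int i' - int j) (int d' - int j)) =
            int (a choose j) * bsum TYPE('k) \<kappa> (verts H) (edges H) (d' - j) (d' - i')"
          unfolding if_P[OF True] by (simp only:)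
      qed
      show ?thesis unfolding bJ if_P[OF True] bj s e by (rule refl)
    next
      case le: False
      have "(\<Sum>j<d' - 1. int (a choose j) * int (graph_betti TYPE('k) H (int i' - int j) (int d' - int j))) = 0"
      proof (rule sum.neutral, rule ballI)
        fix j assume "j \<in> {..<d' - 1}"
        then have "j < d' - 1" by (simp only: lessThan_iff)
        from bH[OF this] show "int (a choose j) * int (graph_betti TYPE('k) H (int i' - int j) (int d' - int j)) = 0"
          unfolding if_not_P[OF le] by (simp only: mult_zero_right)
      qed
      moreover have "\<not> int d' = int i' + 1" using le by linarith
      ultimately show ?thesis using bJ le by (simp only: if_False of_bool_eq mult_zero_left add_0_right)
    qed
    then show ?thesis unfolding id s1 s2 n nat_int .
  qed
qed

text \<open>At i = d = 0 the right side is 0, since the first sum is empty and the Kronecker factor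
  vanishes, whereas the Betti number is 1; hence the excluded pair. The indices are integers so that
  out-of-range degrees are expressible and count as zero.\<close>

theorem theorem4p4:
  fixes a b n :: nat and i d :: int
  assumes "a \<ge> 1" and "n \<ge> 1" and "b \<ge> 3"
    and "i \<ge> 0" and "d \<ge> 0" and "(i, d) \<noteq> (0, 0)"
  shows
    "graph_betti TYPE('k::field) (G_graph a b n) i d =
       (\<Sum>j = 0..d - 2.
          (a choose nat j) * graph_betti TYPE('k) (disjoint_copies n (B_graph b)) (i - j) (d - j))
       + of_bool (d = i + 1) * (\<Sum>j = 1..d - 1. (a choose nat j) * ((2 * b * n) choose nat (d - j)))
     \<and>
     int (graph_betti TYPE('k) (G_graph a b n) i d) =
       (\<Sum>j = 0..d - 2. int (a choose nat j) * coeff_uv (P_poly b ^ n) (i - j) (d - j))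
       + of_bool (d = i + 1) *
         (\<Sum>j = 1..d - 1. int (a choose nat j) * int ((2 * b * n) choose nat (d - j)))"
proof -
  let ?H = "disjoint_copies n (B_graph b)"
  have H: "simple_graph ?H" by (intro simple_graph_disjoint_copies simple_graph_B_graph)
  have card: "card (verts ?H) = 2 * b * n"
    by (simp add: disjoint_copies_def verts_B card_cartesian_product card_Plus mult_2 algebra_simps)
  have 1: "int (graph_betti TYPE('k) (G_graph a b n) i d) =
    (\<Sum>j = 0..d - 2. int (a choose nat j) * int (graph_betti TYPE('k) ?H (i - j) (d - j))) +
    of_bool (d = i + 1) * (\<Sum>j = 1..d - 1. int (a choose nat j) * int ((2 * b * n) choose nat (d - j)))"
    using graph_betti_join[OF H assms(4-6), of a, where 'k = 'k] unfolding G_graph_def card .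
  have 2: "int (graph_betti TYPE('k) ?H i' d') = coeff_uv (P_poly b ^ n) i' d'" for i' d'
    by (rule graph_betti_copies[OF simple_graph_B_graph upper_P_poly]) (rule bsum_B[OF assms(3)], assumption)
  have "int (graph_betti TYPE('k) (G_graph a b n) i d) =
    int ((\<Sum>j = 0..d - 2. (a choose nat j) * graph_betti TYPE('k) ?H (i - j) (d - j))
       + of_bool (d = i + 1) * (\<Sum>j = 1..d - 1. (a choose nat j) * ((2 * b * n) choose nat (d - j))))"
    unfolding 1 by (simp add: of_nat_sum)
  then have "graph_betti TYPE('k) (G_graph a b n) i d =
    (\<Sum>j = 0..d - 2. (a choose nat j) * graph_betti TYPE('k) ?H (i - j) (d - j))
       + of_bool (d = i + 1) * (\<Sum>j = 1..d - 1. (a choose nat j) * ((2 * b * n) choose nat (d - j)))"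
    by (rule of_nat_eq_iff[THEN iffD1])
  then show ?thesis using 1 unfolding 2 by (rule conjI)
qed

end
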